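(* Let $\lambda\in\mathbb{R}\setminus\{0\}$ and let the domain $\Omega$ and the initial datum $\varphi$ be in one of the following three situations: (i) $\Omega=\mathbb{R}$ and $\varphi\in W_2(\mathbb{R})\cap\mathfrak{D}(\mathbb{R})$; (ii) $\Omega=(-a,a)$ for some $a>0$, equipped with Neumann, Dirichlet or periodic boundary conditions, and $\varphi\in W_2(\Omega)\cap\mathfrak{D}(\Omega)$; (iii) $\Omega=\mathbb{R}$, $\lambda>0$ and $\varphi\in E_{\mathrm{logGP}}\cap\mathfrak{D}(\mathbb{R})$. Let $s>\frac72$ and assume furthermore that $\varphi'\in H^{s-1}(\Omega)$. Let $u$ be the unique solution (in the class recalled in the context) of $$ i\partial_t u+\partial_x^2 u=\lambda u\log|u|^2,\qquad u(0)=\varphi, $$ on $\mathbb{R}\times\Omega$ (with the chosen boundary conditions in case (ii)). Then for all $T>0$ and all $x_0>0$ with $(-x_0,x_0)\subset\Omega$, $$ u\notin L^\infty\big((0,T);H^s((-x_0,x_0))\big). $$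
   Context: Functions are complex-valued; $z\log|z|^2$ is understood as $0$ at $z=0$. $\mathfrak{D}(\Omega)=\{\phi\in H^1_{\rm loc}(\Omega) : \phi \text{ odd},\ \partial_x\phi(0)\neq 0\}$. Domain of the Laplacian $D(\Delta)$: $H^2(\mathbb{R})$ if $\Omega=\mathbb{R}$; $H^2(\Omega)\cap H^1_0(\Omega)$ for Dirichlet conditions; $\{\phi\in H^2(\Omega):\partial_x\phi(\pm a)=0\}$ for Neumann conditions; the space of $2a$-periodic $H^2$ functions (i.e. $H^2$ of the torus $\mathbb{R}/2a\mathbb{Z}$) for periodic conditions. $W_2(\Omega)=\{\phi\in D(\Delta): \phi\log|\phi|^2\in L^2(\Omega)\}$ (equal to $D(\Delta)$ if $\Omega$ is bounded). $E_{\mathrm{logGP}}=\{v\in H^1_{\rm loc}(\mathbb{R}) : \mathcal{E}_{\mathrm{logGP}}(v)<\infty\}$ where $\mathcal{E}_{\mathrm{logGP}}(v)=\|\partial_x v\|_{L^2(\mathbb{R})}^2+\lambda\int_{\mathbb{R}}\big(|v|^2\log|v|^2-|v|^2+1\big)\,dx$. Known well-posedness (solution classes). In cases (i), (ii): there is a unique $u$ with $u\in W^{1,\infty}_{\rm loc}(\mathbb{R};L^2(\Omega))$, $\partial_t u\in \mathcal{C}_w(\mathbb{R};L^2_{\rm loc}(\Omega))$, $\Delta u\in(\mathcal{C}_w\cap L^\infty_{\rm loc})(\mathbb{R};L^2_{\rm loc}(\Omega))$, $u(0)=\varphi$, satisfying the equation in $L^2(\omega)$ for every bounded open $\omega\subset\Omega$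 and a.e. $t$ ($\mathcal{C}_w$ denotes weak continuity in time); if $\Omega$ is bounded, moreover $u\in\mathcal{C}(\mathbb{R};W_2(\Omega))$ (so that the boundary conditions hold) and the equation holds in $L^2(\Omega)$ for all $t$. In case (iii): there is a unique weak solution $u\in L^\infty_{\rm loc}(\mathbb{R};E_{\mathrm{logGP}})$, and it satisfies $u-\varphi\in\mathcal{C}(\mathbb{R};L^2(\mathbb{R}))$; if $\varphi''\in L^2$ then also $u-\varphi\in W^{1,\infty}_{\rm loc}(\mathbb{R};L^2(\mathbb{R}))\cap L^\infty_{\rm loc}(\mathbb{R};H^2(\mathbb{R}))$. *)

theory Defs
  imports "HOL-Analysis.Analysis"
begin

text \<open>
  Functions of the space variable are total functions \<^typ>\<open>real \<Rightarrow> complex\<close>; on an open set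
  \<open>\<Omega>\<close> only their values almost everywhere on \<open>\<Omega>\<close> matter.  Functions of time and space are
  curried, time first.  The (squared) norm of a function space is represented by a map into
  \<^typ>\<open>ennreal\<close>, with the value \<open>\<infinity>\<close> exactly outside the space.  Working with the squares
  avoids a square root on \<^typ>\<open>ennreal\<close> and changes neither boundedness nor convergence.
\<close>

section \<open>Test functions and weak derivatives\<close>

definition smooth :: "(real \<Rightarrow> complex) \<Rightarrow> bool" where
  "smooth f \<longleftrightarrow> (\<exists>D :: nat \<Rightarrow> real \<Rightarrow> complex. D 0 = f \<and>
     (\<forall>n x. (D n has_vector_derivative D (Suc n) x) (at x)))"

definition test_fun :: "real set \<Rightarrow> (real \<Rightarrow> complex) set" where
  "test_fun \<Omega> = {\<psi>. smooth \<psi> \<and> (\<exists>K. compact K \<and> K \<subseteq> \<Omega> \<and> (\<forall>x. x \<notin> K \<longrightarrow> \<psi> x = 0))}"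

definition locally_integrable :: "real set \<Rightarrow> (real \<Rightarrow> complex) \<Rightarrow> bool" where
  "locally_integrable \<Omega> f \<longleftrightarrow> (\<forall>K. compact K \<and> K \<subseteq> \<Omega> \<longrightarrow> f absolutely_integrable_on K)"

definition weak_deriv :: "real set \<Rightarrow> (real \<Rightarrow> complex) \<Rightarrow> (real \<Rightarrow> complex) \<Rightarrow> bool" where
  "weak_deriv \<Omega> f g \<longleftrightarrow> locally_integrable \<Omega> f \<and> locally_integrable \<Omega> g \<and>
     (\<forall>\<psi>\<in>test_fun \<Omega>.
        (LINT x|lebesgue_on \<Omega>. f x * vector_derivative \<psi> (at x)) =
        - (LINT x|lebesgue_on \<Omega>. g x * \<psi> x))"

section \<open>Sobolev spaces\<close>

definition L2_sq :: "real set \<Rightarrow> (real \<Rightarrow> complex) \<Rightarrow> ennreal" where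
  "L2_sq \<Omega> f = (if f \<in> borel_measurable (lebesgue_on \<Omega>)
     then \<integral>\<^sup>+x. ennreal ((cmod (f x))\<^sup>2) \<partial>lebesgue_on \<Omega> else \<infinity>)"

definition L2 :: "real set \<Rightarrow> (real \<Rightarrow> complex) set" where
  "L2 \<Omega> = {f. L2_sq \<Omega> f < \<infinity>}"

definition gagliardo_sq :: "real \<Rightarrow> real set \<Rightarrow> (real \<Rightarrow> complex) \<Rightarrow> ennreal" where
  "gagliardo_sq \<sigma> \<Omega> g =
     (\<integral>\<^sup>+x. (\<integral>\<^sup>+y. ennreal ((cmod (g x - g y))\<^sup>2 / \<bar>x - y\<bar> powr (1 + 2 * \<sigma>))
        \<partial>lebesgue_on \<Omega>) \<partial>lebesgue_on \<Omega>)"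

text \<open>
  The Sobolev--Slobodeckij norm, for real \<open>s \<ge> 0\<close>.  The functions \<open>D j\<close> are the successive weak
  derivatives of \<open>f\<close> up to order \<open>\<lfloor>s\<rfloor>\<close>.  They are unique almost everywhere, so the infimum is
  over equal values; it is \<open>\<infinity>\<close> if one of these weak derivatives does not exist.
\<close>

definition Hs_sq :: "real \<Rightarrow> real set \<Rightarrow> (real \<Rightarrow> complex) \<Rightarrow> ennreal" where
  "Hs_sq s \<Omega> f =
     (INF D\<in>{D :: nat \<Rightarrow> real \<Rightarrow> complex. D 0 = f \<and>
              (\<forall>j < nat \<lfloor>s\<rfloor>. weak_deriv \<Omega> (D j) (D (Suc j)))}.
        (\<Sum>j\<le>nat \<lfloor>s\<rfloor>. L2_sq \<Omega> (D j)) +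
        (if frac s = 0 then 0 else gagliardo_sq (frac s) \<Omega> (D (nat \<lfloor>s\<rfloor>))))"

definition Hs :: "real \<Rightarrow> real set \<Rightarrow> (real \<Rightarrow> complex) set" where
  "Hs s \<Omega> = {f. Hs_sq s \<Omega> f < \<infinity>}"

definition Hs_loc :: "real \<Rightarrow> real set \<Rightarrow> (real \<Rightarrow> complex) set" where
  "Hs_loc s \<Omega> = {f. \<forall>\<omega>. open \<omega> \<and> compact (closure \<omega>) \<and> closure \<omega> \<subseteq> \<Omega> \<longrightarrow> f \<in> Hs s \<omega>}"

definition H1_0 :: "real set \<Rightarrow> (real \<Rightarrow> complex) set" where
  "H1_0 \<Omega> = {f \<in> Hs 1 \<Omega>. \<forall>e>0. \<exists>\<psi>\<in>test_fun \<Omega>. Hs_sq 1 \<Omega> (\<lambda>x. f x - \<psi> x) < ennreal e}"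

section \<open>Functions of time with values in a function space\<close>

text \<open>
  Here \<open>N\<close> is the squared norm of the target space.  Measurability is strong (Bochner)
  measurability.
\<close>

definition bochner_measurable ::
    "((real \<Rightarrow> complex) \<Rightarrow> ennreal) \<Rightarrow> real set \<Rightarrow> (real \<Rightarrow> real \<Rightarrow> complex) \<Rightarrow> bool" where
  "bochner_measurable N I u \<longleftrightarrow> (\<exists>S :: nat \<Rightarrow> real \<Rightarrow> real \<Rightarrow> complex.
     (\<forall>n. simple_function (lebesgue_on I) (S n) \<and> (\<forall>t\<in>I. N (S n t) < \<infinity>)) \<and>
     (AE t in lebesgue_on I. (\<lambda>n. N (\<lambda>x. S n t x - u t x)) \<longlonglongrightarrow> 0))"

definition Linf ::
    "real set \<Rightarrow> ((real \<Rightarrow> complex) \<Rightarrow> ennreal) \<Rightarrow> (real \<Rightarrow> real \<Rightarrow> complex) set" where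
  "Linf I N = {u. bochner_measurable N I u \<and>
     (\<exists>C::real. AE t in lebesgue_on I. N (u t) \<le> ennreal C)}"

definition Linf_loc ::
    "((real \<Rightarrow> complex) \<Rightarrow> ennreal) \<Rightarrow> (real \<Rightarrow> real \<Rightarrow> complex) set" where
  "Linf_loc N = {u. \<forall>T>0. u \<in> Linf {-T<..<T} N}"

definition C_time ::
    "((real \<Rightarrow> complex) \<Rightarrow> ennreal) \<Rightarrow> (real \<Rightarrow> real \<Rightarrow> complex) set" where
  "C_time N = {u. (\<forall>t. N (u t) < \<infinity>) \<and>
     (\<forall>t. ((\<lambda>r. N (\<lambda>x. u r x - u t x)) \<longlongrightarrow> 0) (at t))}"

definition Linf_loc_L2_loc :: "real set \<Rightarrow> (real \<Rightarrow> real \<Rightarrow> complex) set" where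
  "Linf_loc_L2_loc \<Omega> = {w. \<forall>K. compact K \<and> K \<subseteq> \<Omega> \<longrightarrow> w \<in> Linf_loc (L2_sq K)}"

definition Cw_L2_loc :: "real set \<Rightarrow> (real \<Rightarrow> real \<Rightarrow> complex) set" where
  "Cw_L2_loc \<Omega> = {w. \<forall>K. compact K \<and> K \<subseteq> \<Omega> \<longrightarrow> (\<forall>t. w t \<in> L2 K) \<and>
     (\<forall>g\<in>L2 K. continuous_on UNIV (\<lambda>t. LINT x|lebesgue_on K. w t x * g x))}"

text \<open>
  The identity \<open>\<integral> \<theta>'(t) u(t) dt = - \<integral> \<theta>(t) v(t) dt\<close> between Bochner integrals in \<open>L\<^sup>2(\<Omega>)\<close>,
  tested against every \<open>g\<close> in \<open>L\<^sup>2(\<Omega>)\<close>.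
\<close>

definition weak_time_deriv ::
    "real set \<Rightarrow> (real \<Rightarrow> real \<Rightarrow> complex) \<Rightarrow> (real \<Rightarrow> real \<Rightarrow> complex) \<Rightarrow> bool" where
  "weak_time_deriv \<Omega> u v \<longleftrightarrow> (\<forall>\<theta>\<in>test_fun UNIV. \<forall>g\<in>L2 \<Omega>.
     (LINT t|lebesgue. vector_derivative \<theta> (at t) * (LINT x|lebesgue_on \<Omega>. u t x * g x)) =
     - (LINT t|lebesgue. \<theta> t * (LINT x|lebesgue_on \<Omega>. v t x * g x)))"

text \<open>\<open>u \<in> W\<^sup>1\<^sup>,\<^sup>\<infinity>\<close> locally in time with values in \<open>L\<^sup>2(\<Omega>)\<close>, with \<open>\<partial>\<^sub>t u = v\<close>.\<close>

definition W1inf_loc_L2 ::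
    "real set \<Rightarrow> (real \<Rightarrow> real \<Rightarrow> complex) \<Rightarrow> (real \<Rightarrow> real \<Rightarrow> complex) \<Rightarrow> bool" where
  "W1inf_loc_L2 \<Omega> u v \<longleftrightarrow>
     u \<in> Linf_loc (L2_sq \<Omega>) \<and> v \<in> Linf_loc (L2_sq \<Omega>) \<and> weak_time_deriv \<Omega> u v"

section \<open>Domains, boundary conditions and data\<close>

datatype bc = Neumann | Dirichlet | Periodic

text \<open>\<open>Interval a b\<close> is the interval \<open>(-a, a)\<close> with boundary condition \<open>b\<close>.\<close>

datatype spatial_domain = Line | Interval real bc

fun region :: "spatial_domain \<Rightarrow> real set" where
  "region Line = UNIV"
| "region (Interval a b) = {-a<..<a}"

text \<open>
  In the Neumann case \<open>g\<close> is the continuous representative of \<open>\<phi>'\<close> up to the boundary.  In the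
  periodic case \<open>\<psi>\<close> is the periodic extension of \<open>\<phi>\<close>.
\<close>

fun Dom_Laplace :: "spatial_domain \<Rightarrow> (real \<Rightarrow> complex) set" where
  "Dom_Laplace Line = Hs 2 UNIV"
| "Dom_Laplace (Interval a Dirichlet) = Hs 2 {-a<..<a} \<inter> H1_0 {-a<..<a}"
| "Dom_Laplace (Interval a Neumann) = {\<phi> \<in> Hs 2 {-a<..<a}.
     \<exists>g. continuous_on {-a..a} g \<and> weak_deriv {-a<..<a} \<phi> g \<and> g (-a) = 0 \<and> g a = 0}"
| "Dom_Laplace (Interval a Periodic) = {\<phi>. \<exists>\<psi>\<in>Hs_loc 2 UNIV.
     (\<forall>x. \<psi> (x + 2 * a) = \<psi> x) \<and> (AE x in lebesgue_on {-a<..<a}. \<phi> x = \<psi> x)}"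

text \<open>This is \<open>0\<close> at \<open>z = 0\<close>, whatever the value of \<open>ln 0\<close>.\<close>

definition log_nl :: "complex \<Rightarrow> complex" where
  "log_nl z = z * of_real (ln ((cmod z)\<^sup>2))"

definition W2 :: "spatial_domain \<Rightarrow> (real \<Rightarrow> complex) set" where
  "W2 X = {\<phi> \<in> Dom_Laplace X. (\<lambda>x. log_nl (\<phi> x)) \<in> L2 (region X)}"

text \<open>
  The value of the derivative at the point \<open>0\<close> is that of the continuous representative \<open>g\<close>
  of \<open>\<phi>\<close>.
\<close>

definition odd_data :: "real set \<Rightarrow> (real \<Rightarrow> complex) set" where
  "odd_data \<Omega> = {\<phi> \<in> Hs_loc 1 \<Omega>. (AE x in lebesgue_on \<Omega>. \<phi> (-x) = - \<phi> x) \<and>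
     (\<exists>g d. continuous_on \<Omega> g \<and> (AE x in lebesgue_on \<Omega>. g x = \<phi> x) \<and>
        (g has_vector_derivative d) (at 0) \<and> d \<noteq> 0)}"

text \<open>
  The energy is only used for \<open>\<lambda> > 0\<close>.  The potential part of the integrand is nonnegative, as
  \<open>y ln y - y + 1 \<ge> 0\<close> for \<open>y \<ge> 0\<close>.
\<close>

definition logGP_energy :: "real \<Rightarrow> (real \<Rightarrow> complex) \<Rightarrow> ennreal" where
  "logGP_energy lam v =
     (INF dv\<in>{dv. weak_deriv UNIV v dv}. L2_sq UNIV dv) +
     ennreal lam * (\<integral>\<^sup>+x. ennreal ((cmod (v x))\<^sup>2 * ln ((cmod (v x))\<^sup>2) - (cmod (v x))\<^sup>2 + 1) \<partial>lebesgue)"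

definition E_logGP :: "real \<Rightarrow> (real \<Rightarrow> complex) set" where
  "E_logGP lam = {v \<in> Hs_loc 1 UNIV. logGP_energy lam v < \<infinity>}"

text \<open>
  \<open>E_logGP\<close> is not a vector space: \<open>L\<^sup>\<infinity>\<close> locally in time with values in it means measurability
  with values in \<open>H\<^sup>1\<close> on bounded intervals, and essential boundedness of the energy.
\<close>

definition Linf_loc_E :: "real \<Rightarrow> (real \<Rightarrow> real \<Rightarrow> complex) set" where
  "Linf_loc_E lam = {u. \<forall>T>0.
     (\<forall>r>0. bochner_measurable (Hs_sq 1 {-r<..<r}) {-T<..<T} u) \<and>
     (\<exists>C::real. AE t in lebesgue_on {-T<..<T}. u t \<in> E_logGP lam \<and> logGP_energy lam (u t) \<le> ennreal C)}"

section \<open>Solution classes\<close>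

text \<open>\<open>i v + w = \<lambda> f ln |f|\<^sup>2\<close> in \<open>L\<^sup>2(\<omega>)\<close>, at a fixed time.\<close>

definition eq_in_L2 :: "real \<Rightarrow> real set \<Rightarrow>
    (real \<Rightarrow> complex) \<Rightarrow> (real \<Rightarrow> complex) \<Rightarrow> (real \<Rightarrow> complex) \<Rightarrow> bool" where
  "eq_in_L2 lam \<omega> f v w \<longleftrightarrow> v \<in> L2 \<omega> \<and> w \<in> L2 \<omega> \<and> (\<lambda>x. log_nl (f x)) \<in> L2 \<omega> \<and>
     (AE x in lebesgue_on \<omega>. \<i> * v x + w x = of_real lam * log_nl (f x))"

text \<open>
  The functions \<open>v\<close> and \<open>w\<close> are the weakly continuous representatives of \<open>\<partial>\<^sub>t u\<close> and \<open>\<partial>\<^sub>x\<^sup>2 u\<close>.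
  Membership in \<open>C_time (L2_sq \<Omega>)\<close> selects the time-continuous representative of \<open>u\<close>, the one
  to which the initial condition refers.  For bounded \<open>\<Omega>\<close>, \<open>W2\<close> is the domain of the Laplacian,
  with the topology of \<open>H\<^sup>2(\<Omega>)\<close>.
\<close>

definition logNLS_solution ::
    "real \<Rightarrow> spatial_domain \<Rightarrow> (real \<Rightarrow> complex) \<Rightarrow> (real \<Rightarrow> real \<Rightarrow> complex) \<Rightarrow> bool" where
  "logNLS_solution lam X \<phi> u \<longleftrightarrow> (let \<Omega> = region X in
     u \<in> C_time (L2_sq \<Omega>) \<and> (AE x in lebesgue_on \<Omega>. u 0 x = \<phi> x) \<and>
     (\<exists>v w. W1inf_loc_L2 \<Omega> u v \<and> v \<in> Cw_L2_loc \<Omega> \<and>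
        (\<forall>t. \<exists>d. weak_deriv \<Omega> (u t) d \<and> weak_deriv \<Omega> d (w t)) \<and>
        w \<in> Cw_L2_loc \<Omega> \<and> w \<in> Linf_loc_L2_loc \<Omega> \<and>
        (\<forall>\<omega>. open \<omega> \<and> bounded \<omega> \<and> \<omega> \<subseteq> \<Omega> \<longrightarrow>
           (AE t in lebesgue. eq_in_L2 lam \<omega> (u t) (v t) (w t))) \<and>
        (bounded \<Omega> \<longrightarrow>
           u \<in> C_time (Hs_sq 2 \<Omega>) \<and> (\<forall>t. u t \<in> W2 X) \<and>
           (\<forall>t. eq_in_L2 lam \<Omega> (u t) (v t) (w t)))))"

text \<open>
  A test function \<open>\<psi>\<close> on \<open>\<real> \<times> \<real>\<close> is given by the family \<open>D j k\<close> of its partial derivatives of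
  order \<open>j\<close> in \<open>t\<close> and \<open>k\<close> in \<open>x\<close>; thus \<open>\<psi> = D 0 0\<close>.
\<close>

definition test_fun2 :: "(nat \<Rightarrow> nat \<Rightarrow> real \<Rightarrow> real \<Rightarrow> complex) set" where
  "test_fun2 = {D.
     (\<forall>j k. continuous_on UNIV (\<lambda>p. D j k (fst p) (snd p))) \<and>
     (\<forall>j k t x. ((\<lambda>\<tau>. D j k \<tau> x) has_vector_derivative D (Suc j) k t x) (at t) \<and>
                ((\<lambda>y. D j k t y) has_vector_derivative D j (Suc k) t x) (at x)) \<and>
     (\<exists>R. \<forall>t x. \<bar>t\<bar> > R \<or> \<bar>x\<bar> > R \<longrightarrow> D 0 0 t x = 0)}"

definition logNLS_distributional :: "real \<Rightarrow> (real \<Rightarrow> real \<Rightarrow> complex) \<Rightarrow> bool" where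
  "logNLS_distributional lam u \<longleftrightarrow> (\<forall>D\<in>test_fun2.
     (LINT t|lebesgue. LINT x|lebesgue. u t x * (- \<i> * D 1 0 t x + D 0 2 t x)) =
     of_real lam * (LINT t|lebesgue. LINT x|lebesgue. log_nl (u t x) * D 0 0 t x))"

definition logGP_solution ::
    "real \<Rightarrow> (real \<Rightarrow> complex) \<Rightarrow> (real \<Rightarrow> real \<Rightarrow> complex) \<Rightarrow> bool" where
  "logGP_solution lam \<phi> u \<longleftrightarrow>
     u \<in> Linf_loc_E lam \<and> logNLS_distributional lam u \<and>
     (AE x in lebesgue. u 0 x = \<phi> x) \<and>
     (\<lambda>t x. u t x - \<phi> x) \<in> C_time (L2_sq UNIV) \<and>
     ((\<exists>d d2. weak_deriv UNIV \<phi> d \<and> weak_deriv UNIV d d2 \<and> d2 \<in> L2 UNIV) \<longrightarrow>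
        (\<exists>v. W1inf_loc_L2 UNIV (\<lambda>t x. u t x - \<phi> x) v) \<and>
        (\<lambda>t x. u t x - \<phi> x) \<in> Linf_loc (Hs_sq 2 UNIV))"

end

theory Submission
  imports Defs
begin

text \<open>
  Oddness is propagated: by the inequality of Cazenave and Haraux the nonlinearity contributes at
  most a multiple of \<open>\<parallel>z\<parallel>\<^sup>2\<close> to the growth of \<open>\<parallel>z\<parallel>\<^sup>2\<close>, where \<open>z = u(t, x) + u(t, -x)\<close> vanishes at
  time \<open>0\<close>.  Suppose that \<open>u\<close> is bounded in \<open>H\<^sup>s\<close> near \<open>x = 0\<close>, with \<open>s > 7/2\<close>.
  The dyadic averages of the third derivative over \<open>[0, l]\<close> then stay bounded, so the odd function
  \<open>\<partial>\<^sub>x\<^sup>2 u\<close> is \<open>O(x)\<close>, and dividing the equation by \<open>x\<close> gives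
  \<open>i \<partial>\<^sub>t (u/x) = 2 \<lambda> ln x (u/x) + O(1)\<close>.  Hence, up to an error \<open>O(t)\<close>, the quotient \<open>u/x\<close> at time
  \<open>t\<close> is its initial value rotated by the angle \<open>- 2 \<lambda> t ln x\<close>.  Both quotients have limits as \<open>x\<close>
  tends to \<open>0\<close>, while the angle takes every value modulo \<open>2 \<pi>\<close> along a suitable sequence; for small
  \<open>t\<close> this forces \<open>\<partial>\<^sub>x \<phi>(0) = 0\<close>.  Averages over windows \<open>[e, 2e]\<close> replace point values, which are
  not controlled in time.
\<close>

section \<open>Smooth steps and test functions\<close>

text \<open>The threshold \<open>7/2\<close> is \<open>3 + 1/2\<close>. For \<open>s < 4\<close> the
  third derivative has fractional regularity above \<open>1/2\<close>, so that its averages over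
  \<open>[0, l]\<close> change by a convergent geometric series when \<open>l\<close> is halved; for
  \<open>s \<ge> 4\<close> a fourth derivative in \<open>L2\<close> bounds it. The term
  \<open>ln x\<close> appears because the logarithm of \<open>u\<close> splits into that of
  \<open>x\<close> and that of \<open>u/x\<close>, and the second one times \<open>u/x\<close> stays
  bounded. The phase error is proportional to \<open>t\<close> with a constant that does not see the
  frequency, so a small time is fixed first and \<open>x\<close> tends to 0 afterwards. The main
  obstacle is that the time derivative is known only through pairings with fixed functions of
  \<open>x\<close>. Hence no energy is differentiated: test functions are frozen over short time
  steps and inequalities between increments are added up. For oddness, integration by parts leaves a
  flux of \<open>z\<close>, which must vanish along suitable radii: by the boundary conditions on an
  interval, by square integrability on the line. In the Gross-Pitaevskii case the equation is
  distributional, and countably many test functions turn it into one at almost every time.\<close>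

definition flat :: "real poly \<Rightarrow> real \<Rightarrow> real" where
  "flat p x = (if x \<le> 0 then 0 else poly p (1 / x) * exp (- (1 / x)))"

lemma poly_div_exp_tendsto_0: "((\<lambda>x. poly p x / exp x) \<longlongrightarrow> (0::real)) at_top"
proof -
  have "((\<lambda>x. \<Sum>i\<le>degree p. coeff p i * (x ^ i / exp x)) \<longlongrightarrow> (\<Sum>i\<le>degree p. coeff p i * 0)) at_top"
    by (intro tendsto_intros tendsto_power_div_exp_0)
  then show ?thesis
    by (simp add: poly_altdef sum_divide_distrib)
qed

lemma flat_tendsto_0: "(flat p \<longlongrightarrow> 0) (at_right 0)"
proof -
  have "((\<lambda>x. poly p (inverse x) / exp (inverse x)) \<longlongrightarrow> 0) (at_right (0::real))"
    by (rule filterlim_compose[OF poly_div_exp_tendsto_0 filterlim_inverse_at_top_right])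
  then show ?thesis
    by (rule Lim_transform_eventually)
       (auto simp: eventually_at_right_less flat_def exp_minus divide_inverse
             intro!: eventually_at_rightI[of 0 1])
qed

text \<open>With \<open>y = 1 / x\<close> the chain rule produces the factor
  \<open>y\<^sup>2\<close> in front of \<open>p - pderiv p\<close>, so the derivative is again of
  the form \<open>flat\<close> and this single rule gives derivatives of all orders. At 0 the
  difference quotient is \<open>flat\<close> for the polynomial \<open>y * p\<close>, hence tends to
  0.\<close>

lemma flat_has_derivative:
  "(flat p has_real_derivative flat ([:0, 0, 1:] * (p - pderiv p)) x) (at x)"
proof -
  consider "x < 0" | "x = 0" | "x > 0" by linarith
  then show ?thesis
  proof cases
    case 1
    have "((\<lambda>_. 0) has_real_derivative 0) (at x)" by simp
    then have "(flat p has_real_derivative 0) (at x)"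
      by (rule has_field_derivative_transform_within_open[where S="{..<0}"])
         (use 1 in \<open>auto simp: flat_def\<close>)
    then show ?thesis using 1 by (simp add: flat_def)
  next
    case 2
    have "((\<lambda>h. flat p h / h) \<longlongrightarrow> 0) (at 0)"
    proof (rule filterlim_split_at)
      show "((\<lambda>h. flat p h / h) \<longlongrightarrow> 0) (at_left 0)"
        by (rule tendsto_eventually) (auto simp: flat_def eventually_at_filter)
      have "(flat ([:0, 1:] * p) \<longlongrightarrow> 0) (at_right 0)" by (rule flat_tendsto_0)
      then show "((\<lambda>h. flat p h / h) \<longlongrightarrow> 0) (at_right 0)"
        by (rule Lim_transform_eventually)
           (auto simp: flat_def intro!: eventually_at_rightI[of 0 1])
    qed
    then show ?thesis using 2 by (simp add: DERIV_def flat_def)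
  next
    case 3
    have "((\<lambda>x. poly p (1/x) * exp (- (1/x))) has_real_derivative
       (poly (pderiv p) (1/x) * (- (1/x^2))) * exp (- (1/x)) + poly p (1/x) * (exp (- (1/x)) * (1/x^2))) (at x)"
      using 3 by (auto intro!: derivative_eq_intros DERIV_chain2[OF poly_DERIV] simp: power2_eq_square)
    then have "(flat p has_real_derivative
       (poly (pderiv p) (1/x) * (- (1/x^2))) * exp (- (1/x)) + poly p (1/x) * (exp (- (1/x)) * (1/x^2))) (at x)"
      by (rule has_field_derivative_transform_within_open[where S="{0<..}"])
         (use 3 in \<open>auto simp: flat_def\<close>)
    moreover have "(poly (pderiv p) (1/x) * (- (1/x^2))) * exp (- (1/x)) + poly p (1/x) * (exp (- (1/x)) * (1/x^2))
       = flat ([:0, 0, 1:] * (p - pderiv p)) x"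
      using 3 by (simp add: flat_def power2_eq_square field_simps)
    ultimately show ?thesis by simp
  qed
qed

lemma flat_uminus: "flat (- p) x = - flat p x"
  by (simp add: flat_def)

text \<open>Choice turns the closure property into an operator on \<open>A\<close>; its iterates
  applied to \<open>f\<close> form the derivative sequence that \<open>smooth\<close> asks
  for.\<close>

lemma smooth_if_closed:
  assumes "f \<in> A" and "\<And>g. g \<in> A \<Longrightarrow> \<exists>g'\<in>A. \<forall>x. (g has_vector_derivative g' x) (at x)"
  shows "smooth f"
proof -
  obtain d where d: "\<And>g. g \<in> A \<Longrightarrow> d g \<in> A \<and> (\<forall>x. (g has_vector_derivative d g x) (at x))"
    using assms(2) by metis
  have "(d ^^ n) f \<in> A" for n
    by (induction n) (use assms(1) d in auto)
  then show ?thesis unfolding smooth_def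
    by (intro exI[of _ "\<lambda>n. (d ^^ n) f"]) (use d in auto)
qed

section \<open>Calculus of smooth functions\<close>

lemma smooth_primitive:
  assumes "smooth f" "\<And>x. (F has_vector_derivative f x) (at x)"
  shows "smooth F"
proof -
  obtain D where D: "D 0 = f" "\<And>n x. (D n has_vector_derivative D (Suc n) x) (at x)"
    using assms(1) unfolding smooth_def by auto
  show ?thesis unfolding smooth_def
    by (intro exI[of _ "\<lambda>n. case n of 0 \<Rightarrow> F | Suc m \<Rightarrow> D m"])
       (use D assms(2) in \<open>auto split: nat.split\<close>)
qed

lemma smooth_cmult_affine:
  assumes "smooth f"
  shows "smooth (\<lambda>x. c * f (k * x + m))"
proof -
  obtain D where D: "D 0 = f" "\<And>n x. (D n has_vector_derivative D (Suc n) x) (at x)"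
    using assms(1) unfolding smooth_def by auto
  have "((\<lambda>x. c * (of_real k ^ n * D n (k * x + m))) has_vector_derivative
     c * (of_real k ^ Suc n * D (Suc n) (k * x + m))) (at x)" for n x
  proof -
    have "(D n \<circ> (\<lambda>x. k * x + m) has_vector_derivative k *\<^sub>R D (Suc n) (k * x + m)) (at x)"
      by (rule vector_diff_chain_at)
         (auto intro!: derivative_eq_intros D simp: has_real_derivative_iff_has_vector_derivative[symmetric])
    then have "((\<lambda>x. (c * of_real k ^ n) * (D n \<circ> (\<lambda>x. k * x + m)) x) has_vector_derivative
        (c * of_real k ^ n) * (k *\<^sub>R D (Suc n) (k * x + m))) (at x)"
      by (rule has_vector_derivative_mult_right)
    then show ?thesis
      by (simp add: o_def scaleR_conv_of_real algebra_simps)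
  qed
  then show ?thesis unfolding smooth_def
    by (intro exI[of _ "\<lambda>n x. c * (of_real k ^ n * D n (k * x + m))"]) (use D in auto)
qed

lemma smooth_add:
  assumes "smooth f" "smooth g"
  shows "smooth (\<lambda>x. f x + g x)"
proof -
  obtain D E where "D 0 = f" "\<And>n x. (D n has_vector_derivative D (Suc n) x) (at x)"
     "E 0 = g" "\<And>n x. (E n has_vector_derivative E (Suc n) x) (at x)"
    using assms unfolding smooth_def by auto
  then show ?thesis unfolding smooth_def
    by (intro exI[of _ "\<lambda>n x. D n x + E n x"]) (auto intro!: derivative_intros)
qed

lemma smooth_diff:
  assumes "smooth f" "smooth g"
  shows "smooth (\<lambda>x. f x - g x)"
  using smooth_add[OF assms(1) smooth_cmult_affine[OF assms(2), of "-1" 1 0]] by simp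

lemma smooth_D:
  assumes "smooth f"
  shows "(f has_vector_derivative vector_derivative f (at x)) (at x)"
    and "smooth (\<lambda>x. vector_derivative f (at x))"
proof -
  obtain D where D: "D 0 = f" "\<And>n x. (D n has_vector_derivative D (Suc n) x) (at x)"
    using assms(1) unfolding smooth_def by auto
  then have eq: "vector_derivative f (at x) = D 1 x" for x
    by (metis One_nat_def vector_derivative_at)
  show "(f has_vector_derivative vector_derivative f (at x)) (at x)"
    using D eq by (metis One_nat_def)
  have "(\<lambda>x. vector_derivative f (at x)) = D 1" using eq by auto
  then show "smooth (\<lambda>x. vector_derivative f (at x))" unfolding smooth_def
    by (intro exI[of _ "\<lambda>n. D (Suc n)"]) (use D in auto)
qed

lemma smooth_imp_continuous_on: "smooth f \<Longrightarrow> continuous_on A f"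
  using smooth_D(1) by (meson continuous_at_imp_continuous_on has_vector_derivative_continuous)

section \<open>A bump function and its first two primitives\<close>

inductive_set flat_products :: "(real \<Rightarrow> complex) set" where
  base: "(\<lambda>x. of_real (flat p x * flat q (1 - x))) \<in> flat_products"
| add: "f \<in> flat_products \<Longrightarrow> g \<in> flat_products \<Longrightarrow> (\<lambda>x. f x + g x) \<in> flat_products"

text \<open>The product rule sends a generator to a sum of two generators, the sign from the
  argument \<open>1 - x\<close> being absorbed into the polynomial; this is why the set is closed
  under sums.\<close>

lemma flat_products_derivative:
  "f \<in> flat_products \<Longrightarrow> \<exists>f'\<in>flat_products. \<forall>x. (f has_vector_derivative f' x) (at x)"
proof (induction rule: flat_products.induct)
  case (base p q)
  let ?d = "\<lambda>p. [:0, 0, 1:] * (p - pderiv p)"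
  let ?f = "\<lambda>x. complex_of_real (flat (?d p) x * flat q (1 - x)) + of_real (flat p x * flat (- ?d q) (1 - x))"
  have "((\<lambda>x. complex_of_real (flat p x * flat q (1 - x))) has_vector_derivative ?f x) (at x)" for x
  proof -
    have "((\<lambda>x. flat q (1 - x)) has_real_derivative flat (?d q) (1 - x) * (0 - 1)) (at x)"
      by (rule DERIV_chain2[where g="\<lambda>x. 1 - x", OF flat_has_derivative])
         (auto intro!: derivative_eq_intros)
    from DERIV_mult[OF flat_has_derivative[of p x] this]
    have "((\<lambda>x. flat p x * flat q (1 - x)) has_real_derivative
       flat (?d p) x * flat q (1 - x) + flat p x * flat (- ?d q) (1 - x)) (at x)"
      unfolding flat_uminus by (simp add: mult.commute)
    from has_vector_derivative_of_real[OF this]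
    show ?thesis by simp
  qed
  moreover have "?f \<in> flat_products" by (intro flat_products.intros)
  ultimately show ?case by (intro bexI[of _ ?f]) auto
next
  case (add f g)
  then obtain f' g' where "f' \<in> flat_products" "g' \<in> flat_products"
    "\<forall>x. (f has_vector_derivative f' x) (at x)" "\<forall>x. (g has_vector_derivative g' x) (at x)" by blast
  then show ?case
    by (intro bexI[of _ "\<lambda>x. f' x + g' x"]) (auto intro!: derivative_intros flat_products.add)
qed

lemma continuous_antiderivative_real:
  fixes f :: "real \<Rightarrow> real"
  assumes "\<And>x. isCont f x"
  obtains F where "\<And>x. (F has_real_derivative f x) (at x)"
proof -
  have "\<exists>F. \<forall>x::real. -\<infinity> < ereal x \<longrightarrow> ereal x < \<infinity> \<longrightarrow> (F has_vector_derivative f x) (at x)"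
    by (rule einterval_antiderivative) (use assms in auto)
  then show thesis
    using that by (auto simp: has_real_derivative_iff_has_vector_derivative)
qed

text \<open>The product \<open>flat 1 x * flat 1 (1 - x)\<close> is a bump on \<open>[0, 1]\<close>,
  \<Phi> is its normalised primitive, and \<open>S\<close> is a primitive of \<Phi>. Both are needed
  together: a test function built from \<open>S\<close> is to have a derivative built from \<Phi>.
  Beyond 1 the slope is exactly 1, so the difference of two translates of \<open>S\<close> is
  eventually constant.\<close>

lemma smooth_ramp_exists:
  "\<exists>S \<Phi>. (\<forall>x. (S has_real_derivative \<Phi> x) (at x)) \<and> smooth (\<lambda>x. of_real (\<Phi> x)) \<and>
     (\<forall>x\<le>0. \<Phi> x = 0 \<and> S x = 0) \<and> (\<forall>x\<ge>1. \<Phi> x = 1 \<and> S x = S 1 + (x - 1)) \<and> (\<forall>x. 0 \<le> \<Phi> x \<and> \<Phi> x \<le> 1)"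
proof -
  define b where "b = (\<lambda>x. flat 1 x * flat 1 (1 - x))"
  have flat1: "isCont (flat 1) x" for x
    using DERIV_isCont flat_has_derivative by blast
  have bc: "isCont b x" for x unfolding b_def
    by (intro isCont_mult flat1 isCont_o2[where f="\<lambda>x. 1 - x", OF _ flat1]) auto
  obtain G where G: "\<And>x. (G has_real_derivative b x) (at x)"
    using continuous_antiderivative_real[OF bc] by blast
  have b0: "b x \<ge> 0" for x by (simp add: b_def flat_def)
  have bpos: "b x > 0" if "0 < x" "x < 1" for x using that by (simp add: b_def flat_def)
  have bz: "b x = 0" if "x \<le> 0 \<or> x \<ge> 1" for x using that by (auto simp: b_def flat_def)
  have G01: "G 0 < G 1"
    by (rule DERIV_pos_imp_increasing_open[of 0 1])
       (use G bpos in \<open>auto intro!: DERIV_continuous_on continuous_at_imp_continuous_on DERIV_isCont\<close>)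
  have mono: "G x \<le> G y" if "x \<le> y" for x y
    by (rule DERIV_nonneg_imp_nondecreasing[OF that]) (use G b0 in auto)
  have G0: "G x = G 0" if "x \<le> 0" for x
  proof (cases "x = 0")
    case False
    then have "\<exists>z>x. z < 0 \<and> G 0 - G x = (0 - x) * b z"
      by (intro MVT2) (use that G in auto)
    then show ?thesis using bz by auto
  qed simp
  have G1: "G x = G 1" if "x \<ge> 1" for x
  proof (cases "x = 1")
    case False
    then have "\<exists>z>1. z < x \<and> G x - G 1 = (x - 1) * b z"
      by (intro MVT2) (use that G in auto)
    then show ?thesis using bz by auto
  qed simp
  define \<Phi> where "\<Phi> = (\<lambda>x. (G x - G 0) / (G 1 - G 0))"
  have d\<Phi>: "(\<Phi> has_real_derivative b x / (G 1 - G 0)) (at x)" for x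
    unfolding \<Phi>_def using G01 by (auto intro!: derivative_eq_intros G)
  then have \<Phi>c: "isCont \<Phi> x" for x using DERIV_isCont by blast
  have \<Phi>0: "\<Phi> x = 0" if "x \<le> 0" for x using G0[OF that] by (simp add: \<Phi>_def)
  have \<Phi>1: "\<Phi> x = 1" if "x \<ge> 1" for x using G1[OF that] G01 by (auto simp: \<Phi>_def)
  have \<Phi>b: "0 \<le> \<Phi> x \<and> \<Phi> x \<le> 1" for x
  proof -
    have "G 0 \<le> G x" using mono[of 0 x] G0[of x] by (cases "x \<le> 0") auto
    moreover have "G x \<le> G 1" using mono[of x 1] G1[of x] by (cases "x \<ge> 1") auto
    ultimately show ?thesis using G01 unfolding \<Phi>_def by (simp add: divide_le_eq)
  qed
  obtain S0 where S0: "\<And>x. (S0 has_real_derivative \<Phi> x) (at x)"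
    using continuous_antiderivative_real[OF \<Phi>c] by blast
  define S where "S = (\<lambda>x. S0 x - S0 0)"
  have S: "(S has_real_derivative \<Phi> x) (at x)" for x
    unfolding S_def by (auto intro!: derivative_eq_intros S0)
  have "S x = 0" if "x \<le> 0" for x
  proof (cases "x = 0")
    case False
    then have "\<exists>z>x. z < 0 \<and> S 0 - S x = (0 - x) * \<Phi> z"
      by (intro MVT2) (use that S in auto)
    then show ?thesis using \<Phi>0 by (auto simp: S_def)
  qed (simp add: S_def)
  moreover have "S x = S 1 + (x - 1)" if "x \<ge> 1" for x
  proof (cases "x = 1")
    case False
    then have "\<exists>z>1. z < x \<and> S x - S 1 = (x - 1) * \<Phi> z"
      by (intro MVT2) (use that S in auto)
    then show ?thesis using \<Phi>1 by auto
  qed simp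
  moreover have "smooth (\<lambda>x. of_real (\<Phi> x))"
  proof (rule smooth_primitive)
    have "(\<lambda>x. complex_of_real (b x)) \<in> flat_products"
      unfolding b_def by (rule flat_products.base)
    then have "smooth (\<lambda>x. of_real (b x))"
      by (rule smooth_if_closed) (rule flat_products_derivative)
    from smooth_cmult_affine[OF this, of "1 / of_real (G 1 - G 0)" 1 0]
    show "smooth (\<lambda>x. of_real (b x / (G 1 - G 0)))" by simp
    show "((\<lambda>x. complex_of_real (\<Phi> x)) has_vector_derivative of_real (b x / (G 1 - G 0))) (at x)" for x
      using has_vector_derivative_of_real[OF d\<Phi>] .
  qed
  ultimately show ?thesis using S \<Phi>0 \<Phi>1 \<Phi>b by blast
qed

definition smooth_ramp :: "real \<Rightarrow> real" where
  "smooth_ramp = (SOME S. \<exists>\<Phi>. (\<forall>x. (S has_real_derivative \<Phi> x) (at x)) \<and> smooth (\<lambda>x. of_real (\<Phi> x)) \<and>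
     (\<forall>x\<le>0. \<Phi> x = 0 \<and> S x = 0) \<and> (\<forall>x\<ge>1. \<Phi> x = 1 \<and> S x = S 1 + (x - 1)) \<and> (\<forall>x. 0 \<le> \<Phi> x \<and> \<Phi> x \<le> 1))"

text \<open>Obtained from the ramp, so that both functions stem from the same choice and share all
  the properties above.\<close>

definition smooth_step :: "real \<Rightarrow> real" where
  "smooth_step = deriv smooth_ramp"

lemma smooth_step_props:
  shows smooth_ramp_derivative: "(smooth_ramp has_real_derivative smooth_step x) (at x)"
    and smooth_smooth_step: "smooth (\<lambda>x. of_real (smooth_step x))"
    and smooth_step_eq_0: "x \<le> 0 \<Longrightarrow> smooth_step x = 0"
    and smooth_ramp_eq_0: "x \<le> 0 \<Longrightarrow> smooth_ramp x = 0"
    and smooth_step_eq_1: "x \<ge> 1 \<Longrightarrow> smooth_step x = 1"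
    and smooth_ramp_eq: "x \<ge> 1 \<Longrightarrow> smooth_ramp x = smooth_ramp 1 + (x - 1)"
    and smooth_step_nonneg: "0 \<le> smooth_step x"
    and smooth_step_le_1: "smooth_step x \<le> 1"
proof -
  obtain \<Phi> where \<Phi>: "\<forall>x. (smooth_ramp has_real_derivative \<Phi> x) (at x)" "smooth (\<lambda>x. of_real (\<Phi> x))"
     "\<forall>x\<le>0. \<Phi> x = 0 \<and> smooth_ramp x = 0"
     "\<forall>x\<ge>1. \<Phi> x = 1 \<and> smooth_ramp x = smooth_ramp 1 + (x - 1)" "\<forall>x. 0 \<le> \<Phi> x \<and> \<Phi> x \<le> 1"
    using someI_ex[OF smooth_ramp_exists, folded smooth_ramp_def] by blast
  have "smooth_step = \<Phi>" unfolding smooth_step_def using \<Phi>(1) DERIV_imp_deriv by blast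
  note \<Phi>' = \<Phi>[folded this]
  show "(smooth_ramp has_real_derivative smooth_step x) (at x)"
     "smooth (\<lambda>x. of_real (smooth_step x))" "x \<le> 0 \<Longrightarrow> smooth_step x = 0"
     "x \<le> 0 \<Longrightarrow> smooth_ramp x = 0" "x \<ge> 1 \<Longrightarrow> smooth_step x = 1"
     "x \<ge> 1 \<Longrightarrow> smooth_ramp x = smooth_ramp 1 + (x - 1)"
     "0 \<le> smooth_step x" "smooth_step x \<le> 1"
    using \<Phi>' by blast+
qed

text \<open>As \<open>e\<close> tends to \<open>0\<close> from above, \<open>plateau e p l\<close> tends to the indicator of \<open>(p, p + l]\<close>.\<close>

definition plateau :: "real \<Rightarrow> real \<Rightarrow> real \<Rightarrow> real \<Rightarrow> complex" where
  "plateau e p l x = of_real (smooth_step ((x - p) / e) - smooth_step ((x - p - l) / e))"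

definition plateau_ramp :: "real \<Rightarrow> real \<Rightarrow> real \<Rightarrow> real \<Rightarrow> complex" where
  "plateau_ramp e p l x = of_real (e * (smooth_ramp ((x - p) / e) - smooth_ramp ((x - p - l) / e)))"

lemma smooth_plateau: "smooth (plateau e p l)"
proof -
  have *: "smooth (\<lambda>x. complex_of_real (smooth_step ((x - q) / e)))" for q
    using smooth_cmult_affine[OF smooth_smooth_step, of 1 "1 / e" "- q / e"]
    by (simp add: diff_divide_distrib)
  show ?thesis
    using smooth_diff[OF *[of p] *[of "p + l"]] unfolding plateau_def[abs_def]
    by (simp add: algebra_simps)
qed

lemma plateau_ramp_derivative:
  assumes "e > 0"
  shows "(plateau_ramp e p l has_vector_derivative plateau e p l x) (at x)"
proof -
  have "((\<lambda>x. e * (smooth_ramp ((x - p) / e) - smooth_ramp ((x - p - l) / e))) has_real_derivative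
      smooth_step ((x - p) / e) - smooth_step ((x - p - l) / e)) (at x)"
    using assms
    by (auto intro!: derivative_eq_intros DERIV_chain2[OF smooth_ramp_derivative] simp: field_simps)
  from has_vector_derivative_of_real[OF this]
  show ?thesis unfolding plateau_ramp_def[abs_def] plateau_def .
qed

lemma smooth_plateau_ramp: "e > 0 \<Longrightarrow> smooth (plateau_ramp e p l)"
  using smooth_primitive smooth_plateau plateau_ramp_derivative by blast

lemma plateau_eq_0:
  assumes "e > 0" "l \<ge> 0" "x \<le> p \<or> x \<ge> p + l + e"
  shows "plateau e p l x = 0"
  using assms(3)
proof
  assume "x \<le> p"
  then have "(x - p) / e \<le> 0" "(x - p - l) / e \<le> 0" using assms
    by (auto simp: divide_nonpos_pos)
  then show ?thesis by (simp add: plateau_def smooth_step_eq_0)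
next
  assume "x \<ge> p + l + e"
  then have "(x - p) / e \<ge> 1" "(x - p - l) / e \<ge> 1" using assms by auto
  then show ?thesis by (simp add: plateau_def smooth_step_eq_1)
qed

lemma plateau_ramp_left:
  assumes "e > 0" "l \<ge> 0" "x \<le> p"
  shows "plateau_ramp e p l x = 0"
proof -
  have "(x - p) / e \<le> 0" "(x - p - l) / e \<le> 0" using assms
    by (auto simp: divide_nonpos_pos)
  then show ?thesis by (simp add: plateau_ramp_def smooth_ramp_eq_0)
qed

text \<open>The unknown value \<open>smooth_ramp 1\<close> cancels in the difference. The total mass
  of the plateau is therefore exactly \<open>l\<close> for every \<open>e\<close>, and two ramps
  divided by their lengths agree far to the right.\<close>

lemma plateau_ramp_right:
  assumes "e > 0" "l \<ge> 0" "x \<ge> p + l + e"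
  shows "plateau_ramp e p l x = of_real l"
proof -
  have "(x - p) / e \<ge> 1" "(x - p - l) / e \<ge> 1" using assms by auto
  then have "smooth_ramp ((x - p) / e) - smooth_ramp ((x - p - l) / e) = l / e"
    using smooth_ramp_eq[of "(x - p) / e"] smooth_ramp_eq[of "(x - p - l) / e"]
    by (simp add: diff_divide_distrib)
  then show ?thesis using assms by (simp add: plateau_ramp_def)
qed

lemma norm_plateau_le: "cmod (plateau e p l x) \<le> 1"
  using smooth_step_nonneg[of "(x - p) / e"] smooth_step_le_1[of "(x - p) / e"]
    smooth_step_nonneg[of "(x - p - l) / e"] smooth_step_le_1[of "(x - p - l) / e"]
  unfolding plateau_def norm_of_real by linarith

text \<open>\<open>smooth_step\<close> is 0 at 0, so at each of the two jumps the limit is the value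
  from the left; hence the half-open interval.\<close>

lemma plateau_tendsto:
  assumes "l \<ge> 0"
  shows "(\<lambda>n. plateau (1 / real (Suc n)) p l x) \<longlonglongrightarrow> indicator {p<..p + l} x"
proof -
  have step: "(\<lambda>n. smooth_step (y / (1 / real (Suc n)))) \<longlonglongrightarrow> indicator {0<..} y" for y :: real
  proof (cases "y > 0")
    case True
    obtain N where N: "1 / y < real N" using reals_Archimedean2[of "1 / y"] by auto
    have "smooth_step (y / (1 / real (Suc n))) = 1" if "n \<ge> N" for n
    proof (rule smooth_step_eq_1)
      have "1 < real N * y" using N True by (simp only: pos_divide_less_eq)
      also have "\<dots> \<le> real (Suc n) * y" using that True by (intro mult_right_mono) auto
      finally show "1 \<le> y / (1 / real (Suc n))" by (simp only: divide_divide_eq_right div_by_1 mult.commute)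
    qed
    then show ?thesis
      using True by (intro tendsto_eventually eventually_sequentiallyI[of N]) auto
  next
    case False
    then have "smooth_step (y / (1 / real (Suc n))) = 0" for n
      by (intro smooth_step_eq_0 divide_nonpos_pos) auto
    moreover have "indicator {0<..} y = (0::real)" using False by simp
    ultimately show ?thesis by (simp only: tendsto_const)
  qed
  have "(\<lambda>n. complex_of_real (smooth_step ((x - p) / (1 / real (Suc n))) - smooth_step ((x - p - l) / (1 / real (Suc n)))))
     \<longlonglongrightarrow> of_real (indicator {0<..} (x - p) - indicator {0<..} (x - p - l))"
    by (intro tendsto_intros step)
  moreover have "complex_of_real (indicator {0<..} (x - p) - indicator {0<..} (x - p - l)) = indicator {p<..p + l} x"
    using assms by (auto simp: indicator_def)
  ultimately show ?thesis unfolding plateau_def by simp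
qed

lemma plateau_in_test_fun:
  assumes "e > 0" "l \<ge> 0" "{p..p + l + e} \<subseteq> \<Omega>"
  shows "plateau e p l \<in> test_fun \<Omega>"
  unfolding test_fun_def
proof (intro CollectI conjI smooth_plateau exI[of _ "{p..p + l + e}"])
  show "\<forall>x. x \<notin> {p..p + l + e} \<longrightarrow> plateau e p l x = 0"
    using plateau_eq_0[OF assms(1,2)] by auto
qed (use assms in auto)

section \<open>Indefinite integrals\<close>

lemma AE_lebesgue_on_iff:
  assumes "S \<in> sets lebesgue"
  shows "(AE x in lebesgue_on S. P x) \<longleftrightarrow> (\<exists>N. negligible N \<and> (\<forall>x\<in>S - N. P x))"
proof -
  have "(AE x in lebesgue_on S. P x) \<longleftrightarrow> (AE x in lebesgue. x \<in> S \<longrightarrow> P x)"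
    by (rule AE_restrict_space_iff) (use assms in auto)
  also have "\<dots> \<longleftrightarrow> (\<exists>N. negligible N \<and> {x. \<not> (x \<in> S \<longrightarrow> P x)} \<subseteq> N)"
    by (rule eventually_ae_filter_negligible)
  also have "\<dots> \<longleftrightarrow> (\<exists>N. negligible N \<and> (\<forall>x\<in>S - N. P x))" by blast
  finally show ?thesis .
qed

lemma AE_lebesgue_onE:
  assumes "AE x in lebesgue_on S. P x" "S \<in> sets lebesgue"
  obtains N where "negligible N" "\<And>x. x \<in> S - N \<Longrightarrow> P x"
proof -
  have "\<exists>N. negligible N \<and> (\<forall>x\<in>S - N. P x)"
    using assms(1) unfolding AE_lebesgue_on_iff[OF assms(2)] .
  then obtain N where "negligible N" "\<forall>x\<in>S - N. P x" by (elim exE conjE)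
  then show thesis by (intro that[of N]) (simp_all only: Ball_def)
qed

lemma AE_lebesgue_onI:
  assumes "negligible N" "\<And>x. x \<in> S - N \<Longrightarrow> P x" "S \<in> sets lebesgue"
  shows "AE x in lebesgue_on S. P x"
  unfolding AE_lebesgue_on_iff[OF assms(3)]
  by (intro exI[of _ N] conjI ballI assms(1,2))

lemma Icc_subset_interval:
  fixes S :: "real set"
  assumes "is_interval S" "x \<in> S" "y \<in> S"
  shows "{x..y} \<subseteq> S"
  by (rule subsetI, rule mem_is_interval_1_I[OF assms]) simp_all

lemma AE_lebesgue_on_subset:
  assumes "AE x in lebesgue_on S. P x" "T \<subseteq> S" "S \<in> sets lebesgue" "T \<in> sets lebesgue"
  shows "AE x in lebesgue_on T. P x"
proof -
  obtain N where "negligible N" "\<forall>x\<in>S - N. P x"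
    using assms(1) unfolding AE_lebesgue_on_iff[OF assms(3)] by blast
  then show ?thesis
    unfolding AE_lebesgue_on_iff[OF assms(4)] using assms(2) by (intro exI[of _ N]) auto
qed

text \<open>Inequalities between increments are additive, so bisection carries them from short
  intervals to the whole one. This takes the place of differentiation wherever only increments are
  controlled.\<close>

lemma increment_le:
  fixes P Q :: "real \<Rightarrow> real"
  assumes "a \<le> b" "\<delta> > 0"
    and step: "\<And>x y. a \<le> x \<Longrightarrow> x \<le> y \<Longrightarrow> y \<le> b \<Longrightarrow> y - x < \<delta> \<Longrightarrow> P y - P x \<le> Q y - Q x"
  shows "P b - P a \<le> Q b - Q a"
proof -
  let ?R = "\<lambda>x y. a \<le> x \<longrightarrow> x \<le> y \<longrightarrow> y \<le> b \<longrightarrow> P y - P x \<le> Q y - Q x"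
  have "?R a b"
  proof (rule Bolzano[of a b ?R, OF \<open>a \<le> b\<close>])
    fix x y z assume R: "?R x y" "?R y z" and "x \<le> y" "y \<le> z"
    show "?R x z"
    proof (intro impI)
      assume "a \<le> x" "x \<le> z" "z \<le> b"
      then have "P y - P x \<le> Q y - Q x" "P z - P y \<le> Q z - Q y"
        using R \<open>x \<le> y\<close> \<open>y \<le> z\<close> by auto
      then show "P z - P x \<le> Q z - Q x" by linarith
    qed
  next
    fix x assume "a \<le> x" "x \<le> b"
    show "\<exists>d>0. \<forall>u v. u \<le> x \<and> x \<le> v \<and> v - u < d \<longrightarrow> ?R u v"
      by (intro exI[of _ \<delta>] conjI allI impI \<open>\<delta> > 0\<close> step) auto
  qed
  then show ?thesis using \<open>a \<le> b\<close> by simp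
qed

lemma norm_increment_le:
  fixes P :: "real \<Rightarrow> 'a::real_normed_vector" and Q :: "real \<Rightarrow> real"
  assumes "a \<le> b" "\<delta> > 0"
    and step: "\<And>x y. a \<le> x \<Longrightarrow> x \<le> y \<Longrightarrow> y \<le> b \<Longrightarrow> y - x < \<delta> \<Longrightarrow> norm (P y - P x) \<le> Q y - Q x"
  shows "norm (P b - P a) \<le> Q b - Q a"
proof -
  have "norm (P b - P a) - norm (P a - P a) \<le> Q b - Q a"
  proof (rule increment_le[OF assms(1,2)])
    fix x y assume *: "a \<le> x" "x \<le> y" "y \<le> b" "y - x < \<delta>"
    have "norm (P y - P a) - norm (P x - P a) \<le> norm ((P y - P a) - (P x - P a))"
      by (rule norm_triangle_ineq2)
    then show "norm (P y - P a) - norm (P x - P a) \<le> Q y - Q x" using step[OF *] by simp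
  qed
  then show ?thesis by simp
qed

text \<open>Absolute continuity with density \<open>f\<close>, expressed by increments so that
  neither a pointwise derivative nor a base point enters. It says something on \<open>F\<close> at
  every point of \<open>S\<close>, whereas \<open>f\<close> matters only up to null sets.\<close>

definition prim :: "real set \<Rightarrow> (real \<Rightarrow> complex) \<Rightarrow> (real \<Rightarrow> complex) \<Rightarrow> bool" where
  "prim S F f \<longleftrightarrow> (\<forall>x\<in>S. \<forall>y\<in>S. x \<le> y \<longrightarrow>
     f absolutely_integrable_on {x..y} \<and> integral {x..y} f = F y - F x)"

lemma primD:
  assumes "prim S F f" "x \<in> S" "y \<in> S" "x \<le> y"
  shows "f absolutely_integrable_on {x..y}" "integral {x..y} f = F y - F x" "f integrable_on {x..y}"
proof -
  show "f absolutely_integrable_on {x..y}" "integral {x..y} f = F y - F x"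
    using assms unfolding prim_def by blast+
  then show "f integrable_on {x..y}" by (simp only: absolutely_integrable_on_def)
qed

lemma prim_subset: "prim S F f \<Longrightarrow> T \<subseteq> S \<Longrightarrow> prim T F f"
  unfolding prim_def by blast

lemma prim_cong_AE:
  assumes "prim S F f" "is_interval S" "AE x in lebesgue_on S. f x = g x" "S \<in> sets lebesgue"
  shows "prim S F g"
proof -
  obtain N where N: "negligible N" "\<And>x. x \<in> S - N \<Longrightarrow> f x = g x"
    using AE_lebesgue_onE[OF assms(3,4)] by blast
  show ?thesis unfolding prim_def
  proof (intro ballI impI)
    fix x y assume *: "x \<in> S" "y \<in> S" "x \<le> y"
    have sub: "{x..y} \<subseteq> S" by (intro Icc_subset_interval assms *)
    have "g absolutely_integrable_on {x..y}"
      by (rule absolutely_integrable_spike[OF primD(1)[OF assms(1) *] N(1)]) (use N sub in auto)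
    moreover have "integral {x..y} g = integral {x..y} f"
      by (rule integral_spike[OF N(1)]) (use N sub in auto)
    ultimately show "g absolutely_integrable_on {x..y} \<and> integral {x..y} g = F y - F x"
      using primD(2)[OF assms(1) *] by simp
  qed
qed

lemma prim_continuous_on_Icc:
  assumes "prim {a..b} F f"
  shows "continuous_on {a..b} F"
proof (cases "a \<le> b")
  case True
  have "continuous_on {a..b} (\<lambda>x. F a + integral {a..x} f)"
    by (intro continuous_intros indefinite_integral_continuous_1 primD(3)[OF assms]) (use True in auto)
  then show ?thesis
    by (rule continuous_on_eq) (use primD(2)[OF assms] True in auto)
qed auto

lemma prim_continuous_on:
  assumes "prim S F f" "open S"
  shows "continuous_on S F"
proof -
  have "isCont F x" if x: "x \<in> S" for x
  proof -
    obtain e where e: "e > 0" "{x - e..x + e} \<subseteq> S"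
      using assms(2) x by (metis cball_eq_atLeastAtMost open_contains_cball)
    then have "continuous_on {x - e..x + e} F"
      using prim_continuous_on_Icc prim_subset[OF assms(1)] by blast
    then show ?thesis using e(1) by (intro continuous_on_interior) auto
  qed
  then show ?thesis by (simp add: continuous_at_imp_continuous_on)
qed

lemma prim_has_vector_derivative_within:
  assumes "prim {a..b} F f" "continuous_on {a..b} f" "x \<in> {a..b}"
  shows "(F has_vector_derivative f x) (at x within {a..b})"
proof -
  have "((\<lambda>x. F a + integral {a..x} f) has_vector_derivative f x) (at x within {a..b})"
    using has_vector_derivative_add[OF has_vector_derivative_const integral_has_vector_derivative[OF assms(2,3)]]
    by simp
  then show ?thesis
    by (rule has_vector_derivative_transform[OF assms(3), rotated])
       (use primD(2)[OF assms(1)] assms(3) in auto)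
qed

lemma prim_has_vector_derivative:
  assumes "prim S F f" "open S" "continuous_on S f" "x \<in> S"
  shows "(F has_vector_derivative f x) (at x)"
proof -
  obtain e where e: "e > 0" "{x - e..x + e} \<subseteq> S"
    using assms by (metis cball_eq_atLeastAtMost open_contains_cball)
  have "(F has_vector_derivative f x) (at x within {x - e..x + e})"
    by (rule prim_has_vector_derivative_within)
       (use e assms prim_subset continuous_on_subset in auto)
  moreover have "x \<in> interior {x - e..x + e}" using e by simp
  ultimately show ?thesis by (simp only: at_within_interior)
qed

lemma prim_of_derivative:
  assumes "\<And>x. x \<in> S \<Longrightarrow> (F has_vector_derivative f x) (at x)" "continuous_on S f" "is_interval S"
  shows "prim S F f"
  unfolding prim_def
proof (intro ballI impI)
  fix x y assume *: "x \<in> S" "y \<in> S" "x \<le> y"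
  have sub: "{x..y} \<subseteq> S" by (intro Icc_subset_interval assms *)
  have "(f has_integral F y - F x) {x..y}"
    by (rule fundamental_theorem_of_calculus[OF *(3)])
       (use sub assms(1) has_vector_derivative_at_within in blast)
  moreover have "f absolutely_integrable_on {x..y}"
    using continuous_on_subset[OF assms(2) sub] by (rule absolutely_integrable_continuous_real)
  ultimately show "f absolutely_integrable_on {x..y} \<and> integral {x..y} f = F y - F x"
    by (simp add: integral_unique)
qed

lemma prim_add:
  assumes "prim S F f" "prim S G g"
  shows "prim S (\<lambda>x. F x + G x) (\<lambda>x. f x + g x)"
  unfolding prim_def
proof (intro ballI impI conjI)
  fix x y assume *: "x \<in> S" "y \<in> S" "x \<le> y"
  note f = primD[OF assms(1) *] and g = primD[OF assms(2) *]
  show "(\<lambda>x. f x + g x) absolutely_integrable_on {x..y}"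
    using f(1) g(1) by (rule set_integral_add(1))
  show "integral {x..y} (\<lambda>x. f x + g x) = F y + G y - (F x + G x)"
    using f g by (simp add: Henstock_Kurzweil_Integration.integral_add)
qed

lemma prim_diff:
  assumes "prim S F f" "prim S G g"
  shows "prim S (\<lambda>x. F x - G x) (\<lambda>x. f x - g x)"
  unfolding prim_def
proof (intro ballI impI conjI)
  fix x y assume *: "x \<in> S" "y \<in> S" "x \<le> y"
  note f = primD[OF assms(1) *] and g = primD[OF assms(2) *]
  show "(\<lambda>x. f x - g x) absolutely_integrable_on {x..y}"
    using f(1) g(1) by (rule set_integral_diff(1))
  show "integral {x..y} (\<lambda>x. f x - g x) = F y - G y - (F x - G x)"
    using f g by (simp add: Henstock_Kurzweil_Integration.integral_diff)
qed

lemma prim_cnj: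
  assumes "prim S F f"
  shows "prim S (\<lambda>x. cnj (F x)) (\<lambda>x. cnj (f x))"
  unfolding prim_def
proof (intro ballI impI conjI)
  fix x y assume *: "x \<in> S" "y \<in> S" "x \<le> y"
  note f = primD[OF assms *]
  show "(\<lambda>x. cnj (f x)) absolutely_integrable_on {x..y}"
    using absolutely_integrable_linear[OF f(1) bounded_linear_cnj] by (simp add: o_def)
  show "integral {x..y} (\<lambda>x. cnj (f x)) = cnj (F y) - cnj (F x)"
    using f(2) by (metis Henstock_Kurzweil_Integration.integral_cnj complex_cnj_diff)
qed

lemma prim_reflect:
  assumes "prim S F f"
  shows "prim (uminus ` S) (\<lambda>x. - F (- x)) (\<lambda>x. f (- x))"
  unfolding prim_def
proof (clarify)
  fix x y assume *: "x \<in> S" "y \<in> S" "- x \<le> - y"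
  then show "(\<lambda>x. f (- x)) absolutely_integrable_on {- x..- y} \<and>
    integral {- x..- y} (\<lambda>x. f (- x)) = (- F (- (- y))) - (- F (- (- x)))"
    using primD[OF assms, of y x] by simp
qed

lemma abs_integrable_mult_continuous:
  fixes f g :: "real \<Rightarrow> complex"
  assumes "f absolutely_integrable_on {a..b}" "continuous_on {a..b} g"
  shows "(\<lambda>x. f x * g x) absolutely_integrable_on {a..b}" "(\<lambda>x. g x * f x) absolutely_integrable_on {a..b}"
proof -
  have "(\<lambda>x. g x * f x) absolutely_integrable_on {a..b}"
    by (rule absolutely_integrable_bounded_measurable_product[OF bilinear_times _ _ _ assms(1)])
       (use assms(2) in \<open>auto intro!: continuous_imp_measurable_on_sets_lebesgue compact_imp_bounded compact_continuous_image\<close>)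
  then show "(\<lambda>x. g x * f x) absolutely_integrable_on {a..b}" "(\<lambda>x. f x * g x) absolutely_integrable_on {a..b}"
    by (simp_all add: mult.commute)
qed

text \<open>On a short interval \<open>[x, y]\<close> the increment of \<open>F G\<close> differs from the integral of \<open>f G + F g\<close>
  by at most a small multiple of the integral of \<open>\<bar>f\<bar> + \<bar>g\<bar>\<close>; these errors add up.\<close>

lemma prim_mult_Icc:
  assumes F: "prim {a..b} F f" and G: "prim {a..b} G g" and "a \<le> b"
  shows "integral {a..b} (\<lambda>x. f x * G x + F x * g x) = F b * G b - F a * G a"
proof -
  note Fc = prim_continuous_on_Icc[OF F] and Gc = prim_continuous_on_Icc[OF G]
  define H where "H = (\<lambda>x. f x * G x + F x * g x)"
  define P where "P = (\<lambda>x. F x * G x - integral {a..x} H)"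
  define Q where "Q = (\<lambda>x. integral {a..x} (\<lambda>x. norm (f x) + norm (g x)))"
  have fa: "f absolutely_integrable_on {x..y}" and ga: "g absolutely_integrable_on {x..y}"
    if "a \<le> x" "x \<le> y" "y \<le> b" for x y
    using that primD(1)[OF F, of x y] primD(1)[OF G, of x y] by auto
  have Fc': "continuous_on {x..y} F" and Gc': "continuous_on {x..y} G" if "a \<le> x" "x \<le> y" "y \<le> b" for x y
    using that continuous_on_subset[OF Fc, of "{x..y}"] continuous_on_subset[OF Gc, of "{x..y}"] by auto
  have Ha: "H absolutely_integrable_on {x..y}" if "a \<le> x" "x \<le> y" "y \<le> b" for x y
    unfolding H_def by (intro set_integral_add abs_integrable_mult_continuous fa ga Fc' Gc' that)
  have Hi: "H integrable_on {x..y}" if "a \<le> x" "x \<le> y" "y \<le> b" for x y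
    using Ha[OF that] by (simp add: absolutely_integrable_on_def)
  have Qi: "(\<lambda>x. norm (f x) + norm (g x)) integrable_on {x..y}" if "a \<le> x" "x \<le> y" "y \<le> b" for x y
    using fa[OF that] ga[OF that] by (auto simp: absolutely_integrable_on_def intro!: integrable_add)
  have bound: "norm (P b - P a) \<le> e * (Q b - Q a)" if "e > 0" for e
  proof -
    obtain d1 where d1: "d1 > 0" "\<And>x y. x \<in> {a..b} \<Longrightarrow> y \<in> {a..b} \<Longrightarrow> dist y x < d1 \<Longrightarrow> dist (F y) (F x) < e"
      using compact_uniformly_continuous[OF Fc] \<open>e > 0\<close> unfolding uniformly_continuous_on_def by (metis compact_Icc)
    obtain d2 where d2: "d2 > 0" "\<And>x y. x \<in> {a..b} \<Longrightarrow> y \<in> {a..b} \<Longrightarrow> dist y x < d2 \<Longrightarrow> dist (G y) (G x) < e"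
      using compact_uniformly_continuous[OF Gc] \<open>e > 0\<close> unfolding uniformly_continuous_on_def by (metis compact_Icc)
    have "norm (P b - P a) \<le> e * Q b - e * Q a"
    proof (rule norm_increment_le[OF \<open>a \<le> b\<close>, of "min d1 d2"])
      fix x y assume *: "a \<le> x" "x \<le> y" "y \<le> b" "y - x < min d1 d2"
      have "P y - P x = (F y * G y - F x * G x) - integral {x..y} H"
        unfolding P_def using Henstock_Kurzweil_Integration.integral_combine[of a x y H] Hi[of a y] * by (simp add: algebra_simps)
      \<comment> \<open>With \<open>G x\<close> and \<open>F y\<close> frozen the increment is an
        exact integral; compared with \<open>H\<close>, only differences of \<open>F\<close> and of
        \<open>G\<close> over the short interval remain.\<close>
      also have "F y * G y - F x * G x = (F y - F x) * G x + F y * (G y - G x)"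
        by (simp add: algebra_simps)
      also have "\<dots> = integral {x..y} (\<lambda>s. f s * G x + F y * g s)"
        using primD[OF F, of x y] primD[OF G, of x y] *
        by (subst Henstock_Kurzweil_Integration.integral_add) (auto intro!: integrable_on_mult_left integrable_on_mult_right)
      also have "\<dots> - integral {x..y} H = integral {x..y} (\<lambda>s. (f s * G x + F y * g s) - H s)"
        using primD[OF F, of x y] primD[OF G, of x y] * Hi[of x y]
        by (subst Henstock_Kurzweil_Integration.integral_diff) (auto intro!: integrable_add integrable_on_mult_left integrable_on_mult_right)
      also have "norm \<dots> \<le> integral {x..y} (\<lambda>s. e * (norm (f s) + norm (g s)))"
      proof (rule integral_norm_bound_integral)
        show "(\<lambda>s. (f s * G x + F y * g s) - H s) integrable_on {x..y}"
          using primD[OF F, of x y] primD[OF G, of x y] * Hi[of x y]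
          by (auto intro!: integrable_diff integrable_add integrable_on_mult_left integrable_on_mult_right)
        show "(\<lambda>s. e * (norm (f s) + norm (g s))) integrable_on {x..y}"
          using Qi[of x y] * by (intro integrable_on_mult_right) auto
        fix s assume s: "s \<in> {x..y}"
        have "(f s * G x + F y * g s) - H s = f s * (G x - G s) + (F y - F s) * g s"
          by (simp add: H_def algebra_simps)
        also have "norm \<dots> \<le> norm (f s) * norm (G x - G s) + norm (F y - F s) * norm (g s)"
          by (metis norm_mult norm_triangle_ineq)
        also have "\<dots> \<le> norm (f s) * e + e * norm (g s)"
          using d1(2)[of s y] d2(2)[of s x] s *
          by (intro add_mono mult_left_mono mult_right_mono) (auto simp: dist_norm)
        finally show "norm ((f s * G x + F y * g s) - H s) \<le> e * (norm (f s) + norm (g s))"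
          by (simp add: algebra_simps)
      qed
      also have "\<dots> = e * Q y - e * Q x"
        unfolding Q_def using Henstock_Kurzweil_Integration.integral_combine[of a x y "\<lambda>x. norm (f x) + norm (g x)"] Qi[of a y] *
        by (subst integral_mult_right) (simp add: right_diff_distrib[symmetric] del: integral_mult_right)
      finally show "norm (P y - P x) \<le> e * Q y - e * Q x" .
    qed (use d1 d2 in auto)
    then show ?thesis by (simp add: algebra_simps)
  qed
  have "norm (P b - P a) \<le> 0"
  proof (rule field_le_epsilon)
    fix e :: real assume "e > 0"
    have Q: "Q b - Q a \<ge> 0" unfolding Q_def
      by (simp add: Henstock_Kurzweil_Integration.integral_nonneg Qi \<open>a \<le> b\<close>)
    \<comment> \<open>Adding 1 guards against \<open>Q b = Q a\<close>.\<close>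
    have "norm (P b - P a) \<le> e / (Q b - Q a + 1) * (Q b - Q a)"
      by (rule bound) (use Q \<open>e > 0\<close> in auto)
    also have "\<dots> \<le> e" using Q \<open>e > 0\<close> by (simp add: field_simps)
    finally show "norm (P b - P a) \<le> 0 + e" by simp
  qed
  then show ?thesis by (simp add: P_def H_def algebra_simps)
qed

text \<open>Lebesgue differentiation: outside a negligible set the function is the limit of its
  averages over \<open>[x, x + h]\<close>, and these vanish. Extending \<open>f\<close> by 0 makes
  sense of the averages that leave \<open>[a, b]\<close>.\<close>

lemma AE_zero_if_integral_zero:
  fixes f :: "real \<Rightarrow> complex"
  assumes int: "f integrable_on {a..b}"
    and zero: "\<And>x y. a \<le> x \<Longrightarrow> x \<le> y \<Longrightarrow> y \<le> b \<Longrightarrow> integral {x..y} f = 0"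
  shows "\<exists>N. negligible N \<and> (\<forall>x\<in>{a..b} - N. f x = 0)"
proof -
  let ?f = "\<lambda>x. if x \<in> {a..b} then f x else 0"
  have restr: "?f integrable_on {x..y}" "integral {x..y} ?f = 0" for x y
  proof -
    have eq: "{x..y} \<inter> {a..b} = {max x a..min y b}" by auto
    have "f integrable_on {max x a..min y b}"
      by (rule integrable_on_subinterval[OF int]) auto
    then show "?f integrable_on {x..y}"
      using integrable_restrict_Int[of "{a..b}" f "{x..y}"] by (simp add: eq Int_commute max.commute min.commute)
    have "integral {x..y} ?f = integral {max x a..min y b} f"
      using integral_restrict_Int[of "{x..y}" "{a..b}" f] by (simp add: eq Int_commute max.commute min.commute)
    also have "\<dots> = 0"
      by (cases "max x a \<le> min y b") (auto intro!: zero)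
    finally show "integral {x..y} ?f = 0" .
  qed
  obtain N where N: "negligible N"
      "\<And>x e. x \<notin> N \<Longrightarrow> 0 < e \<Longrightarrow> \<exists>d>0. \<forall>h. 0 < h \<and> h < d \<longrightarrow>
         norm (integral (cbox x (x + h *\<^sub>R One)) ?f /\<^sub>R h ^ DIM(real) - ?f x) < e"
    by (rule integrable_ccontinuous_explicit[of ?f]) (use restr(1) in auto)
  have "?f x = 0" if xN: "x \<notin> N" for x
  proof (rule ccontr)
    assume "?f x \<noteq> 0"
    then obtain d where d: "d > 0" "\<And>h. 0 < h \<Longrightarrow> h < d \<Longrightarrow>
         norm (integral (cbox x (x + h *\<^sub>R One)) ?f /\<^sub>R h ^ DIM(real) - ?f x) < norm (?f x)"
      using N(2)[OF xN, of "norm (?f x)"] zero_less_norm_iff by blast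
    have "norm (integral (cbox x (x + (d/2) *\<^sub>R One)) ?f /\<^sub>R (d/2) ^ DIM(real) - ?f x) < norm (?f x)"
      using d by (intro d(2)) auto
    then show False by (simp only: box_real restr(2)) simp
  qed
  then show ?thesis using N(1) by (metis DiffD1 DiffD2)
qed

section \<open>From compact intervals to open ones\<close>

lemma open_rational_Icc:
  fixes S :: "real set"
  assumes "open S" "x \<in> S"
  shows "\<exists>p q. p \<in> \<rat> \<and> q \<in> \<rat> \<and> p \<in> S \<and> q \<in> S \<and> p \<le> x \<and> x \<le> q"
proof -
  obtain e where e: "e > 0" "{x - e..x + e} \<subseteq> S"
    using assms by (metis cball_eq_atLeastAtMost open_contains_cball)
  obtain p where p: "p \<in> \<rat>" "x - e < p" "p < x" using Rats_dense_in_real[of "x - e" x] e by auto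
  obtain q where q: "q \<in> \<rat>" "x < q" "q < x + e" using Rats_dense_in_real[of x "x + e"] e by auto
  have "p \<in> S" "q \<in> S" using e p q by auto
  then show ?thesis using p q by (intro exI[of _ p] exI[of _ q]) auto
qed

text \<open>An open interval is the union of the countably many compact intervals with rational
  endpoints in it, so the exceptional sets can be collected into one.\<close>

lemma AE_on_open_interval:
  fixes S :: "real set"
  assumes "open S" "is_interval S"
    and "\<And>a b. a \<in> S \<Longrightarrow> b \<in> S \<Longrightarrow> a \<le> b \<Longrightarrow> \<exists>N. negligible N \<and> (\<forall>x\<in>{a..b} - N. P x)"
  shows "AE x in lebesgue_on S. P x"
proof -
  let ?I = "{(p, q). p \<in> \<rat> \<and> q \<in> \<rat> \<and> p \<in> S \<and> q \<in> S \<and> p \<le> q}"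
  have "\<forall>i\<in>?I. \<exists>N. negligible N \<and> (\<forall>x\<in>{fst i..snd i} - N. P x)"
    using assms(3) by auto
  then have "\<exists>N. \<forall>i\<in>?I. negligible (N i) \<and> (\<forall>x\<in>{fst i..snd i} - N i. P x)"
    by (rule bchoice)
  then obtain N where N: "\<forall>i\<in>?I. negligible (N i) \<and> (\<forall>x\<in>{fst i..snd i} - N i. P x)" ..
  have "countable ?I"
    by (rule countable_subset[of _ "\<rat> \<times> \<rat>"]) (auto simp: countable_rat)
  then have "negligible (\<Union>(N ` ?I))" using N by (intro negligible_countable_Union) auto
  moreover have "\<forall>x\<in>S - \<Union>(N ` ?I). P x"
  proof
    fix x assume x: "x \<in> S - \<Union>(N ` ?I)"
    then obtain p q where "p \<in> \<rat>" "q \<in> \<rat>" "p \<in> S" "q \<in> S" "p \<le> x" "x \<le> q"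
      using open_rational_Icc[OF assms(1), of x] by blast
    then have i: "(p, q) \<in> ?I" and "x \<in> {p..q}" by auto
    then have "x \<in> {p..q} - N (p, q)" using x by blast
    then show "P x" using bspec[OF N i] by simp
  qed
  moreover have "S \<in> sets lebesgue" using assms(1) by (simp add: borel_open)
  ultimately show ?thesis by (intro AE_lebesgue_onI[of "\<Union>(N ` ?I)" S P]) auto
qed

lemma prim_const_imp_AE_zero:
  assumes "prim S C h" "open S" "is_interval S" "\<And>x y. x \<in> S \<Longrightarrow> y \<in> S \<Longrightarrow> C x = C y"
  shows "AE x in lebesgue_on S. h x = 0"
proof (rule AE_on_open_interval[OF assms(2,3)])
  fix a b assume *: "a \<in> S" "b \<in> S" "a \<le> b"
  show "\<exists>N. negligible N \<and> (\<forall>x\<in>{a..b} - N. h x = 0)"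
  proof (rule AE_zero_if_integral_zero)
    show "h integrable_on {a..b}" using primD[OF assms(1) *] by simp
    fix x y assume "a \<le> x" "x \<le> y" "y \<le> b"
    then have "x \<in> S" "y \<in> S" using Icc_subset_interval[OF assms(3) *(1,2)] by auto
    then show "integral {x..y} h = 0"
      using primD(2)[OF assms(1) _ _ \<open>x \<le> y\<close>] assms(4)[of x y] by simp
  qed
qed

text \<open>The points where the functions differ form an open set, and a nonempty open set is not
  negligible.\<close>

lemma continuous_AE_eq_imp_eq:
  fixes F G :: "real \<Rightarrow> complex"
  assumes "continuous_on S F" "continuous_on S G" "open S" "AE x in lebesgue_on S. F x = G x" "x \<in> S"
  shows "F x = G x"
proof (rule ccontr)
  assume "F x \<noteq> G x"
  have S: "S \<in> sets lebesgue" using assms(3) by (simp add: borel_open)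
  obtain N where N: "negligible N" "\<And>x. x \<in> S - N \<Longrightarrow> F x = G x"
    using AE_lebesgue_onE[OF assms(4) S] by blast
  let ?U = "S \<inter> (\<lambda>x. F x - G x) -` (- {0})"
  have "open ?U"
    by (rule continuous_open_preimage) (use assms in \<open>auto intro!: continuous_intros\<close>)
  moreover have "x \<in> ?U" using assms(5) \<open>F x \<noteq> G x\<close> by auto
  moreover have "?U \<subseteq> N" using N(2) by auto
  ultimately show False using N(1) open_not_negligible negligible_subset by blast
qed

text \<open>The signed integral from 0, a base point that all the domains share.\<close>

definition int0 :: "(real \<Rightarrow> complex) \<Rightarrow> real \<Rightarrow> complex" where
  "int0 f x = (if 0 \<le> x then integral {0..x} f else - integral {x..0} f)"

lemma prim_int0:
  assumes "0 \<in> S" "is_interval S" "\<And>x y. x \<in> S \<Longrightarrow> y \<in> S \<Longrightarrow> f absolutely_integrable_on {x..y}"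
  shows "prim S (\<lambda>x. c + int0 f x) f"
  unfolding prim_def
proof (intro ballI impI conjI)
  fix x y assume *: "x \<in> S" "y \<in> S" "x \<le> y"
  show "f absolutely_integrable_on {x..y}" by (rule assms) fact+
  have i: "f integrable_on {u..v}" if "u \<in> S" "v \<in> S" for u v
    using assms(3)[OF that] by (simp add: absolutely_integrable_on_def)
  consider "0 \<le> x" | "x < 0" "0 \<le> y" | "y < 0" by linarith
  then show "integral {x..y} f = c + int0 f y - (c + int0 f x)"
  proof cases
    case 1
    then show ?thesis
      using Henstock_Kurzweil_Integration.integral_combine[of 0 x y f] i[of 0 y] * assms(1) by (simp add: int0_def algebra_simps)
  next
    case 2
    then show ?thesis
      using Henstock_Kurzweil_Integration.integral_combine[of x 0 y f] i[of x y] * assms(1) by (simp add: int0_def algebra_simps)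
  next
    case 3
    then show ?thesis
      using Henstock_Kurzweil_Integration.integral_combine[of x y 0 f] i[of x 0] * assms(1) by (simp add: int0_def algebra_simps)
  qed
qed

section \<open>Weak derivatives on open intervals\<close>

text \<open>The bridge between the Lebesgue integral over \<Omega>, in which weak derivatives are
  defined, and the gauge integral over a compact interval, in which the calculus is done.\<close>

lemma integral_lebesgue_on_support:
  fixes h :: "real \<Rightarrow> complex"
  assumes "{a..b} \<subseteq> \<Omega>" "\<Omega> \<in> sets lebesgue" "\<And>x. x \<notin> {a..b} \<Longrightarrow> h x = 0"
    and "h absolutely_integrable_on {a..b}"
  shows "integrable (lebesgue_on \<Omega>) h" "integral\<^sup>L (lebesgue_on \<Omega>) h = integral {a..b} h"
proof -
  have eq: "indicator \<Omega> x *\<^sub>R h x = indicator {a..b} x *\<^sub>R h x" for x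
    using assms(1) assms(3)[of x] by (auto simp: indicator_def)
  have \<Omega>: "\<Omega> \<inter> space lebesgue \<in> sets lebesgue" using assms(2) by simp
  show "integrable (lebesgue_on \<Omega>) h"
    unfolding integrable_restrict_space[OF \<Omega>] eq using assms(4) by (simp only: set_integrable_def)
  have "integral\<^sup>L (lebesgue_on \<Omega>) h = (LINT x:{a..b}|lebesgue. h x)"
    unfolding integral_restrict_space[OF \<Omega>] eq set_lebesgue_integral_def ..
  also have "\<dots> = integral {a..b} h" by (rule set_lebesgue_integral_eq_integral[OF assms(4)])
  finally show "integral\<^sup>L (lebesgue_on \<Omega>) h = integral {a..b} h" .
qed

lemma vector_derivative_zero_on_open:
  assumes "open U" "x \<in> U" "\<And>y. y \<in> U \<Longrightarrow> \<psi> y = (0::complex)"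
  shows "vector_derivative \<psi> (at x) = 0"
proof -
  have "((\<lambda>_. 0::complex) has_vector_derivative 0) (at x)" by (rule has_vector_derivative_const)
  then have "(\<psi> has_vector_derivative 0) (at x)"
    by (rule has_vector_derivative_transform_within_open[OF _ assms(1,2)]) (use assms(3) in auto)
  then show ?thesis by (rule vector_derivative_at)
qed

lemma test_fun_smooth: "\<psi> \<in> test_fun \<Omega> \<Longrightarrow> smooth \<psi>"
  by (simp add: test_fun_def)

lemma test_fun_support:
  assumes "\<psi> \<in> test_fun \<Omega>" "open \<Omega>" "z \<in> \<Omega>"
  shows "\<exists>a\<in>\<Omega>. \<exists>b\<in>\<Omega>. a < b \<and>
    (\<forall>x. x \<le> a \<or> x \<ge> b \<longrightarrow> \<psi> x = 0 \<and> vector_derivative \<psi> (at x) = 0)"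
proof -
  obtain K where K: "compact K" "K \<subseteq> \<Omega>" "\<And>x. x \<notin> K \<Longrightarrow> \<psi> x = 0"
    using assms(1) by (auto simp: test_fun_def)
  \<comment> \<open>\<open>K\<close> may be empty; with \<open>z\<close> added, a least and a
    greatest element exist.\<close>
  let ?K = "insert z K"
  have cK: "compact ?K" using K(1) by simp
  obtain m where m: "m \<in> ?K" "\<And>x. x \<in> ?K \<Longrightarrow> m \<le> x"
    using compact_attains_inf[OF cK] by blast
  obtain M where M: "M \<in> ?K" "\<And>x. x \<in> ?K \<Longrightarrow> x \<le> M"
    using compact_attains_sup[OF cK] by blast
  have mM: "m \<in> \<Omega>" "M \<in> \<Omega>" using m(1) M(1) K(2) assms(3) by auto
  obtain e where e: "e > 0" "{m - e..m + e} \<subseteq> \<Omega>"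
    using assms(2) mM by (metis cball_eq_atLeastAtMost open_contains_cball)
  obtain e' where e': "e' > 0" "{M - e'..M + e'} \<subseteq> \<Omega>"
    using assms(2) mM by (metis cball_eq_atLeastAtMost open_contains_cball)
  have z: "m \<le> z" "z \<le> M" using m(2) M(2) by auto
  have left: "\<psi> x = 0" if "x \<in> {..<m}" for x using m(2)[of x] that by (intro K(3)) auto
  have right: "\<psi> x = 0" if "x \<in> {M<..}" for x using M(2)[of x] that by (intro K(3)) auto
  show ?thesis
  proof (rule bexI[of _ "m - e"], rule bexI[of _ "M + e'"], rule conjI[rotated], intro allI impI)
    fix x assume "x \<le> m - e \<or> x \<ge> M + e'"
    then have "x \<in> {..<m} \<or> x \<in> {M<..}" using e(1) e'(1) by auto
    then show "\<psi> x = 0 \<and> vector_derivative \<psi> (at x) = 0"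
    proof
      assume x: "x \<in> {..<m}"
      show "\<psi> x = 0 \<and> vector_derivative \<psi> (at x) = 0"
        by (intro conjI left[OF x] vector_derivative_zero_on_open[OF open_lessThan x] left)
    next
      assume x: "x \<in> {M<..}"
      show "\<psi> x = 0 \<and> vector_derivative \<psi> (at x) = 0"
        by (intro conjI right[OF x] vector_derivative_zero_on_open[OF open_greaterThan x] right)
    qed
  qed (use e e' z in auto)
qed

text \<open>Absolute continuity implies weak differentiability: the product
  \<open>G * \<psi>\<close> vanishes at both ends of an interval that contains the support of
  \<psi>.\<close>

lemma test_fun_by_parts:
  assumes "prim \<Omega> G g" "open \<Omega>" "is_interval \<Omega>" "\<psi> \<in> test_fun \<Omega>"
  shows "integrable (lebesgue_on \<Omega>) (\<lambda>x. G x * vector_derivative \<psi> (at x))"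
    "integrable (lebesgue_on \<Omega>) (\<lambda>x. g x * \<psi> x)"
    "(LINT x|lebesgue_on \<Omega>. G x * vector_derivative \<psi> (at x)) = - (LINT x|lebesgue_on \<Omega>. g x * \<psi> x)"
proof -
  have "integrable (lebesgue_on \<Omega>) (\<lambda>x. G x * vector_derivative \<psi> (at x)) \<and>
    integrable (lebesgue_on \<Omega>) (\<lambda>x. g x * \<psi> x) \<and>
    (LINT x|lebesgue_on \<Omega>. G x * vector_derivative \<psi> (at x)) = - (LINT x|lebesgue_on \<Omega>. g x * \<psi> x)"
  proof (cases "\<Omega> = {}")
    case True
    then show ?thesis by simp
  next
    case False
    then obtain z where "z \<in> \<Omega>" by blast
    then obtain a b where ab: "a \<in> \<Omega>" "b \<in> \<Omega>" "a < b"
      and z: "\<And>x. x \<le> a \<or> x \<ge> b \<Longrightarrow> \<psi> x = 0 \<and> vector_derivative \<psi> (at x) = 0"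
      using test_fun_support[OF assms(4,2)] by blast
    have sub: "{a..b} \<subseteq> \<Omega>" using Icc_subset_interval[OF assms(3) ab(1,2)] .
    have \<Omega>: "\<Omega> \<in> sets lebesgue" using assms(2) by (simp add: borel_open)
    note sm = test_fun_smooth[OF assms(4)]
    have p\<psi>: "prim {a..b} \<psi> (\<lambda>x. vector_derivative \<psi> (at x))"
      by (rule prim_of_derivative)
         (auto intro: smooth_D smooth_imp_continuous_on[OF smooth_D(2)] sm is_interval_cc)
    note pG = prim_subset[OF assms(1) sub]
    have i1: "(\<lambda>x. G x * vector_derivative \<psi> (at x)) absolutely_integrable_on {a..b}"
      using primD(1)[OF p\<psi>, of a b] ab(3)
      by (intro abs_integrable_mult_continuous prim_continuous_on_Icc[OF pG]) auto
    have i2: "(\<lambda>x. g x * \<psi> x) absolutely_integrable_on {a..b}"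
      using primD(1)[OF pG, of a b] ab(3)
      by (intro abs_integrable_mult_continuous smooth_imp_continuous_on[OF sm]) auto
    note I1 = integral_lebesgue_on_support[OF sub \<Omega> _ i1] and I2 = integral_lebesgue_on_support[OF sub \<Omega> _ i2]
    have "integral {a..b} (\<lambda>x. g x * \<psi> x + G x * vector_derivative \<psi> (at x)) = 0"
      using prim_mult_Icc[OF pG p\<psi>] ab(3) z[of a] z[of b] by simp
    also have "integral {a..b} (\<lambda>x. g x * \<psi> x + G x * vector_derivative \<psi> (at x)) =
       integral {a..b} (\<lambda>x. g x * \<psi> x) + integral {a..b} (\<lambda>x. G x * vector_derivative \<psi> (at x))"
      using i1 i2 by (intro Henstock_Kurzweil_Integration.integral_add) (simp_all only: absolutely_integrable_on_def)
    finally have "integral {a..b} (\<lambda>x. G x * vector_derivative \<psi> (at x)) = - integral {a..b} (\<lambda>x. g x * \<psi> x)"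
      by (simp add: eq_neg_iff_add_eq_0 add.commute)
    moreover have z': "x \<notin> {a..b} \<Longrightarrow> g x * \<psi> x = 0" "x \<notin> {a..b} \<Longrightarrow> G x * vector_derivative \<psi> (at x) = 0" for x
      using z[of x] by auto
    ultimately show ?thesis using I1 I2 by simp
  qed
  then show "integrable (lebesgue_on \<Omega>) (\<lambda>x. G x * vector_derivative \<psi> (at x))"
    "integrable (lebesgue_on \<Omega>) (\<lambda>x. g x * \<psi> x)"
    "(LINT x|lebesgue_on \<Omega>. G x * vector_derivative \<psi> (at x)) = - (LINT x|lebesgue_on \<Omega>. g x * \<psi> x)"
    by blast+
qed

lemma plateau_integral_tendsto:
  fixes k :: "real \<Rightarrow> complex"
  assumes "k absolutely_integrable_on {a..b}" "a \<le> p" "l \<ge> 0" "p + l \<le> b"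
  shows "(\<lambda>n. integral {a..b} (\<lambda>x. k x * plateau (1 / real (Suc n)) p l x)) \<longlonglongrightarrow> integral {p..p + l} k"
proof -
  have "(\<lambda>n. integral {a..b} (\<lambda>x. k x * plateau (1 / real (Suc n)) p l x))
      \<longlonglongrightarrow> integral {a..b} (\<lambda>x. k x * indicator {p<..p + l} x)"
  proof (rule dominated_convergence(2)[where h="\<lambda>x. cmod (k x)"])
    show "(\<lambda>x. k x * plateau (1 / real (Suc n)) p l x) integrable_on {a..b}" for n
      using abs_integrable_mult_continuous(1)[OF assms(1) smooth_imp_continuous_on[OF smooth_plateau]]
      by (simp only: absolutely_integrable_on_def)
    show "(\<lambda>x. cmod (k x)) integrable_on {a..b}" using assms(1) by (simp only: absolutely_integrable_on_def)
    show "cmod (k x * plateau (1 / real (Suc n)) p l x) \<le> cmod (k x)" for n x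
      unfolding norm_mult by (intro mult_left_le norm_plateau_le) simp
    show "(\<lambda>n. k x * plateau (1 / real (Suc n)) p l x) \<longlonglongrightarrow> k x * indicator {p<..p + l} x" for x
      by (intro tendsto_intros plateau_tendsto assms)
  qed
  also have "integral {a..b} (\<lambda>x. k x * indicator {p<..p + l} x) = integral {a..b} (\<lambda>x. if x \<in> {p..p + l} then k x else 0)"
    by (rule integral_spike[of "{p}"]) (auto simp: indicator_def)
  also have "\<dots> = integral ({a..b} \<inter> {p..p + l}) k"
    using integral_restrict_Int[of "{a..b}" "{p..p + l}" k] by (simp add: Int_commute)
  also have "{a..b} \<inter> {p..p + l} = {p..p + l}" using assms(2-4) by auto
  finally show ?thesis .
qed

section \<open>Weak derivatives and absolutely continuous representatives\<close>

lemma locally_integrable_Icc: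
  assumes "locally_integrable \<Omega> f" "is_interval \<Omega>" "x \<in> \<Omega>" "y \<in> \<Omega>"
  shows "f absolutely_integrable_on {x..y}"
  using assms(1) Icc_subset_interval[OF assms(2-4)] compact_Icc[of x y]
  unfolding locally_integrable_def by blast

lemma prim_locally_integrable:
  assumes "prim \<Omega> F f" "open \<Omega>" "is_interval \<Omega>"
  shows "locally_integrable \<Omega> f" "locally_integrable \<Omega> F"
proof -
  have *: "\<exists>a b. K \<subseteq> {a..b} \<and> {a..b} \<subseteq> \<Omega> \<and> (a \<le> b \<longrightarrow> a \<in> \<Omega> \<and> b \<in> \<Omega>)" if K: "compact K" "K \<subseteq> \<Omega>" for K
  proof (cases "K = {}")
    case True
    \<comment> \<open>The empty set is covered by the empty interval \<open>{1..0}\<close>.\<close>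
    then show ?thesis by (intro exI[of _ 1] exI[of _ 0]) simp
  next
    case False
    then obtain m M where "m \<in> K" "M \<in> K" "\<And>x. x \<in> K \<Longrightarrow> m \<le> x" "\<And>x. x \<in> K \<Longrightarrow> x \<le> M"
      using compact_attains_inf[OF K(1)] compact_attains_sup[OF K(1)] by metis
    then show ?thesis using K(2) Icc_subset_interval[OF assms(3), of m M]
      by (intro exI[of _ m] exI[of _ M]) auto
  qed
  show "locally_integrable \<Omega> f" unfolding locally_integrable_def
  proof (intro allI impI)
    fix K assume K: "compact K \<and> K \<subseteq> \<Omega>"
    then obtain a b where ab: "K \<subseteq> {a..b}" "{a..b} \<subseteq> \<Omega>" "a \<le> b \<longrightarrow> a \<in> \<Omega> \<and> b \<in> \<Omega>" using * by metis
    have "f absolutely_integrable_on {a..b}"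
      using primD(1)[OF assms(1), of a b] ab(3) by (cases "a \<le> b") auto
    then show "f absolutely_integrable_on K"
      by (rule set_integrable_subset) (use K ab(1) in \<open>auto simp: compact_imp_closed borel_closed\<close>)
  qed
  show "locally_integrable \<Omega> F" unfolding locally_integrable_def
  proof (intro allI impI)
    fix K assume K: "compact K \<and> K \<subseteq> \<Omega>"
    then obtain a b where ab: "K \<subseteq> {a..b}" "{a..b} \<subseteq> \<Omega>" using * by metis
    have "F absolutely_integrable_on {a..b}"
      by (rule absolutely_integrable_continuous_real[OF prim_continuous_on_Icc[OF prim_subset[OF assms(1) ab(2)]]])
    then show "F absolutely_integrable_on K"
      by (rule set_integrable_subset) (use K ab(1) in \<open>auto simp: compact_imp_closed borel_closed\<close>)
  qed
qed

text \<open>Testing with the difference of two normalised ramps compares the averages of \<open>k\<close> over two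
  intervals.\<close>

lemma weak_deriv_zero_averages:
  assumes "open \<Omega>" "is_interval \<Omega>" "locally_integrable \<Omega> k"
    and "\<And>\<psi>. \<psi> \<in> test_fun \<Omega> \<Longrightarrow> (LINT x|lebesgue_on \<Omega>. k x * vector_derivative \<psi> (at x)) = 0"
    and "p \<in> \<Omega>" "p + l \<in> \<Omega>" "q \<in> \<Omega>" "q + m \<in> \<Omega>" "l > 0" "m > 0"
  shows "integral {p..p + l} k / of_real l = integral {q..q + m} k / of_real m"
proof -
  have \<Omega>: "\<Omega> \<in> sets lebesgue" using assms(1) by (simp add: borel_open)
  define a where "a = min p q"
  define M where "M = max (p + l) (q + m)"
  have "a \<in> \<Omega>" "M \<in> \<Omega>" using assms(5-8) by (auto simp: a_def M_def min_def max_def)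
  \<comment> \<open>A plateau overshoots its interval to the right by the width of its transition;
    \<open>e\<close> is the room left for that.\<close>
  obtain e where e: "e > 0" "{M - e..M + e} \<subseteq> \<Omega>"
    using assms(1) \<open>M \<in> \<Omega>\<close> by (metis cball_eq_atLeastAtMost open_contains_cball)
  define b where "b = M + e"
  have "b \<in> \<Omega>" using e by (auto simp: b_def)
  have sub: "{a..b} \<subseteq> \<Omega>" by (intro Icc_subset_interval assms \<open>a \<in> \<Omega>\<close> \<open>b \<in> \<Omega>\<close>)
  have ka: "k absolutely_integrable_on {a..b}"
    by (intro locally_integrable_Icc[OF assms(3,2)] \<open>a \<in> \<Omega>\<close> \<open>b \<in> \<Omega>\<close>)
  have ineq: "a \<le> p" "a \<le> q" "p + l \<le> M" "q + m \<le> M" by (auto simp: a_def M_def)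
  let ?I = "\<lambda>n p l. integral {a..b} (\<lambda>x. k x * plateau (1 / real (Suc n)) p l x)"
  obtain N where N: "1 / real (Suc N) < e" by (rule nat_approx_posE[OF e(1)])
  have ev: "?I n p l / of_real l - ?I n q m / of_real m = 0" if "n \<ge> N" for n
  proof -
    define d where "d = 1 / real (Suc n)"
    have "d \<le> 1 / real (Suc N)" unfolding d_def using that by (intro divide_left_mono) auto
    then have d: "d > 0" "d < e" using N by (auto simp: d_def)
    define \<psi> where "\<psi> = (\<lambda>x. (1 / of_real l) * plateau_ramp d p l x - (1 / of_real m) * plateau_ramp d q m x)"
    have sm: "smooth \<psi>"
      using smooth_diff[OF smooth_cmult_affine[OF smooth_plateau_ramp[OF d(1)], where c="1 / of_real l" and k=1 and m=0]
          smooth_cmult_affine[OF smooth_plateau_ramp[OF d(1)], where c="1 / of_real m" and k=1 and m=0]]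
      unfolding \<psi>_def by simp
    have "\<psi> x = 0" if "x \<notin> {a..b}" for x
    proof (cases "x < a")
      case True
      then show ?thesis using ineq d(1) assms(9,10) by (simp add: \<psi>_def plateau_ramp_left)
    next
      case False
      then have "x > b" using that by auto
      then have "x \<ge> p + l + d" "x \<ge> q + m + d" using ineq d(2) by (auto simp: b_def)
      then show ?thesis using d(1) assms(9,10) by (simp add: \<psi>_def plateau_ramp_right)
    qed
    then have "\<psi> \<in> test_fun \<Omega>" using sm sub by (auto simp: test_fun_def intro!: exI[of _ "{a..b}"])
    moreover have "vector_derivative \<psi> (at x) = (1 / of_real l) * plateau d p l x - (1 / of_real m) * plateau d q m x" for x
      unfolding \<psi>_def
      by (intro vector_derivative_at has_vector_derivative_diff has_vector_derivative_mult_right plateau_ramp_derivative d)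
    ultimately have "(LINT x|lebesgue_on \<Omega>. k x * ((1 / of_real l) * plateau d p l x - (1 / of_real m) * plateau d q m x)) = 0"
      using assms(4)[of \<psi>] by simp
    also have "(LINT x|lebesgue_on \<Omega>. k x * ((1 / of_real l) * plateau d p l x - (1 / of_real m) * plateau d q m x))
       = integral {a..b} (\<lambda>x. k x * ((1 / of_real l) * plateau d p l x - (1 / of_real m) * plateau d q m x))"
    proof (rule integral_lebesgue_on_support(2)[OF sub \<Omega>])
      show "k x * ((1 / of_real l) * plateau d p l x - (1 / of_real m) * plateau d q m x) = 0" if "x \<notin> {a..b}" for x
      proof -
        have "x \<le> p \<or> x \<ge> p + l + d" "x \<le> q \<or> x \<ge> q + m + d" using that ineq d(2) by (auto simp: b_def)
        then show ?thesis using d(1) assms(9,10) by (simp add: plateau_eq_0)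
      qed
      show "(\<lambda>x. k x * ((1 / of_real l) * plateau d p l x - (1 / of_real m) * plateau d q m x)) absolutely_integrable_on {a..b}"
        by (intro abs_integrable_mult_continuous ka continuous_intros smooth_imp_continuous_on[OF smooth_plateau])
    qed
    also have "\<dots> = integral {a..b} (\<lambda>x. (1 / of_real l) * (k x * plateau d p l x) - (1 / of_real m) * (k x * plateau d q m x))"
      by (simp add: algebra_simps)
    also have "\<dots> = integral {a..b} (\<lambda>x. (1 / of_real l) * (k x * plateau d p l x)) - integral {a..b} (\<lambda>x. (1 / of_real m) * (k x * plateau d q m x))"
      using abs_integrable_mult_continuous(1)[OF ka smooth_imp_continuous_on[OF smooth_plateau]]
      by (intro Henstock_Kurzweil_Integration.integral_diff integrable_on_mult_right) (simp_all only: absolutely_integrable_on_def)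
    finally show ?thesis by (simp add: d_def)
  qed
  have "(\<lambda>n. ?I n p l / of_real l - ?I n q m / of_real m) \<longlonglongrightarrow> integral {p..p + l} k / of_real l - integral {q..q + m} k / of_real m"
    using ineq e(1) assms(9,10) by (intro tendsto_intros plateau_integral_tendsto ka) (auto simp: b_def)
  moreover have "(\<lambda>n. ?I n p l / of_real l - ?I n q m / of_real m) \<longlonglongrightarrow> 0"
    by (rule tendsto_eventually, rule eventually_sequentiallyI[of N], rule ev)
  ultimately have "integral {p..p + l} k / of_real l - integral {q..q + m} k / of_real m = 0"
    using LIMSEQ_unique by blast
  then show ?thesis by simp
qed

text \<open>The lemma of du Bois-Reymond. All averages of \<open>k\<close> equal one number
  \<open>c\<close>, so \<open>k - c\<close> integrates to 0 over every compact subinterval.\<close>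

lemma weak_deriv_zero_imp_const:
  assumes "open \<Omega>" "is_interval \<Omega>" "locally_integrable \<Omega> k"
    and "\<And>\<psi>. \<psi> \<in> test_fun \<Omega> \<Longrightarrow> (LINT x|lebesgue_on \<Omega>. k x * vector_derivative \<psi> (at x)) = 0"
  shows "\<exists>c. AE x in lebesgue_on \<Omega>. k x = c"
proof (cases "\<Omega> = {}")
  case True
  then show ?thesis by (auto simp: AE_lebesgue_on_iff intro!: exI[of _ "{}"])
next
  case False
  then obtain q where q: "q \<in> \<Omega>" by blast
  obtain m where m: "m > 0" "{q - m..q + m} \<subseteq> \<Omega>"
    using assms(1) q by (metis cball_eq_atLeastAtMost open_contains_cball)
  define c where "c = integral {q..q + m} k / of_real m"
  have kI: "integral {x..y} k = c * of_real (y - x)" if "x \<in> \<Omega>" "y \<in> \<Omega>" "x \<le> y" for x y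
  proof (cases "x = y")
    case False
    then have "integral {x..x + (y - x)} k / of_real (y - x) = c"
      unfolding c_def using q m that by (intro weak_deriv_zero_averages[OF assms]) auto
    then show ?thesis using False that by (auto simp: field_simps)
  qed simp
  have "prim \<Omega> (\<lambda>_. 0) (\<lambda>x. k x - c)"
    unfolding prim_def
  proof (intro ballI impI conjI)
    fix x y assume *: "x \<in> \<Omega>" "y \<in> \<Omega>" "x \<le> y"
    note k = locally_integrable_Icc[OF assms(3,2) *(1,2)]
    show "(\<lambda>x. k x - c) absolutely_integrable_on {x..y}"
      by (intro set_integral_diff(1) k absolutely_integrable_continuous_real continuous_intros)
    have "integral {x..y} (\<lambda>x. k x - c) = integral {x..y} k - integral {x..y} (\<lambda>x. c)"
      using k by (intro Henstock_Kurzweil_Integration.integral_diff) (simp_all add: absolutely_integrable_on_def integrable_const_ivl)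
    then show "integral {x..y} (\<lambda>x. k x - c) = 0 - 0"
      using kI[OF *] *(3) by (simp add: scaleR_conv_of_real mult.commute)
  qed
  from prim_const_imp_AE_zero[OF this assms(1,2)]
  show ?thesis by (intro exI[of _ c]) simp
qed

text \<open>Integration by parts shows that \<open>f\<close> minus a primitive of \<open>g\<close>
  has weak derivative 0, hence is constant.\<close>

lemma weak_deriv_imp_int0:
  assumes "weak_deriv \<Omega> f g" "open \<Omega>" "is_interval \<Omega>" "0 \<in> \<Omega>"
  obtains c where "AE x in lebesgue_on \<Omega>. f x = c + int0 g x"
proof -
  have f: "locally_integrable \<Omega> f" and g: "locally_integrable \<Omega> g"
    and w: "\<And>\<psi>. \<psi> \<in> test_fun \<Omega> \<Longrightarrow> (LINT x|lebesgue_on \<Omega>. f x * vector_derivative \<psi> (at x)) = - (LINT x|lebesgue_on \<Omega>. g x * \<psi> x)"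
    using assms(1) by (auto simp: weak_deriv_def)
  have \<Omega>: "\<Omega> \<in> sets lebesgue" using assms(2) by (simp add: borel_open)
  have pG: "prim \<Omega> (\<lambda>x. 0 + int0 g x) g"
    by (intro prim_int0 assms locally_integrable_Icc[OF g])
  have G: "locally_integrable \<Omega> (\<lambda>x. 0 + int0 g x)"
    by (intro prim_locally_integrable[OF pG] assms)
  have "\<exists>c. AE x in lebesgue_on \<Omega>. f x - (0 + int0 g x) = c"
  proof (rule weak_deriv_zero_imp_const[OF assms(2,3)])
    show "locally_integrable \<Omega> (\<lambda>x. f x - (0 + int0 g x))"
      unfolding locally_integrable_def
    proof (intro allI impI)
      fix K assume K: "compact K \<and> K \<subseteq> \<Omega>"
      show "(\<lambda>x. f x - (0 + int0 g x)) absolutely_integrable_on K"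
        by (rule set_integral_diff(1)) (use f G K in \<open>auto simp: locally_integrable_def\<close>)
    qed
    fix \<psi> assume \<psi>: "\<psi> \<in> test_fun \<Omega>"
    note bp = test_fun_by_parts[OF pG assms(2,3) \<psi>]
    obtain a b where ab: "a \<in> \<Omega>" "b \<in> \<Omega>" "a < b"
      and z: "\<And>x. x \<le> a \<or> x \<ge> b \<Longrightarrow> \<psi> x = 0 \<and> vector_derivative \<psi> (at x) = 0"
      using test_fun_support[OF \<psi> assms(2,4)] by blast
    have "integrable (lebesgue_on \<Omega>) (\<lambda>x. f x * vector_derivative \<psi> (at x))"
    proof (rule integral_lebesgue_on_support(1)[OF Icc_subset_interval[OF assms(3) ab(1,2)] \<Omega>])
      show "(\<lambda>x. f x * vector_derivative \<psi> (at x)) absolutely_integrable_on {a..b}"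
        by (intro abs_integrable_mult_continuous locally_integrable_Icc[OF f assms(3)] ab
            smooth_imp_continuous_on[OF smooth_D(2)] test_fun_smooth[OF \<psi>])
      show "f x * vector_derivative \<psi> (at x) = 0" if "x \<notin> {a..b}" for x
        using z[of x] that by auto
    qed
    from Bochner_Integration.integral_diff[OF this bp(1)]
    show "(LINT x|lebesgue_on \<Omega>. (f x - (0 + int0 g x)) * vector_derivative \<psi> (at x)) = 0"
      using w[OF \<psi>] bp(3) by (simp add: left_diff_distrib)
  qed
  then obtain c where "AE x in lebesgue_on \<Omega>. f x - (0 + int0 g x) = c" ..
  then have "AE x in lebesgue_on \<Omega>. f x = c + int0 g x" by eventually_elim (simp add: diff_eq_eq)
  then show thesis by (rule that)
qed

lemma weak_deriv_prim:
  assumes "weak_deriv \<Omega> f g" "open \<Omega>" "is_interval \<Omega>" "0 \<in> \<Omega>"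
  obtains F where "prim \<Omega> F g" "AE x in lebesgue_on \<Omega>. f x = F x"
proof -
  obtain c where "AE x in lebesgue_on \<Omega>. f x = c + int0 g x"
    using weak_deriv_imp_int0[OF assms] .
  moreover have "prim \<Omega> (\<lambda>x. c + int0 g x) g"
    using assms(1) by (intro prim_int0 assms locally_integrable_Icc[of \<Omega> g]) (auto simp: weak_deriv_def)
  ultimately show thesis by (rule that[rotated])
qed

lemma prim_unique_AE:
  assumes "prim \<Omega> F g" "prim \<Omega> G h" "open \<Omega>" "is_interval \<Omega>" "AE x in lebesgue_on \<Omega>. F x = G x"
  shows "AE x in lebesgue_on \<Omega>. g x = h x" "\<And>x. x \<in> \<Omega> \<Longrightarrow> F x = G x"
proof -
  show eq: "F x = G x" if "x \<in> \<Omega>" for x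
    by (rule continuous_AE_eq_imp_eq[OF prim_continuous_on[OF assms(1,3)]
          prim_continuous_on[OF assms(2,3)] assms(3,5) that])
  have "AE x in lebesgue_on \<Omega>. g x - h x = 0"
    by (rule prim_const_imp_AE_zero[OF prim_diff[OF assms(1,2)] assms(3,4)]) (simp add: eq)
  then show "AE x in lebesgue_on \<Omega>. g x = h x" by simp
qed

lemma weak_deriv_unique:
  assumes "weak_deriv \<Omega> f g" "weak_deriv \<Omega> f' h" "AE x in lebesgue_on \<Omega>. f x = f' x"
    "open \<Omega>" "is_interval \<Omega>" "0 \<in> \<Omega>"
  shows "AE x in lebesgue_on \<Omega>. g x = h x"
proof -
  obtain F where F: "prim \<Omega> F g" "AE x in lebesgue_on \<Omega>. f x = F x" using weak_deriv_prim[OF assms(1,4-6)] .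
  obtain G where G: "prim \<Omega> G h" "AE x in lebesgue_on \<Omega>. f' x = G x" using weak_deriv_prim[OF assms(2,4-6)] .
  have "AE x in lebesgue_on \<Omega>. F x = G x" using F(2) G(2) assms(3) by eventually_elim simp
  from prim_unique_AE(1)[OF F(1) G(1) assms(4,5) this] show ?thesis .
qed

lemma weak_deriv_subset:
  assumes "weak_deriv \<Omega> f g" "\<Omega>' \<subseteq> \<Omega>" "open \<Omega>" "open \<Omega>'"
  shows "weak_deriv \<Omega>' f g"
  unfolding weak_deriv_def
proof (intro conjI ballI)
  show "locally_integrable \<Omega>' f" "locally_integrable \<Omega>' g"
    using assms(1,2) unfolding weak_deriv_def locally_integrable_def by blast+
  fix \<psi> assume \<psi>: "\<psi> \<in> test_fun \<Omega>'"
  then have \<psi>': "\<psi> \<in> test_fun \<Omega>" using assms(2) by (auto simp: test_fun_def)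
  obtain K where K: "compact K" "K \<subseteq> \<Omega>'" "\<And>x. x \<notin> K \<Longrightarrow> \<psi> x = 0"
    using \<psi> by (auto simp: test_fun_def)
  have d0: "vector_derivative \<psi> (at x) = 0" if "x \<notin> K" for x
    by (rule vector_derivative_zero_on_open[of "- K"]) (use K that in \<open>auto simp: compact_imp_closed open_Compl\<close>)
  have eq: "(LINT x|lebesgue_on \<Omega>'. h x * q x) = (LINT x|lebesgue_on \<Omega>. h x * q x)"
    if "\<And>x. x \<notin> K \<Longrightarrow> q x = 0" for h q :: "real \<Rightarrow> complex"
  proof -
    have "indicator \<Omega>' x *\<^sub>R (h x * q x) = indicator \<Omega> x *\<^sub>R (h x * q x)" for x
      using that[of x] K(2) assms(2) by (auto simp: indicator_def)
    note ind = this
    have "\<Omega>' \<inter> space lebesgue \<in> sets lebesgue" "\<Omega> \<inter> space lebesgue \<in> sets lebesgue"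
      using assms(3,4) by (simp_all add: borel_open)
    then show ?thesis by (simp only: integral_restrict_space ind)
  qed
  show "(LINT x|lebesgue_on \<Omega>'. f x * vector_derivative \<psi> (at x)) = - (LINT x|lebesgue_on \<Omega>'. g x * \<psi> x)"
    using assms(1) \<psi>' unfolding weak_deriv_def by (simp add: eq d0 K(3))
qed

text \<open>Plateaus with rational data yield the integrals over rational intervals, and continuity
  of the primitive yields the others. The point is that countably many tests suffice: later each of
  them has its own null set of exceptional times.\<close>

lemma AE_zero_if_plateau_integrals_zero:
  assumes "locally_integrable UNIV k"
    and "\<And>p l n. p \<in> \<rat> \<Longrightarrow> l \<in> \<rat> \<Longrightarrow> l \<ge> 0 \<Longrightarrow>
      (LINT x|lebesgue. k x * plateau (1 / real (Suc n)) p l x) = 0"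
  shows "AE x in lebesgue. k x = 0"
proof -
  have k: "k absolutely_integrable_on {x..y}" for x y
    using assms(1) by (simp add: locally_integrable_def)
  have pk: "prim UNIV (\<lambda>x. 0 + int0 k x) k" by (intro prim_int0 k) auto
  have zero: "integral {p..p + l} k = 0" if "p \<in> \<rat>" "l \<in> \<rat>" "l \<ge> 0" for p l
  proof -
    have "(\<lambda>n. integral {p..p + l + 1} (\<lambda>x. k x * plateau (1 / real (Suc n)) p l x)) \<longlonglongrightarrow> integral {p..p + l} k"
      using that by (intro plateau_integral_tendsto k) auto
    moreover have "integral {p..p + l + 1} (\<lambda>x. k x * plateau (1 / real (Suc n)) p l x) = 0" for n
    proof -
      have "integral\<^sup>L (lebesgue_on UNIV) (\<lambda>x. k x * plateau (1 / real (Suc n)) p l x)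
         = integral {p..p + l + 1} (\<lambda>x. k x * plateau (1 / real (Suc n)) p l x)"
      proof (rule integral_lebesgue_on_support(2))
        show "k x * plateau (1 / real (Suc n)) p l x = 0" if "x \<notin> {p..p + l + 1}" for x
        proof -
          have "1 / real (Suc n) \<le> 1" by simp
          moreover have "x < p \<or> x > p + l + 1" using that by fastforce
          ultimately have "x \<le> p \<or> x \<ge> p + l + 1 / real (Suc n)" by linarith
          then have "plateau (1 / real (Suc n)) p l x = 0" using \<open>l \<ge> 0\<close> by (intro plateau_eq_0) auto
          then show ?thesis by simp
        qed
      qed (auto intro!: abs_integrable_mult_continuous(1) k smooth_imp_continuous_on[OF smooth_plateau])
      then show ?thesis using assms(2)[OF that, of n] by (simp add: lebesgue_on_UNIV_eq)
    qed
    ultimately show ?thesis by (simp add: LIMSEQ_const_iff)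
  qed
  have rat: "int0 k q = 0" if "q \<in> \<rat>" for q
  proof (cases "0 \<le> q")
    case True
    then show ?thesis using zero[of 0 q] that by (simp add: int0_def)
  next
    case False
    then show ?thesis using zero[of q "- q"] that by (simp add: int0_def)
  qed
  have c: "continuous_on UNIV (\<lambda>x. 0 + int0 k x)" by (rule prim_continuous_on[OF pk]) simp
  have all: "0 + int0 k x = 0" for x
  proof (rule ccontr)
    assume x: "0 + int0 k x \<noteq> 0"
    have "open ((\<lambda>x. 0 + int0 k x) -` (- {0}))" by (rule open_vimage[OF _ c]) auto
    with x obtain e where e: "e > 0" "ball x e \<subseteq> (\<lambda>x. 0 + int0 k x) -` (- {0})"
      by (metis ComplI open_contains_ball singletonD vimageI)
    obtain q where "q \<in> \<rat>" "x < q" "q < x + e" using Rats_dense_in_real[of x "x + e"] e(1) by auto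
    then show False using e(2) rat[of q] by (auto simp: dist_real_def subset_iff)
  qed
  have "AE x in lebesgue_on UNIV. k x = 0"
    by (rule prim_const_imp_AE_zero[OF pk]) (simp_all only: all open_UNIV is_interval_univ)
  then show ?thesis by (simp add: AE_restrict_space_iff)
qed

section \<open>The space \<open>L\<^sup>2\<close>\<close>

text \<open>The real counterpart of \<open>L2_sq\<close>. As the integral of a nonintegrable
  function is 0 by convention, it is informative only together with membership in
  \<open>L2\<close>.\<close>

definition nsq :: "real set \<Rightarrow> (real \<Rightarrow> complex) \<Rightarrow> real" where
  "nsq \<Omega> f = (LINT x|lebesgue_on \<Omega>. (cmod (f x))\<^sup>2)"

lemma nsq_nonneg: "nsq \<Omega> f \<ge> 0"
  by (simp add: nsq_def)

section \<open>Membership in \<open>L2\<close> and the squared norm\<close>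

lemma L2_iff:
  "f \<in> L2 \<Omega> \<longleftrightarrow> f \<in> borel_measurable (lebesgue_on \<Omega>) \<and> integrable (lebesgue_on \<Omega>) (\<lambda>x. (cmod (f x))\<^sup>2)"
proof (cases "f \<in> borel_measurable (lebesgue_on \<Omega>)")
  case True
  then have "(\<lambda>x. (cmod (f x))\<^sup>2) \<in> borel_measurable (lebesgue_on \<Omega>)" by measurable
  then show ?thesis using True
    by (simp add: L2_def L2_sq_def integrable_iff_bounded)
qed (simp add: L2_def L2_sq_def)

lemma L2_D:
  assumes "f \<in> L2 \<Omega>"
  shows "f \<in> borel_measurable (lebesgue_on \<Omega>)" "integrable (lebesgue_on \<Omega>) (\<lambda>x. (cmod (f x))\<^sup>2)"
  using assms by (auto simp: L2_iff)

lemma L2_sq_eq: "f \<in> L2 \<Omega> \<Longrightarrow> L2_sq \<Omega> f = ennreal (nsq \<Omega> f)"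
  unfolding L2_sq_def nsq_def using L2_D[of f \<Omega>] by (simp add: nn_integral_eq_integral)

lemma L2_sq_le_iff: "C \<ge> 0 \<Longrightarrow> L2_sq \<Omega> f \<le> ennreal C \<longleftrightarrow> f \<in> L2 \<Omega> \<and> nsq \<Omega> f \<le> C"
proof (cases "f \<in> L2 \<Omega>")
  case False
  then have "L2_sq \<Omega> f = \<infinity>" by (simp add: L2_def not_less top_unique)
  then show ?thesis using False by (simp add: top_unique)
qed (simp add: L2_sq_eq)

lemma L2_bound:
  assumes "f \<in> borel_measurable (lebesgue_on \<Omega>)" "integrable (lebesgue_on \<Omega>) h"
    "AE x in lebesgue_on \<Omega>. (cmod (f x))\<^sup>2 \<le> h x"
  shows "f \<in> L2 \<Omega>"
  unfolding L2_iff
proof (intro conjI assms(1) Bochner_Integration.integrable_bound[OF assms(2)])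
  show "(\<lambda>x. (cmod (f x))\<^sup>2) \<in> borel_measurable (lebesgue_on \<Omega>)" using assms(1) by measurable
  show "AE x in lebesgue_on \<Omega>. norm ((cmod (f x))\<^sup>2) \<le> norm (h x)"
    using assms(3) by eventually_elim simp
qed

lemma L2_cong_AE:
  assumes "f \<in> L2 \<Omega>" "AE x in lebesgue_on \<Omega>. f x = g x" "g \<in> borel_measurable (lebesgue_on \<Omega>)"
  shows "g \<in> L2 \<Omega>" "nsq \<Omega> g = nsq \<Omega> f"
proof -
  show "g \<in> L2 \<Omega>"
    by (rule L2_bound[OF assms(3) L2_D(2)[OF assms(1)]]) (use assms(2) in eventually_elim, simp)
  then show "nsq \<Omega> g = nsq \<Omega> f" unfolding nsq_def
    by (intro integral_cong_AE) (use assms(2) L2_D[OF assms(1)] L2_D[of g \<Omega>] in \<open>auto elim: eventually_mono\<close>)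
qed

lemma norm_sum_sq_le: "(norm (a + b))\<^sup>2 \<le> 2 * (norm a)\<^sup>2 + 2 * (norm (b::'a::real_normed_vector))\<^sup>2"
proof -
  have "(norm (a + b))\<^sup>2 \<le> (norm a + norm b)\<^sup>2" by (intro power_mono norm_triangle_ineq) simp
  also have "\<dots> \<le> 2 * (norm a)\<^sup>2 + 2 * (norm b)\<^sup>2"
    using zero_le_power2[of "norm a - norm b"] by (simp add: power2_eq_square algebra_simps)
  finally show ?thesis .
qed

lemma L2_add: "f \<in> L2 \<Omega> \<Longrightarrow> g \<in> L2 \<Omega> \<Longrightarrow> (\<lambda>x. f x + g x) \<in> L2 \<Omega>"
  by (rule L2_bound[where h="\<lambda>x. 2 * (cmod (f x))\<^sup>2 + 2 * (cmod (g x))\<^sup>2"])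
     (auto simp: L2_iff norm_sum_sq_le)

lemma L2_cmult: "f \<in> L2 \<Omega> \<Longrightarrow> (\<lambda>x. c * f x) \<in> L2 \<Omega>"
  by (auto simp: L2_iff norm_mult power_mult_distrib)

lemma L2_uminus: "f \<in> L2 \<Omega> \<Longrightarrow> (\<lambda>x. - f x) \<in> L2 \<Omega>"
  using L2_cmult[of f \<Omega> "-1"] by simp

lemma L2_diff: "f \<in> L2 \<Omega> \<Longrightarrow> g \<in> L2 \<Omega> \<Longrightarrow> (\<lambda>x. f x - g x) \<in> L2 \<Omega>"
  using L2_add[of f \<Omega> "\<lambda>x. - g x"] L2_uminus[of g \<Omega>] by simp

lemma borel_measurable_cnj: "f \<in> borel_measurable M \<Longrightarrow> (\<lambda>x. cnj (f x)) \<in> borel_measurable M"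
  by (rule measurable_compose[OF _ borel_measurable_continuous_onI]) (auto intro: continuous_intros)

lemma L2_cnj: "f \<in> L2 \<Omega> \<Longrightarrow> (\<lambda>x. cnj (f x)) \<in> L2 \<Omega>"
  by (auto simp: L2_iff borel_measurable_cnj)

lemma L2_zero: "(\<lambda>x. 0) \<in> L2 \<Omega>"
  by (simp add: L2_iff)

lemma L2_mult_integrable:
  assumes "f \<in> L2 \<Omega>" "g \<in> L2 \<Omega>"
  shows "integrable (lebesgue_on \<Omega>) (\<lambda>x. f x * g x)"
proof (rule Bochner_Integration.integrable_bound)
  show "integrable (lebesgue_on \<Omega>) (\<lambda>x. (cmod (f x))\<^sup>2 + (cmod (g x))\<^sup>2)"
    using assms by (auto simp: L2_iff)
  show "(\<lambda>x. f x * g x) \<in> borel_measurable (lebesgue_on \<Omega>)"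
    using assms by (auto simp: L2_iff)
  have "cmod (f x) * cmod (g x) \<le> (cmod (f x))\<^sup>2 + (cmod (g x))\<^sup>2" for x
  proof -
    have "0 \<le> cmod (f x) * cmod (g x)" by simp
    then show ?thesis using sum_squares_bound[of "cmod (f x)" "cmod (g x)"] by linarith
  qed
  then show "AE x in lebesgue_on \<Omega>. norm (f x * g x) \<le> norm ((cmod (f x))\<^sup>2 + (cmod (g x))\<^sup>2)"
    by (simp add: norm_mult)
qed

lemma sq_div_le: "a\<^sup>2 / (a + d) \<le> a" if "a \<ge> 0" "d > 0" for a d :: real
  using that by (simp add: pos_divide_le_eq power2_eq_square distrib_left)

text \<open>Young's inequality holds for every weight \<open>k > 0\<close>, and the best weight is
  the norm of \<open>g\<close> divided by that of \<open>f\<close>. Adding \<open>d\<close> to both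
  norms keeps the quotient positive and finite when one of them vanishes; the cost is linear in
  \<open>d\<close>.\<close>

lemma L2_Cauchy_Schwarz:
  assumes "f \<in> L2 \<Omega>" "g \<in> L2 \<Omega>"
  shows "cmod (LINT x|lebesgue_on \<Omega>. f x * g x) \<le> sqrt (nsq \<Omega> f) * sqrt (nsq \<Omega> g)"
proof -
  let ?I = "cmod (LINT x|lebesgue_on \<Omega>. f x * g x)"
  have young: "2 * ?I \<le> k * nsq \<Omega> f + nsq \<Omega> g / k" if "k > 0" for k
  proof -
    have "?I \<le> (LINT x|lebesgue_on \<Omega>. cmod (f x * g x))"
      by (rule integral_norm_bound)
    also have "\<dots> \<le> (LINT x|lebesgue_on \<Omega>. (k * (cmod (f x))\<^sup>2 + (cmod (g x))\<^sup>2 / k) / 2)"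
    proof (rule integral_mono)
      show "integrable (lebesgue_on \<Omega>) (\<lambda>x. cmod (f x * g x))"
        using L2_mult_integrable[OF assms] by (rule integrable_norm)
      show "integrable (lebesgue_on \<Omega>) (\<lambda>x. (k * (cmod (f x))\<^sup>2 + (cmod (g x))\<^sup>2 / k) / 2)"
        using L2_D(2)[OF assms(1)] L2_D(2)[OF assms(2)] by auto
      fix x
      have "0 \<le> (k * cmod (f x) - cmod (g x))\<^sup>2 / k" using that by simp
      also have "\<dots> = k * (cmod (f x))\<^sup>2 + (cmod (g x))\<^sup>2 / k - 2 * (cmod (f x) * cmod (g x))"
        using that by (simp add: power2_eq_square field_simps)
      finally show "cmod (f x * g x) \<le> (k * (cmod (f x))\<^sup>2 + (cmod (g x))\<^sup>2 / k) / 2"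
        by (simp add: norm_mult)
    qed
    also have "\<dots> = (k * nsq \<Omega> f + nsq \<Omega> g / k) / 2"
      using L2_D(2)[OF assms(1)] L2_D(2)[OF assms(2)] by (simp add: nsq_def)
    finally show ?thesis by simp
  qed
  let ?a = "sqrt (nsq \<Omega> f)" and ?b = "sqrt (nsq \<Omega> g)"
  have sq: "nsq \<Omega> f = ?a\<^sup>2" "nsq \<Omega> g = ?b\<^sup>2" by (simp_all add: nsq_nonneg)
  have nn: "?a \<ge> 0" "?b \<ge> 0" by (simp_all add: nsq_nonneg)
  show ?thesis
  proof (rule field_le_epsilon)
    fix e :: real assume "e > 0"
    define d where "d = e / (?a + ?b + 1)"
    have ab1: "?a + ?b + 1 > 0" using nn by linarith
    have d: "d > 0" unfolding d_def by (rule divide_pos_pos[OF \<open>e > 0\<close> ab1])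
    have "(?a + ?b) * e \<le> (?a + ?b + 1) * e" using \<open>e > 0\<close> by (intro mult_right_mono) auto
    then have de: "(?a + ?b) * d \<le> e"
      using ab1 by (simp add: d_def pos_divide_le_eq mult.commute)
    have "2 * ?I \<le> (?b + d) / (?a + d) * ?a\<^sup>2 + ?b\<^sup>2 / ((?b + d) / (?a + d))"
      using young[of "(?b + d) / (?a + d)"] d nn unfolding sq[symmetric] by simp
    also have "(?b + d) / (?a + d) * ?a\<^sup>2 \<le> (?b + d) * ?a"
    proof -
      have "?a\<^sup>2 / (?a + d) \<le> ?a" by (rule sq_div_le) (use d nn in auto)
      from mult_left_mono[OF this, of "?b + d"] show ?thesis using d nn
        by (simp only: times_divide_eq_left times_divide_eq_right)
    qed
    also have "?b\<^sup>2 / ((?b + d) / (?a + d)) \<le> (?a + d) * ?b"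
    proof -
      have "?b\<^sup>2 / (?b + d) \<le> ?b" by (rule sq_div_le) (use d nn in auto)
      from mult_left_mono[OF this, of "?a + d"] show ?thesis using d nn
        by (simp only: divide_divide_eq_right times_divide_eq_right mult.commute[of "?b\<^sup>2"])
    qed
    finally have "2 * ?I \<le> 2 * (?a * ?b) + (?a + ?b) * d" by (simp add: algebra_simps)
    then show "?I \<le> ?a * ?b + e" using de \<open>e > 0\<close> by simp
  qed
qed

lemma nsq_add:
  assumes "f \<in> L2 \<Omega>" "g \<in> L2 \<Omega>"
  shows "nsq \<Omega> (\<lambda>x. f x + g x) = nsq \<Omega> f + nsq \<Omega> g + 2 * Re (LINT x|lebesgue_on \<Omega>. f x * cnj (g x))"
proof -
  define q where "q = (\<lambda>x. Re (f x * cnj (g x)))"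
  have i: "integrable (lebesgue_on \<Omega>) q" unfolding q_def
    by (intro integrable_Re L2_mult_integrable L2_cnj assms)
  have "(cmod (f x + g x))\<^sup>2 = (cmod (f x))\<^sup>2 + (cmod (g x))\<^sup>2 + 2 * q x" for x
    unfolding cmod_power2 q_def by (simp add: power2_eq_square algebra_simps)
  then have "nsq \<Omega> (\<lambda>x. f x + g x) =
     (LINT x|lebesgue_on \<Omega>. (cmod (f x))\<^sup>2 + (cmod (g x))\<^sup>2 + 2 * q x)"
    by (simp add: nsq_def)
  also have "\<dots> = nsq \<Omega> f + nsq \<Omega> g + 2 * (LINT x|lebesgue_on \<Omega>. q x)"
    using i L2_D(2)[OF assms(1)] L2_D(2)[OF assms(2)] by (simp add: nsq_def)
  also have "(LINT x|lebesgue_on \<Omega>. q x) = Re (LINT x|lebesgue_on \<Omega>. f x * cnj (g x))"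
    unfolding q_def by (intro integral_Re L2_mult_integrable L2_cnj assms)
  finally show ?thesis .
qed

lemma nsq_add_le:
  assumes "f \<in> L2 \<Omega>" "g \<in> L2 \<Omega>"
  shows "nsq \<Omega> (\<lambda>x. f x + g x) \<le> 2 * nsq \<Omega> f + 2 * nsq \<Omega> g"
proof -
  have "nsq \<Omega> (\<lambda>x. f x + g x) \<le> (LINT x|lebesgue_on \<Omega>. 2 * (cmod (f x))\<^sup>2 + 2 * (cmod (g x))\<^sup>2)"
    unfolding nsq_def using L2_D(2)[OF assms(1)] L2_D(2)[OF assms(2)] L2_D(2)[OF L2_add[OF assms]]
    by (intro integral_mono norm_sum_sq_le) auto
  also have "\<dots> = 2 * nsq \<Omega> f + 2 * nsq \<Omega> g"
    using L2_D(2)[OF assms(1)] L2_D(2)[OF assms(2)] by (simp add: nsq_def)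
  finally show ?thesis .
qed

lemma L2_mult_cnj_self: "(LINT x|lebesgue_on \<Omega>. f x * cnj (f x)) = of_real (nsq \<Omega> f)"
proof -
  have "(\<lambda>x. f x * cnj (f x)) = (\<lambda>x. of_real ((cmod (f x))\<^sup>2))"
    by (intro ext) (rule complex_norm_square[symmetric])
  then show ?thesis by (simp add: nsq_def del: of_real_power)
qed

lemma nsq_eq_0_imp_AE:
  assumes "f \<in> L2 \<Omega>" "nsq \<Omega> f = 0"
  shows "AE x in lebesgue_on \<Omega>. f x = 0"
  using integral_nonneg_eq_0_iff_AE[OF L2_D(2)[OF assms(1)]] assms(2) by (simp add: nsq_def)

lemma L2_subset:
  assumes "f \<in> L2 \<Omega>" "\<Omega>' \<subseteq> \<Omega>" "\<Omega> \<in> sets lebesgue" "\<Omega>' \<in> sets lebesgue"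
  shows "f \<in> L2 \<Omega>'" "nsq \<Omega>' f \<le> nsq \<Omega> f"
proof -
  have m: "\<Omega> \<inter> space lebesgue \<in> sets lebesgue" "\<Omega>' \<inter> space lebesgue \<in> sets lebesgue" using assms by auto
  have i: "integrable lebesgue (\<lambda>x. indicator \<Omega> x *\<^sub>R (cmod (f x))\<^sup>2)"
    using L2_D(2)[OF assms(1)] by (simp only: integrable_restrict_space[OF m(1)])
  have "(\<lambda>x. indicator \<Omega>' x *\<^sub>R (indicator \<Omega> x *\<^sub>R (cmod (f x))\<^sup>2)) = (\<lambda>x. indicator \<Omega>' x *\<^sub>R (cmod (f x))\<^sup>2)"
    by (rule ext) (use assms(2) in \<open>auto simp: indicator_def\<close>)
  with integrable_mult_indicator[OF assms(4) i]
  have i': "integrable lebesgue (\<lambda>x. indicator \<Omega>' x *\<^sub>R (cmod (f x))\<^sup>2)" by simp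
  show "f \<in> L2 \<Omega>'"
    unfolding L2_iff integrable_restrict_space[OF m(2)]
    using i' measurable_restrict_mono[OF L2_D(1)[OF assms(1)] assms(2)] by simp
  show "nsq \<Omega>' f \<le> nsq \<Omega> f"
    unfolding nsq_def integral_restrict_space[OF m(1)] integral_restrict_space[OF m(2)]
    by (intro integral_mono i i') (use assms(2) in \<open>auto simp: indicator_def\<close>)
qed

lemma L2_bounded_integrable:
  assumes "f \<in> L2 \<Omega>" "\<Omega> \<in> lmeasurable"
  shows "integrable (lebesgue_on \<Omega>) f"
proof (rule Bochner_Integration.integrable_bound)
  have "emeasure (lebesgue_on \<Omega>) (space (lebesgue_on \<Omega>)) < \<infinity>"
    using assms(2) by (simp add: emeasure_restrict_space fmeasurable_def del: emeasure_completion)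
  then have "integrable (lebesgue_on \<Omega>) (\<lambda>x. 1::real)"
    by (intro finite_measure.integrable_const finite_measureI) (simp add: less_top)
  then show "integrable (lebesgue_on \<Omega>) (\<lambda>x. 1 + (cmod (f x))\<^sup>2)"
    using L2_D(2)[OF assms(1)] by auto
  show "AE x in lebesgue_on \<Omega>. norm (f x) \<le> norm (1 + (cmod (f x))\<^sup>2)"
  proof (rule AE_I2)
    fix x show "norm (f x) \<le> norm (1 + (cmod (f x))\<^sup>2)"
    proof (cases "cmod (f x) \<ge> 1")
      case True
      then show ?thesis using self_le_power[of "cmod (f x)" 2] by simp
    next
      case False
      then have "cmod (f x) \<le> 1 + (cmod (f x))\<^sup>2" using zero_le_power2[of "cmod (f x)"] by linarith
      then show ?thesis by simp
    qed
  qed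
qed (use assms in \<open>auto simp: L2_iff\<close>)

lemma L2_absolutely_integrable:
  assumes "f \<in> L2 \<Omega>" "\<Omega> \<in> sets lebesgue" "{a..b} \<subseteq> \<Omega>"
  shows "f absolutely_integrable_on {a..b}"
proof -
  have "integrable (lebesgue_on {a..b}) f"
    by (rule L2_bounded_integrable[OF L2_subset(1)[OF assms(1,3,2)]]) auto
  then show ?thesis by (simp add: integrable_restrict_space set_integrable_def)
qed

lemma L2_bounded_measurable:
  assumes "f \<in> borel_measurable (lebesgue_on \<Omega>)" "\<Omega> \<in> lmeasurable" "AE x in lebesgue_on \<Omega>. cmod (f x) \<le> C"
  shows "f \<in> L2 \<Omega>"
proof (rule L2_bound[OF assms(1)])
  have "emeasure (lebesgue_on \<Omega>) (space (lebesgue_on \<Omega>)) < \<infinity>"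
    using assms(2) by (simp add: emeasure_restrict_space fmeasurable_def del: emeasure_completion)
  then show "integrable (lebesgue_on \<Omega>) (\<lambda>x. C\<^sup>2)"
    by (intro finite_measure.integrable_const finite_measureI) (simp add: less_top)
  show "AE x in lebesgue_on \<Omega>. (cmod (f x))\<^sup>2 \<le> C\<^sup>2"
    using assms(3) by eventually_elim (intro power_mono, auto)
qed

text \<open>Continuity only gives Borel measurability; for the completed measure, reflection is
  treated as scaling by \<open>-1\<close>.\<close>

lemma uminus_lebesgue_measurable: "uminus \<in> (lebesgue :: real measure) \<rightarrow>\<^sub>M lebesgue"
proof -
  have "((*\<^sub>R) (-1) :: real \<Rightarrow> real) = uminus" by auto
  then show ?thesis using lebesgue_measurable_scaling[where x="-1" and 'a=real] by simp
qed

lemma AE_reflect: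
  fixes \<Omega> :: "real set"
  assumes "AE x in lebesgue_on \<Omega>. P x" "\<Omega> \<in> sets lebesgue" "\<And>x. x \<in> \<Omega> \<Longrightarrow> - x \<in> \<Omega>"
  shows "AE x in lebesgue_on \<Omega>. P (- x)"
proof -
  obtain N where N: "negligible N" "\<And>x. x \<in> \<Omega> - N \<Longrightarrow> P x" using AE_lebesgue_onE[OF assms(1,2)] by blast
  have "negligible (uminus ` N)"
    by (rule negligible_differentiable_image_negligible[OF _ N(1)]) (auto intro: derivative_intros)
  then show ?thesis
  proof (rule AE_lebesgue_onI[OF _ _ assms(2)])
    fix x assume "x \<in> \<Omega> - uminus ` N"
    then have "- x \<in> \<Omega> - N" using assms(3) by (metis DiffD1 DiffD2 DiffI image_eqI minus_minus)
    then show "P (- x)" by (rule N(2))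
  qed
qed

lemma measurable_reflect:
  fixes \<Omega> :: "real set"
  assumes "f \<in> borel_measurable (lebesgue_on \<Omega>)" "\<Omega> \<in> sets lebesgue" "\<And>x. x \<in> \<Omega> \<Longrightarrow> - x \<in> \<Omega>"
  shows "(\<lambda>x. f (- x)) \<in> borel_measurable (lebesgue_on \<Omega>)"
proof -
  have "uminus \<in> lebesgue_on \<Omega> \<rightarrow>\<^sub>M lebesgue_on \<Omega>"
  proof (rule measurable_restrict_space2)
    show "uminus \<in> lebesgue_on \<Omega> \<rightarrow>\<^sub>M lebesgue"
      by (rule measurable_restrict_space1) (rule uminus_lebesgue_measurable)
  qed (use assms(3) in \<open>auto simp: space_restrict_space\<close>)
  from measurable_compose[OF this assms(1)] show ?thesis .
qed

text \<open>The change of variables on the line is applied to the function cut off to \<Omega>, and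
  the indicator of a symmetric set is even.\<close>

lemma integral_reflect_symmetric:
  fixes f :: "real \<Rightarrow> 'a :: euclidean_space"
  assumes "\<Omega> \<in> sets lebesgue" "\<And>x. x \<in> \<Omega> \<Longrightarrow> - x \<in> \<Omega>"
  shows "(LINT x|lebesgue_on \<Omega>. f (- x)) = (LINT x|lebesgue_on \<Omega>. f x)"
    and "integrable (lebesgue_on \<Omega>) (\<lambda>x. f (- x)) \<longleftrightarrow> integrable (lebesgue_on \<Omega>) f"
proof -
  have m: "\<Omega> \<inter> space lebesgue \<in> sets lebesgue" using assms by auto
  have ind: "indicator \<Omega> (- x) = (indicator \<Omega> x :: real)" for x
    using assms(2)[of x] assms(2)[of "- x"] by (auto simp: indicator_def)
  have iff: "has_bochner_integral lebesgue (\<lambda>x. indicator \<Omega> x *\<^sub>R f (- x)) i \<longleftrightarrow>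
      has_bochner_integral lebesgue (\<lambda>x. indicator \<Omega> x *\<^sub>R f x) i" for i
    using has_bochner_integral_lebesgue_real_affine_iff[of "-1" "\<lambda>x. indicator \<Omega> x *\<^sub>R f x" i 0]
    by (simp add: ind)
  show 1: "integrable (lebesgue_on \<Omega>) (\<lambda>x. f (- x)) \<longleftrightarrow> integrable (lebesgue_on \<Omega>) f"
    unfolding integrable_restrict_space[OF m] using iff by (auto simp: integrable.simps)
  show "(LINT x|lebesgue_on \<Omega>. f (- x)) = (LINT x|lebesgue_on \<Omega>. f x)"
  proof (cases "integrable (lebesgue_on \<Omega>) f")
    case True
    then have "has_bochner_integral lebesgue (\<lambda>x. indicator \<Omega> x *\<^sub>R f x) (LINT x|lebesgue_on \<Omega>. f x)"
      unfolding integrable_restrict_space[OF m] integral_restrict_space[OF m] by (rule has_bochner_integral_integrable)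
    then have "has_bochner_integral lebesgue (\<lambda>x. indicator \<Omega> x *\<^sub>R f (- x)) (LINT x|lebesgue_on \<Omega>. f x)"
      by (simp only: iff)
    then show ?thesis unfolding integral_restrict_space[OF m, of "\<lambda>x. f (- x)"]
      by (rule has_bochner_integral_integral_eq)
  next
    case False
    then show ?thesis using 1 by (simp add: not_integrable_integral_eq)
  qed
qed

lemma L2_reflect:
  assumes "f \<in> L2 \<Omega>" "\<Omega> \<in> sets lebesgue" "\<And>x. x \<in> \<Omega> \<Longrightarrow> - x \<in> \<Omega>"
  shows "(\<lambda>x. f (- x)) \<in> L2 \<Omega>" "nsq \<Omega> (\<lambda>x. f (- x)) = nsq \<Omega> f"
  using integral_reflect_symmetric[OF assms(2,3), of "\<lambda>x. (cmod (f x))\<^sup>2"] L2_D[OF assms(1)]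
    measurable_reflect[OF _ assms(2,3)]
  by (auto simp: L2_iff nsq_def)

section \<open>Weak derivatives in time\<close>

text \<open>Meant for a \<open>c\<close> that is the expected value of the density at a frozen time:
  the bound then tells how far the increment is from being linear.\<close>

lemma prim_increment_bound:
  assumes "prim S F f" "x \<in> S" "y \<in> S" "x \<le> y"
    and "AE t in lebesgue_on {x..y}. cmod (f t - c) \<le> B"
  shows "cmod (F y - F x - c * of_real (y - x)) \<le> B * (y - x)"
proof -
  obtain N where N: "negligible N" "\<And>t. t \<in> {x..y} - N \<Longrightarrow> cmod (f t - c) \<le> B"
    using AE_lebesgue_onE[OF assms(5)] by (metis lmeasurable_cbox box_real(2) fmeasurableD)
  note f = primD[OF assms(1-4)]
  let ?g = "\<lambda>t. if t \<in> N then 0 else f t - c"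
  show ?thesis
  proof (cases "x = y")
    case False
    \<comment> \<open>A nondegenerate interval is not negligible, so the bound holds at some point
      and \<open>B\<close> is nonnegative.\<close>
    then have ne: "{x..y} - N \<noteq> {}"
      using N(1) assms(4) open_not_negligible[of "{x<..<y}"] negligible_subset[of N "{x<..<y}"]
      by fastforce
    have B: "B \<ge> 0" using ne N(2) by (metis equals0I norm_ge_zero order_trans)
    have i: "(\<lambda>t. f t - c) integrable_on {x..y}"
      using f(3) by (intro integrable_diff integrable_const_ivl)
    have "F y - F x - c * of_real (y - x) = integral {x..y} (\<lambda>t. f t - c)"
      using f assms(4) by (simp add: Henstock_Kurzweil_Integration.integral_diff integrable_const_ivl scaleR_conv_of_real mult.commute)
    also have "\<dots> = integral {x..y} ?g" by (rule integral_spike[OF N(1)]) auto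
    also have "cmod \<dots> \<le> integral {x..y} (\<lambda>_. B)"
    proof (rule integral_norm_bound_integral)
      show "?g integrable_on {x..y}" by (rule integrable_spike[OF i N(1)]) auto
      show "cmod (?g t) \<le> B" if "t \<in> {x..y}" for t using N(2)[of t] that B by auto
    qed (simp add: integrable_const_ivl)
    also have "\<dots> = B * (y - x)" using assms(4) by simp
    finally show ?thesis .
  qed simp
qed

lemma prim_Re_increment_bound:
  assumes "prim S F f" "x \<in> S" "y \<in> S" "x \<le> y"
    and "AE t in lebesgue_on {x..y}. Re (f t) \<le> B"
  shows "Re (F y - F x) \<le> B * (y - x)"
proof -
  obtain N where N: "negligible N" "\<And>t. t \<in> {x..y} - N \<Longrightarrow> Re (f t) \<le> B"
    using AE_lebesgue_onE[OF assms(5)] by (metis lmeasurable_cbox box_real(2) fmeasurableD)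
  note f = primD[OF assms(1-4)]
  let ?g = "\<lambda>t. if t \<in> N then B else Re (f t)"
  have i: "(\<lambda>t. Re (f t)) integrable_on {x..y}"
    using integrable_linear[OF f(3) bounded_linear_Re] by (simp add: o_def)
  have "Re (F y - F x) = integral {x..y} (\<lambda>t. Re (f t))"
    using f(2) integral_linear[OF f(3) bounded_linear_Re] by (simp add: o_def)
  also have "\<dots> = integral {x..y} ?g" by (rule integral_spike[OF N(1)]) auto
  also have "\<dots> \<le> integral {x..y} (\<lambda>_. B)"
  proof (rule integral_le)
    show "?g integrable_on {x..y}" by (rule integrable_spike[OF i N(1)]) auto
    show "?g t \<le> B" if "t \<in> {x..y}" for t using N(2)[of t] that by auto
  qed (simp add: integrable_const_ivl)
  also have "\<dots> = B * (y - x)" using assms(4) by simp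
  finally show ?thesis .
qed

text \<open>\<open>U\<close> is strongly continuous and thus has a value at every time, while
  \<open>v\<close> is controlled at almost every time only. It is applied with \<open>U\<close> the
  solution itself or, for finite energy data, the solution minus the initial datum.\<close>

locale time_derivative =
  fixes \<Omega> :: "real set" and U v :: "real \<Rightarrow> real \<Rightarrow> complex"
  assumes \<Omega>: "\<Omega> \<in> sets lebesgue"
    and C_time: "U \<in> C_time (L2_sq \<Omega>)"
    and W1inf: "W1inf_loc_L2 \<Omega> U v"
begin

lemma U_L2: "U t \<in> L2 \<Omega>"
  using C_time by (auto simp: C_time_def L2_def)

lemma nsq_U_tendsto: "((\<lambda>r. nsq \<Omega> (\<lambda>x. U r x - U t x)) \<longlongrightarrow> 0) (at t)"
proof -
  have "((\<lambda>r. L2_sq \<Omega> (\<lambda>x. U r x - U t x)) \<longlongrightarrow> 0) (at t)"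
    using C_time by (auto simp: C_time_def)
  then have "((\<lambda>r. ennreal (nsq \<Omega> (\<lambda>x. U r x - U t x))) \<longlongrightarrow> ennreal 0) (at t)"
    by (simp add: L2_sq_eq L2_diff U_L2)
  then show ?thesis by (rule tendsto_ennrealD) (simp_all add: nsq_nonneg)
qed

lemma inner_diff:
  assumes "g \<in> L2 \<Omega>"
  shows "(LINT x|lebesgue_on \<Omega>. U r x * g x) - (LINT x|lebesgue_on \<Omega>. U t x * g x)
     = (LINT x|lebesgue_on \<Omega>. (U r x - U t x) * g x)"
  using L2_mult_integrable[OF U_L2 assms] by (simp add: left_diff_distrib)

lemma inner_continuous:
  assumes "g \<in> L2 \<Omega>"
  shows "continuous_on UNIV (\<lambda>t. LINT x|lebesgue_on \<Omega>. U t x * g x)"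
proof (intro continuous_at_imp_continuous_on ballI)
  fix t
  let ?f = "\<lambda>t. LINT x|lebesgue_on \<Omega>. U t x * g x"
  have "((\<lambda>r. ?f r - ?f t) \<longlongrightarrow> 0) (at t)"
  proof (rule Lim_null_comparison)
    show "\<forall>\<^sub>F r in at t. cmod (?f r - ?f t) \<le> sqrt (nsq \<Omega> (\<lambda>x. U r x - U t x)) * sqrt (nsq \<Omega> g)"
      by (intro always_eventually allI) (simp only: inner_diff[OF assms] L2_Cauchy_Schwarz L2_diff U_L2 assms)
    have "((\<lambda>r. sqrt (nsq \<Omega> (\<lambda>x. U r x - U t x)) * sqrt (nsq \<Omega> g)) \<longlongrightarrow> sqrt 0 * sqrt (nsq \<Omega> g)) (at t)"
      by (intro tendsto_intros nsq_U_tendsto)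
    then show "((\<lambda>r. sqrt (nsq \<Omega> (\<lambda>x. U r x - U t x)) * sqrt (nsq \<Omega> g)) \<longlongrightarrow> 0) (at t)" by simp
  qed
  then show "isCont ?f t" unfolding isCont_def using Lim_null by blast
qed

lemma v_bound:
  assumes "T > 0"
  obtains C where "C \<ge> 0" "AE t in lebesgue_on {-T<..<T}. v t \<in> L2 \<Omega> \<and> nsq \<Omega> (v t) \<le> C"
proof -
  have "v \<in> Linf {-T<..<T} (L2_sq \<Omega>)" using W1inf assms by (auto simp: W1inf_loc_L2_def Linf_loc_def)
  then obtain C where C: "AE t in lebesgue_on {-T<..<T}. L2_sq \<Omega> (v t) \<le> ennreal C"
    by (auto simp: Linf_def)
  \<comment> \<open>The constant that \<open>Linf\<close> provides may be negative.\<close>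
  have "AE t in lebesgue_on {-T<..<T}. v t \<in> L2 \<Omega> \<and> nsq \<Omega> (v t) \<le> max C 0"
    using C
  proof eventually_elim
    case (elim t)
    have "ennreal C \<le> ennreal (max C 0)" by (simp add: ennreal_leI)
    with elim have "L2_sq \<Omega> (v t) \<le> ennreal (max C 0)" by (rule order_trans)
    then show ?case using L2_sq_le_iff[of "max C 0" \<Omega> "v t"] by simp
  qed
  then show thesis by (intro that[of "max C 0"]) auto
qed

text \<open>The approximating simple functions give simple functions \<open>\<langle>S n t, g\<rangle>\<close> of time.\<close>

lemma inner_v_measurable:
  assumes "T > 0" "g \<in> L2 \<Omega>"
  shows "(\<lambda>t. indicator {-T<..<T} t * (LINT x|lebesgue_on \<Omega>. v t x * g x)) \<in> borel_measurable lebesgue"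
proof -
  let ?I = "{-T<..<T}"
  have I: "?I \<in> sets lebesgue" by simp
  have "bochner_measurable (L2_sq \<Omega>) ?I v"
    using W1inf assms by (auto simp: W1inf_loc_L2_def Linf_loc_def Linf_def)
  then obtain S where S: "\<And>n. simple_function (lebesgue_on ?I) (S n)"
      "\<And>n t. t \<in> ?I \<Longrightarrow> L2_sq \<Omega> (S n t) < \<infinity>"
      "AE t in lebesgue_on ?I. (\<lambda>n. L2_sq \<Omega> (\<lambda>x. S n t x - v t x)) \<longlonglongrightarrow> 0"
    unfolding bochner_measurable_def by blast
  obtain C where C: "AE t in lebesgue_on ?I. v t \<in> L2 \<Omega> \<and> nsq \<Omega> (v t) \<le> C"
    using v_bound[OF assms(1)] by blast
  let ?h = "\<lambda>w. LINT x|lebesgue_on \<Omega>. w x * g x"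
  have "AE t in lebesgue_on ?I. (\<lambda>n. ?h (S n t)) \<longlonglongrightarrow> ?h (v t)"
    using S(3) C AE_space
  proof eventually_elim
    case (elim t)
    then have t: "t \<in> ?I" by simp
    have SL: "S n t \<in> L2 \<Omega>" for n using S(2)[OF t] by (simp add: L2_def)
    have vL: "v t \<in> L2 \<Omega>" using elim by simp
    have "(\<lambda>n. ennreal (nsq \<Omega> (\<lambda>x. S n t x - v t x))) \<longlonglongrightarrow> ennreal 0"
      using elim(1) by (simp add: L2_sq_eq L2_diff SL vL)
    then have lim: "(\<lambda>n. nsq \<Omega> (\<lambda>x. S n t x - v t x)) \<longlonglongrightarrow> 0"
      by (rule tendsto_ennrealD) (simp_all add: nsq_nonneg)
    have "(\<lambda>n. ?h (S n t) - ?h (v t)) \<longlonglongrightarrow> 0"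
    proof (rule Lim_null_comparison)
      have "cmod (?h (S n t) - ?h (v t)) \<le> sqrt (nsq \<Omega> (\<lambda>x. S n t x - v t x)) * sqrt (nsq \<Omega> g)" for n
        using L2_Cauchy_Schwarz[OF L2_diff[OF SL vL] assms(2), of n]
          L2_mult_integrable[OF SL assms(2)] L2_mult_integrable[OF vL assms(2)]
        by (simp add: left_diff_distrib)
      then show "\<forall>\<^sub>F n in sequentially. cmod (?h (S n t) - ?h (v t)) \<le> sqrt (nsq \<Omega> (\<lambda>x. S n t x - v t x)) * sqrt (nsq \<Omega> g)"
        by (intro always_eventually allI)
      have "(\<lambda>n. sqrt (nsq \<Omega> (\<lambda>x. S n t x - v t x)) * sqrt (nsq \<Omega> g)) \<longlonglongrightarrow> sqrt 0 * sqrt (nsq \<Omega> g)"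
        by (intro tendsto_intros lim)
      then show "(\<lambda>n. sqrt (nsq \<Omega> (\<lambda>x. S n t x - v t x)) * sqrt (nsq \<Omega> g)) \<longlonglongrightarrow> 0" by simp
    qed
    then show ?case using Lim_null by blast
  qed
  then obtain N where N: "negligible N" "\<And>t. t \<in> ?I - N \<Longrightarrow> (\<lambda>n. ?h (S n t)) \<longlonglongrightarrow> ?h (v t)"
    using AE_lebesgue_onE[OF _ I] by blast
  have Ns: "N \<in> sets lebesgue" using N(1) by (simp add: negligible_iff_null_sets null_setsD2)
  have meas: "(\<lambda>t. indicator (?I - N) t * ?h (S n t)) \<in> borel_measurable lebesgue" for n
  proof -
    have "(\<lambda>t. ?h (S n t)) \<in> borel_measurable (lebesgue_on ?I)"
      by (intro borel_measurable_simple_function simple_function_compose1[OF S(1)])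
    then have "(\<lambda>t. indicator ?I t *\<^sub>R ?h (S n t)) \<in> borel_measurable lebesgue"
      by (subst (asm) borel_measurable_restrict_space_iff) (use I in auto)
    moreover have "(indicator (- N) :: real \<Rightarrow> complex) \<in> borel_measurable lebesgue"
      using Ns by (intro borel_measurable_indicator) (metis Compl_in_sets_lebesgue)
    ultimately have "(\<lambda>t. indicator (- N) t * (indicator ?I t *\<^sub>R ?h (S n t))) \<in> borel_measurable lebesgue"
      by (rule borel_measurable_times[rotated])
    moreover have "(\<lambda>t. indicator (- N) t * (indicator ?I t *\<^sub>R ?h (S n t))) = (\<lambda>t. indicator (?I - N) t * ?h (S n t))"
      by (rule ext) (auto simp: indicator_def)
    ultimately show ?thesis by simp
  qed
  have lim': "(\<lambda>n. indicator (?I - N) t * ?h (S n t)) \<longlonglongrightarrow> indicator (?I - N) t * ?h (v t)" for t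
  proof (cases "t \<in> ?I - N")
    case True
    then show ?thesis using N(2) by simp
  next
    case False
    then have "(indicator (?I - N) t :: complex) = 0" by (rule indicator_simps(2))
    then show ?thesis by (simp only: mult_zero_left tendsto_const)
  qed
  have "(\<lambda>t. indicator (?I - N) t * ?h (v t)) \<in> borel_measurable lebesgue"
    by (rule borel_measurable_LIMSEQ_metric[OF meas lim'])
  moreover have "AE t in lebesgue. indicator (?I - N) t * ?h (v t) = indicator ?I t * ?h (v t)"
    unfolding eventually_ae_filter_negligible
    by (intro exI[of _ N] conjI N(1)) (auto simp: indicator_def)
  ultimately show ?thesis by (rule borel_measurable_AE)
qed

lemma inner_v_abs_integrable:
  assumes "g \<in> L2 \<Omega>"
  shows "(\<lambda>t. LINT x|lebesgue_on \<Omega>. v t x * g x) absolutely_integrable_on {a..b}"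
proof -
  define T where "T = \<bar>a\<bar> + \<bar>b\<bar> + 1"
  have T: "T > 0" "{a..b} \<subseteq> {-T<..<T}" by (auto simp: T_def)
  let ?h = "\<lambda>t. LINT x|lebesgue_on \<Omega>. v t x * g x"
  obtain C where C: "C \<ge> 0" "AE t in lebesgue_on {-T<..<T}. v t \<in> L2 \<Omega> \<and> nsq \<Omega> (v t) \<le> C"
    using v_bound[OF T(1)] by blast
  then obtain N where N: "negligible N" "\<And>t. t \<in> {-T<..<T} - N \<Longrightarrow> v t \<in> L2 \<Omega> \<and> nsq \<Omega> (v t) \<le> C"
    using AE_lebesgue_onE[OF C(2)] by auto
  have "integrable lebesgue (\<lambda>t. indicator {a..b} t *\<^sub>R ?h t)"
  proof (rule Bochner_Integration.integrable_bound)
    show "integrable lebesgue (\<lambda>t. indicator {a..b} t *\<^sub>R (sqrt C * sqrt (nsq \<Omega> g)))"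
      by (intro integrable_scaleR_left integrable_real_indicator) (auto simp: emeasure_lborel_Icc_eq)
    have "(\<lambda>t. indicator {a..b} t * (indicator {-T<..<T} t * ?h t)) \<in> borel_measurable lebesgue"
      by (intro borel_measurable_times inner_v_measurable assms T borel_measurable_indicator) simp
    moreover have "(\<lambda>t. indicator {a..b} t * (indicator {-T<..<T} t * ?h t)) = (\<lambda>t. indicator {a..b} t *\<^sub>R ?h t)"
      by (rule ext) (use T(2) in \<open>auto simp: indicator_def\<close>)
    ultimately show "(\<lambda>t. indicator {a..b} t *\<^sub>R ?h t) \<in> borel_measurable lebesgue" by simp
    have bd: "norm (indicator {a..b} t *\<^sub>R ?h t) \<le> norm (indicator {a..b} t *\<^sub>R (sqrt C * sqrt (nsq \<Omega> g)))"
      if "t \<notin> N" for t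
    proof (cases "t \<in> {a..b}")
      case True
      then have v: "v t \<in> L2 \<Omega>" "nsq \<Omega> (v t) \<le> C" using N(2)[of t] T(2) that by auto
      have "cmod (?h t) \<le> sqrt (nsq \<Omega> (v t)) * sqrt (nsq \<Omega> g)" by (rule L2_Cauchy_Schwarz[OF v(1) assms])
      also have "\<dots> \<le> sqrt C * sqrt (nsq \<Omega> g)" using v(2) by (intro mult_right_mono) (auto simp: nsq_nonneg)
      finally show ?thesis using True C(1) by (simp add: nsq_nonneg abs_mult)
    qed simp
    then show "AE t in lebesgue. norm (indicator {a..b} t *\<^sub>R ?h t) \<le> norm (indicator {a..b} t *\<^sub>R (sqrt C * sqrt (nsq \<Omega> g)))"
      unfolding eventually_ae_filter_negligible by (intro exI[of _ N] conjI N(1)) auto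
  qed
  then show ?thesis by (simp add: set_integrable_def)
qed

text \<open>For fixed \<open>g\<close> the weak time derivative becomes a scalar weak derivative, so
  the pairing has an absolutely continuous representative; both are continuous in time and therefore
  agree at every time. All evolution estimates below pass through this scalar statement.\<close>

lemma inner_prim:
  assumes "g \<in> L2 \<Omega>"
  shows "prim UNIV (\<lambda>t. LINT x|lebesgue_on \<Omega>. U t x * g x) (\<lambda>t. LINT x|lebesgue_on \<Omega>. v t x * g x)"
    (is "prim UNIV ?f ?h")
proof -
  have hp: "prim UNIV (\<lambda>x. 0 + int0 ?h x) ?h"
    by (intro prim_int0 inner_v_abs_integrable assms) auto
  have "weak_deriv UNIV ?f ?h"
    unfolding weak_deriv_def
  proof (intro conjI ballI)
    show "locally_integrable UNIV ?h"
      using prim_locally_integrable[OF hp] by simp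
    show "locally_integrable UNIV ?f"
      unfolding locally_integrable_def
    proof (intro allI impI)
      fix K :: "real set" assume K: "compact K \<and> K \<subseteq> UNIV"
      then obtain a b where ab: "K \<subseteq> {a..b}"
        by (metis bounded_subset_cbox_symmetric box_real(2) compact_imp_bounded)
      have "?f absolutely_integrable_on {a..b}"
        by (intro absolutely_integrable_continuous_real continuous_on_subset[OF inner_continuous[OF assms]]) simp
      then show "?f absolutely_integrable_on K"
        by (rule set_integrable_subset) (use K ab in \<open>auto simp: compact_imp_closed borel_closed\<close>)
    qed
    fix \<theta> assume "\<theta> \<in> test_fun UNIV"
    then show "(LINT t|lebesgue_on UNIV. ?f t * vector_derivative \<theta> (at t)) = - (LINT t|lebesgue_on UNIV. ?h t * \<theta> t)"
      using W1inf assms unfolding W1inf_loc_L2_def weak_time_deriv_def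
      by (simp add: lebesgue_on_UNIV_eq mult.commute)
  qed
  then obtain F where F: "prim UNIV F ?h" "AE t in lebesgue_on UNIV. ?f t = F t"
    using weak_deriv_prim[of UNIV ?f ?h] by auto
  have "?f t = F t" for t
    by (rule continuous_AE_eq_imp_eq[OF inner_continuous[OF assms] prim_continuous_on[OF F(1) open_UNIV] open_UNIV F(2) UNIV_I])
  then have "?f = F" by (rule ext)
  then show ?thesis using F(1) by simp
qed

text \<open>The increment \<open>w\<close> is paired with its own conjugate. For its norm
  \<open>d\<close> this gives \<open>d\<^sup>2 \<le> sqrt C * d * (t - r)\<close>, and one factor
  \<open>d\<close> cancels.\<close>

lemma U_Lipschitz:
  assumes "T > 0"
  obtains C where "C \<ge> 0" "AE t in lebesgue_on {-T<..<T}. v t \<in> L2 \<Omega> \<and> nsq \<Omega> (v t) \<le> C"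
    "\<And>r t. r \<in> {-T<..<T} \<Longrightarrow> t \<in> {-T<..<T} \<Longrightarrow> nsq \<Omega> (\<lambda>x. U r x - U t x) \<le> C * (r - t)\<^sup>2"
proof -
  obtain C where C: "C \<ge> 0" "AE t in lebesgue_on {-T<..<T}. v t \<in> L2 \<Omega> \<and> nsq \<Omega> (v t) \<le> C"
    using v_bound[OF assms] by blast
  have le: "nsq \<Omega> (\<lambda>x. U t x - U r x) \<le> C * (t - r)\<^sup>2" if rt: "r \<in> {-T<..<T}" "t \<in> {-T<..<T}" "r \<le> t" for r t
  proof -
    define w where "w = (\<lambda>x. U t x - U r x)"
    define d where "d = sqrt (nsq \<Omega> w)"
    have w: "w \<in> L2 \<Omega>" unfolding w_def by (intro L2_diff U_L2)
    note cw = L2_cnj[OF w]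
    have nc: "nsq \<Omega> (\<lambda>x. cnj (w x)) = nsq \<Omega> w" by (simp add: nsq_def)
    have d: "d \<ge> 0" "nsq \<Omega> w = d\<^sup>2" by (simp_all add: d_def nsq_nonneg)
    have sub: "{r..t} \<subseteq> {-T<..<T}" using rt by auto
    have "AE \<tau> in lebesgue_on {r..t}. v \<tau> \<in> L2 \<Omega> \<and> nsq \<Omega> (v \<tau>) \<le> C"
      by (rule AE_lebesgue_on_subset[OF C(2) sub]) auto
    then have "AE \<tau> in lebesgue_on {r..t}. cmod ((LINT x|lebesgue_on \<Omega>. v \<tau> x * cnj (w x)) - 0) \<le> sqrt C * d"
    proof eventually_elim
      case (elim \<tau>)
      have "cmod (LINT x|lebesgue_on \<Omega>. v \<tau> x * cnj (w x)) \<le> sqrt (nsq \<Omega> (v \<tau>)) * d"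
        using L2_Cauchy_Schwarz[of "v \<tau>" \<Omega>, OF _ cw] elim by (simp add: nc d_def)
      also have "\<dots> \<le> sqrt C * d" using elim d(1) by (intro mult_right_mono) auto
      finally show ?case by simp
    qed
    note bound = prim_increment_bound[OF inner_prim[OF cw] UNIV_I UNIV_I rt(3) this]
    have "U t x - U r x = w x" for x by (simp add: w_def)
    with bound have "cmod (LINT x|lebesgue_on \<Omega>. w x * cnj (w x)) \<le> sqrt C * d * (t - r)"
      by (simp only: inner_diff[OF cw] mult_zero_left diff_zero)
    then have "d\<^sup>2 \<le> sqrt C * d * (t - r)"
      unfolding L2_mult_cnj_self d(2) norm_of_real by simp
    then have "d \<le> sqrt C * (t - r)"
    proof (cases "d = 0")
      case False
      then have "d * d \<le> (sqrt C * (t - r)) * d" using \<open>d\<^sup>2 \<le> sqrt C * d * (t - r)\<close>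
        by (simp add: power2_eq_square algebra_simps)
      then show ?thesis using False d(1) mult_right_le_imp_le[of d d "sqrt C * (t - r)"] by simp
    qed (use C(1) rt(3) in simp)
    then have "d\<^sup>2 \<le> (sqrt C * (t - r))\<^sup>2" using d(1) by (rule power_mono)
    also have "\<dots> = C * (t - r)\<^sup>2" using C(1) by (simp add: power_mult_distrib)
    finally show ?thesis using d(2) by (simp add: w_def)
  qed
  have "nsq \<Omega> (\<lambda>x. U r x - U t x) \<le> C * (r - t)\<^sup>2" if "r \<in> {-T<..<T}" "t \<in> {-T<..<T}" for r t
  proof (cases "t \<le> r")
    case False
    have "nsq \<Omega> (\<lambda>x. U r x - U t x) = nsq \<Omega> (\<lambda>x. U t x - U r x)"
      by (simp add: nsq_def norm_minus_commute)
    then show ?thesis using le[OF that] False by (simp add: power2_commute)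
  qed (use le that in auto)
  with C show thesis by (rule that)
qed

end

section \<open>The logarithmic nonlinearity\<close>

lemma log_nl_uminus: "log_nl (- z) = - log_nl z"
  by (simp add: log_nl_def)

lemma log_nl_measurable:
  assumes f: "f \<in> borel_measurable M"
  shows "(\<lambda>x. log_nl (f x)) \<in> borel_measurable M"
proof -
  have "(\<lambda>x. ln ((cmod (f x))\<^sup>2)) \<in> borel_measurable M" using f by measurable
  then have "(\<lambda>x. complex_of_real (ln ((cmod (f x))\<^sup>2))) \<in> borel_measurable M"
    by (rule measurable_compose[OF _ borel_measurable_continuous_onI]) (intro continuous_intros)
  with f show ?thesis unfolding log_nl_def by (rule borel_measurable_times)
qed

text \<open>For \<open>m = cmod z \<ge> 1\<close> use \<open>ln m \<le> m\<close>. For smaller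
  \<open>m\<close> and \<open>k = sqrt m\<close> the left side is
  \<open>4 * k * (k * (- ln k))\<close>, at most \<open>4 * k * (1 - k) \<le> 1\<close>. A quadratic
  bound is what functions that are locally in \<open>L2\<close> can integrate.\<close>

lemma log_nl_norm_le: "cmod (log_nl z) \<le> 1 + 2 * (cmod z)\<^sup>2"
proof (cases "z = 0")
  case False
  define m where "m = cmod z"
  have m: "m > 0" using False by (simp add: m_def)
  have n: "cmod (log_nl z) = m * \<bar>2 * ln m\<bar>"
    using m by (simp add: log_nl_def norm_mult m_def[symmetric] ln_realpow)
  show ?thesis
  proof (cases "m \<ge> 1")
    case True
    then have "\<bar>2 * ln m\<bar> \<le> 2 * m" using ln_le_minus_one[of m] m by simp
    then have "m * \<bar>2 * ln m\<bar> \<le> m * (2 * m)" using m by (intro mult_left_mono) auto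
    then show ?thesis unfolding n by (simp add: m_def[symmetric] power2_eq_square)
  next
    case False
    define k where "k = sqrt m"
    have k: "k > 0" "m = k * k" using m by (simp_all add: k_def)
    have l: "ln m = 2 * ln k" using k by (simp add: ln_mult)
    have "- ln k \<le> 1 / k - 1" using ln_le_minus_one[of "1 / k"] k by (simp add: ln_div)
    then have "k * (- ln k) \<le> k * (1 / k - 1)" using k(1) by (intro mult_left_mono) auto
    also have "\<dots> = 1 - k" using k(1) by (simp add: right_diff_distrib)
    finally have kl: "k * (- ln k) \<le> 1 - k" .
    have "ln m < 0" using False m by simp
    then have "\<bar>2 * ln m\<bar> = - 4 * ln k" unfolding l by simp
    then have "m * \<bar>2 * ln m\<bar> = 4 * k * (k * (- ln k))" unfolding k(2) by simp
    also have "\<dots> \<le> 4 * k * (1 - k)" using kl k(1) by (intro mult_left_mono) auto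
    also have "\<dots> \<le> 1" using zero_le_power2[of "2 * k - 1"] by (simp add: power2_eq_square algebra_simps)
    finally show ?thesis unfolding n using zero_le_power2[of "cmod z"] by linarith
  qed
qed (simp add: log_nl_def)

text \<open>This is \<open>ln y \<le> y - 1\<close> at the quotient of the two moduli; the factor
  \<open>cmod z2\<close>, the smaller one, removes the singularity. The 2 comes from the
  squares.\<close>

lemma ln_norm_sq_diff_le:
  assumes "z2 \<noteq> 0" "cmod z2 \<le> cmod z1"
  shows "\<bar>ln ((cmod z1)\<^sup>2) - ln ((cmod z2)\<^sup>2)\<bar> * cmod z2 \<le> 2 * cmod (z1 - z2)"
proof -
  have p: "cmod z2 > 0" "cmod z1 > 0" using assms by auto
  have "ln (cmod z1) - ln (cmod z2) = ln (cmod z1 / cmod z2)" using p by (simp add: ln_div)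
  also have "\<dots> \<le> cmod z1 / cmod z2 - 1" using p by (intro ln_le_minus_one) simp
  finally have "(ln (cmod z1) - ln (cmod z2)) * cmod z2 \<le> (cmod z1 / cmod z2 - 1) * cmod z2"
    by (intro mult_right_mono) auto
  also have "\<dots> = cmod z1 - cmod z2" using p by (simp add: left_diff_distrib)
  also have "\<dots> \<le> cmod (z1 - z2)" by (rule norm_triangle_ineq2)
  finally have "(ln (cmod z1) - ln (cmod z2)) * cmod z2 \<le> cmod (z1 - z2)" .
  moreover have "ln (cmod z2) \<le> ln (cmod z1)" using p assms(2) by simp
  ultimately show ?thesis using p by (simp add: ln_realpow algebra_simps)
qed

text \<open>Cazenave and Haraux: the imaginary part only sees the difference of the logarithms,
  multiplied by \<open>Im (z\<^sub>1 cnj z\<^sub>2) = Im ((z\<^sub>1 - z\<^sub>2) cnj z\<^sub>2)\<close>.\<close>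

lemma log_nl_quasi_monotone:
  "\<bar>Im ((log_nl z1 - log_nl z2) * cnj (z1 - z2))\<bar> \<le> 2 * (cmod (z1 - z2))\<^sup>2"
proof -
  have main: "\<bar>Im ((log_nl z1 - log_nl z2) * cnj (z1 - z2))\<bar> \<le> 2 * (cmod (z1 - z2))\<^sup>2"
    if le: "cmod z2 \<le> cmod z1" for z1 z2
  proof (cases "z2 = 0")
    case True
    have "log_nl z1 * cnj z1 = of_real ((cmod z1)\<^sup>2 * ln ((cmod z1)\<^sup>2))"
      unfolding log_nl_def of_real_mult complex_norm_square by (simp add: mult_ac)
    then have "Im (log_nl z1 * cnj z1) = 0" by (simp only: Im_complex_of_real)
    then show ?thesis using True by (simp add: log_nl_def)
  next
    case False
    let ?L = "\<lambda>z. ln ((cmod z)\<^sup>2)"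
    have "Im ((log_nl z1 - log_nl z2) * cnj (z1 - z2)) = - (?L z1 - ?L z2) * Im (z1 * cnj z2)"
      unfolding log_nl_def by (simp add: algebra_simps)
    moreover have "Im (z1 * cnj z2) = Im ((z1 - z2) * cnj z2)" by (simp add: algebra_simps)
    moreover have "\<bar>Im ((z1 - z2) * cnj z2)\<bar> \<le> cmod (z1 - z2) * cmod z2"
      by (metis abs_Im_le_cmod complex_mod_cnj norm_mult)
    ultimately have "\<bar>Im ((log_nl z1 - log_nl z2) * cnj (z1 - z2))\<bar> \<le> \<bar>?L z1 - ?L z2\<bar> * (cmod (z1 - z2) * cmod z2)"
      by (simp only: abs_mult abs_minus_cancel) (intro mult_left_mono, auto)
    also have "\<dots> = (\<bar>?L z1 - ?L z2\<bar> * cmod z2) * cmod (z1 - z2)" by (simp only: mult_ac)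
    also have "\<dots> \<le> (2 * cmod (z1 - z2)) * cmod (z1 - z2)"
      by (intro mult_right_mono ln_norm_sq_diff_le False le) simp
    finally show ?thesis by (simp add: power2_eq_square)
  qed
  show ?thesis
  proof (cases "cmod z2 \<le> cmod z1")
    case False
    have "(log_nl z1 - log_nl z2) * cnj (z1 - z2) = (log_nl z2 - log_nl z1) * cnj (z2 - z1)"
      by (simp add: algebra_simps)
    then show ?thesis using main[of z1 z2] False by (simp only: norm_minus_commute[of z1 z2])
  qed (rule main)
qed

section \<open>Odd data stay odd\<close>

text \<open>Stated for increments because \<open>n\<close> is not known to be differentiable. The
  integrating factor absorbs the growth through \<open>1 + x \<le> exp x\<close>, and the quadratic
  errors add up to an arbitrarily small amount as the step shrinks.\<close>

lemma discrete_Gronwall: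
  fixes n :: "real \<Rightarrow> real"
  assumes "0 \<le> b" "n 0 = 0" "\<kappa> \<ge> 0" "E \<ge> 0"
    and nn: "\<And>x. 0 \<le> x \<Longrightarrow> x \<le> b \<Longrightarrow> n x \<ge> 0"
    and step: "\<And>x y. 0 \<le> x \<Longrightarrow> x \<le> y \<Longrightarrow> y \<le> b \<Longrightarrow> n y \<le> (1 + \<kappa> * (y - x)) * n x + E * (y - x)\<^sup>2"
  shows "n b = 0"
proof -
  define P where "P = (\<lambda>t. exp (- \<kappa> * t) * n t)"
  have bound: "P b \<le> e * b" if "e > 0" for e
  proof -
    have "P b - P 0 \<le> e * b - e * 0"
    proof (rule increment_le[OF assms(1), of "e / (E + 1)"])
      show "e / (E + 1) > 0" using that assms(4) by simp
      fix x y assume *: "0 \<le> x" "x \<le> y" "y \<le> b" "y - x < e / (E + 1)"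
      let ?h = "y - x"
      have Eh: "E * ?h \<le> e"
      proof -
        have "?h * (E + 1) \<le> e" using *(4) assms(4) by (simp add: pos_less_divide_eq)
        then show ?thesis using *(2) by (simp add: algebra_simps)
      qed
      have "P y \<le> exp (- \<kappa> * y) * ((1 + \<kappa> * ?h) * n x + E * ?h\<^sup>2)"
        unfolding P_def by (intro mult_left_mono step *) auto
      also have "\<dots> \<le> exp (- \<kappa> * y) * (exp (\<kappa> * ?h) * n x) + 1 * (E * ?h\<^sup>2)"
        unfolding distrib_left
      proof (intro add_mono mult_left_mono mult_right_mono)
        show "1 + \<kappa> * ?h \<le> exp (\<kappa> * ?h)" by (rule exp_ge_add_one_self)
        show "exp (- \<kappa> * y) \<le> 1" using assms(3) * by simp
      qed (use nn * assms(4) in auto)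
      also have "exp (- \<kappa> * y) * (exp (\<kappa> * ?h) * n x) = P x"
        unfolding P_def by (simp add: mult.assoc[symmetric] exp_add[symmetric] algebra_simps)
      also have "1 * (E * ?h\<^sup>2) \<le> e * ?h"
        using mult_right_mono[OF Eh, of ?h] *(2) by (simp add: power2_eq_square mult.assoc)
      finally show "P y - P x \<le> e * y - e * x" by (simp add: right_diff_distrib)
    qed
    then show ?thesis using assms(2) by (simp add: P_def)
  qed
  have "P b \<le> 0"
  proof (rule field_le_epsilon)
    fix e :: real assume "e > 0"
    have "P b \<le> e / (b + 1) * b" using \<open>e > 0\<close> assms(1) by (intro bound) simp
    also have "\<dots> \<le> e" using \<open>e > 0\<close> assms(1) by (simp add: pos_divide_le_eq mult_left_mono)
    finally show "P b \<le> 0 + e" by simp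
  qed
  then have "n b \<le> 0" by (simp add: P_def mult_le_0_iff)
  then show ?thesis using nn[of b] assms(1) by simp
qed

context time_derivative
begin

text \<open>Twice the even part in the usual normalisation.\<close>

definition even_part :: "real \<Rightarrow> real \<Rightarrow> complex" where
  "even_part t x = U t x + U t (- x)"

lemma odd_preserved:
  assumes sym: "\<And>x. x \<in> \<Omega> \<Longrightarrow> - x \<in> \<Omega>"
    and init: "AE x in lebesgue_on \<Omega>. even_part 0 x = 0"
    and K: "K \<ge> 0"
    and ineq: "AE \<tau> in lebesgue. Re (LINT x|lebesgue_on \<Omega>. v \<tau> x * cnj (even_part \<tau> x)) \<le> K * nsq \<Omega> (even_part \<tau>)"
    and "t \<ge> 0"
  shows "AE x in lebesgue_on \<Omega>. even_part t x = 0"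
proof -
  let ?r = even_part
  define T where "T = t + 1"
  have T: "T > 0" "t < T" using \<open>t \<ge> 0\<close> by (auto simp: T_def)
  obtain C where C: "C \<ge> 0" and vC: "AE t in lebesgue_on {-T<..<T}. v t \<in> L2 \<Omega> \<and> nsq \<Omega> (v t) \<le> C"
    and lip: "\<And>r t. r \<in> {-T<..<T} \<Longrightarrow> t \<in> {-T<..<T} \<Longrightarrow> nsq \<Omega> (\<lambda>x. U r x - U t x) \<le> C * (r - t)\<^sup>2"
    using U_Lipschitz[OF T(1)] by blast
  have rL: "?r s \<in> L2 \<Omega>" for s
    unfolding even_part_def[abs_def] by (intro L2_add U_L2 L2_reflect \<Omega> sym)
  have dL: "(\<lambda>x. ?r y x - ?r s x) \<in> L2 \<Omega>" for y s by (intro L2_diff rL)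
  have rlip: "nsq \<Omega> (\<lambda>x. ?r y x - ?r s x) \<le> 4 * C * (y - s)\<^sup>2" if "y \<in> {0..t}" "s \<in> {0..t}" for y s
  proof -
    let ?w = "\<lambda>x. U y x - U s x"
    have w: "?w \<in> L2 \<Omega>" by (intro L2_diff U_L2)
    have "nsq \<Omega> (\<lambda>x. ?r y x - ?r s x) = nsq \<Omega> (\<lambda>x. ?w x + ?w (- x))"
      by (simp add: even_part_def algebra_simps)
    also have "\<dots> \<le> 2 * nsq \<Omega> ?w + 2 * nsq \<Omega> (\<lambda>x. ?w (- x))"
      by (intro nsq_add_le w L2_reflect(1)[OF w \<Omega> sym])
    also have "\<dots> = 4 * nsq \<Omega> ?w" using L2_reflect(2)[OF w \<Omega> sym] by simp
    also have "\<dots> \<le> 4 * (C * (y - s)\<^sup>2)" using lip[of y s] that T by simp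
    finally show ?thesis by simp
  qed
  define n where "n = (\<lambda>s. nsq \<Omega> (?r s))"
  have n0: "n 0 = 0"
    using L2_cong_AE(2)[OF rL init] by (simp add: n_def nsq_def)
  have nB: "n s \<le> 4 * C * t\<^sup>2" if s: "s \<in> {0..t}" for s
  proof -
    have "nsq \<Omega> (\<lambda>x. ?r s x - ?r 0 x) = n s" unfolding n_def
      by (rule L2_cong_AE(2)[OF rL _ L2_D(1)[OF dL]]) (use init in eventually_elim, simp)
    then have "n s \<le> 4 * C * (s - 0)\<^sup>2" using rlip[OF s, of 0] \<open>t \<ge> 0\<close> by simp
    also have "\<dots> \<le> 4 * C * t\<^sup>2" using s C by (intro mult_left_mono power_mono) auto
    finally show ?thesis .
  qed
  have expand: "n y = nsq \<Omega> (\<lambda>x. ?r y x - ?r s x) + n s + 2 * Re (LINT x|lebesgue_on \<Omega>. (?r y x - ?r s x) * cnj (?r s x))" for y s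
    using nsq_add[OF dL[of y s] rL[of s]] by (simp add: n_def)
  \<comment> \<open>A bound for the growth rate of \<open>n\<close>: the first summand stems from
    the squared increment, the second from twice the cross term.\<close>
  define E where "E = 4 * C * t + 8 * C * t"
  have E: "E \<ge> 0" using C \<open>t \<ge> 0\<close> by (simp add: E_def)
  have nlip: "n y \<le> n s + E * (y - s)" if ys: "s \<in> {0..t}" "y \<in> {0..t}" "s \<le> y" for y s
  proof -
    let ?h = "y - s"
    have "Re (LINT x|lebesgue_on \<Omega>. (?r y x - ?r s x) * cnj (?r s x)) \<le> sqrt (nsq \<Omega> (\<lambda>x. ?r y x - ?r s x)) * sqrt (nsq \<Omega> (\<lambda>x. cnj (?r s x)))"
      using complex_Re_le_cmod L2_Cauchy_Schwarz[OF dL L2_cnj[OF rL]] by (rule order_trans)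
    also have "\<dots> \<le> sqrt (4 * C * ?h\<^sup>2) * sqrt (4 * C * t\<^sup>2)"
      using rlip[OF ys(2,1)] nB[OF ys(1)] C
      by (intro mult_mono) (auto simp: n_def nsq_def)
    also have "\<dots> = 4 * C * t * ?h"
      using C \<open>t \<ge> 0\<close> ys(3) by (simp add: real_sqrt_mult)
    finally have A: "Re (LINT x|lebesgue_on \<Omega>. (?r y x - ?r s x) * cnj (?r s x)) \<le> 4 * C * t * ?h" .
    have "4 * C * ?h\<^sup>2 \<le> 4 * C * (t * ?h)"
      unfolding power2_eq_square using ys C by (intro mult_left_mono mult_right_mono) auto
    then have "nsq \<Omega> (\<lambda>x. ?r y x - ?r s x) \<le> 4 * C * t * ?h"
      using rlip[OF ys(2,1)] by (simp add: mult.assoc)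
    with A show ?thesis using expand[of y s] by (simp add: E_def algebra_simps)
  qed
  have "n t = 0"
  \<comment> \<open>The factor 4 has one 2 from the cross term of the expansion and one from
    reflecting \<open>U\<close>. In the error, \<open>4 * C\<close> is the squared increment,
    \<open>K * E\<close> the change of \<open>n\<close> within a step, and \<open>2 * C\<close> the
    cost of freezing the test function.\<close>
  proof (rule discrete_Gronwall[of t n "4 * K" "4 * C + 4 * (K * E + 2 * C)"])
    show "0 \<le> 4 * C + 4 * (K * E + 2 * C)" using C K E by simp
    fix s y assume *: "0 \<le> s" "s \<le> y" "y \<le> t"
    let ?h = "y - s"
    let ?g = "\<lambda>x. cnj (?r s x)"
    have g: "?g \<in> L2 \<Omega>" by (intro L2_cnj rL)
    have ys: "s \<in> {0..t}" "y \<in> {0..t}" using * by auto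
    have sub: "{s..y} \<subseteq> {-T<..<T}" using * T by auto
    have "AE \<tau> in lebesgue_on {s..y}. v \<tau> \<in> L2 \<Omega> \<and> nsq \<Omega> (v \<tau>) \<le> C"
      by (rule AE_lebesgue_on_subset[OF vC sub]) auto
    moreover have "AE \<tau> in lebesgue_on {s..y}. Re (LINT x|lebesgue_on \<Omega>. v \<tau> x * cnj (?r \<tau> x)) \<le> K * n \<tau>"
      using ineq by (simp add: AE_restrict_space_iff n_def) (elim eventually_mono, simp)
    moreover have "AE \<tau> in lebesgue_on {s..y}. \<tau> \<in> {s..y}" by (simp add: AE_restrict_space_iff)
    ultimately have "AE \<tau> in lebesgue_on {s..y}. Re (LINT x|lebesgue_on \<Omega>. v \<tau> x * ?g x) \<le> K * (n s + E * ?h) + 2 * C * ?h"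
    proof eventually_elim
      case (elim \<tau>)
      have \<tau>: "\<tau> \<in> {0..t}" "s \<le> \<tau>" "\<tau> \<le> y" using elim(3) * by auto
      have v: "v \<tau> \<in> L2 \<Omega>" "nsq \<Omega> (v \<tau>) \<le> C" using elim(1) by auto
      note cd = L2_cnj[OF dL[of s \<tau>]]
      have "(LINT x|lebesgue_on \<Omega>. v \<tau> x * ?g x) =
        (LINT x|lebesgue_on \<Omega>. v \<tau> x * cnj (?r \<tau> x) + v \<tau> x * cnj (?r s x - ?r \<tau> x))"
        by (simp add: algebra_simps)
      also have "\<dots> = (LINT x|lebesgue_on \<Omega>. v \<tau> x * cnj (?r \<tau> x)) + (LINT x|lebesgue_on \<Omega>. v \<tau> x * cnj (?r s x - ?r \<tau> x))"
        by (intro Bochner_Integration.integral_add L2_mult_integrable v cd L2_cnj[OF rL])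
      finally have eq: "(LINT x|lebesgue_on \<Omega>. v \<tau> x * ?g x) = \<dots>" .
      have "Re (LINT x|lebesgue_on \<Omega>. v \<tau> x * cnj (?r s x - ?r \<tau> x)) \<le> sqrt (nsq \<Omega> (v \<tau>)) * sqrt (nsq \<Omega> (\<lambda>x. cnj (?r s x - ?r \<tau> x)))"
        using complex_Re_le_cmod L2_Cauchy_Schwarz[OF v(1) cd] by (rule order_trans)
      also have "nsq \<Omega> (\<lambda>x. cnj (?r s x - ?r \<tau> x)) = nsq \<Omega> (\<lambda>x. ?r s x - ?r \<tau> x)"
        unfolding nsq_def complex_mod_cnj ..
      also have "sqrt (nsq \<Omega> (v \<tau>)) * sqrt (nsq \<Omega> (\<lambda>x. ?r s x - ?r \<tau> x)) \<le> sqrt C * sqrt (4 * C * (s - \<tau>)\<^sup>2)"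
        using rlip[OF ys(1) \<tau>(1)] v(2) C by (intro mult_mono) (auto simp: nsq_nonneg)
      also have "\<dots> = 2 * C * (\<tau> - s)"
        using C \<tau>(2) by (simp add: real_sqrt_mult)
      also have "\<dots> \<le> 2 * C * ?h" using C \<tau>(3) by (intro mult_left_mono) auto
      finally have B: "Re (LINT x|lebesgue_on \<Omega>. v \<tau> x * cnj (?r s x - ?r \<tau> x)) \<le> 2 * C * ?h" .
      have "n \<tau> \<le> n s + E * (\<tau> - s)" using nlip[OF ys(1) \<tau>(1,2)] .
      also have "\<dots> \<le> n s + E * ?h" using E \<tau>(3) by (intro add_left_mono mult_left_mono) auto
      finally have "K * n \<tau> \<le> K * (n s + E * ?h)" using K by (intro mult_left_mono)
      then show ?case using B elim(2) unfolding eq plus_complex.sel by linarith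
    qed
    from prim_Re_increment_bound[OF inner_prim[OF g] UNIV_I UNIV_I *(2) this]
    have inc: "Re (LINT x|lebesgue_on \<Omega>. (U y x - U s x) * ?g x) \<le> (K * (n s + E * ?h) + 2 * C * ?h) * ?h"
      by (simp only: inner_diff[OF g])
    let ?w = "\<lambda>x. U y x - U s x"
    have w: "?w \<in> L2 \<Omega>" by (intro L2_diff U_L2)
    have ev: "?g (- x) = ?g x" for x by (simp add: even_part_def add.commute)
    have "(LINT x|lebesgue_on \<Omega>. (?r y x - ?r s x) * ?g x) = (LINT x|lebesgue_on \<Omega>. ?w x * ?g x + ?w (- x) * ?g (- x))"
      by (simp only: ev) (simp add: even_part_def algebra_simps)
    also have "\<dots> = (LINT x|lebesgue_on \<Omega>. ?w x * ?g x) + (LINT x|lebesgue_on \<Omega>. ?w (- x) * ?g (- x))"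
      using L2_mult_integrable[OF w g] integral_reflect_symmetric(2)[OF \<Omega> sym, of "\<lambda>x. ?w x * ?g x"]
      by (intro Bochner_Integration.integral_add) auto
    also have "(LINT x|lebesgue_on \<Omega>. ?w (- x) * ?g (- x)) = (LINT x|lebesgue_on \<Omega>. ?w x * ?g x)"
      by (rule integral_reflect_symmetric(1)[OF \<Omega> sym, of "\<lambda>x. ?w x * ?g x"])
    finally have two: "Re (LINT x|lebesgue_on \<Omega>. (?r y x - ?r s x) * ?g x) = 2 * Re (LINT x|lebesgue_on \<Omega>. ?w x * ?g x)"
      by simp
    have "n y \<le> 4 * C * ?h\<^sup>2 + n s + 4 * ((K * (n s + E * ?h) + 2 * C * ?h) * ?h)"
      using expand[of y s] two inc rlip[OF ys(2,1)] by linarith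
    also have "\<dots> = (1 + 4 * K * ?h) * n s + (4 * C + 4 * (K * E + 2 * C)) * ?h\<^sup>2"
      by (simp add: power2_eq_square algebra_simps)
    finally show "n y \<le> (1 + 4 * K * ?h) * n s + (4 * C + 4 * (K * E + 2 * C)) * ?h\<^sup>2" .
  qed (use n0 K \<open>t \<ge> 0\<close> in \<open>auto simp: n_def nsq_nonneg\<close>)
  then show ?thesis unfolding n_def by (rule nsq_eq_0_imp_AE[OF rL])
qed

end

section \<open>The flux through the boundary\<close>

lemma integrable_lebesgue_on_subset:
  fixes f :: "real \<Rightarrow> 'a :: euclidean_space"
  assumes "integrable (lebesgue_on \<Omega>) f" "A \<subseteq> \<Omega>" "\<Omega> \<in> sets lebesgue" "A \<in> sets lebesgue"
  shows "integrable (lebesgue_on A) f"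
    "(LINT x|lebesgue_on A. f x) = (LINT x|lebesgue_on \<Omega>. indicator A x *\<^sub>R f x)"
proof -
  have m: "\<Omega> \<inter> space lebesgue \<in> sets lebesgue" "A \<inter> space lebesgue \<in> sets lebesgue" using assms by auto
  have eq: "(\<lambda>x. indicator A x *\<^sub>R (indicator \<Omega> x *\<^sub>R f x)) = (\<lambda>x. indicator A x *\<^sub>R f x)"
    "(\<lambda>x. indicator \<Omega> x *\<^sub>R (indicator A x *\<^sub>R f x)) = (\<lambda>x. indicator A x *\<^sub>R f x)"
    by (rule ext, use assms(2) in \<open>auto simp: indicator_def\<close>)+
  show "integrable (lebesgue_on A) f"
    using integrable_mult_indicator[OF assms(4), of "\<lambda>x. indicator \<Omega> x *\<^sub>R f x"] assms(1)
    unfolding integrable_restrict_space[OF m(1)] integrable_restrict_space[OF m(2)] eq by simp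
  show "(LINT x|lebesgue_on A. f x) = (LINT x|lebesgue_on \<Omega>. indicator A x *\<^sub>R f x)"
    unfolding integral_restrict_space[OF m(1)] integral_restrict_space[OF m(2)] eq ..
qed

text \<open>Reflection flips the sign of a derivative: the density of the even part is odd, and the
  next density is even again.\<close>

lemma prim_even_part:
  assumes "prim \<Omega> F0 D0" "prim \<Omega> D0 w" "\<And>x. x \<in> \<Omega> \<Longrightarrow> - x \<in> \<Omega>"
  shows "prim \<Omega> (\<lambda>x. F0 x + F0 (- x)) (\<lambda>x. D0 x - D0 (- x))"
    "prim \<Omega> (\<lambda>x. D0 x - D0 (- x)) (\<lambda>x. w x + w (- x))"
proof -
  have sym: "uminus ` \<Omega> = \<Omega>" using assms(3) by force
  show "prim \<Omega> (\<lambda>x. F0 x + F0 (- x)) (\<lambda>x. D0 x - D0 (- x))"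
    using prim_diff[OF assms(1) prim_reflect[OF assms(1), unfolded sym]] by simp
  show "prim \<Omega> (\<lambda>x. D0 x - D0 (- x)) (\<lambda>x. w x + w (- x))"
    using prim_add[OF assms(2) prim_reflect[OF assms(2), unfolded sym]] by simp
qed

text \<open>The equations at \<open>x\<close> and \<open>-x\<close> are added and multiplied by the
  conjugate of \<open>r\<close>; the imaginary part isolates \<open>Re (V x * cnj (r x))\<close>.
  The nonlinear term is controlled by \<open>log_nl_quasi_monotone\<close>. The second derivative is
  integrated by parts over \<open>[- \<rho> n, \<rho> n]\<close>: the integral of the squared first
  derivative is real and drops out, and only the flux at the endpoints is left, which tends to
  0.\<close>

lemma flux_inequality:
  assumes op: "open \<Omega>" and int: "is_interval \<Omega>" and sym: "\<And>x. x \<in> \<Omega> \<Longrightarrow> - x \<in> \<Omega>"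
    and F0: "prim \<Omega> F0 D0" and D0: "prim \<Omega> D0 w"
    and fF: "AE x in lebesgue_on \<Omega>. f x = F0 x"
    and v: "v \<in> L2 \<Omega>" and r: "r \<in> L2 \<Omega>"
    and rF: "AE x in lebesgue_on \<Omega>. r x = F0 x + F0 (- x)"
    and eqn: "AE x in lebesgue_on \<Omega>. \<i> * v x + w x = of_real lam * log_nl (f x)"
    and \<rho>: "\<And>n. \<rho> n \<in> \<Omega>" "\<And>n. \<rho> n > 0"
    and cover: "\<And>x. x \<in> \<Omega> \<Longrightarrow> \<forall>\<^sub>F n in sequentially. \<bar>x\<bar> \<le> \<rho> n"
    and flux: "(\<lambda>n. cmod (D0 (\<rho> n) - D0 (- \<rho> n)) * cmod (F0 (\<rho> n) + F0 (- \<rho> n))) \<longlonglongrightarrow> 0"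
  shows "Re (LINT x|lebesgue_on \<Omega>. v x * cnj (r x)) \<le> \<bar>lam\<bar> * nsq \<Omega> r"
proof -
  have \<Omega>: "\<Omega> \<in> sets lebesgue" using op by (simp add: borel_open)
  have rF': "AE x in lebesgue_on \<Omega>. r (- x) = F0 (- x) + F0 (- (- x))"
    by (rule AE_reflect[OF rF \<Omega> sym])
  have fF': "AE x in lebesgue_on \<Omega>. f (- x) = F0 (- x)"
    by (rule AE_reflect[OF fF \<Omega> sym])
  define Rr where "Rr = (\<lambda>x. F0 x + F0 (- x))"
  define Rd where "Rd = (\<lambda>x. D0 x - D0 (- x))"
  define W where "W = (\<lambda>x. w x + w (- x))"
  have pR: "prim \<Omega> Rr Rd" and pD: "prim \<Omega> Rd W"
    unfolding Rr_def Rd_def W_def using prim_even_part[OF F0 D0 sym] by blast+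
  define V where "V = (\<lambda>x. v x + v (- x))"
  have V: "V \<in> L2 \<Omega>" unfolding V_def by (intro L2_add v L2_reflect(1)[OF v \<Omega> sym])
  define q where "q = (\<lambda>x. Re (V x * cnj (r x)))"
  have qi: "integrable (lebesgue_on \<Omega>) q" unfolding q_def
    by (intro integrable_Re L2_mult_integrable V L2_cnj r)
  have q2: "(LINT x|lebesgue_on \<Omega>. q x) = 2 * Re (LINT x|lebesgue_on \<Omega>. v x * cnj (r x))"
  proof -
    have vr: "integrable (lebesgue_on \<Omega>) (\<lambda>x. v x * cnj (r x))"
      by (intro L2_mult_integrable v L2_cnj r)
    have vr': "integrable (lebesgue_on \<Omega>) (\<lambda>x. v (- x) * cnj (r x))"
      by (intro L2_mult_integrable L2_reflect(1)[OF v \<Omega> sym] L2_cnj r)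
    have "AE x in lebesgue_on \<Omega>. r (- x) = r x"
      using rF rF' by eventually_elim (simp add: add.commute)
    then have "AE x in lebesgue_on \<Omega>. v (- x) * cnj (r x) = v (- x) * cnj (r (- x))"
      by eventually_elim simp
    then have "(LINT x|lebesgue_on \<Omega>. v (- x) * cnj (r x)) = (LINT x|lebesgue_on \<Omega>. v (- x) * cnj (r (- x)))"
      using vr' integral_reflect_symmetric(2)[OF \<Omega> sym, of "\<lambda>x. v x * cnj (r x)"] vr
      by (intro integral_cong_AE) auto
    also have "\<dots> = (LINT x|lebesgue_on \<Omega>. v x * cnj (r x))"
      by (rule integral_reflect_symmetric(1)[OF \<Omega> sym, of "\<lambda>x. v x * cnj (r x)"])
    finally have refl: "(LINT x|lebesgue_on \<Omega>. v (- x) * cnj (r x)) = (LINT x|lebesgue_on \<Omega>. v x * cnj (r x))" .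
    have "(LINT x|lebesgue_on \<Omega>. V x * cnj (r x)) = (LINT x|lebesgue_on \<Omega>. v x * cnj (r x)) + (LINT x|lebesgue_on \<Omega>. v (- x) * cnj (r x))"
      unfolding V_def distrib_right by (rule Bochner_Integration.integral_add[OF vr vr'])
    moreover have "(LINT x|lebesgue_on \<Omega>. q x) = Re (LINT x|lebesgue_on \<Omega>. V x * cnj (r x))"
      unfolding q_def by (intro integral_Re L2_mult_integrable V L2_cnj r)
    ultimately show ?thesis using refl by simp
  qed
  have "AE x in lebesgue_on \<Omega>. \<i> * v (- x) + w (- x) = of_real lam * log_nl (f (- x))"
    by (rule AE_reflect[OF eqn \<Omega> sym])
  with eqn rF fF fF'
  have pw: "AE x in lebesgue_on \<Omega>. q x \<le> 2 * \<bar>lam\<bar> * (cmod (r x))\<^sup>2 - Im (W x * cnj (Rr x))"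
  proof eventually_elim
    case (elim x)
    define z1 where "z1 = f x"
    \<comment> \<open>Since \<open>log_nl\<close> is odd, the sum of the two equations contains
      \<open>log_nl z1 - log_nl z2\<close>, while \<open>z1 - z2\<close> is exactly
      \<open>r x\<close>.\<close>
    define z2 where "z2 = - f (- x)"
    have r: "r x = z1 - z2" "Rr x = z1 - z2" using elim by (simp_all add: z1_def z2_def Rr_def)
    have "\<i> * V x + W x = of_real lam * (log_nl z1 - log_nl z2)"
      using elim(1,5) by (simp add: V_def W_def z1_def z2_def log_nl_uminus algebra_simps)
    then have "\<i> * (V x * cnj (z1 - z2)) = of_real lam * ((log_nl z1 - log_nl z2) * cnj (z1 - z2)) - W x * cnj (z1 - z2)"
      by (metis add_diff_cancel_right' left_diff_distrib mult.assoc)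
    then have "Im (\<i> * (V x * cnj (z1 - z2))) = lam * Im ((log_nl z1 - log_nl z2) * cnj (z1 - z2)) - Im (W x * cnj (z1 - z2))"
      by (simp only: minus_complex.sel Im_complex_of_real times_complex.sel(2) Re_complex_of_real)
    then have "q x = lam * Im ((log_nl z1 - log_nl z2) * cnj (z1 - z2)) - Im (W x * cnj (z1 - z2))"
      unfolding q_def r by simp
    moreover have "lam * Im ((log_nl z1 - log_nl z2) * cnj (z1 - z2)) \<le> \<bar>lam\<bar> * (2 * (cmod (z1 - z2))\<^sup>2)"
    proof -
      have "lam * Im ((log_nl z1 - log_nl z2) * cnj (z1 - z2)) \<le> \<bar>lam\<bar> * \<bar>Im ((log_nl z1 - log_nl z2) * cnj (z1 - z2))\<bar>"
        by (metis abs_ge_self abs_mult)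
      also have "\<dots> \<le> \<bar>lam\<bar> * (2 * (cmod (z1 - z2))\<^sup>2)"
        by (intro mult_left_mono log_nl_quasi_monotone) simp
      finally show ?thesis .
    qed
    ultimately show ?case unfolding r by (simp add: algebra_simps)
  qed
  \<comment> \<open>Truncation by an indicator keeps the integrals on the fixed set \<Omega>, ready
    for dominated convergence.\<close>
  define I where "I = (\<lambda>n. LINT x|lebesgue_on \<Omega>. indicator {- \<rho> n..\<rho> n} x *\<^sub>R q x)"
  have Ibound: "I n \<le> 2 * \<bar>lam\<bar> * nsq \<Omega> r + 2 * (cmod (Rd (\<rho> n)) * cmod (Rr (\<rho> n)))" for n
  proof -
    let ?A = "{- \<rho> n..\<rho> n}"
    have A: "?A \<in> sets lebesgue" by simp
    have sub: "?A \<subseteq> \<Omega>" by (intro Icc_subset_interval int sym \<rho>)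
    have le: "- \<rho> n \<le> \<rho> n" using \<rho>(2)[of n] by simp
    note pR' = prim_subset[OF pR sub] and pD' = prim_subset[OF pD sub]
    have cR: "continuous_on ?A Rr" and cD: "continuous_on ?A Rd"
      using prim_continuous_on_Icc[OF pR'] prim_continuous_on_Icc[OF pD'] by auto
    have Wi: "W absolutely_integrable_on ?A" using primD(1)[OF pD'] le by simp
    have WR: "(\<lambda>x. W x * cnj (Rr x)) absolutely_integrable_on ?A"
      by (intro abs_integrable_mult_continuous(1) Wi continuous_on_cnj cR)
    have RR: "(\<lambda>x. Rd x * cnj (Rd x)) absolutely_integrable_on ?A"
      by (intro absolutely_integrable_continuous_real continuous_intros cD)
    have "integral ?A (\<lambda>x. W x * cnj (Rr x) + Rd x * cnj (Rd x)) = Rd (\<rho> n) * cnj (Rr (\<rho> n)) - Rd (- \<rho> n) * cnj (Rr (- \<rho> n))"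
      by (rule prim_mult_Icc[OF pD' prim_cnj[OF pR'] le])
    \<comment> \<open>\<open>Rd\<close> is odd and \<open>Rr\<close> is even, so both endpoints
      contribute the same.\<close>
    also have "\<dots> = 2 * (Rd (\<rho> n) * cnj (Rr (\<rho> n)))"
      by (simp add: Rd_def Rr_def algebra_simps)
    finally have bp: "integral ?A (\<lambda>x. W x * cnj (Rr x)) + integral ?A (\<lambda>x. Rd x * cnj (Rd x)) = 2 * (Rd (\<rho> n) * cnj (Rr (\<rho> n)))"
      using WR RR by (simp add: Henstock_Kurzweil_Integration.integral_add absolutely_integrable_on_def)
    have "integral ?A (\<lambda>x. Rd x * cnj (Rd x)) = integral\<^sup>L (lebesgue_on ?A) (\<lambda>x. Rd x * cnj (Rd x))"
      by (rule lebesgue_integral_eq_integral[symmetric]) (use absolutely_integrable_imp_integrable[OF RR] in auto)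
    then have "Im (integral ?A (\<lambda>x. Rd x * cnj (Rd x))) = 0"
      by (simp only: L2_mult_cnj_self Im_complex_of_real)
    then have ImW: "Im (integral ?A (\<lambda>x. W x * cnj (Rr x))) = 2 * Im (Rd (\<rho> n) * cnj (Rr (\<rho> n)))"
      using arg_cong[OF bp, of Im] by simp
    have WRi: "integrable (lebesgue_on ?A) (\<lambda>x. W x * cnj (Rr x))"
      by (rule absolutely_integrable_imp_integrable[OF WR A])
    have ri: "integrable (lebesgue_on \<Omega>) (\<lambda>x. (cmod (r x))\<^sup>2)" by (rule L2_D(2)[OF r])
    have "I n = (LINT x|lebesgue_on ?A. q x)"
      unfolding I_def by (rule integrable_lebesgue_on_subset(2)[OF qi sub \<Omega> A, symmetric])
    also have "\<dots> \<le> (LINT x|lebesgue_on ?A. 2 * \<bar>lam\<bar> * (cmod (r x))\<^sup>2 - Im (W x * cnj (Rr x)))"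
      using integrable_lebesgue_on_subset(1)[OF qi sub \<Omega> A] integrable_lebesgue_on_subset(1)[OF ri sub \<Omega> A] WRi
        AE_lebesgue_on_subset[OF pw sub \<Omega> A]
      by (intro integral_mono_AE Bochner_Integration.integrable_diff integrable_Im integrable_mult_right)
    also have "\<dots> = 2 * \<bar>lam\<bar> * nsq ?A r - Im (LINT x|lebesgue_on ?A. W x * cnj (Rr x))"
      using integrable_lebesgue_on_subset(1)[OF ri sub \<Omega> A] integrable_Im[OF WRi] integral_Im[OF WRi]
      by (subst Bochner_Integration.integral_diff) (auto simp: nsq_def simp del: times_complex.sel)
    also have "(LINT x|lebesgue_on ?A. W x * cnj (Rr x)) = integral ?A (\<lambda>x. W x * cnj (Rr x))"
      by (rule lebesgue_integral_eq_integral[OF WRi A])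
    finally have "I n \<le> 2 * \<bar>lam\<bar> * nsq ?A r - Im (integral ?A (\<lambda>x. W x * cnj (Rr x)))" .
    moreover have "2 * \<bar>lam\<bar> * nsq ?A r \<le> 2 * \<bar>lam\<bar> * nsq \<Omega> r"
      by (intro mult_left_mono L2_subset(2)[OF r sub \<Omega> A]) auto
    moreover have "- Im (integral ?A (\<lambda>x. W x * cnj (Rr x))) \<le> 2 * cmod (Rd (\<rho> n) * cnj (Rr (\<rho> n)))"
      unfolding ImW using abs_Im_le_cmod[of "Rd (\<rho> n) * cnj (Rr (\<rho> n))"] by linarith
    ultimately have "I n \<le> 2 * \<bar>lam\<bar> * nsq \<Omega> r + 2 * cmod (Rd (\<rho> n) * cnj (Rr (\<rho> n)))" by linarith
    then show ?thesis by (simp only: norm_mult complex_mod_cnj)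
  qed
  have Ilim: "I \<longlonglongrightarrow> (LINT x|lebesgue_on \<Omega>. q x)"
    unfolding I_def
  proof (rule integral_dominated_convergence[where w="\<lambda>x. \<bar>q x\<bar>"])
    show "q \<in> borel_measurable (lebesgue_on \<Omega>)" using qi by auto
    show "(\<lambda>x. indicator {- \<rho> n..\<rho> n} x *\<^sub>R q x) \<in> borel_measurable (lebesgue_on \<Omega>)" for n
    proof -
      have "(indicator {- \<rho> n..\<rho> n} :: real \<Rightarrow> real) \<in> borel_measurable (lebesgue_on \<Omega>)"
        by (intro measurable_restrict_space1 borel_measurable_indicator) simp
      with qi show ?thesis by auto
    qed
    show "integrable (lebesgue_on \<Omega>) (\<lambda>x. \<bar>q x\<bar>)" using qi by auto
    show "AE x in lebesgue_on \<Omega>. (\<lambda>n. indicator {- \<rho> n..\<rho> n} x *\<^sub>R q x) \<longlonglongrightarrow> q x"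
    proof (rule AE_I2)
      fix x assume "x \<in> space (lebesgue_on \<Omega>)"
      then have "x \<in> \<Omega>" by simp
      from cover[OF this] show "(\<lambda>n. indicator {- \<rho> n..\<rho> n} x *\<^sub>R q x) \<longlonglongrightarrow> q x"
        by (intro tendsto_eventually) (elim eventually_mono, auto simp: indicator_def)
    qed
  qed (auto simp: indicator_def)
  have "(\<lambda>n. 2 * \<bar>lam\<bar> * nsq \<Omega> r + 2 * (cmod (Rd (\<rho> n)) * cmod (Rr (\<rho> n)))) \<longlonglongrightarrow> 2 * \<bar>lam\<bar> * nsq \<Omega> r + 2 * 0"
    using flux unfolding Rd_def Rr_def by (intro tendsto_intros)
  with Ilim have "(LINT x|lebesgue_on \<Omega>. q x) \<le> 2 * \<bar>lam\<bar> * nsq \<Omega> r + 2 * 0"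
    by (rule LIMSEQ_le) (use Ibound in blast)
  then show ?thesis using q2 by simp
qed

text \<open>Chebyshev's argument: a modulus above \<open>A\<close> on the whole interval would force
  the squared norm up to at least \<open>A\<^sup>2 * h\<close>.\<close>

lemma L2_small_value:
  assumes r: "r \<in> L2 UNIV" and rR: "AE x in lebesgue_on UNIV. r x = Rr x"
    and h: "h > 0" "A \<ge> 0" "nsq UNIV r < A\<^sup>2 * h"
  shows "\<exists>y\<in>{c..c + h}. cmod (Rr y) \<le> A"
proof (rule ccontr)
  assume "\<not> ?thesis"
  then have big: "cmod (Rr y) \<ge> A" if "y \<in> {c..c + h}" for y using that by force
  have I: "{c..c + h} \<in> sets lebesgue" "(UNIV :: real set) \<in> sets lebesgue" by auto
  have "A\<^sup>2 * h = (LINT x|lebesgue_on {c..c + h}. A\<^sup>2)"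
    using h(1) by (simp add: measure_restrict_space)
  also have "\<dots> \<le> (LINT x|lebesgue_on {c..c + h}. (cmod (r x))\<^sup>2)"
  proof (rule integral_mono_AE)
    show "integrable (lebesgue_on {c..c + h}) (\<lambda>x. A\<^sup>2)"
      using absolutely_integrable_imp_integrable[OF absolutely_integrable_continuous_real[of c "c + h" "\<lambda>_. A\<^sup>2"] I(1)]
      by simp
    show "integrable (lebesgue_on {c..c + h}) (\<lambda>x. (cmod (r x))\<^sup>2)"
      by (rule L2_D(2)[OF L2_subset(1)[OF r subset_UNIV I(2,1)]])
    have "AE x in lebesgue_on {c..c + h}. r x = Rr x"
      by (rule AE_lebesgue_on_subset[OF rR subset_UNIV I(2,1)])
    moreover have "AE x in lebesgue_on {c..c + h}. x \<in> {c..c + h}" by (rule AE_I2) simp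
    ultimately show "AE x in lebesgue_on {c..c + h}. A\<^sup>2 \<le> (cmod (r x))\<^sup>2"
      by eventually_elim (use big h(2) in \<open>simp add: power_mono\<close>)
  qed
  also have "\<dots> \<le> nsq UNIV r"
    using L2_subset(2)[OF r subset_UNIV I(2,1)] by (simp only: nsq_def)
  finally show False using h(3) by simp
qed

text \<open>Square integrability is available for \<open>Rr\<close> only. On intervals of length 2
  the oscillation of \<open>Rd\<close> is at most \<open>B\<close>, and its mean between two points
  where \<open>Rr\<close> is bounded is bounded; hence \<open>Rd\<close> is bounded on the line. It
  then suffices to go to infinity along points where \<open>Rr\<close> is small.\<close>

lemma flux_vanishes_on_line:
  assumes pR: "prim UNIV Rr Rd" and pD: "prim UNIV Rd W"
    and r: "r \<in> L2 UNIV" and rR: "AE x in lebesgue_on UNIV. r x = Rr x"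
    and B: "\<And>c. integral {c..c + 2} (\<lambda>x. cmod (W x)) \<le> B"
  obtains \<rho> where "\<And>n. \<rho> n > 0" "\<And>x. \<forall>\<^sub>F n in sequentially. \<bar>x\<bar> \<le> \<rho> n"
    "(\<lambda>n. cmod (Rd (\<rho> n)) * cmod (Rr (\<rho> n))) \<longlonglongrightarrow> 0"
proof -
  \<comment> \<open>Large enough for \<open>nsq UNIV r < A\<^sup>2 / 2\<close>, so that every
    interval of length \<open>1/2\<close> contains a point with
    \<open>cmod (Rr y) \<le> A\<close>.\<close>
  define A where "A = 1 + 2 * nsq UNIV r"
  have A1: "A \<ge> 1" using nsq_nonneg[of UNIV r] by (simp add: A_def)
  have "A * 1 \<le> A * A" using A1 by (intro mult_left_mono) auto
  then have "A - 1 < A\<^sup>2" unfolding power2_eq_square by linarith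
  moreover have "nsq UNIV r = (A - 1) / 2" by (simp add: A_def)
  ultimately have A: "A \<ge> 0" "nsq UNIV r < A\<^sup>2 * (1/2)"
    using A1 by simp_all
  have osc: "cmod (Rd s - Rd x) \<le> B" if "s \<in> {c..c + 2}" "x \<in> {c..c + 2}" for s x c
  proof -
    have main: "cmod (Rd s - Rd x) \<le> B" if "s \<in> {c..c + 2}" "x \<in> {c..c + 2}" "x \<le> s" for s x
    proof -
      note W = primD[OF pD UNIV_I UNIV_I that(3)] and W2 = primD[OF pD UNIV_I UNIV_I, of c "c + 2"]
      have "cmod (Rd s - Rd x) = cmod (integral {x..s} W)" using W(2) by simp
      also have "\<dots> \<le> integral {x..s} (\<lambda>x. cmod (W x))"
        using W(1) by (intro integral_norm_bound_integral) (auto simp: absolutely_integrable_on_def)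
      also have "\<dots> \<le> integral {c..c + 2} (\<lambda>x. cmod (W x))"
        using W(1) W2(1) that by (intro integral_subset_le) (auto simp: absolutely_integrable_on_def)
      also have "\<dots> \<le> B" by (rule B)
      finally show ?thesis .
    qed
    show ?thesis using main[OF that] main[OF that(2,1)] by (cases "x \<le> s") (auto simp: norm_minus_commute)
  qed
  have Rd: "cmod (Rd x) \<le> 4 * A + 3 * B" for x
  proof -
    \<comment> \<open>The second window starts at \<open>x + 1\<close>: the two points are at least
      \<open>1/2\<close> apart, and both lie in \<open>[x, x + 2]\<close>, where the oscillation
      bound applies.\<close>
    obtain y1 where y1: "y1 \<in> {x..x + 1/2}" "cmod (Rr y1) \<le> A"
      using L2_small_value[OF r rR _ A, of x] by auto
    obtain y2 where y2: "y2 \<in> {x + 1..x + 1 + 1/2}" "cmod (Rr y2) \<le> A"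
      using L2_small_value[OF r rR _ A, of "x + 1"] by auto
    have le: "y1 \<le> y2" "1/2 \<le> y2 - y1" "y2 - y1 \<le> 3/2" using y1 y2 by auto
    have B0: "B \<ge> 0" using osc[of x x x] by simp
    have "cmod (Rr y2 - Rr y1 - Rd x * of_real (y2 - y1)) \<le> B * (y2 - y1)"
    proof (rule prim_increment_bound[OF pR UNIV_I UNIV_I le(1)])
      have "AE t in lebesgue_on {y1..y2}. t \<in> {y1..y2}" by (rule AE_I2) simp
      then show "AE t in lebesgue_on {y1..y2}. cmod (Rd t - Rd x) \<le> B"
        by eventually_elim (rule osc[of _ x], use y1 y2 in auto)
    qed
    also have "\<dots> \<le> B * (3/2)" using le B0 by (intro mult_left_mono) auto
    finally have inc: "cmod (Rr y2 - Rr y1 - Rd x * of_real (y2 - y1)) \<le> B * (3/2)" .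
    have "cmod (Rd x * of_real (y2 - y1)) \<le> cmod (Rr y2 - Rr y1) + cmod (Rr y2 - Rr y1 - Rd x * of_real (y2 - y1))"
      by (metis norm_triangle_sub norm_minus_commute)
    also have "\<dots> \<le> 2 * A + B * (3/2)" using inc norm_triangle_ineq4[of "Rr y2" "Rr y1"] y1(2) y2(2) by simp
    finally have "cmod (Rd x) * (y2 - y1) \<le> 2 * A + B * (3/2)" using le by (simp add: norm_mult del: of_real_diff)
    moreover have "cmod (Rd x) * (1/2) \<le> cmod (Rd x) * (y2 - y1)" using le by (intro mult_left_mono) auto
    ultimately show ?thesis by simp
  qed
  \<comment> \<open>The window is just long enough for \<open>L2_small_value\<close> to force the
    bound \<open>1 / (n + 1)\<close> somewhere in it.\<close>
  have "\<exists>y\<in>{real n + 1..real n + 1 + (nsq UNIV r + 1) * (real n + 1)\<^sup>2}. cmod (Rr y) \<le> 1 / (real n + 1)" for n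
  proof (rule L2_small_value[OF r rR])
    show "(nsq UNIV r + 1) * (real n + 1)\<^sup>2 > 0"
      using nsq_nonneg[of UNIV r] by (intro mult_pos_pos) auto
    show "nsq UNIV r < (1 / (real n + 1))\<^sup>2 * ((nsq UNIV r + 1) * (real n + 1)\<^sup>2)"
      by (simp add: power_divide)
  qed auto
  then obtain \<rho> where \<rho>: "\<And>n. \<rho> n \<ge> real n + 1" "\<And>n. cmod (Rr (\<rho> n)) \<le> 1 / (real n + 1)"
    by (metis atLeastAtMost_iff)
  show thesis
  proof (rule that[of \<rho>])
    show "\<rho> n > 0" for n using \<rho>(1)[of n] by linarith
    fix x :: real
    obtain N where N: "\<bar>x\<bar> \<le> real N" using real_arch_simple by blast
    show "\<forall>\<^sub>F n in sequentially. \<bar>x\<bar> \<le> \<rho> n"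
    proof (rule eventually_sequentiallyI[of N])
      fix n assume "N \<le> n"
      then show "\<bar>x\<bar> \<le> \<rho> n" using N \<rho>(1)[of n] by (simp add: order_trans)
    qed
  next
    show "(\<lambda>n. cmod (Rd (\<rho> n)) * cmod (Rr (\<rho> n))) \<longlonglongrightarrow> 0"
    proof (rule Lim_null_comparison)
      have "norm (cmod (Rd (\<rho> n)) * cmod (Rr (\<rho> n))) \<le> (4 * A + 3 * B) * (1 / (real n + 1))" for n
        using mult_mono[OF Rd[of "\<rho> n"] \<rho>(2)[of n]] order_trans[OF norm_ge_zero Rd] by simp
      then show "\<forall>\<^sub>F n in sequentially. norm (cmod (Rd (\<rho> n)) * cmod (Rr (\<rho> n))) \<le> (4 * A + 3 * B) * (1 / (real n + 1))"
        by (intro always_eventually allI)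
      have "(\<lambda>n. (4 * A + 3 * B) * (1 / (real (Suc n)))) \<longlonglongrightarrow> (4 * A + 3 * B) * 0"
        by (intro tendsto_intros lim_1_over_n[THEN LIMSEQ_Suc])
      then show "(\<lambda>n. (4 * A + 3 * B) * (1 / (real n + 1))) \<longlonglongrightarrow> 0"
        by (simp add: add.commute)
    qed
  qed
qed

text \<open>The hypothesis \<open>bc\<close> unites the three boundary conditions: Dirichlet makes
  the second factor vanish, Neumann and periodicity the first. Continuity up to the boundary does
  the rest.\<close>

lemma flux_vanishes_on_interval:
  assumes "a > 0" and F0: "prim {-a..a} F0 D0" and D0: "prim {-a..a} D0 w"
    and bc: "(D0 a - D0 (- a)) * (F0 a + F0 (- a)) = 0"
  obtains \<rho> where "\<And>n. \<rho> n > 0" "\<And>n. \<rho> n \<in> {-a<..<a}"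
    "\<And>x. x \<in> {-a<..<a} \<Longrightarrow> \<forall>\<^sub>F n in sequentially. \<bar>x\<bar> \<le> \<rho> n"
    "(\<lambda>n. cmod (D0 (\<rho> n) - D0 (- \<rho> n)) * cmod (F0 (\<rho> n) + F0 (- \<rho> n))) \<longlonglongrightarrow> 0"
proof -
  define \<rho> where "\<rho> = (\<lambda>n. a - a / (real (Suc (Suc n))))"
  have \<rho>: "\<rho> n > 0" "\<rho> n < a" for n
  proof -
    have "a / real (Suc (Suc n)) < a / 1"
      by (rule divide_strict_left_mono) (use \<open>a > 0\<close> in auto)
    then show "\<rho> n > 0" "\<rho> n < a" using \<open>a > 0\<close> by (simp_all add: \<rho>_def)
  qed
  have lim0: "(\<lambda>n. a - a * (1 / real (Suc (Suc n)))) \<longlonglongrightarrow> a - a * 0"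
    by (intro tendsto_intros lim_1_over_n[THEN LIMSEQ_Suc, THEN LIMSEQ_Suc])
  then have lim: "\<rho> \<longlonglongrightarrow> a" by (simp add: \<rho>_def)
  have conv: "(\<lambda>n. g (\<rho> n)) \<longlonglongrightarrow> g a" "(\<lambda>n. g (- \<rho> n)) \<longlonglongrightarrow> g (- a)"
    if "continuous_on {-a..a} g" for g :: "real \<Rightarrow> complex"
  proof -
    have in1: "\<rho> n \<in> {-a..a}" "- \<rho> n \<in> {-a..a}" for n using \<rho>[of n] by auto
    show "(\<lambda>n. g (\<rho> n)) \<longlonglongrightarrow> g a"
      by (rule continuous_on_tendsto_compose[OF that lim]) (use in1 \<open>a > 0\<close> in auto)
    show "(\<lambda>n. g (- \<rho> n)) \<longlonglongrightarrow> g (- a)"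
      by (rule continuous_on_tendsto_compose[OF that tendsto_minus[OF lim]]) (use in1 \<open>a > 0\<close> in auto)
  qed
  have "(\<lambda>n. cmod (D0 (\<rho> n) - D0 (- \<rho> n)) * cmod (F0 (\<rho> n) + F0 (- \<rho> n)))
      \<longlonglongrightarrow> cmod (D0 a - D0 (- a)) * cmod (F0 a + F0 (- a))"
    by (intro tendsto_intros conv prim_continuous_on_Icc[OF F0] prim_continuous_on_Icc[OF D0])
  moreover have "cmod (D0 a - D0 (- a)) * cmod (F0 a + F0 (- a)) = 0"
    using bc by (simp only: norm_mult[symmetric] norm_zero)
  ultimately have flux: "(\<lambda>n. cmod (D0 (\<rho> n) - D0 (- \<rho> n)) * cmod (F0 (\<rho> n) + F0 (- \<rho> n))) \<longlonglongrightarrow> 0"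
    by simp
  show thesis
  proof (rule that[of \<rho>])
    show "\<rho> n > 0" "\<rho> n \<in> {-a<..<a}" for n using \<rho>[of n] by auto
    fix x assume "x \<in> {-a<..<a}"
    then have "\<bar>x\<bar> < a" by auto
    from order_tendstoD(1)[OF lim this] show "\<forall>\<^sub>F n in sequentially. \<bar>x\<bar> \<le> \<rho> n"
      by eventually_elim simp
  qed (rule flux)
qed

section \<open>Boundary conditions\<close>

text \<open>An infimum below \<open>C\<close> is undercut by one admissible family. The strict
  inequality avoids the question whether the infimum is attained; the price is \<open>C + 1\<close>
  in place of \<open>C\<close> later on.\<close>

lemma Hs_sq_lessD:
  assumes "Hs_sq s \<Omega> f < C"
  shows "\<exists>D. D 0 = f \<and> (\<forall>j<nat \<lfloor>s\<rfloor>. weak_deriv \<Omega> (D j) (D (Suc j))) \<and>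
    (\<forall>j\<le>nat \<lfloor>s\<rfloor>. L2_sq \<Omega> (D j) < C) \<and>
    (frac s \<noteq> 0 \<longrightarrow> gagliardo_sq (frac s) \<Omega> (D (nat \<lfloor>s\<rfloor>)) < C)"
proof -
  let ?G = "\<lambda>D. if frac s = 0 then 0 else gagliardo_sq (frac s) \<Omega> (D (nat \<lfloor>s\<rfloor>))"
  obtain D where D: "D 0 = f" "\<forall>j<nat \<lfloor>s\<rfloor>. weak_deriv \<Omega> (D j) (D (Suc j))"
    and less: "(\<Sum>j\<le>nat \<lfloor>s\<rfloor>. L2_sq \<Omega> (D j)) + ?G D < C"
    using assms unfolding Hs_sq_def INF_less_iff by blast
  have "L2_sq \<Omega> (D j) < C" if "j \<le> nat \<lfloor>s\<rfloor>" for j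
  proof -
    have "L2_sq \<Omega> (D j) \<le> (\<Sum>j\<le>nat \<lfloor>s\<rfloor>. L2_sq \<Omega> (D j))"
      using that by (intro member_le_sum) auto
    also have "\<dots> \<le> (\<Sum>j\<le>nat \<lfloor>s\<rfloor>. L2_sq \<Omega> (D j)) + ?G D" by simp
    finally show ?thesis using less by (rule le_less_trans)
  qed
  moreover have "gagliardo_sq (frac s) \<Omega> (D (nat \<lfloor>s\<rfloor>)) < C" if "frac s \<noteq> 0"
  proof -
    have "gagliardo_sq (frac s) \<Omega> (D (nat \<lfloor>s\<rfloor>)) \<le> (\<Sum>j\<le>nat \<lfloor>s\<rfloor>. L2_sq \<Omega> (D j)) + ?G D"
      using that by simp
    then show ?thesis using less by (rule le_less_trans)
  qed
  ultimately show ?thesis using D by blast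
qed

section \<open>Values of representatives at the boundary\<close>

lemma L2_Ioo_imp_abs_integrable_Icc:
  assumes "f \<in> L2 {a<..<b}" "a \<le> x" "y \<le> b"
  shows "f absolutely_integrable_on {x..y}"
proof -
  have "integrable (lebesgue_on {a<..<b}) f" by (rule L2_bounded_integrable[OF assms(1)]) simp
  then have "f absolutely_integrable_on {a<..<b}"
    by (simp add: integrable_restrict_space set_integrable_def)
  then have "f absolutely_integrable_on {a..b}" by (simp only: absolutely_integrable_on_Icc_iff_Ioo)
  then show ?thesis by (rule absolutely_integrable_on_subinterval) (use assms in auto)
qed

lemma prim_int0_Icc:
  assumes "f absolutely_integrable_on {a..b}" "a \<le> 0" "0 \<le> b"
  shows "prim {a..b} (\<lambda>x. c + int0 f x) f"
  by (rule prim_int0) (use assms in \<open>auto intro: absolutely_integrable_on_subinterval is_interval_cc\<close>)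

lemma int0_cong_AE:
  assumes "AE x in lebesgue_on S. f x = g x" "is_interval S" "S \<in> sets lebesgue" "0 \<in> S" "x \<in> S"
  shows "int0 f x = int0 g x"
proof -
  obtain N where N: "negligible N" "\<And>x. x \<in> S - N \<Longrightarrow> f x = g x"
    using AE_lebesgue_onE[OF assms(1,3)] by blast
  have "integral {y..z} f = integral {y..z} g" if "y \<in> S" "z \<in> S" for y z
    by (rule integral_spike[OF N(1)]) (use N(2) Icc_subset_interval[OF assms(2) that] in force)
  then show ?thesis using assms(4,5) by (simp add: int0_def)
qed

text \<open>The representatives are explicit integrals because these formulas keep their meaning on
  the closed interval, where boundary values are read off.\<close>

lemma second_weak_deriv_prim:
  assumes "weak_deriv \<Omega> f d" "weak_deriv \<Omega> d w" "open \<Omega>" "is_interval \<Omega>" "0 \<in> \<Omega>"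
  obtains c0 c1 where "AE x in lebesgue_on \<Omega>. d x = c1 + int0 w x"
    "AE x in lebesgue_on \<Omega>. f x = c0 + int0 (\<lambda>x. c1 + int0 w x) x"
    "prim \<Omega> (\<lambda>x. c1 + int0 w x) w"
    "prim \<Omega> (\<lambda>x. c0 + int0 (\<lambda>x. c1 + int0 w x) x) (\<lambda>x. c1 + int0 w x)"
proof -
  have \<Omega>: "\<Omega> \<in> sets lebesgue" using assms(3) by (simp add: borel_open)
  obtain c0 where c0: "AE x in lebesgue_on \<Omega>. f x = c0 + int0 d x"
    using weak_deriv_imp_int0[OF assms(1,3-5)] .
  obtain c1 where c1: "AE x in lebesgue_on \<Omega>. d x = c1 + int0 w x"
    using weak_deriv_imp_int0[OF assms(2,3-5)] .
  have li: "locally_integrable \<Omega> w" using assms(2) by (simp add: weak_deriv_def)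
  have pw: "prim \<Omega> (\<lambda>x. c1 + int0 w x) w"
    by (intro prim_int0 assms locally_integrable_Icc[OF li])
  then have "locally_integrable \<Omega> (\<lambda>x. c1 + int0 w x)" by (intro prim_locally_integrable assms)
  then have p0: "prim \<Omega> (\<lambda>x. c0 + int0 (\<lambda>x. c1 + int0 w x) x) (\<lambda>x. c1 + int0 w x)"
    by (intro prim_int0 assms(4,5)) (rule locally_integrable_Icc[OF _ assms(4)])
  have "AE x in lebesgue_on \<Omega>. f x = c0 + int0 (\<lambda>x. c1 + int0 w x) x"
  proof -
    have "AE x in lebesgue_on \<Omega>. x \<in> \<Omega>" by (rule AE_I2) simp
    with c0 show ?thesis
      by eventually_elim (simp add: int0_cong_AE[OF c1 assms(4) \<Omega> assms(5)])
  qed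
  with c1 show thesis using pw p0 by (rule that)
qed

lemma continuous_eq_on_closed_interval:
  fixes F G :: "real \<Rightarrow> complex"
  assumes "continuous_on {a..b} F" "continuous_on {a..b} G" "a < b" "\<And>x. x \<in> {a<..<b} \<Longrightarrow> F x = G x"
    "x \<in> {a..b}"
  shows "F x = G x"
proof -
  have cl: "closure {a<..<b} = {a..b}" using assms(3) by (rule closure_greaterThanLessThan)
  have "F x - G x = 0"
    by (rule continuous_constant_on_closure[of "{a<..<b}" "\<lambda>x. F x - G x"])
       (use assms cl in \<open>auto intro!: continuous_intros\<close>)
  then show ?thesis by simp
qed

text \<open>A trace inequality, from integrating the derivative of \<open>P x * (x + z)\<close>: the
  weight vanishes at the end opposite to \<open>z\<close>, and the boundary term is
  \<open>2 * a * P z\<close> for either sign of \<open>z\<close>.\<close>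

lemma H1_boundary_estimate:
  assumes "a > 0" and P: "prim {-a..a} P q" "q \<in> L2 {-a<..<a}" "nsq {-a<..<a} P \<le> e" "nsq {-a<..<a} q \<le> e"
    and z: "z = a \<or> z = - a"
  shows "2 * a * cmod (P z) \<le> (sqrt (nsq {-a<..<a} (\<lambda>_. 1)) + sqrt (nsq {-a<..<a} (\<lambda>x. of_real (x + z)))) * sqrt e"
proof -
  let ?I = "{-a<..<a}"
  let ?g = "\<lambda>x. complex_of_real (x + z)"
  have cP: "continuous_on {-a..a} P" by (rule prim_continuous_on_Icc[OF P(1)])
  have g: "prim {-a..a} ?g (\<lambda>_. 1)"
  proof (rule prim_of_derivative)
    show "(?g has_vector_derivative 1) (at x)" for x
      using has_vector_derivative_of_real[of "\<lambda>x. x + z" 1 "at x"] by (auto intro!: derivative_eq_intros)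
  qed (auto intro: is_interval_cc)
  have cont_L2: "h \<in> L2 ?I" if h: "continuous_on {-a..a} h" for h :: "real \<Rightarrow> complex"
  proof -
    obtain M where M: "\<And>x. x \<in> {-a..a} \<Longrightarrow> cmod (h x) \<le> M"
      using compact_imp_bounded[OF compact_continuous_image[OF h compact_Icc]] unfolding bounded_iff by (meson imageI)
    show ?thesis
    proof (rule L2_bounded_measurable)
      show "h \<in> borel_measurable (lebesgue_on ?I)"
        by (rule continuous_imp_measurable_on_sets_lebesgue[OF continuous_on_subset[OF h]]) auto
      show "AE x in lebesgue_on ?I. cmod (h x) \<le> M" by (rule AE_I2) (auto intro: M)
    qed simp
  qed
  have PL: "P \<in> L2 ?I" by (rule cont_L2[OF cP])
  have gL: "?g \<in> L2 ?I" by (rule cont_L2) (intro continuous_intros)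
  have oL: "(\<lambda>_. 1) \<in> L2 ?I" by (rule cont_L2) (intro continuous_intros)
  have conv: "integral {-a..a} h = (LINT x|lebesgue_on ?I. h x)" if "integrable (lebesgue_on ?I) h" for h :: "real \<Rightarrow> complex"
  proof -
    have "(LINT x|lebesgue_on ?I. h x) = integral ?I h" by (rule lebesgue_integral_eq_integral[OF that]) simp
    then show ?thesis using integral_open_interval_real[of "-a" a h] by simp
  qed
  note i1 = L2_mult_integrable[OF P(2) gL] and i2 = L2_mult_integrable[OF PL oL]
  have "integral {-a..a} (\<lambda>x. q x * ?g x + P x * 1) = P a * ?g a - P (- a) * ?g (- a)"
    by (rule prim_mult_Icc[OF P(1) g]) (use \<open>a > 0\<close> in simp)
  also have "\<dots> = (if z = a then 1 else -1) * (2 * a * P z) \<or> \<dots> = 2 * a * P z"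
    using z by (auto simp: algebra_simps)
  then have "cmod (P a * ?g a - P (- a) * ?g (- a)) = 2 * a * cmod (P z)"
    using \<open>a > 0\<close> by (auto simp: norm_mult)
  finally have "2 * a * cmod (P z) = cmod (integral {-a..a} (\<lambda>x. q x * ?g x + P x * 1))" by simp
  also have "integral {-a..a} (\<lambda>x. q x * ?g x + P x * 1) = (LINT x|lebesgue_on ?I. q x * ?g x + P x * 1)"
    by (rule conv) (rule Bochner_Integration.integrable_add[OF i1 i2])
  also have "\<dots> = (LINT x|lebesgue_on ?I. q x * ?g x) + (LINT x|lebesgue_on ?I. P x * 1)"
    by (rule Bochner_Integration.integral_add[OF i1 i2])
  also have "cmod \<dots> \<le> cmod (LINT x|lebesgue_on ?I. q x * ?g x) + cmod (LINT x|lebesgue_on ?I. P x * 1)"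
    by (rule norm_triangle_ineq)
  also have "\<dots> \<le> sqrt (nsq ?I q) * sqrt (nsq ?I ?g) + sqrt (nsq ?I P) * sqrt (nsq ?I (\<lambda>_. 1))"
    by (intro add_mono L2_Cauchy_Schwarz P(2) gL PL oL)
  also have "\<dots> \<le> sqrt e * sqrt (nsq ?I ?g) + sqrt e * sqrt (nsq ?I (\<lambda>_. 1))"
    using P(3,4) by (intro add_mono mult_right_mono) (auto simp: nsq_nonneg)
  finally show ?thesis by (simp add: algebra_simps)
qed

text \<open>Some test function is close to \<open>f\<close> in \<open>H1\<close> and vanishes at
  \<open>z\<close>, and the trace inequality passes the closeness on to \<open>F0 z\<close>.\<close>

lemma Dirichlet_boundary_value:
  assumes "a > 0" "f \<in> H1_0 {-a<..<a}" and F0: "continuous_on {-a..a} F0" "AE x in lebesgue_on {-a<..<a}. f x = F0 x"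
    and z: "z = a \<or> z = - a"
  shows "F0 z = 0"
proof -
  let ?I = "{-a<..<a}"
  have I: "open ?I" "is_interval ?I" "0 \<in> ?I" "?I \<in> sets lebesgue" using \<open>a > 0\<close> by (auto intro: is_interval_oo)
  define K where "K = sqrt (nsq ?I (\<lambda>_. 1)) + sqrt (nsq ?I (\<lambda>x. of_real (x + z)))"
  have K: "K \<ge> 0" by (simp add: K_def nsq_nonneg)
  have bound: "2 * a * cmod (F0 z) \<le> K * sqrt e" if e: "e > 0" for e
  proof -
    obtain \<psi> where \<psi>: "\<psi> \<in> test_fun ?I" "Hs_sq 1 ?I (\<lambda>x. f x - \<psi> x) < ennreal e"
      using assms(2) e by (auto simp: H1_0_def)
    obtain D where D: "D 0 = (\<lambda>x. f x - \<psi> x)" "\<forall>j<nat \<lfloor>1::real\<rfloor>. weak_deriv ?I (D j) (D (Suc j))"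
      "\<forall>j\<le>nat \<lfloor>1::real\<rfloor>. L2_sq ?I (D j) < ennreal e"
      using Hs_sq_lessD[OF \<psi>(2)] by blast
    have D1: "weak_deriv ?I (\<lambda>x. f x - \<psi> x) (D 1)" using D(1,2) by auto
    have DL: "D j \<in> L2 ?I" "nsq ?I (D j) \<le> e" if "j \<le> 1" for j
      using D(3) that L2_sq_le_iff[of e ?I "D j"] \<open>e > 0\<close> by (auto simp: less_imp_le)
    obtain c where c: "AE x in lebesgue_on ?I. f x - \<psi> x = c + int0 (D 1) x"
      using weak_deriv_imp_int0[OF D1 I(1-3)] .
    define P where "P = (\<lambda>x. c + int0 (D 1) x)"
    have pP: "prim {-a..a} P (D 1)" unfolding P_def
      by (rule prim_int0_Icc[OF L2_Ioo_imp_abs_integrable_Icc[OF DL(1)]]) (use \<open>a > 0\<close> in auto)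
    have cP: "continuous_on {-a..a} P" by (rule prim_continuous_on_Icc[OF pP])
    have "nsq ?I P = nsq ?I (D 0)"
    proof (rule L2_cong_AE(2)[OF DL(1)])
      show "AE x in lebesgue_on ?I. D 0 x = P x" using c by (simp add: D(1) P_def)
      show "P \<in> borel_measurable (lebesgue_on ?I)"
        by (rule continuous_imp_measurable_on_sets_lebesgue[OF continuous_on_subset[OF cP]]) auto
    qed simp
    then have "nsq ?I P \<le> e" using DL(2)[of 0] by simp
    from H1_boundary_estimate[OF \<open>a > 0\<close> pP DL(1) this DL(2) z]
    have est: "2 * a * cmod (P z) \<le> K * sqrt e" by (simp add: K_def)
    have c\<psi>: "continuous_on {-a..a} \<psi>" by (rule smooth_imp_continuous_on[OF test_fun_smooth[OF \<psi>(1)]])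
    have "F0 z - \<psi> z = P z"
    proof (rule continuous_eq_on_closed_interval)
      show "continuous_on {-a..a} (\<lambda>x. F0 x - \<psi> x)" by (intro continuous_intros F0(1) c\<psi>)
      show "continuous_on {-a..a} P" by (rule cP)
      fix x assume x: "x \<in> ?I"
      show "F0 x - \<psi> x = P x"
      proof (rule continuous_AE_eq_imp_eq[OF _ _ I(1) _ x])
        have sub: "?I \<subseteq> {-a..a}" by auto
        show "continuous_on ?I (\<lambda>x. F0 x - \<psi> x)" "continuous_on ?I P"
          by (intro continuous_intros continuous_on_subset[OF F0(1) sub] continuous_on_subset[OF c\<psi> sub] continuous_on_subset[OF cP sub])+
        show "AE x in lebesgue_on ?I. F0 x - \<psi> x = P x"
          using c F0(2) by eventually_elim (simp add: P_def)
      qed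
    qed (use z \<open>a > 0\<close> in auto)
    moreover have "\<psi> z = 0" using \<psi>(1) z unfolding test_fun_def by auto
    ultimately show ?thesis using est by simp
  qed
  have "2 * a * cmod (F0 z) \<le> 0"
  proof (rule field_le_epsilon)
    fix e :: real assume "e > 0"
    \<comment> \<open>The bound is used at \<open>k\<^sup>2\<close>, which removes the root and
      leaves \<open>K * k \<le> e\<close>.\<close>
    define k where "k = e / (K + 1)"
    have k: "k > 0" using \<open>e > 0\<close> K by (simp add: k_def)
    have "2 * a * cmod (F0 z) \<le> K * sqrt (k\<^sup>2)" by (rule bound) (use k in simp)
    also have "\<dots> = K * k" using k by simp
    also have "\<dots> \<le> e" using K \<open>e > 0\<close> by (simp add: k_def pos_divide_le_eq algebra_simps)
    finally show "2 * a * cmod (F0 z) \<le> 0 + e" by simp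
  qed
  then show ?thesis using \<open>a > 0\<close> by (simp add: mult_le_0_iff)
qed

text \<open>The periodic extension is regular across the endpoints, so on the tripled interval its
  derivatives at \<open>-a\<close> and at \<open>a\<close> are related by the shift. On the closed
  original interval its derivative coincides with \<open>D0\<close> by continuity.\<close>

lemma periodic_boundary_derivative:
  assumes "a > 0" "\<psi> \<in> Hs_loc 2 UNIV" "\<And>x. \<psi> (x + 2 * a) = \<psi> x" "AE x in lebesgue_on {-a<..<a}. f x = \<psi> x"
    and F0: "prim {-a..a} F0 D0" "continuous_on {-a..a} D0" "AE x in lebesgue_on {-a<..<a}. f x = F0 x"
  shows "D0 a = D0 (- a)"
proof -
  let ?I = "{-a<..<a}" and ?J = "{-(3 * a)<..<3 * a}"
  have I: "open ?I" "is_interval ?I" "0 \<in> ?I" "?I \<in> sets lebesgue" using \<open>a > 0\<close> by (auto intro: is_interval_oo)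
  have J: "open ?J" "is_interval ?J" "0 \<in> ?J" "?J \<in> sets lebesgue" using \<open>a > 0\<close> by (auto intro: is_interval_oo)
  have IJ: "?I \<subseteq> ?J" using \<open>a > 0\<close> by auto
  have "bounded ?J" by (rule bounded_subset[OF bounded_closed_interval[of "-(3 * a)" "3 * a"]]) auto
  then have "compact (closure ?J)" by (simp only: compact_closure)
  then have "Hs_sq 2 ?J \<psi> < \<infinity>" using assms(2) by (auto simp: Hs_loc_def Hs_def)
  then obtain D where D: "D 0 = \<psi>" "\<forall>j<nat \<lfloor>2::real\<rfloor>. weak_deriv ?J (D j) (D (Suc j))"
    using Hs_sq_lessD by blast
  have n2: "nat \<lfloor>2::real\<rfloor> = 2" by simp
  have w: "weak_deriv ?J \<psi> (D 1)" "weak_deriv ?J (D 1) (D 2)"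
    using D(1) spec[OF D(2), of 0] spec[OF D(2), of 1] by (simp_all add: n2 numeral_2_eq_2)
  obtain P0 P1 where P: "AE x in lebesgue_on ?J. \<psi> x = P0 x" "prim ?J P1 (D 2)" "prim ?J P0 P1"
    by (rule second_weak_deriv_prim[OF w J(1-3)])
  have cP1: "continuous_on ?J P1" and cP0: "continuous_on ?J P0"
    using prim_continuous_on[OF P(2) J(1)] prim_continuous_on[OF P(3) J(1)] by auto
  have dP: "(P0 has_vector_derivative P1 x) (at x)" if "x \<in> ?J" for x
    by (rule prim_has_vector_derivative[OF P(3) J(1) cP1 that])
  \<comment> \<open>The points whose shift by \<open>2 * a\<close> stays in \<open>?J\<close>; the
    set is a neighbourhood of \<open>-a\<close>.\<close>
  let ?S = "{-(3 * a)<..<a}"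
  have S: "open ?S" "?S \<in> sets lebesgue" "?S \<subseteq> ?J" using \<open>a > 0\<close> by auto
  have shift: "P0 (x + 2 * a) = P0 x" if "x \<in> ?S" for x
  proof (rule continuous_AE_eq_imp_eq[OF _ _ S(1) _ that])
    show "continuous_on ?S P0" by (rule continuous_on_subset[OF cP0 S(3)])
    show "continuous_on ?S (\<lambda>x. P0 (x + 2 * a))"
      by (rule continuous_on_compose2[OF cP0]) (auto intro!: continuous_intros)
    obtain N where N: "negligible N" "\<And>x. x \<in> ?J - N \<Longrightarrow> \<psi> x = P0 x"
      using AE_lebesgue_onE[OF P(1) J(4)] by blast
    have "negligible ((\<lambda>x. x - 2 * a) ` N \<union> N)"
      using N(1) negligible_translation[OF N(1), of "- 2 * a"] by (simp add: add.commute)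
    then show "AE x in lebesgue_on ?S. P0 (x + 2 * a) = P0 x"
    proof (rule AE_lebesgue_onI[OF _ _ S(2)])
      fix x assume x: "x \<in> ?S - ((\<lambda>x. x - 2 * a) ` N \<union> N)"
      have "x + 2 * a \<notin> N"
      proof
        assume "x + 2 * a \<in> N"
        then have "(x + 2 * a) - 2 * a \<in> (\<lambda>x. x - 2 * a) ` N" by (rule imageI)
        then show False using x by simp
      qed
      then have "\<psi> (x + 2 * a) = P0 (x + 2 * a)" using x by (intro N(2)) auto
      moreover have "\<psi> x = P0 x" using x S(3) by (intro N(2)) auto
      ultimately show "P0 (x + 2 * a) = P0 x" using assms(3)[of x] by simp
    qed
  qed
  have "P1 a = P1 (- a)"
  proof -
    have "(P0 \<circ> (\<lambda>x. x + 2 * a) has_vector_derivative 1 *\<^sub>R P1 (- a + 2 * a)) (at (- a))"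
      by (rule vector_diff_chain_at) (use \<open>a > 0\<close> in \<open>auto intro!: derivative_eq_intros dP simp: has_real_derivative_iff_has_vector_derivative[symmetric]\<close>)
    then have "((\<lambda>x. P0 (x + 2 * a)) has_vector_derivative P1 a) (at (- a))" by (simp add: o_def)
    then have "(P0 has_vector_derivative P1 a) (at (- a))"
      by (rule has_vector_derivative_transform_within_open[OF _ S(1)]) (use shift \<open>a > 0\<close> in auto)
    moreover have "(P0 has_vector_derivative P1 (- a)) (at (- a))" by (rule dP) (use \<open>a > 0\<close> in auto)
    ultimately show ?thesis by (rule vector_derivative_unique_at)
  qed
  have sub: "?I \<subseteq> {-a..a}" by auto
  have IccJ: "{-a..a} \<subseteq> ?J" using \<open>a > 0\<close> by auto
  have "AE x in lebesgue_on ?I. \<psi> x = P0 x" by (rule AE_lebesgue_on_subset[OF P(1) IJ J(4) I(4)])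
  with assms(4) F0(3) have "AE x in lebesgue_on ?I. F0 x = P0 x" by eventually_elim simp
  from prim_unique_AE(1)[OF prim_subset[OF F0(1) sub] prim_subset[OF P(3) IJ] I(1,2) this]
  have ae: "AE x in lebesgue_on ?I. D0 x = P1 x" .
  have eqI: "D0 x = P1 x" if "x \<in> ?I" for x
    by (rule continuous_AE_eq_imp_eq[OF continuous_on_subset[OF F0(2) sub] continuous_on_subset[OF cP1 IJ] I(1) ae that])
  have "D0 x = P1 x" if "x \<in> {-a..a}" for x
    by (rule continuous_eq_on_closed_interval[OF F0(2) continuous_on_subset[OF cP1 IccJ] _ eqI that])
       (use \<open>a > 0\<close> in auto)
  then show ?thesis using \<open>P1 a = P1 (- a)\<close> \<open>a > 0\<close> by simp
qed

lemma Dom_Laplace_boundary: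
  assumes "a > 0" "f \<in> Dom_Laplace (Interval a b)"
    and w: "weak_deriv {-a<..<a} f d" "weak_deriv {-a<..<a} d w" "w \<in> L2 {-a<..<a}"
  obtains F0 D0 where "prim {-a..a} F0 D0" "prim {-a..a} D0 w" "AE x in lebesgue_on {-a<..<a}. f x = F0 x"
    "(D0 a - D0 (- a)) * (F0 a + F0 (- a)) = 0"
proof -
  let ?I = "{-a<..<a}"
  have I: "open ?I" "is_interval ?I" "0 \<in> ?I" "?I \<in> sets lebesgue" using \<open>a > 0\<close> by (auto intro: is_interval_oo)
  have a: "-a \<le> 0" "0 \<le> a" "- a < a" using \<open>a > 0\<close> by auto
  have sub: "?I \<subseteq> {-a..a}" by auto
  obtain c0 c1 where c: "AE x in lebesgue_on ?I. d x = c1 + int0 w x"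
    "AE x in lebesgue_on ?I. f x = c0 + int0 (\<lambda>x. c1 + int0 w x) x"
    using second_weak_deriv_prim[OF w(1,2) I(1-3)] by blast
  define D0 where "D0 = (\<lambda>x. c1 + int0 w x)"
  define F0 where "F0 = (\<lambda>x. c0 + int0 D0 x)"
  have pD: "prim {-a..a} D0 w" unfolding D0_def
    by (rule prim_int0_Icc[OF L2_Ioo_imp_abs_integrable_Icc[OF w(3)] a(1,2)]) auto
  have cD: "continuous_on {-a..a} D0" by (rule prim_continuous_on_Icc[OF pD])
  have pF: "prim {-a..a} F0 D0" unfolding F0_def
    by (rule prim_int0_Icc[OF absolutely_integrable_continuous_real[OF cD] a(1,2)])
  have cF: "continuous_on {-a..a} F0" by (rule prim_continuous_on_Icc[OF pF])
  have ae: "AE x in lebesgue_on ?I. f x = F0 x" using c(2) by (simp add: F0_def D0_def)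
  have "(D0 a - D0 (- a)) * (F0 a + F0 (- a)) = 0"
  proof (cases b)
    case Dirichlet
    then have "f \<in> H1_0 ?I" using assms(2) by simp
    then have "F0 a = 0" "F0 (- a) = 0"
      using Dirichlet_boundary_value[OF \<open>a > 0\<close> _ cF ae] by auto
    then show ?thesis by simp
  next
    case Neumann
    then obtain g where g: "continuous_on {-a..a} g" "weak_deriv ?I f g" "g (-a) = 0" "g a = 0"
      using assms(2) by auto
    have "AE x in lebesgue_on ?I. d x = g x"
      by (rule weak_deriv_unique[OF w(1) g(2) _ I(1-3)]) simp
    with c(1) have ae': "AE x in lebesgue_on ?I. D0 x = g x" unfolding D0_def by eventually_elim simp
    have eqI: "D0 x = g x" if "x \<in> ?I" for x
      by (rule continuous_AE_eq_imp_eq[OF continuous_on_subset[OF cD sub] continuous_on_subset[OF g(1) sub] I(1) ae' that])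
    have "D0 x = g x" if "x \<in> {-a..a}" for x
      by (rule continuous_eq_on_closed_interval[OF cD g(1) a(3) eqI that])
    then show ?thesis using g(3,4) \<open>a > 0\<close> by simp
  next
    case Periodic
    then obtain \<psi> where "\<psi> \<in> Hs_loc 2 UNIV" "\<And>x. \<psi> (x + 2 * a) = \<psi> x" "AE x in lebesgue_on ?I. f x = \<psi> x"
      using assms(2) by auto
    from periodic_boundary_derivative[OF \<open>a > 0\<close> this pF cD ae] show ?thesis by simp
  qed
  with pF pD ae show thesis by (rule that)
qed

section \<open>Local bounds from Sobolev regularity\<close>

text \<open>Needed for lower bounds of the Gagliardo integrand, which may be negative;
  \<open>ennreal\<close> cuts them off at 0.\<close>

lemma ennreal_integral_le_nn_integral:
  fixes \<phi> :: "'a \<Rightarrow> real"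
  assumes "integrable M \<phi>"
  shows "ennreal (integral\<^sup>L M \<phi>) \<le> (\<integral>\<^sup>+x. ennreal (\<phi> x) \<partial>M)"
proof -
  have i: "integrable M (\<lambda>x. max 0 (\<phi> x))" using assms by (intro integrable_max) auto
  have "integral\<^sup>L M \<phi> \<le> integral\<^sup>L M (\<lambda>x. max 0 (\<phi> x))"
    by (intro integral_mono assms i) auto
  then have "ennreal (integral\<^sup>L M \<phi>) \<le> ennreal (integral\<^sup>L M (\<lambda>x. max 0 (\<phi> x)))"
    by (rule ennreal_leI)
  also have "\<dots> = (\<integral>\<^sup>+x. ennreal (max 0 (\<phi> x)) \<partial>M)"
    by (rule nn_integral_eq_integral[symmetric, OF i]) auto
  also have "\<dots> = (\<integral>\<^sup>+x. ennreal (\<phi> x) \<partial>M)"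
    by (intro nn_integral_cong) (auto simp: max_def ennreal_neg)
  finally show ?thesis .
qed

lemma nn_integral_lebesgue_on_subset:
  assumes "A \<subseteq> \<Omega>" "A \<in> sets lebesgue" "\<Omega> \<in> sets lebesgue"
  shows "(\<integral>\<^sup>+x. f x \<partial>lebesgue_on A) \<le> (\<integral>\<^sup>+x. f x \<partial>lebesgue_on \<Omega>)"
proof -
  have m: "A \<inter> space lebesgue \<in> sets lebesgue" "\<Omega> \<inter> space lebesgue \<in> sets lebesgue" using assms by auto
  show ?thesis
    unfolding nn_integral_restrict_space[OF m(1)] nn_integral_restrict_space[OF m(2)]
    by (intro nn_integral_mono) (use assms(1) in \<open>auto simp: indicator_def\<close>)
qed

lemma norm_integral_le_nsq:
  assumes g: "g \<in> L2 {-X<..<X}" and x: "0 \<le> x" "x < X"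
  shows "cmod (integral {0..x} g) \<le> X + nsq {-X<..<X} g"
proof -
  have sub: "{0..x} \<subseteq> {-X<..<X}" using x by auto
  have A: "{0..x} \<in> sets lebesgue" "{-X<..<X} \<in> sets lebesgue" by auto
  have gA: "g \<in> L2 {0..x}" by (rule L2_subset(1)[OF g sub A(2,1)])
  have gi: "integrable (lebesgue_on {0..x}) g" by (rule L2_bounded_integrable[OF gA]) simp
  have oi: "integrable (lebesgue_on {0..x}) (\<lambda>_. 1 :: real)"
    by (rule absolutely_integrable_imp_integrable[OF absolutely_integrable_continuous_real A(1)]) (intro continuous_intros)
  have "cmod (integral {0..x} g) = cmod (LINT x|lebesgue_on {0..x}. g x)"
    by (simp add: lebesgue_integral_eq_integral[OF gi A(1)])
  also have "\<dots> \<le> (LINT x|lebesgue_on {0..x}. cmod (g x))" by (rule integral_norm_bound)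
  also have "\<dots> \<le> (LINT x|lebesgue_on {0..x}. 1 + (cmod (g x))\<^sup>2)"
  proof (rule integral_mono)
    show "cmod (g y) \<le> 1 + (cmod (g y))\<^sup>2" for y
      using zero_le_power2[of "cmod (g y) - 1/2"] by (simp add: power2_eq_square algebra_simps)
  qed (use gi oi L2_D(2)[OF gA] in auto)
  also have "\<dots> = x + nsq {0..x} g"
    using oi L2_D(2)[OF gA] x by (simp add: nsq_def measure_restrict_space)
  also have "\<dots> \<le> X + nsq {-X<..<X} g" using x L2_subset(2)[OF g sub A(2,1)] by simp
  finally show ?thesis .
qed

text \<open>The two averages are compared by averaging \<open>g x - g y\<close> over \<open>x \<in> [0, l / 2]\<close> and
  \<open>y \<in> [0, l]\<close>; the bound \<open>2 \<bar>g x - g y\<bar> \<le> \<kappa> + \<bar>g x - g y\<bar>\<^sup>2 / \<kappa>\<close> is used with \<open>\<kappa> = l powr \<beta>\<close>.\<close>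

lemma gagliardo_average_step:
  assumes g: "g \<in> L2 {-X<..<X}" and G: "gagliardo_sq \<sigma> {-X<..<X} g \<le> ennreal C" and C: "C \<ge> 0"
    and \<sigma>: "\<sigma> = 1/2 + \<beta>" "\<beta> > 0" and l: "0 < l" "l < X"
  shows "cmod (integral {0..l / 2} g / of_real (l / 2) - integral {0..l} g / of_real l) \<le> (1/2 + C) * l powr \<beta>"
proof -
  let ?I = "{-X<..<X}" and ?A = "{0..l / 2}" and ?B = "{0..l}"
  define \<kappa> where "\<kappa> = l powr \<beta>"
  \<comment> \<open>Multiplying \<open>k - \<kappa> / 2 \<le> k\<^sup>2 / (2 * \<kappa>)\<close> by
    \<open>c\<close> leaves \<open>k\<^sup>2 / l powr (1 + 2 * \<sigma>)\<close> on the right, which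
    is below the Gagliardo integrand because \<open>\<bar>x - y\<bar> \<le> l\<close>.\<close>
  define c where "c = 2 * \<kappa> / l powr (1 + 2 * \<sigma>)"
  have \<kappa>: "\<kappa> > 0" using l by (simp add: \<kappa>_def)
  have c: "c > 0" using l \<kappa> by (simp add: c_def)
  have S: "?A \<in> sets lebesgue" "?B \<in> sets lebesgue" "?I \<in> sets lebesgue" by auto
  have sub: "?A \<subseteq> ?I" "?B \<subseteq> ?I" "?A \<subseteq> ?B" using l by auto
  have gA: "g absolutely_integrable_on ?A" and gB: "g absolutely_integrable_on ?B"
    by (rule L2_absolutely_integrable[OF g S(3)], use sub in auto)+
  have giA: "integrable (lebesgue_on ?A) g" and giB: "integrable (lebesgue_on ?B) g"
    using absolutely_integrable_imp_integrable[OF gA S(1)] absolutely_integrable_imp_integrable[OF gB S(2)] by auto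
  have const: "integrable (lebesgue_on {a..b}) (\<lambda>_. k)" "(LINT x|lebesgue_on {a..b}. k) = (b - a) *\<^sub>R k" if "a \<le> b"
    for a b :: real and k :: "'a :: euclidean_space"
  proof -
    show "integrable (lebesgue_on {a..b}) (\<lambda>_. k)"
      by (rule absolutely_integrable_imp_integrable[OF absolutely_integrable_continuous_real]) (auto intro: continuous_intros)
    then show "(LINT x|lebesgue_on {a..b}. k) = (b - a) *\<^sub>R k"
      using that by (subst lebesgue_integral_eq_integral) auto
  qed
  define mA where "mA = (LINT x|lebesgue_on ?A. g x)"
  define mB where "mB = (LINT x|lebesgue_on ?B. g x)"
  \<comment> \<open>This is \<open>l\<close> times the deviation of \<open>g x\<close> from its
    average over \<open>[0, l]\<close>.\<close>
  define H where "H = (\<lambda>x. of_real l * g x - mB)"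
  have Hi: "integrable (lebesgue_on ?A) H"
    unfolding H_def using giA const(1)[of 0 "l / 2" mB] l by auto
  have inner: "ennreal ((cmod (H x) - \<kappa> * l / 2) * c) \<le>
     (\<integral>\<^sup>+y. ennreal ((cmod (g x - g y))\<^sup>2 / \<bar>x - y\<bar> powr (1 + 2 * \<sigma>)) \<partial>lebesgue_on ?I)" if x: "x \<in> ?A" for x
  proof -
    have gd: "integrable (lebesgue_on ?B) (\<lambda>y. g x - g y)"
      using giB const(1)[of 0 l "g x"] l by auto
    have pi: "integrable (lebesgue_on ?B) (\<lambda>y. (cmod (g x - g y) - \<kappa> / 2) * c)"
      using integrable_norm[OF gd] const(1)[of 0 l "\<kappa> / 2"] l by auto
    have "H x = (LINT y|lebesgue_on ?B. g x - g y)"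
      using giB const[of 0 l "g x"] l by (simp add: H_def mB_def measure_restrict_space scaleR_conv_of_real)
    then have "cmod (H x) \<le> (LINT y|lebesgue_on ?B. cmod (g x - g y))"
      using integral_norm_bound[of "lebesgue_on ?B" "\<lambda>y. g x - g y"] by simp
    then have "(cmod (H x) - \<kappa> * l / 2) * c \<le> ((LINT y|lebesgue_on ?B. cmod (g x - g y)) - \<kappa> * l / 2) * c"
      using c by (intro mult_right_mono) auto
    also have "\<dots> = (LINT y|lebesgue_on ?B. (cmod (g x - g y) - \<kappa> / 2) * c)"
      using integrable_norm[OF gd] const[of 0 l "\<kappa> / 2"] l by (simp add: algebra_simps measure_restrict_space)
    finally have "ennreal ((cmod (H x) - \<kappa> * l / 2) * c) \<le> ennreal (LINT y|lebesgue_on ?B. (cmod (g x - g y) - \<kappa> / 2) * c)"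
      by (rule ennreal_leI)
    also have "\<dots> \<le> (\<integral>\<^sup>+y. ennreal ((cmod (g x - g y) - \<kappa> / 2) * c) \<partial>lebesgue_on ?B)"
      by (rule ennreal_integral_le_nn_integral[OF pi])
    also have "\<dots> \<le> (\<integral>\<^sup>+y. ennreal ((cmod (g x - g y))\<^sup>2 / \<bar>x - y\<bar> powr (1 + 2 * \<sigma>)) \<partial>lebesgue_on ?B)"
    proof (intro nn_integral_mono ennreal_leI)
      fix y assume "y \<in> space (lebesgue_on ?B)"
      then have y: "y \<in> ?B" by simp
      define k where "k = cmod (g x - g y)"
      show "(cmod (g x - g y) - \<kappa> / 2) * c \<le> (cmod (g x - g y))\<^sup>2 / \<bar>x - y\<bar> powr (1 + 2 * \<sigma>)"
      proof (cases "x = y")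
        case True
        then show ?thesis using c \<kappa> by (simp add: mult_nonneg_nonneg)
      next
        case False
        have "2 * \<kappa> * (k - \<kappa> / 2) \<le> k\<^sup>2"
          using zero_le_power2[of "k - \<kappa>"] by (simp add: power2_eq_square algebra_simps)
        then have "(k - \<kappa> / 2) * c \<le> k\<^sup>2 / l powr (1 + 2 * \<sigma>)"
          unfolding c_def using l by (simp add: divide_right_mono mult.commute)
        also have "\<dots> \<le> k\<^sup>2 / \<bar>x - y\<bar> powr (1 + 2 * \<sigma>)"
        proof (intro divide_left_mono powr_mono2)
          show "0 \<le> 1 + 2 * \<sigma>" using \<sigma> by simp
          show "\<bar>x - y\<bar> \<le> l" using x y by auto
          show "0 < l powr (1 + 2 * \<sigma>) * \<bar>x - y\<bar> powr (1 + 2 * \<sigma>)" using l False by simp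
        qed auto
        finally show ?thesis by (simp add: k_def)
      qed
    qed
    also have "\<dots> \<le> (\<integral>\<^sup>+y. ennreal ((cmod (g x - g y))\<^sup>2 / \<bar>x - y\<bar> powr (1 + 2 * \<sigma>)) \<partial>lebesgue_on ?I)"
      by (rule nn_integral_lebesgue_on_subset[OF sub(2) S(2,3)])
    finally show ?thesis .
  qed
  have Hni: "integrable (lebesgue_on ?A) (\<lambda>x. cmod (H x))" by (rule integrable_norm[OF Hi])
  have pi: "integrable (lebesgue_on ?A) (\<lambda>x. (cmod (H x) - \<kappa> * l / 2) * c)"
    using Hni const(1)[of 0 "l / 2" "\<kappa> * l / 2"] l by auto
  have "ennreal (LINT x|lebesgue_on ?A. (cmod (H x) - \<kappa> * l / 2) * c) \<le> (\<integral>\<^sup>+x. ennreal ((cmod (H x) - \<kappa> * l / 2) * c) \<partial>lebesgue_on ?A)"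
    by (rule ennreal_integral_le_nn_integral[OF pi])
  also have "\<dots> \<le> (\<integral>\<^sup>+x. (\<integral>\<^sup>+y. ennreal ((cmod (g x - g y))\<^sup>2 / \<bar>x - y\<bar> powr (1 + 2 * \<sigma>)) \<partial>lebesgue_on ?I) \<partial>lebesgue_on ?A)"
    by (rule nn_integral_mono) (simp add: inner)
  also have "\<dots> \<le> gagliardo_sq \<sigma> ?I g"
    unfolding gagliardo_sq_def by (rule nn_integral_lebesgue_on_subset[OF sub(1) S(1,3)])
  finally have "ennreal (LINT x|lebesgue_on ?A. (cmod (H x) - \<kappa> * l / 2) * c) \<le> ennreal C" using G by (rule order_trans)
  then have "(LINT x|lebesgue_on ?A. (cmod (H x) - \<kappa> * l / 2) * c) \<le> C" using C by (simp add: ennreal_le_iff)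
  also have "(LINT x|lebesgue_on ?A. (cmod (H x) - \<kappa> * l / 2) * c) = ((LINT x|lebesgue_on ?A. cmod (H x)) - l / 2 * (\<kappa> * l / 2)) * c"
    using Hni const[of 0 "l / 2" "\<kappa> * l / 2"] l by (simp add: algebra_simps measure_restrict_space)
  finally have "(LINT x|lebesgue_on ?A. cmod (H x)) - l / 2 * (\<kappa> * l / 2) \<le> C / c"
    using c by (simp add: pos_le_divide_eq)
  \<comment> \<open>Here \<open>1 + 2 * \<sigma> = 2 + 2 * \<beta>\<close>: the factor
    \<open>l\<^sup>2\<close> is used up by the double average, and one factor
    \<open>l powr \<beta>\<close> survives as the gain.\<close>
  moreover have "C / c = C / 2 * (l\<^sup>2 * \<kappa>)"
  proof -
    have "l powr (1 + 2 * \<sigma>) = l powr 2 * l powr \<beta> * l powr \<beta>"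
      using \<sigma> by (simp add: powr_add[symmetric] add.commute)
    also have "l powr 2 = l\<^sup>2" using l by simp
    finally have "l powr (1 + 2 * \<sigma>) = l\<^sup>2 * \<kappa> * \<kappa>" by (simp only: \<kappa>_def)
    then show ?thesis using \<kappa> by (simp add: c_def)
  qed
  ultimately have Hb: "(LINT x|lebesgue_on ?A. cmod (H x)) \<le> (1/4 + C / 2) * (l\<^sup>2 * \<kappa>)"
    by (simp add: power2_eq_square algebra_simps)
  have "(LINT x|lebesgue_on ?A. H x) = of_real l * mA - of_real (l / 2) * mB"
    unfolding H_def using giA const[of 0 "l / 2" mB] l by (simp add: mA_def scaleR_conv_of_real measure_restrict_space)
  moreover have "mA / of_real (l / 2) - mB / of_real l = of_real (2 / l\<^sup>2) * (of_real l * mA - of_real (l / 2) * mB)"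
    using l by (simp add: field_simps power2_eq_square)
  ultimately have "mA / of_real (l / 2) - mB / of_real l = of_real (2 / l\<^sup>2) * (LINT x|lebesgue_on ?A. H x)"
    by (simp only:)
  then have "cmod (mA / of_real (l / 2) - mB / of_real l) = 2 / l\<^sup>2 * cmod (LINT x|lebesgue_on ?A. H x)"
    by (simp only: norm_mult norm_of_real) simp
  also have "\<dots> \<le> 2 / l\<^sup>2 * ((1/4 + C / 2) * (l\<^sup>2 * \<kappa>))"
    using order_trans[OF integral_norm_bound Hb] by (intro mult_left_mono) auto
  also have "\<dots> = (1/2 + C) * l powr \<beta>" using l by (simp add: \<kappa>_def field_simps)
  finally have "cmod (mA / of_real (l / 2) - mB / of_real l) \<le> (1/2 + C) * l powr \<beta>" .
  then show ?thesis
    unfolding mA_def mB_def lebesgue_integral_eq_integral[OF giA S(1)] lebesgue_integral_eq_integral[OF giB S(2)] .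
qed

text \<open>Under repeated halving the changes of the average form a geometric series of ratio
  \<open>2 powr (- \<beta>)\<close>. The constant \<open>c\<close> is its sum, chosen so that \<psi>
  does not grow when \<open>l\<close> is halved; induction over dyadic shells carries the bound from
  \<open>[X / 2, X)\<close> towards 0.\<close>

lemma gagliardo_average_bound:
  assumes "\<sigma> > 1/2" "X > 0" "C \<ge> 0"
  obtains K where "K \<ge> 0" "\<And>g x. g \<in> L2 {-X<..<X} \<Longrightarrow> nsq {-X<..<X} g \<le> C \<Longrightarrow>
    gagliardo_sq \<sigma> {-X<..<X} g \<le> ennreal C \<Longrightarrow> 0 < x \<Longrightarrow> x < X \<Longrightarrow> cmod (integral {0..x} g) \<le> K * x"
proof -
  define \<beta> where "\<beta> = \<sigma> - 1/2"
  have \<beta>: "\<sigma> = 1/2 + \<beta>" "\<beta> > 0" using assms(1) by (auto simp: \<beta>_def)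
  have p2: "2 powr (- \<beta>) < 1" using \<beta> by (simp add: powr_less_one)
  define c where "c = (1/2 + C) / (1 - 2 powr (- \<beta>))"
  have c: "c \<ge> 0" "c * (1 - 2 powr (- \<beta>)) = 1/2 + C" using p2 assms(3) by (auto simp: c_def)
  define M where "M = (X + C) * (2 / X) + c * X powr \<beta>"
  have M: "M \<ge> 0" using assms c by (simp add: M_def)
  have "cmod (integral {0..x} g) \<le> M * x"
    if g: "g \<in> L2 {-X<..<X}" "nsq {-X<..<X} g \<le> C" "gagliardo_sq \<sigma> {-X<..<X} g \<le> ennreal C" and x: "0 < x" "x < X" for g x
  proof -
    define m where "m = (\<lambda>l. integral {0..l} g / of_real l)"
    define \<psi> where "\<psi> = (\<lambda>l. cmod (m l) + c * l powr \<beta>)"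
    have half: "\<psi> (l / 2) \<le> \<psi> l" if l: "0 < l" "l < X" for l
    proof -
      have "(l / 2) powr \<beta> = l powr \<beta> * 2 powr (- \<beta>)"
        using l by (simp add: powr_divide powr_minus_divide)
      then have "c * (l / 2) powr \<beta> = c * l powr \<beta> - (c * (1 - 2 powr (- \<beta>))) * l powr \<beta>"
        by (simp add: algebra_simps)
      moreover have "cmod (m (l / 2)) \<le> cmod (m l) + cmod (m (l / 2) - m l)"
        by (metis add.commute diff_add_cancel norm_triangle_ineq)
      moreover have "cmod (m (l / 2) - m l) \<le> (1/2 + C) * l powr \<beta>"
        unfolding m_def by (rule gagliardo_average_step[OF g(1,3) assms(3) \<beta> l])
      ultimately show ?thesis unfolding \<psi>_def c(2) by linarith
    qed
    have claim: "\<forall>y. X / 2 ^ Suc k \<le> y \<and> y < X \<longrightarrow> \<psi> y \<le> M" for k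
    proof (induction k)
      case 0
      show ?case
      proof (intro allI impI)
        fix y assume "X / 2 ^ Suc 0 \<le> y \<and> y < X"
        then have y: "X / 2 \<le> y" "y < X" "0 < y" using assms(2) by auto
        have "cmod (integral {0..y} g) \<le> X + C"
          using norm_integral_le_nsq[OF g(1), of y] g(2) y by simp
        moreover have "1 / y \<le> 2 / X" using y assms(2) by (simp add: field_simps)
        ultimately have "cmod (integral {0..y} g) * (1 / y) \<le> (X + C) * (2 / X)"
          using assms y by (intro mult_mono) auto
        then have "cmod (m y) \<le> (X + C) * (2 / X)" using y by (simp add: m_def norm_divide)
        moreover have "c * y powr \<beta> \<le> c * X powr \<beta>"
          using y c \<beta> by (intro mult_left_mono powr_mono2) auto
        ultimately show "\<psi> y \<le> M" by (simp add: \<psi>_def M_def)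
      qed
    next
      case (Suc k)
      show ?case
      proof (intro allI impI)
        fix y assume y: "X / 2 ^ Suc (Suc k) \<le> y \<and> y < X"
        show "\<psi> y \<le> M"
        \<comment> \<open>Either \<open>2 * y\<close> is covered by the induction hypothesis and one
          halving remains, or \<open>y\<close> lies in the outermost shell, which the induction
          hypothesis contains.\<close>
        proof (cases "2 * y < X")
          case True
          have "X / 2 ^ Suc k \<le> 2 * y" using y by (simp add: field_simps)
          then have "\<psi> (2 * y) \<le> M" using Suc.IH True by blast
          moreover have "0 < 2 * y" using y assms(2) by (smt (verit) divide_pos_pos zero_less_power)
          then have "\<psi> (2 * y / 2) \<le> \<psi> (2 * y)" by (rule half[OF _ True])
          ultimately show ?thesis by simp
        next
          case False
          have "X / 2 ^ Suc k \<le> X / 2" using assms(2) by (simp add: field_simps)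
          then have "X / 2 ^ Suc k \<le> y" using False by simp
          then show ?thesis using Suc.IH y by blast
        qed
      qed
    qed
    obtain k where "X / x < 2 ^ k" using real_arch_pow[of 2 "X / x"] by auto
    then have "X < 2 ^ k * x" using x by (simp add: pos_divide_less_eq)
    also have "\<dots> \<le> x * 2 ^ Suc k" using x by simp
    finally have "X / 2 ^ Suc k \<le> x" by (simp add: pos_divide_le_eq)
    then have "\<psi> x \<le> M" using claim x(2) by blast
    then have "cmod (m x) \<le> M" using c(1) by (simp add: \<psi>_def) (smt (verit) mult_nonneg_nonneg powr_ge_zero)
    then show ?thesis using x by (simp add: m_def norm_divide pos_divide_le_eq)
  qed
  with M show thesis by (rule that)
qed

text \<open>The trace inequality bounds the value at \<open>X\<close>, and integrals of
  \<open>q\<close> bound the distance of all other values from it.\<close>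

lemma H1_sup_bound:
  assumes "X > 0" "C \<ge> 0"
  obtains K where "K \<ge> 0" "\<And>P q x. prim {-X..X} P q \<Longrightarrow> q \<in> L2 {-X<..<X} \<Longrightarrow> nsq {-X<..<X} P \<le> C \<Longrightarrow>
    nsq {-X<..<X} q \<le> C \<Longrightarrow> 0 \<le> x \<Longrightarrow> x < X \<Longrightarrow> cmod (P x) \<le> K"
proof -
  define K0 where "K0 = (sqrt (nsq {-X<..<X} (\<lambda>_. 1)) + sqrt (nsq {-X<..<X} (\<lambda>x. of_real (x + X)))) * sqrt C / (2 * X)"
  have K0: "K0 \<ge> 0" using assms by (simp add: K0_def nsq_nonneg)
  have "cmod (P x) \<le> K0 + 2 * (X + C)"
    if P: "prim {-X..X} P q" "q \<in> L2 {-X<..<X}" "nsq {-X<..<X} P \<le> C" "nsq {-X<..<X} q \<le> C" and x: "0 \<le> x" "x < X" for P q x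
  proof -
    have "2 * X * cmod (P X) \<le> K0 * (2 * X)"
      using H1_boundary_estimate[OF assms(1) P, of X] assms(1) by (simp add: K0_def)
    then have PX: "cmod (P X) \<le> K0" using assms(1) by (simp add: mult.commute)
    have cP: "continuous_on {-X..X} P" by (rule prim_continuous_on_Icc[OF P(1)])
    have diff: "cmod (P y - P 0) \<le> X + C" if "0 \<le> y" "y < X" for y
    proof -
      have "P y - P 0 = integral {0..y} q" using primD(2)[OF P(1), of 0 y] that by simp
      then show ?thesis using norm_integral_le_nsq[OF P(2) that] P(4) by simp
    qed
    have "cmod (P X - P 0) \<le> X + C"
    \<comment> \<open>The integral estimate is available below \<open>X\<close> only; the endpoint
      follows by continuity.\<close>
    proof (rule Lim_bounded)
      have lim: "(\<lambda>n. X - X * (1 / real (Suc n))) \<longlonglongrightarrow> X - X * 0"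
        by (intro tendsto_intros lim_1_over_n[THEN LIMSEQ_Suc])
      have in01: "0 \<le> X - X * (1 / real (Suc n)) \<and> X - X * (1 / real (Suc n)) < X" for n
        using assms(1) by (auto simp: field_simps)
      have "(\<lambda>n. P (X - X * (1 / real (Suc n)))) \<longlonglongrightarrow> P (X - X * 0)"
      proof (rule continuous_on_tendsto_compose[OF cP lim])
        show "\<forall>\<^sub>F n in sequentially. X - X * (1 / real (Suc n)) \<in> {-X..X}"
          using in01 assms(1) by (intro always_eventually allI) (meson atLeastAtMost_iff less_imp_le neg_le_0_iff_le order_trans)
      qed (use assms(1) in auto)
      then show "(\<lambda>n. cmod (P (X - X * (1 / real (Suc n))) - P 0)) \<longlonglongrightarrow> cmod (P X - P 0)"
        by (intro tendsto_intros) simp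
      show "\<forall>n\<ge>0. cmod (P (X - X * (1 / real (Suc n))) - P 0) \<le> X + C"
        using diff in01 by blast
    qed
    then show ?thesis
      using PX diff[OF x] norm_triangle_sub[of "P x" "P 0"] norm_triangle_sub[of "P 0" "P X"]
      by (simp add: norm_minus_commute)
  qed
  moreover have "K0 + 2 * (X + C) \<ge> 0" using K0 assms by simp
  ultimately show thesis using that by blast
qed

text \<open>If \<open>F\<close> is odd, then \<open>F x + F (- x)\<close> is 0, hence so is its
  second density \<open>E x + E (- x)\<close>; continuity allows evaluation at 0.\<close>

lemma odd_prim_zero:
  assumes "open \<Omega>" "is_interval \<Omega>" "0 \<in> \<Omega>" "\<And>x. x \<in> \<Omega> \<Longrightarrow> - x \<in> \<Omega>"
    and F: "prim \<Omega> F D" "prim \<Omega> D E" "continuous_on \<Omega> E" and odd: "AE x in lebesgue_on \<Omega>. F (- x) = - F x"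
  shows "F 0 = 0" "E 0 = 0"
proof -
  note even = prim_even_part[OF F(1,2) assms(4)]
  have z: "prim \<Omega> (\<lambda>_. 0) (\<lambda>_. 0)" by (simp add: prim_def)
  have ae: "AE x in lebesgue_on \<Omega>. F x + F (- x) = 0" using odd by eventually_elim simp
  have refl: "continuous_on \<Omega> (\<lambda>x. h (- x))" if "continuous_on \<Omega> h" for h :: "real \<Rightarrow> complex"
    by (rule continuous_on_compose2[OF that]) (use assms(4) in \<open>auto intro: continuous_intros\<close>)
  have "F 0 + F (- 0) = 0"
    by (rule prim_unique_AE(2)[OF even(1) z assms(1,2) ae assms(3)])
  then show "F 0 = 0" by simp
  have ae1: "AE x in lebesgue_on \<Omega>. D x - D (- x) = 0"
    by (rule prim_unique_AE(1)[OF even(1) z assms(1,2) ae])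
  have ae2: "AE x in lebesgue_on \<Omega>. E x + E (- x) = 0"
    by (rule prim_unique_AE(1)[OF even(2) z assms(1,2) ae1])
  have "E 0 + E (- 0) = 0"
    by (rule continuous_AE_eq_imp_eq[OF _ _ assms(1) ae2 assms(3)]) (intro continuous_intros F(3) refl)+
  then show "E 0 = 0" by simp
qed

text \<open>The place where \<open>7/2\<close> enters. For \<open>s < 4\<close> the integer part is
  3 and the fractional part exceeds \<open>1/2\<close>, as \<open>gagliardo_average_bound\<close>
  requires; for \<open>s \<ge> 4\<close> the fourth derivative in \<open>L2\<close> bounds the third
  one pointwise.\<close>

lemma third_derivative_average_bound:
  assumes "s > 7/2" "X > 0" "C \<ge> 0"
  obtains K where "K \<ge> 0" "\<And>D x. \<forall>j<nat \<lfloor>s\<rfloor>. weak_deriv {-X<..<X} (D j) (D (Suc j)) \<Longrightarrow>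
    \<forall>j\<le>nat \<lfloor>s\<rfloor>. D j \<in> L2 {-X<..<X} \<and> nsq {-X<..<X} (D j) \<le> C \<Longrightarrow>
    frac s \<noteq> 0 \<longrightarrow> gagliardo_sq (frac s) {-X<..<X} (D (nat \<lfloor>s\<rfloor>)) \<le> ennreal C \<Longrightarrow>
    0 < x \<Longrightarrow> x < X \<Longrightarrow> cmod (integral {0..x} (D 3)) \<le> K * x"
proof (cases "s < 4")
  case True
  then have fl: "\<lfloor>s\<rfloor> = 3" using assms(1) by (simp add: floor_eq_iff)
  then have fr: "frac s > 1/2" "frac s \<noteq> 0" using assms(1) by (auto simp: frac_def)
  obtain K where K: "K \<ge> 0" "\<And>g x. g \<in> L2 {-X<..<X} \<Longrightarrow> nsq {-X<..<X} g \<le> C \<Longrightarrow>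
    gagliardo_sq (frac s) {-X<..<X} g \<le> ennreal C \<Longrightarrow> 0 < x \<Longrightarrow> x < X \<Longrightarrow> cmod (integral {0..x} g) \<le> K * x"
    using gagliardo_average_bound[OF fr(1) assms(2,3)] by blast
  show thesis
    by (rule that[OF K(1)], rule K(2)) (use fl fr in auto)
next
  case False
  then have fl: "nat \<lfloor>s\<rfloor> \<ge> 4" by (simp add: le_nat_iff le_floor_iff)
  obtain K where K: "K \<ge> 0" "\<And>P q x. prim {-X..X} P q \<Longrightarrow> q \<in> L2 {-X<..<X} \<Longrightarrow> nsq {-X<..<X} P \<le> C \<Longrightarrow>
    nsq {-X<..<X} q \<le> C \<Longrightarrow> 0 \<le> x \<Longrightarrow> x < X \<Longrightarrow> cmod (P x) \<le> K"
    using H1_sup_bound[OF assms(2,3)] by blast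
  show thesis
  proof (rule that[OF K(1)])
    fix D x
    assume D: "\<forall>j<nat \<lfloor>s\<rfloor>. weak_deriv {-X<..<X} (D j) (D (Suc j))"
      "\<forall>j\<le>nat \<lfloor>s\<rfloor>. D j \<in> L2 {-X<..<X} \<and> nsq {-X<..<X} (D j) \<le> C" and x: "0 < x" "x < X"
    let ?I = "{-X<..<X}"
    have I: "open ?I" "is_interval ?I" "0 \<in> ?I" "?I \<in> sets lebesgue" using assms(2) by (auto intro: is_interval_oo)
    have "3 < nat \<lfloor>s\<rfloor>" using fl by linarith
    with D(1) have "weak_deriv ?I (D 3) (D (Suc 3))" by blast
    moreover have "Suc 3 = (4 :: nat)" by simp
    ultimately have w: "weak_deriv ?I (D 3) (D 4)" by (simp only:)
    have D34: "D 3 \<in> L2 ?I" "nsq ?I (D 3) \<le> C" "D 4 \<in> L2 ?I" "nsq ?I (D 4) \<le> C" using D(2) fl by auto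
    obtain c where c: "AE x in lebesgue_on ?I. D 3 x = c + int0 (D 4) x"
      using weak_deriv_imp_int0[OF w I(1-3)] .
    define P where "P = (\<lambda>x. c + int0 (D 4) x)"
    have pP: "prim {-X..X} P (D 4)" unfolding P_def
      by (rule prim_int0_Icc[OF L2_Ioo_imp_abs_integrable_Icc[OF D34(3)]]) (use assms(2) in auto)
    have cP: "continuous_on {-X..X} P" by (rule prim_continuous_on_Icc[OF pP])
    have "nsq ?I P = nsq ?I (D 3)"
    proof (rule L2_cong_AE(2)[OF D34(1)])
      show "AE x in lebesgue_on ?I. D 3 x = P x" using c by (simp add: P_def)
      show "P \<in> borel_measurable (lebesgue_on ?I)"
        by (rule continuous_imp_measurable_on_sets_lebesgue[OF continuous_on_subset[OF cP]]) auto
    qed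
    then have bound: "cmod (P y) \<le> K" if "0 \<le> y" "y < X" for y
      using K(2)[OF pP D34(3) _ D34(4) that] D34(2) by simp
    obtain N where N: "negligible N" "\<And>x. x \<in> ?I - N \<Longrightarrow> D 3 x = P x"
      using AE_lebesgue_onE[OF c I(4)] unfolding P_def by blast
    have "integral {0..x} (D 3) = integral {0..x} P"
      by (rule integral_spike[OF N(1)]) (use N(2) x in force)
    also have "cmod \<dots> \<le> integral {0..x} (\<lambda>_. K)"
    proof (rule integral_norm_bound_integral)
      show "P integrable_on {0..x}"
        by (rule integrable_continuous_real[OF continuous_on_subset[OF cP]]) (use x in auto)
    qed (use bound x in \<open>auto simp: integrable_const_ivl\<close>)
    also have "\<dots> = K * x" using x by simp
    finally show "cmod (integral {0..x} (D 3)) \<le> K * x" .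
  qed
qed

text \<open>Oddness makes the function and its second derivative vanish at 0, so the first is the
  integral of a bounded derivative and the second that of the third derivative. Uniqueness of weak
  derivatives identifies \<open>w\<close> with the second member of the Sobolev family.
  \<open>K\<close> is chosen before \<open>f\<close>, hence serves all times at once.\<close>

lemma Hs_odd_bounds:
  assumes "s > 7/2" "X > 0" "C \<ge> 0"
  obtains K where "K \<ge> 0" "\<And>f d w. Hs_sq s {-X<..<X} f \<le> ennreal C \<Longrightarrow>
     AE x in lebesgue_on {-X<..<X}. f (- x) = - f x \<Longrightarrow>
     weak_deriv {-X<..<X} f d \<Longrightarrow> weak_deriv {-X<..<X} d w \<Longrightarrow>
     (AE x in lebesgue_on {0<..<X}. cmod (f x) \<le> K * x \<and> cmod (w x) \<le> K * x) \<and>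
     (\<exists>F l. (AE x in lebesgue_on {-X<..<X}. f x = F x) \<and> F 0 = 0 \<and> (F has_vector_derivative l) (at 0))"
proof -
  let ?I = "{-X<..<X}"
  have I: "open ?I" "is_interval ?I" "0 \<in> ?I" "?I \<in> sets lebesgue" using assms(2) by (auto intro: is_interval_oo)
  have C1: "C + 1 \<ge> 0" using assms(3) by simp
  obtain K3 where K3: "K3 \<ge> 0" and avg: "\<And>D x. \<forall>j<nat \<lfloor>s\<rfloor>. weak_deriv ?I (D j) (D (Suc j)) \<Longrightarrow>
    \<forall>j\<le>nat \<lfloor>s\<rfloor>. D j \<in> L2 ?I \<and> nsq ?I (D j) \<le> C + 1 \<Longrightarrow>
    frac s \<noteq> 0 \<longrightarrow> gagliardo_sq (frac s) ?I (D (nat \<lfloor>s\<rfloor>)) \<le> ennreal (C + 1) \<Longrightarrow>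
    0 < x \<Longrightarrow> x < X \<Longrightarrow> cmod (integral {0..x} (D 3)) \<le> K3 * x"
    using third_derivative_average_bound[OF assms(1,2) C1] by blast
  obtain K1 where K1: "K1 \<ge> 0" and sup: "\<And>P q x. prim {-X..X} P q \<Longrightarrow> q \<in> L2 ?I \<Longrightarrow> nsq ?I P \<le> C + 1 \<Longrightarrow>
    nsq ?I q \<le> C + 1 \<Longrightarrow> 0 \<le> x \<Longrightarrow> x < X \<Longrightarrow> cmod (P x) \<le> K1"
    using H1_sup_bound[OF assms(2) C1] by blast
  show thesis
  proof (rule that[of "max K1 K3"])
    show "max K1 K3 \<ge> 0" using K1 by simp
    fix f d w
    assume Hs: "Hs_sq s ?I f \<le> ennreal C" and odd: "AE x in lebesgue_on ?I. f (- x) = - f x"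
      and fd: "weak_deriv ?I f d" and dw: "weak_deriv ?I d w"
    have "ennreal C < ennreal (C + 1)" using assms(3) by (simp add: ennreal_less_iff)
    with Hs have "Hs_sq s ?I f < ennreal (C + 1)" by (rule le_less_trans)
    then obtain D where D: "D 0 = f" "\<forall>j<nat \<lfloor>s\<rfloor>. weak_deriv ?I (D j) (D (Suc j))"
      and L: "\<forall>j\<le>nat \<lfloor>s\<rfloor>. L2_sq ?I (D j) < ennreal (C + 1)"
      and G: "frac s \<noteq> 0 \<longrightarrow> gagliardo_sq (frac s) ?I (D (nat \<lfloor>s\<rfloor>)) < ennreal (C + 1)"
      using Hs_sq_lessD by blast
    have L2D: "\<forall>j\<le>nat \<lfloor>s\<rfloor>. D j \<in> L2 ?I \<and> nsq ?I (D j) \<le> C + 1"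
      using L L2_sq_le_iff[OF C1] by (meson less_imp_le)
    have fl: "nat \<lfloor>s\<rfloor> \<ge> 3" using assms(1) by (simp add: le_nat_iff le_floor_iff)
    have w01: "weak_deriv ?I f (D 1)" and w12: "weak_deriv ?I (D 1) (D 2)" and w23: "weak_deriv ?I (D 2) (D 3)"
      using D(1) spec[OF D(2), of 0] spec[OF D(2), of 1] spec[OF D(2), of 2] fl assms(1) by (simp_all add: eval_nat_numeral)
    have Lj: "D j \<in> L2 ?I" "nsq ?I (D j) \<le> C + 1" if "j \<le> 3" for j using L2D fl that by auto
    obtain c2 where c2: "AE x in lebesgue_on ?I. D 2 x = c2 + int0 (D 3) x"
      using weak_deriv_imp_int0[OF w23 I(1-3)] .
    define d2 where "d2 = (\<lambda>x. c2 + int0 (D 3) x)"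
    have p2: "prim {-X..X} d2 (D 3)" unfolding d2_def
      by (rule prim_int0_Icc[OF L2_Ioo_imp_abs_integrable_Icc[OF Lj(1)]]) (use assms(2) in auto)
    have cd2: "continuous_on {-X..X} d2" by (rule prim_continuous_on_Icc[OF p2])
    obtain c1 c0 where c1: "AE x in lebesgue_on ?I. D 1 x = c1 + int0 (D 2) x"
      and c0: "AE x in lebesgue_on ?I. f x = c0 + int0 (\<lambda>x. c1 + int0 (D 2) x) x"
      using second_weak_deriv_prim[OF w01 w12 I(1-3)] by blast
    define d1 where "d1 = (\<lambda>x. c1 + int0 (D 2) x)"
    define f0 where "f0 = (\<lambda>x. c0 + int0 d1 x)"
    have p1': "prim {-X..X} d1 (D 2)" unfolding d1_def
      by (rule prim_int0_Icc[OF L2_Ioo_imp_abs_integrable_Icc[OF Lj(1)]]) (use assms(2) in auto)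
    have cd1: "continuous_on {-X..X} d1" by (rule prim_continuous_on_Icc[OF p1'])
    have sub: "?I \<subseteq> {-X..X}" by auto
    have D2d2: "AE x in lebesgue_on ?I. D 2 x = d2 x" using c2 by (simp add: d2_def)
    have p1: "prim ?I d1 d2" by (rule prim_cong_AE[OF prim_subset[OF p1' sub] I(2) D2d2 I(4)])
    have p0: "prim {-X..X} f0 d1" unfolding f0_def
      by (rule prim_int0_Icc[OF absolutely_integrable_continuous_real[OF cd1]]) (use assms(2) in auto)
    have ff0: "AE x in lebesgue_on ?I. f x = f0 x" using c0 by (simp add: f0_def d1_def)
    have ff0': "AE x in lebesgue_on ?I. f (- x) = f0 (- x)" by (rule AE_reflect[OF ff0 I(4)]) auto
    have odd0: "AE x in lebesgue_on ?I. f0 (- x) = - f0 x"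
      using odd ff0 ff0' by eventually_elim simp
    have symI: "\<And>x. x \<in> ?I \<Longrightarrow> - x \<in> ?I" by auto
    have zero: "f0 0 = 0" "d2 0 = 0"
      using odd_prim_zero[OF I(1-3) symI prim_subset[OF p0 sub] p1 continuous_on_subset[OF cd2 sub] odd0] by auto
    have d2b: "cmod (d2 x) \<le> K3 * x" if "0 < x" "x < X" for x
    proof -
      have "d2 x = integral {0..x} (D 3)" using primD(2)[OF p2, of 0 x] zero(2) that by simp
      then show ?thesis using avg[OF D(2) L2D _ that] G by (simp add: less_imp_le)
    qed
    have nd1: "nsq ?I d1 = nsq ?I (D 1)"
    proof (rule L2_cong_AE(2)[OF Lj(1)])
      show "AE x in lebesgue_on ?I. D 1 x = d1 x" using c1 by (simp add: d1_def)
      show "d1 \<in> borel_measurable (lebesgue_on ?I)"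
        by (rule continuous_imp_measurable_on_sets_lebesgue[OF continuous_on_subset[OF cd1]]) auto
    qed simp
    have d1b: "cmod (d1 x) \<le> K1" if "0 \<le> x" "x < X" for x
      using sup[OF p1' Lj(1) _ Lj(2) that] nd1 Lj(2)[of 1] by simp
    have f0b: "cmod (f0 x) \<le> K1 * x" if "0 < x" "x < X" for x
    proof -
      have "f0 x = integral {0..x} d1" using primD(2)[OF p0, of 0 x] zero(1) that by simp
      also have "cmod \<dots> \<le> integral {0..x} (\<lambda>_. K1)"
      proof (rule integral_norm_bound_integral)
        show "d1 integrable_on {0..x}"
          by (rule integrable_continuous_real[OF continuous_on_subset[OF cd1]]) (use that in auto)
      qed (use d1b that in \<open>auto simp: integrable_const_ivl\<close>)
      also have "\<dots> = K1 * x" using that by simp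
      finally show ?thesis .
    qed
    have wD2: "AE x in lebesgue_on ?I. w x = D 2 x"
    proof (rule weak_deriv_unique[OF dw w12 _ I(1-3)])
      show "AE x in lebesgue_on ?I. d x = D 1 x"
        by (rule weak_deriv_unique[OF fd w01 _ I(1-3)]) simp
    qed
    have J: "{0<..<X} \<in> sets lebesgue" "{0<..<X} \<subseteq> ?I" using assms(2) by auto
    have "AE x in lebesgue_on ?I. f x = f0 x \<and> w x = d2 x"
      using ff0 wD2 D2d2 by eventually_elim simp
    from AE_lebesgue_on_subset[OF this J(2) I(4) J(1)]
    have "AE x in lebesgue_on {0<..<X}. f x = f0 x \<and> w x = d2 x" .
    moreover have "AE x in lebesgue_on {0<..<X}. x \<in> {0<..<X}" by (rule AE_I2) simp
    ultimately have bounds: "AE x in lebesgue_on {0<..<X}. cmod (f x) \<le> max K1 K3 * x \<and> cmod (w x) \<le> max K1 K3 * x"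
    proof eventually_elim
      case (elim x)
      have K: "K1 * x \<le> max K1 K3 * x" "K3 * x \<le> max K1 K3 * x"
        using elim(2) by (auto intro!: mult_right_mono simp del: mult_le_cancel_right)
      have "cmod (f0 x) \<le> max K1 K3 * x" using f0b[of x] K(1) elim(2) by (auto elim: order_trans)
      moreover have "cmod (d2 x) \<le> max K1 K3 * x" using d2b[of x] K(2) elim(2) by (auto elim: order_trans)
      ultimately show ?case using elim(1) by simp
    qed
    have "(f0 has_vector_derivative d1 0) (at 0)"
      by (rule prim_has_vector_derivative[OF prim_subset[OF p0 sub] I(1) continuous_on_subset[OF cd1 sub] I(3)])
    with bounds ff0 zero(1)
    show "(AE x in lebesgue_on {0<..<X}. cmod (f x) \<le> max K1 K3 * x \<and> cmod (w x) \<le> max K1 K3 * x) \<and>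
     (\<exists>F l. (AE x in lebesgue_on ?I. f x = F x) \<and> F 0 = 0 \<and> (F has_vector_derivative l) (at 0))"
      by blast
  qed
qed

section \<open>Oscillation of the phase near the zero\<close>

text \<open>Splits the logarithm at the length \<open>e\<close>. The first term is a pure rotation,
  and where \<open>z\<close> is of order \<open>e\<close> the second one is of order
  \<open>e\<close> too.\<close>

lemma log_nl_scale:
  assumes "e > 0"
  shows "log_nl z = of_real (2 * ln e) * z + of_real e * log_nl (z / of_real e)"
proof (cases "z = 0")
  case False
  have "cmod (z / of_real e) > 0" "e > 0" using False assms by auto
  then have "ln ((cmod (z / of_real e))\<^sup>2) + 2 * ln e = ln ((cmod (z / of_real e) * e)\<^sup>2)"
    by (simp add: ln_mult ln_realpow power_mult_distrib)
  also have "cmod (z / of_real e) * e = cmod z" using assms by (simp add: norm_divide)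
  finally have *: "ln ((cmod z)\<^sup>2) = ln ((cmod (z / of_real e))\<^sup>2) + 2 * ln e" by simp
  show ?thesis unfolding log_nl_def * using assms by (simp add: algebra_simps)
qed (simp add: log_nl_def)

text \<open>\<open>3/2\<close> is the integral of \<open>x\<close> over \<open>[1, 2]\<close>.\<close>

lemma window_average_tendsto:
  fixes f F :: "real \<Rightarrow> complex"
  assumes "X > 0" and f: "\<And>e. 0 < e \<Longrightarrow> 2 * e < X \<Longrightarrow> integrable (lebesgue_on {e..2 * e}) f"
    and F: "AE x in lebesgue_on {0<..<X}. f x = F x" "F 0 = 0" "(F has_vector_derivative l) (at 0)"
  shows "((\<lambda>e. (LINT x|lebesgue_on {e..2 * e}. f x) / of_real (e\<^sup>2)) \<longlongrightarrow> of_real (3/2) * l) (at_right 0)"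
proof (rule tendstoI)
  fix \<eta> :: real assume "\<eta> > 0"
  \<comment> \<open>The average of the error over the window is at most \<open>2 * k\<close>, since
    \<open>x \<le> 2 * e\<close> there.\<close>
  define k where "k = \<eta> / 4"
  have k: "k > 0" using \<open>\<eta> > 0\<close> by (simp add: k_def)
  have "\<exists>d>0. \<forall>y. norm (y - 0) < d \<longrightarrow> norm (F y - F 0 - (y - 0) *\<^sub>R l) \<le> k * norm (y - 0)"
    using F(3) k unfolding has_vector_derivative_def has_derivative_at_alt by blast
  then obtain \<delta> where \<delta>: "\<delta> > 0" "\<And>y. \<bar>y\<bar> < \<delta> \<Longrightarrow> cmod (F y - y *\<^sub>R l) \<le> k * \<bar>y\<bar>"
    using F(2) by auto
  have "dist ((LINT x|lebesgue_on {e..2 * e}. f x) / of_real (e\<^sup>2)) (of_real (3/2) * l) < \<eta>"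
    if e: "0 < e" "2 * e < X" "2 * e < \<delta>" for e
  proof -
    let ?W = "{e..2 * e}"
    have W: "?W \<in> sets lebesgue" "?W \<subseteq> {0<..<X}" "{0<..<X} \<in> sets lebesgue" using e by auto
    have xl: "((\<lambda>x. x *\<^sub>R l) has_integral ((2 * e)\<^sup>2 / 2 - e\<^sup>2 / 2) *\<^sub>R l) ?W"
      using e by (intro has_integral_scaleR_left) (use ident_has_integral[of e "2 * e"] in simp)
    have xa: "(\<lambda>x. x *\<^sub>R l) absolutely_integrable_on ?W"
      by (intro absolutely_integrable_continuous_real continuous_intros)
    have xi: "integrable (lebesgue_on ?W) (\<lambda>x. x *\<^sub>R l)"
      by (rule absolutely_integrable_imp_integrable[OF xa W(1)])
    have "(LINT x|lebesgue_on ?W. x *\<^sub>R l) = ((2 * e)\<^sup>2 / 2 - e\<^sup>2 / 2) *\<^sub>R l"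
      by (rule trans[OF lebesgue_integral_eq_integral[OF xi W(1)] integral_unique[OF xl]])
    also have "\<dots> = of_real (e\<^sup>2) * (of_real (3/2) * l)"
      by (simp add: scaleR_conv_of_real power2_eq_square)
    finally have xI: "(LINT x|lebesgue_on ?W. x *\<^sub>R l) = of_real (e\<^sup>2) * (of_real (3/2) * l)" .
    have ki: "integrable (lebesgue_on ?W) (\<lambda>_. k * (2 * e))"
      by (rule absolutely_integrable_imp_integrable[OF absolutely_integrable_continuous_real W(1)]) (intro continuous_intros)
    have "cmod ((LINT x|lebesgue_on ?W. f x) - of_real (e\<^sup>2) * (of_real (3/2) * l)) = cmod (LINT x|lebesgue_on ?W. f x - x *\<^sub>R l)"
      unfolding xI[symmetric] Bochner_Integration.integral_diff[OF f[OF e(1,2)] xi] ..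
    also have "\<dots> \<le> (LINT x|lebesgue_on ?W. cmod (f x - x *\<^sub>R l))" by (rule integral_norm_bound)
    also have "\<dots> \<le> (LINT x|lebesgue_on ?W. k * (2 * e))"
    proof (rule integral_mono_AE)
      show "integrable (lebesgue_on ?W) (\<lambda>x. cmod (f x - x *\<^sub>R l))" using f[OF e(1,2)] xi by auto
      have "AE x in lebesgue_on ?W. f x = F x" by (rule AE_lebesgue_on_subset[OF F(1) W(2,3,1)])
      moreover have "AE x in lebesgue_on ?W. x \<in> ?W" by (rule AE_I2) simp
      ultimately show "AE x in lebesgue_on ?W. cmod (f x - x *\<^sub>R l) \<le> k * (2 * e)"
      proof eventually_elim
        case (elim x)
        have "cmod (F x - x *\<^sub>R l) \<le> k * \<bar>x\<bar>" using elim e by (intro \<delta>(2)) auto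
        also have "\<dots> \<le> k * (2 * e)" using elim e k by (intro mult_left_mono) auto
        finally show ?case using elim by simp
      qed
    qed (rule ki)
    also have "\<dots> = 2 * k * e\<^sup>2" using e by (simp add: measure_restrict_space power2_eq_square)
    finally have le: "cmod ((LINT x|lebesgue_on ?W. f x) - of_real (e\<^sup>2) * (of_real (3/2) * l)) \<le> 2 * k * e\<^sup>2" .
    have "(LINT x|lebesgue_on ?W. f x) / of_real (e\<^sup>2) - of_real (3/2) * l = ((LINT x|lebesgue_on ?W. f x) - of_real (e\<^sup>2) * (of_real (3/2) * l)) / of_real (e\<^sup>2)"
      using e by (simp add: diff_divide_distrib)
    then have "cmod ((LINT x|lebesgue_on ?W. f x) / of_real (e\<^sup>2) - of_real (3/2) * l) = cmod ((LINT x|lebesgue_on ?W. f x) - of_real (e\<^sup>2) * (of_real (3/2) * l)) / e\<^sup>2"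
      by (simp only: norm_divide norm_of_real abs_power2)
    also have "\<dots> \<le> 2 * k" using le e by (simp add: pos_divide_le_eq)
    also have "\<dots> < \<eta>" using \<open>\<eta> > 0\<close> by (simp add: k_def)
    finally show ?thesis by (simp only: dist_norm)
  qed
  then show "\<forall>\<^sub>F e in at_right 0. dist ((LINT x|lebesgue_on {e..2 * e}. f x) / of_real (e\<^sup>2)) (of_real (3/2) * l) < \<eta>"
    using assms(1) \<delta>(1) by (intro eventually_at_rightI[of 0 "min (X / 2) (\<delta> / 2)"]) auto
qed

section \<open>From the equation on a window to a rotating scalar\<close>

lemma phase_remainder: "cmod (1 - \<i> * of_real \<theta> - exp (- (\<i> * of_real \<theta>))) \<le> \<theta>\<^sup>2"
proof -
  have "norm (exp (- (\<i> * of_real \<theta>)) - (\<Sum>k\<le>1. (- (\<i> * of_real \<theta>)) ^ k / fact k))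
      \<le> exp \<bar>Re (- (\<i> * of_real \<theta>))\<bar> * norm (- (\<i> * of_real \<theta>)) ^ Suc 1 / fact 1"
    by (rule Taylor_exp)
  then have "cmod (exp (- (\<i> * of_real \<theta>)) - (1 - \<i> * of_real \<theta>)) \<le> \<theta>\<^sup>2"
    by (simp add: norm_mult power2_eq_square)
  then show ?thesis by (simp only: norm_minus_commute)
qed

text \<open>The integrating factor \<open>exp (\<i> * of_real (\<mu> * s))\<close> undoes the
  rotation, after which the only first-order contribution of a step is \<open>c\<close>. The
  quantities \<open>E\<close>, \<open>M\<close> and \<mu> influence the mesh alone and are absent
  from the conclusion; this matters because \<mu> grows like \<open>ln e\<close>.\<close>

lemma rotation_estimate:
  fixes a :: "real \<Rightarrow> complex"
  assumes "t \<ge> 0" "c \<ge> 0" "E \<ge> 0" "M \<ge> 0"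
    and aM: "\<And>s. 0 \<le> s \<Longrightarrow> s \<le> t \<Longrightarrow> cmod (a s) \<le> M"
    and step: "\<And>s y. 0 \<le> s \<Longrightarrow> s \<le> y \<Longrightarrow> y \<le> t \<Longrightarrow>
      cmod (a y - a s + \<i> * of_real \<mu> * a s * of_real (y - s)) \<le> (c + E * (y - s)) * (y - s)"
  shows "cmod (exp (\<i> * of_real (\<mu> * t)) * a t - a 0) \<le> c * t"
proof -
  define B where "B = (\<lambda>s. exp (\<i> * of_real (\<mu> * s)) * a s)"
  have bound: "cmod (B t - B 0) \<le> (c + e) * t" if "e > 0" for e
  proof -
    let ?E = "E + \<mu>\<^sup>2 * M"
    have E: "?E \<ge> 0" using assms by simp
    have "cmod (B t - B 0) \<le> (c + e) * t - (c + e) * 0"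
    proof (rule norm_increment_le[OF assms(1), of "e / (?E + 1)"])
      show "e / (?E + 1) > 0" using that E by (intro divide_pos_pos) linarith+
      fix s y assume *: "0 \<le> s" "s \<le> y" "y \<le> t" "y - s < e / (?E + 1)"
      let ?h = "y - s"
      have "?h * (?E + 1) \<le> e" using *(4) E by (simp add: pos_less_divide_eq)
      then have Eh: "?E * ?h \<le> e" using *(2) by (simp add: algebra_simps)
      have e1: "exp (\<i> * of_real (\<mu> * s)) = exp (\<i> * of_real (\<mu> * y)) * exp (- (\<i> * of_real (\<mu> * ?h)))"
        by (simp add: exp_add[symmetric] algebra_simps)
      have "B y - B s = exp (\<i> * of_real (\<mu> * y)) * ((a y - a s + \<i> * of_real \<mu> * a s * of_real ?h)
          + (1 - \<i> * of_real (\<mu> * ?h) - exp (- (\<i> * of_real (\<mu> * ?h)))) * a s)"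
        unfolding B_def e1 by (simp add: algebra_simps)
      then have "cmod (B y - B s) = cmod ((a y - a s + \<i> * of_real \<mu> * a s * of_real ?h)
          + (1 - \<i> * of_real (\<mu> * ?h) - exp (- (\<i> * of_real (\<mu> * ?h)))) * a s)"
        by (simp only: norm_mult norm_exp_i_times mult_1_left)
      also have "\<dots> \<le> cmod (a y - a s + \<i> * of_real \<mu> * a s * of_real ?h)
          + cmod (1 - \<i> * of_real (\<mu> * ?h) - exp (- (\<i> * of_real (\<mu> * ?h)))) * cmod (a s)"
        by (metis norm_mult norm_triangle_ineq)
      also have "\<dots> \<le> (c + E * ?h) * ?h + (\<mu> * ?h)\<^sup>2 * M"
        using * by (intro add_mono mult_mono step phase_remainder aM) auto
      also have "\<dots> = c * ?h + (?E * ?h) * ?h" by (simp add: power2_eq_square algebra_simps)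
      also have "\<dots> \<le> c * ?h + e * ?h" using Eh *(2) by (intro add_left_mono mult_right_mono) auto
      finally show "cmod (B y - B s) \<le> (c + e) * y - (c + e) * s" by (simp add: algebra_simps)
    qed
    then show ?thesis by simp
  qed
  have "cmod (B t - B 0) \<le> c * t"
  proof (rule field_le_epsilon)
    fix e :: real assume "e > 0"
    have "cmod (B t - B 0) \<le> (c + e / (t + 1)) * t" using \<open>e > 0\<close> assms(1) by (intro bound) simp
    also have "\<dots> = c * t + e * (t / (t + 1))" by (simp add: algebra_simps)
    also have "e * (t / (t + 1)) \<le> e * 1" using \<open>e > 0\<close> assms(1) by (intro mult_left_mono) auto
    finally show "cmod (B t - B 0) \<le> c * t + e" by simp
  qed
  then show ?thesis by (simp add: B_def)
qed

context time_derivative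
begin

text \<open>Pairing with the indicator of \<open>[e, 2 * e]\<close> gives a scalar equation for
  \<open>a\<close>. On the window the solution is \<open>e * z\<close> with
  \<open>cmod z \<le> 2 * K\<close>, so that everything except the rotation of frequency
  \<open>2 * lam * ln e\<close> is of order \<open>e\<close> pointwise, and of order
  \<open>e\<^sup>2\<close> after integration.\<close>

lemma window_rotation:
  assumes sub: "{0<..<X} \<subseteq> \<Omega>" and p: "p \<in> L2 {0<..<X}" and K: "K \<ge> 0"
    and bounds: "AE \<tau> in lebesgue_on {0<..<T}. AE x in lebesgue_on {0<..<X}.
        cmod (U \<tau> x + p x) \<le> K * x \<and> cmod (\<i> * v \<tau> x - of_real lam * log_nl (U \<tau> x + p x)) \<le> K * x"
    and e: "0 < e" "2 * e < X" and t: "0 \<le> t" "t < T"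
  defines "a \<equiv> \<lambda>s. LINT x|lebesgue_on {e..2 * e}. U s x + p x"
  shows "cmod (exp (\<i> * of_real (2 * lam * ln e * t)) * a t - a 0) \<le> (\<bar>lam\<bar> * (1 + 8 * K\<^sup>2) + 2 * K) * e\<^sup>2 * t"
proof -
  \<comment> \<open>\<open>2 * K\<close> accounts for the second derivative, at most
    \<open>K * x \<le> 2 * K * e\<close> on the window; \<open>1 + 8 * K\<^sup>2\<close> is
    \<open>1 + 2 * (cmod z)\<^sup>2\<close> at \<open>cmod z = 2 * K\<close>.\<close>
  let ?W = "{e..2 * e}" and ?c = "\<bar>lam\<bar> * (1 + 8 * K\<^sup>2) + 2 * K"
  define \<mu> where "\<mu> = 2 * lam * ln e"
  have W: "?W \<in> sets lebesgue" "?W \<subseteq> \<Omega>" "?W \<subseteq> {0<..<X}" "{0<..<X} \<in> sets lebesgue" using e sub by auto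
  have T: "T > 0" using t by linarith
  define g where "g = (indicator ?W :: real \<Rightarrow> complex)"
  have g: "g \<in> L2 \<Omega>"
  proof -
    have m: "g \<in> borel_measurable (lebesgue_on \<Omega>)" unfolding g_def
      by (intro measurable_restrict_space1 borel_measurable_indicator W(1))
    have "integrable lebesgue (\<lambda>x. indicator ?W x *\<^sub>R (1::real))"
      by (intro integrable_scaleR_left integrable_real_indicator) (auto simp: emeasure_lborel_Icc_eq)
    moreover have "indicator ?W x *\<^sub>R (1::real) = indicator \<Omega> x *\<^sub>R (cmod (g x))\<^sup>2" for x
      using W(2) by (auto simp: g_def indicator_def)
    moreover have "\<Omega> \<inter> space lebesgue \<in> sets lebesgue" using \<Omega> by simp
    ultimately have "integrable (lebesgue_on \<Omega>) (\<lambda>x. (cmod (g x))\<^sup>2)"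
      by (simp only: integrable_restrict_space)
    with m show ?thesis by (simp add: L2_iff)
  qed
  have gI: "(LINT x|lebesgue_on \<Omega>. h x * g x) = (LINT x|lebesgue_on ?W. h x)" for h :: "real \<Rightarrow> complex"
  proof -
    have "\<Omega> \<inter> space lebesgue \<in> sets lebesgue" "?W \<inter> space lebesgue \<in> sets lebesgue" using \<Omega> W(1) by auto
    moreover have "indicator \<Omega> x *\<^sub>R (h x * g x) = indicator ?W x *\<^sub>R h x" for x
      using W(2) by (auto simp: g_def indicator_def)
    ultimately show ?thesis by (simp only: integral_restrict_space)
  qed
  have lm: "?W \<in> lmeasurable" by simp
  have Ui: "integrable (lebesgue_on ?W) (U s)" for s
    by (rule L2_bounded_integrable[OF L2_subset(1)[OF U_L2 W(2) \<Omega> W(1)] lm])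
  have pi: "integrable (lebesgue_on ?W) p"
    by (rule L2_bounded_integrable[OF L2_subset(1)[OF p W(3,4,1)] lm])
  have adiff: "a y - a s = (LINT x|lebesgue_on \<Omega>. U y x * g x) - (LINT x|lebesgue_on \<Omega>. U s x * g x)" for y s
    unfolding a_def gI using Ui pi by simp
  obtain C where C: "C \<ge> 0" "AE t in lebesgue_on {-T<..<T}. v t \<in> L2 \<Omega> \<and> nsq \<Omega> (v t) \<le> C"
    and lip: "\<And>r t. r \<in> {-T<..<T} \<Longrightarrow> t \<in> {-T<..<T} \<Longrightarrow> nsq \<Omega> (\<lambda>x. U r x - U t x) \<le> C * (r - t)\<^sup>2"
    using U_Lipschitz[OF T] by blast
  define L where "L = sqrt C * sqrt (nsq \<Omega> g)"
  have L: "L \<ge> 0" using C(1) by (simp add: L_def nsq_nonneg)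
  have aL: "cmod (a y - a s) \<le> L * \<bar>y - s\<bar>" if "0 \<le> s" "s \<le> t" "0 \<le> y" "y \<le> t" for y s
  proof -
    have "cmod (a y - a s) \<le> sqrt (nsq \<Omega> (\<lambda>x. U y x - U s x)) * sqrt (nsq \<Omega> g)"
      unfolding adiff inner_diff[OF g] by (intro L2_Cauchy_Schwarz L2_diff U_L2 g)
    also have "\<dots> \<le> sqrt (C * (y - s)\<^sup>2) * sqrt (nsq \<Omega> g)"
      using lip[of y s] that t by (intro mult_right_mono) (auto simp: nsq_nonneg)
    also have "\<dots> = L * \<bar>y - s\<bar>" by (simp add: L_def real_sqrt_mult)
    finally show ?thesis .
  qed
  have "AE \<tau> in lebesgue_on {0<..<T}. v \<tau> \<in> L2 \<Omega> \<and> nsq \<Omega> (v \<tau>) \<le> C"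
    by (rule AE_lebesgue_on_subset[OF C(2)]) (use T in auto)
  with bounds have rot: "AE \<tau> in lebesgue_on {0<..<T}. cmod ((LINT x|lebesgue_on \<Omega>. v \<tau> x * g x) + \<i> * of_real \<mu> * a \<tau>) \<le> ?c * e\<^sup>2"
  proof eventually_elim
    case (elim \<tau>)
    have vi: "integrable (lebesgue_on ?W) (v \<tau>)"
      using elim(2) by (intro L2_bounded_integrable[OF L2_subset(1)[OF _ W(2) \<Omega> W(1)] lm]) auto
    have ui: "integrable (lebesgue_on ?W) (\<lambda>x. \<i> * of_real \<mu> * (U \<tau> x + p x))"
      using Ui[of \<tau>] pi by auto
    have ki: "integrable (lebesgue_on ?W) (\<lambda>_. ?c * e)"
      by (rule absolutely_integrable_imp_integrable[OF absolutely_integrable_continuous_real W(1)]) (intro continuous_intros)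
    have "(LINT x|lebesgue_on \<Omega>. v \<tau> x * g x) + \<i> * of_real \<mu> * a \<tau> = (LINT x|lebesgue_on ?W. v \<tau> x + \<i> * of_real \<mu> * (U \<tau> x + p x))"
      unfolding gI a_def using Bochner_Integration.integral_add[OF vi ui] Ui[of \<tau>] pi by simp
    also have "cmod \<dots> \<le> (LINT x|lebesgue_on ?W. cmod (v \<tau> x + \<i> * of_real \<mu> * (U \<tau> x + p x)))"
      by (rule integral_norm_bound)
    also have "\<dots> \<le> (LINT x|lebesgue_on ?W. ?c * e)"
    proof (rule integral_mono_AE)
      show "integrable (lebesgue_on ?W) (\<lambda>x. cmod (v \<tau> x + \<i> * of_real \<mu> * (U \<tau> x + p x)))"
        using vi ui by auto
      have "AE x in lebesgue_on ?W. cmod (U \<tau> x + p x) \<le> K * x \<and> cmod (\<i> * v \<tau> x - of_real lam * log_nl (U \<tau> x + p x)) \<le> K * x"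
        by (rule AE_lebesgue_on_subset[OF elim(1) W(3,4,1)])
      moreover have "AE x in lebesgue_on ?W. x \<in> ?W" by (rule AE_I2) simp
      ultimately show "AE x in lebesgue_on ?W. cmod (v \<tau> x + \<i> * of_real \<mu> * (U \<tau> x + p x)) \<le> ?c * e"
      proof eventually_elim
        case (elim x)
        let ?u = "U \<tau> x + p x"
        have Kx: "K * x \<le> K * (2 * e)" using elim K by (intro mult_left_mono) auto
        define z where "z = ?u / of_real e"
        have "cmod z \<le> 2 * K"
          using order_trans[OF conjunct1[OF elim(1)] Kx] e by (simp add: z_def norm_divide pos_divide_le_eq mult_ac)
        then have "(cmod z)\<^sup>2 \<le> (2 * K)\<^sup>2" by (rule power_mono) simp
        then have lz: "cmod (log_nl z) \<le> 1 + 8 * K\<^sup>2"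
          using log_nl_norm_le[of z] by (simp add: power_mult_distrib)
        have ln: "of_real lam * log_nl ?u = of_real \<mu> * ?u + of_real lam * (of_real e * log_nl z)"
          using log_nl_scale[OF e(1), of ?u] by (simp add: \<mu>_def z_def algebra_simps)
        have "v \<tau> x + \<i> * of_real \<mu> * ?u = - \<i> * ((\<i> * v \<tau> x - of_real lam * log_nl ?u) + of_real lam * (of_real e * log_nl z))"
          unfolding ln by (simp add: algebra_simps)
        then have "cmod (v \<tau> x + \<i> * of_real \<mu> * ?u) = cmod ((\<i> * v \<tau> x - of_real lam * log_nl ?u) + of_real lam * (of_real e * log_nl z))"
          by (simp only: norm_mult norm_minus_cancel norm_ii mult_1_left)
        also have "\<dots> \<le> cmod (\<i> * v \<tau> x - of_real lam * log_nl ?u) + cmod (of_real lam * (of_real e * log_nl z))"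
          by (rule norm_triangle_ineq)
        also have "\<dots> \<le> K * (2 * e) + \<bar>lam\<bar> * (e * (1 + 8 * K\<^sup>2))"
          using order_trans[OF conjunct2[OF elim(1)] Kx] lz e
          by (intro add_mono) (auto simp: norm_mult intro!: mult_left_mono)
        finally show ?case by (simp add: algebra_simps)
      qed
    qed (rule ki)
    also have "\<dots> = ?c * e\<^sup>2" using e by (simp add: measure_restrict_space power2_eq_square)
    finally show ?case .
  qed
  have "cmod (exp (\<i> * of_real (\<mu> * t)) * a t - a 0) \<le> (?c * e\<^sup>2) * t"
  proof (rule rotation_estimate[where M="cmod (a 0) + L * t" and E="\<bar>\<mu>\<bar> * L"])
    show "cmod (a s) \<le> cmod (a 0) + L * t" if "0 \<le> s" "s \<le> t" for s
    proof -
      have "cmod (a s) \<le> cmod (a 0) + cmod (a s - a 0)" by (metis add.commute diff_add_cancel norm_triangle_ineq)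
      also have "cmod (a s - a 0) \<le> L * \<bar>s - 0\<bar>" using that by (intro aL) auto
      also have "L * \<bar>s - 0\<bar> \<le> L * t" using that L by (intro mult_left_mono) auto
      finally show ?thesis by simp
    qed
    fix s y assume *: "0 \<le> s" "s \<le> y" "y \<le> t"
    \<comment> \<open>The rotation term is frozen at time \<open>s\<close>; by the Lipschitz bound
      the cost is proportional to \<open>y - s\<close>, which \<open>rotation_estimate\<close>
      tolerates.\<close>
    have "AE \<tau> in lebesgue_on {s..y}. cmod ((LINT x|lebesgue_on \<Omega>. v \<tau> x * g x) - (- (\<i> * of_real \<mu> * a s))) \<le> ?c * e\<^sup>2 + \<bar>\<mu>\<bar> * L * (y - s)"
    proof -
      have sets: "{s..y} \<in> sets lebesgue" "{s<..<y} \<in> sets lebesgue" "{0<..<T} \<in> sets lebesgue" by auto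
      obtain N where N: "negligible N" "\<And>\<tau>. \<tau> \<in> {0<..<T} - N \<Longrightarrow> cmod ((LINT x|lebesgue_on \<Omega>. v \<tau> x * g x) + \<i> * of_real \<mu> * a \<tau>) \<le> ?c * e\<^sup>2"
        using AE_lebesgue_onE[OF rot sets(3)] by blast
      show ?thesis
      proof (rule AE_lebesgue_onI[OF _ _ sets(1)])
        \<comment> \<open>\<open>s\<close> may be 0, which is not in \<open>(0, T)\<close>.\<close>
        show "negligible (N \<union> {s})" using N(1) by simp
        fix \<tau> assume \<tau>: "\<tau> \<in> {s..y} - (N \<union> {s})"
        then have "\<tau> \<in> {0<..<T} - N" using * t by auto
        from N(2)[OF this] have r: "cmod ((LINT x|lebesgue_on \<Omega>. v \<tau> x * g x) + \<i> * of_real \<mu> * a \<tau>) \<le> ?c * e\<^sup>2" .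
        have "cmod (a \<tau> - a s) \<le> L * \<bar>\<tau> - s\<bar>" using \<tau> * by (intro aL) auto
        also have "\<dots> \<le> L * (y - s)" using \<tau> L by (intro mult_left_mono) auto
        finally have "\<bar>\<mu>\<bar> * cmod (a \<tau> - a s) \<le> \<bar>\<mu>\<bar> * (L * (y - s))" by (intro mult_left_mono) auto
        then have q: "cmod (\<i> * of_real \<mu> * (a \<tau> - a s)) \<le> \<bar>\<mu>\<bar> * L * (y - s)" by (simp add: norm_mult mult.assoc)
        have "(LINT x|lebesgue_on \<Omega>. v \<tau> x * g x) - (- (\<i> * of_real \<mu> * a s)) =
          ((LINT x|lebesgue_on \<Omega>. v \<tau> x * g x) + \<i> * of_real \<mu> * a \<tau>) - \<i> * of_real \<mu> * (a \<tau> - a s)"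
          by (simp add: algebra_simps)
        then show "cmod ((LINT x|lebesgue_on \<Omega>. v \<tau> x * g x) - (- (\<i> * of_real \<mu> * a s))) \<le> ?c * e\<^sup>2 + \<bar>\<mu>\<bar> * L * (y - s)"
          using r q norm_triangle_ineq4 by (smt (verit))
      qed
    qed
    from prim_increment_bound[OF inner_prim[OF g] UNIV_I UNIV_I *(2) this]
    show "cmod (a y - a s + \<i> * of_real \<mu> * a s * of_real (y - s)) \<le> (?c * e\<^sup>2 + \<bar>\<mu>\<bar> * L * (y - s)) * (y - s)"
      unfolding adiff[symmetric] by (simp add: algebra_simps)
  qed (use t K L in auto)
  then show ?thesis by (simp add: \<mu>_def)
qed

text \<open>A small admissible time is fixed; then windows shrinking to 0 are selected along which
  the phase is any prescribed \<theta>. The phases 0 and \<open>pi\<close> place both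
  \<open>3/2 * l\<close> and its negative within \<open>C * t\<close> of \<open>D\<close>, which
  forces \<open>cmod D \<le> C * t\<close>.\<close>

lemma phase_contradiction:
  assumes lam: "lam \<noteq> 0" and X: "X > 0" and T: "T > 0"
    and sub: "{0<..<X} \<subseteq> \<Omega>" and p: "p \<in> L2 {0<..<X}" and K: "K \<ge> 0"
    and bounds: "AE \<tau> in lebesgue_on {0<..<T}. AE x in lebesgue_on {0<..<X}.
        cmod (U \<tau> x + p x) \<le> K * x \<and> cmod (\<i> * v \<tau> x - of_real lam * log_nl (U \<tau> x + p x)) \<le> K * x"
    and trace: "AE \<tau> in lebesgue_on {0<..<T}. \<exists>F l. (AE x in lebesgue_on {0<..<X}. U \<tau> x + p x = F x) \<and> F 0 = 0 \<and>
        (F has_vector_derivative l) (at 0)"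
    and init: "AE x in lebesgue_on {0<..<X}. U 0 x + p x = F0 x" "F0 0 = 0" "(F0 has_vector_derivative d) (at 0)"
  shows "d = 0"
proof (rule ccontr)
  assume "d \<noteq> 0"
  define D where "D = of_real (3/2) * d"
  have D: "cmod D > 0" using \<open>d \<noteq> 0\<close> by (simp add: D_def)
  define C where "C = \<bar>lam\<bar> * (1 + 8 * K\<^sup>2) + 2 * K"
  have C: "C \<ge> 0" using K by (simp add: C_def)
  define a where "a = (\<lambda>e s. LINT x|lebesgue_on {e..2 * e}. U s x + p x)"
  have sT: "{0<..<T} \<in> sets lebesgue" by simp
  obtain N where N: "negligible N" "\<And>\<tau>. \<tau> \<in> {0<..<T} - N \<Longrightarrow> \<exists>F l. (AE x in lebesgue_on {0<..<X}. U \<tau> x + p x = F x) \<and> F 0 = 0 \<and>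
        (F has_vector_derivative l) (at 0)"
    using AE_lebesgue_onE[OF trace sT] by blast
  \<comment> \<open>Below \<open>m\<close> the error \<open>C * t\<close> is smaller than
    \<open>cmod D\<close>.\<close>
  define m where "m = min T (cmod D / (C + 1))"
  have m: "m > 0" using T D C by (simp add: m_def)
  have "\<not> {0<..<m} \<subseteq> N"
    using negligible_subset[OF N(1)] open_not_negligible[of "{0<..<m}"] m by force
  then obtain t where t: "t \<in> {0<..<m}" "t \<notin> N" by blast
  then have t': "0 < t" "t < T" "t < cmod D / (C + 1)" by (auto simp: m_def)
  have Ct: "C * t < cmod D"
  proof -
    have "t * (C + 1) < cmod D" using t'(3) C by (simp add: pos_less_divide_eq)
    then show ?thesis using t'(1) by (simp add: algebra_simps)
  qed
  obtain F l where F: "AE x in lebesgue_on {0<..<X}. U t x + p x = F x" "F 0 = 0" "(F has_vector_derivative l) (at 0)"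
    using N(2)[of t] t(2) t'(1,2) greaterThanLessThan_iff by blast
  have ui: "integrable (lebesgue_on {e..2 * e}) (\<lambda>x. U s x + p x)" if e: "0 < e" "2 * e < X" for e s
  proof -
    have W: "{e..2 * e} \<in> sets lebesgue" "{e..2 * e} \<subseteq> \<Omega>" "{e..2 * e} \<subseteq> {0<..<X}" "{0<..<X} \<in> sets lebesgue"
      using e sub by auto
    show ?thesis
      by (intro Bochner_Integration.integrable_add L2_bounded_integrable[OF L2_subset(1)[OF U_L2 W(2) \<Omega> W(1)]]
          L2_bounded_integrable[OF L2_subset(1)[OF p W(3,4,1)]]) auto
  qed
  have limt: "((\<lambda>e. a e t / of_real (e\<^sup>2)) \<longlongrightarrow> of_real (3/2) * l) (at_right 0)"
    unfolding a_def by (rule window_average_tendsto[OF X ui F])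
  have lim0: "((\<lambda>e. a e 0 / of_real (e\<^sup>2)) \<longlongrightarrow> D) (at_right 0)"
    unfolding a_def D_def by (rule window_average_tendsto[OF X ui init])
  have est: "cmod (exp (\<i> * of_real (2 * lam * ln e * t)) * (a e t / of_real (e\<^sup>2)) - a e 0 / of_real (e\<^sup>2)) \<le> C * t"
    if e: "0 < e" "2 * e < X" for e
  proof -
    have "cmod (exp (\<i> * of_real (2 * lam * ln e * t)) * a e t - a e 0) \<le> C * e\<^sup>2 * t"
      unfolding a_def C_def using window_rotation[OF sub p K bounds e] t' by simp
    then have "cmod (exp (\<i> * of_real (2 * lam * ln e * t)) * a e t - a e 0) / e\<^sup>2 \<le> C * t"
      using e by (simp add: pos_divide_le_eq mult_ac)
    moreover have "exp (\<i> * of_real (2 * lam * ln e * t)) * (a e t / of_real (e\<^sup>2)) - a e 0 / of_real (e\<^sup>2)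
       = (exp (\<i> * of_real (2 * lam * ln e * t)) * a e t - a e 0) / of_real (e\<^sup>2)"
      by (simp add: diff_divide_distrib)
    ultimately show ?thesis by (simp only: norm_divide norm_of_real abs_power2)
  qed
  have key: "cmod (exp (\<i> * of_real \<theta>) * (of_real (3/2) * l) - D) \<le> C * t" for \<theta>
  proof -
    text \<open>Along this sequence the phase is \<open>\<theta>\<close> modulo \<open>2 \<pi>\<close>.\<close>
    define \<epsilon> where "\<epsilon> = (\<lambda>n. exp ((\<theta> / (2 * lam * t)) - (pi / (\<bar>lam\<bar> * t)) * real n))"
    have pos: "\<epsilon> n > 0" for n by (simp add: \<epsilon>_def)
    have "pi / (\<bar>lam\<bar> * t) > 0" using lam t'(1) by simp
    then have "filterlim (\<lambda>n. - (\<theta> / (2 * lam * t)) + pi / (\<bar>lam\<bar> * t) * real n) at_top sequentially"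
      by (intro filterlim_tendsto_add_at_top[OF tendsto_const]
          filterlim_tendsto_pos_mult_at_top[OF tendsto_const _ filterlim_real_sequentially])
    then have "filterlim (\<lambda>n. (\<theta> / (2 * lam * t)) - pi / (\<bar>lam\<bar> * t) * real n) at_bot sequentially"
      unfolding filterlim_uminus_at_bot by simp
    then have "\<epsilon> \<longlonglongrightarrow> 0" unfolding \<epsilon>_def
      by (rule filterlim_compose[OF exp_at_bot])
    then have lim\<epsilon>: "filterlim \<epsilon> (at_right 0) sequentially"
      using pos by (simp add: filterlim_at less_imp_neq[THEN not_sym])
    have phase: "exp (\<i> * of_real (2 * lam * ln (\<epsilon> n) * t)) = exp (\<i> * of_real \<theta>)" for n
    proof -
      \<comment> \<open>The sign of \<open>lam\<close> decides in which direction the phase winds;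
        either way it does so by full turns.\<close>
      define q where "q = lam / \<bar>lam\<bar>"
      have "2 * lam * ln (\<epsilon> n) * t = \<theta> - q * (2 * pi * real n)"
        using lam t'(1) by (simp add: \<epsilon>_def q_def field_simps)
      moreover have "q = 1 \<or> q = - 1" unfolding q_def using lam by (cases "lam > 0") auto
      ultimately have "2 * lam * ln (\<epsilon> n) * t = \<theta> + 2 * pi * real_of_int (- int n) \<or> 2 * lam * ln (\<epsilon> n) * t = \<theta> + 2 * pi * real_of_int (int n)"
        by auto
      moreover have "exp (\<i> * of_real (\<theta> + 2 * pi * real_of_int k)) = exp (\<i> * of_real \<theta>)" for k
        unfolding exp_eq by (intro exI[of _ k]) (simp add: algebra_simps)
      ultimately show ?thesis by metis
    qed
    have "\<forall>\<^sub>F n in sequentially. \<epsilon> n < X / 2" using \<open>\<epsilon> \<longlonglongrightarrow> 0\<close> X by (intro order_tendstoD(2)) auto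
    then have "\<forall>\<^sub>F n in sequentially. cmod (exp (\<i> * of_real \<theta>) * (a (\<epsilon> n) t / of_real ((\<epsilon> n)\<^sup>2)) - a (\<epsilon> n) 0 / of_real ((\<epsilon> n)\<^sup>2)) \<le> C * t"
    proof eventually_elim
      case (elim n)
      then show ?case using est[of "\<epsilon> n", OF pos] unfolding phase by simp
    qed
    moreover have "(\<lambda>n. cmod (exp (\<i> * of_real \<theta>) * (a (\<epsilon> n) t / of_real ((\<epsilon> n)\<^sup>2)) - a (\<epsilon> n) 0 / of_real ((\<epsilon> n)\<^sup>2)))
        \<longlonglongrightarrow> cmod (exp (\<i> * of_real \<theta>) * (of_real (3/2) * l) - D)"
      by (intro tendsto_intros filterlim_compose[OF limt lim\<epsilon>] filterlim_compose[OF lim0 lim\<epsilon>])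
    ultimately show ?thesis by (intro tendsto_upperbound) auto
  qed
  have "cmod (of_real (3/2) * l - D) \<le> C * t" using key[of 0] by simp
  moreover have "cmod (- (of_real (3/2) * l) - D) \<le> C * t" using key[of pi] by (simp add: exp_pi_i)
  \<comment> \<open>The unknown derivative \<open>l\<close> at time \<open>t\<close> cancels and
    \<open>-2 * D\<close> remains.\<close>
  moreover have "2 * cmod D = cmod ((of_real (3/2) * l - D) + (- (of_real (3/2) * l) - D))" by (simp add: norm_mult)
  ultimately have "2 * cmod D \<le> 2 * (C * t)" using norm_triangle_ineq by (smt (verit))
  then show False using Ct by simp
qed

end

section \<open>The growth estimate for the even part\<close>

text \<open>The constant is charged to the length of the interval and \<open>h\<close> to its total
  integral, so the bound is uniform over all intervals of a given length, however far out.\<close>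

lemma integral_norm_le_of_bound:
  fixes w :: "real \<Rightarrow> complex"
  assumes "w absolutely_integrable_on {a..b}" "integrable (lebesgue_on UNIV) h"
    and "a \<le> b" "B \<ge> 0" "AE x in lebesgue_on UNIV. cmod (w x) \<le> B + h x" "\<And>x. h x \<ge> 0"
  shows "integral {a..b} (\<lambda>x. cmod (w x)) \<le> B * (b - a) + (LINT x|lebesgue_on UNIV. h x)"
proof -
  let ?W = "{a..b}"
  have W: "?W \<in> sets lebesgue" "(UNIV :: real set) \<in> sets lebesgue" by auto
  have wi: "integrable (lebesgue_on ?W) (\<lambda>x. cmod (w x))"
    by (rule integrable_norm[OF absolutely_integrable_imp_integrable[OF assms(1) W(1)]])
  have Bi: "integrable (lebesgue_on ?W) (\<lambda>_. B)"
    by (rule absolutely_integrable_imp_integrable[OF absolutely_integrable_continuous_real W(1)]) (intro continuous_intros)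
  note hi = integrable_lebesgue_on_subset[OF assms(2) subset_UNIV W(2,1)]
  have ind: "integrable (lebesgue_on UNIV) (\<lambda>x. indicator ?W x *\<^sub>R h x)"
  proof (rule Bochner_Integration.integrable_bound[OF assms(2)])
    have "(indicator ?W :: real \<Rightarrow> real) \<in> borel_measurable (lebesgue_on UNIV)"
      by (intro measurable_restrict_space1 borel_measurable_indicator W)
    then show "(\<lambda>x. indicator ?W x *\<^sub>R h x) \<in> borel_measurable (lebesgue_on UNIV)" using assms(2) by auto
  qed (auto simp: indicator_def)
  have "integral ?W (\<lambda>x. cmod (w x)) = (LINT x|lebesgue_on ?W. cmod (w x))"
    by (rule lebesgue_integral_eq_integral[symmetric, OF wi W(1)])
  also have "\<dots> \<le> (LINT x|lebesgue_on ?W. B + h x)"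
    by (intro integral_mono_AE wi Bochner_Integration.integrable_add Bi hi(1) AE_lebesgue_on_subset[OF assms(5) subset_UNIV W(2,1)])
  also have "\<dots> = B * (b - a) + (LINT x|lebesgue_on UNIV. indicator ?W x *\<^sub>R h x)"
    using Bi hi assms(3) by (simp add: measure_restrict_space)
  also have "(LINT x|lebesgue_on UNIV. indicator ?W x *\<^sub>R h x) \<le> (LINT x|lebesgue_on UNIV. h x)"
    by (intro integral_mono ind assms(2)) (auto simp: indicator_def assms(6))
  finally show ?thesis by simp
qed

lemma growth_estimate_line:
  assumes fd: "weak_deriv UNIV f d" and dw: "weak_deriv UNIV d w"
    and v: "v \<in> L2 UNIV" and r: "r \<in> L2 UNIV"
    and rf: "AE x in lebesgue_on UNIV. r x = f x + f (- x)"
    and eqn: "AE x in lebesgue_on UNIV. \<i> * v x + w x = of_real lam * log_nl (f x)"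
    and B: "\<And>c. integral {c..c + 2} (\<lambda>x. cmod (w x)) \<le> B"
  shows "Re (LINT x|lebesgue_on UNIV. v x * cnj (r x)) \<le> \<bar>lam\<bar> * nsq UNIV r"
proof -
  have U: "open (UNIV :: real set)" "is_interval (UNIV :: real set)" "(0::real) \<in> UNIV" "(UNIV :: real set) \<in> sets lebesgue"
    by auto
  obtain F0 D0 where p: "AE x in lebesgue_on UNIV. f x = F0 x" "prim UNIV D0 w" "prim UNIV F0 D0"
    by (rule second_weak_deriv_prim[OF fd dw U(1-3)])
  have p': "AE x in lebesgue_on UNIV. f (- x) = F0 (- x)" by (rule AE_reflect[OF p(1) U(4)]) simp
  have rF: "AE x in lebesgue_on UNIV. r x = F0 x + F0 (- x)"
    using rf p(1) p' by eventually_elim simp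
  define W where "W = (\<lambda>x. w x + w (- x))"
  have pR: "prim UNIV (\<lambda>x. F0 x + F0 (- x)) (\<lambda>x. D0 x - D0 (- x))" and pD: "prim UNIV (\<lambda>x. D0 x - D0 (- x)) W"
    unfolding W_def using prim_even_part[OF p(3,2)] by blast+
  \<comment> \<open>\<open>W\<close> sees \<open>w\<close> on the window and on its mirror image,
    each contributing at most \<open>B\<close>.\<close>
  have "integral {c..c + 2} (\<lambda>x. cmod (W x)) \<le> 2 * B" for c
  proof -
    have w1: "w absolutely_integrable_on {c..c + 2}" "w absolutely_integrable_on {- (c + 2)..- c}"
      by (intro primD(1)[OF p(2)]; simp)+
    then have w2: "(\<lambda>x. w (- x)) absolutely_integrable_on {c..c + 2}"
      using absolutely_integrable_reflect_real[where f=w and a="- (c + 2)" and b="- c"] by (simp add: add.commute)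
    have "integral {c..c + 2} (\<lambda>x. cmod (W x)) \<le> integral {c..c + 2} (\<lambda>x. cmod (w x) + cmod (w (- x)))"
      unfolding W_def
    proof (rule integral_le)
      show "(\<lambda>x. cmod (w x + w (- x))) integrable_on {c..c + 2}"
        using set_integral_add(1)[OF w1(1) w2] by (simp only: absolutely_integrable_on_def)
      show "(\<lambda>x. cmod (w x) + cmod (w (- x))) integrable_on {c..c + 2}"
        using w1(1) w2 by (intro integrable_add) (simp_all only: absolutely_integrable_on_def)
    qed (rule norm_triangle_ineq)
    also have "\<dots> = integral {c..c + 2} (\<lambda>x. cmod (w x)) + integral {c..c + 2} (\<lambda>x. cmod (w (- x)))"
      using w1(1) w2 by (intro Henstock_Kurzweil_Integration.integral_add) (simp_all only: absolutely_integrable_on_def)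
    also have "integral {c..c + 2} (\<lambda>x. cmod (w (- x))) = integral {- (c + 2)..- c} (\<lambda>x. cmod (w x))"
      using Henstock_Kurzweil_Integration.integral_reflect_real[of "- c" "- (c + 2)" "\<lambda>x. cmod (w x)"] by (simp add: add.commute)
    also have "\<dots> \<le> B" using B[of "- (c + 2)"] by simp
    finally show ?thesis using B[of c] by simp
  qed
  then obtain \<rho> where \<rho>: "\<And>n. \<rho> n > 0" "\<And>x. \<forall>\<^sub>F n in sequentially. \<bar>x\<bar> \<le> \<rho> n"
    "(\<lambda>n. cmod (D0 (\<rho> n) - D0 (- \<rho> n)) * cmod (F0 (\<rho> n) + F0 (- \<rho> n))) \<longlonglongrightarrow> 0"
    using flux_vanishes_on_line[OF pR pD r rF] by blast
  show ?thesis
    by (rule flux_inequality[OF U(1,2) _ p(3,2,1) v r rF eqn _ \<rho>(1) _ \<rho>(3)]) (auto intro: \<rho>(2))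
qed

lemma growth_estimate_interval:
  assumes "a > 0" "f \<in> Dom_Laplace (Interval a b)"
    and fd: "weak_deriv {-a<..<a} f d" and dw: "weak_deriv {-a<..<a} d w" and w: "w \<in> L2 {-a<..<a}"
    and v: "v \<in> L2 {-a<..<a}" and r: "r \<in> L2 {-a<..<a}"
    and rf: "AE x in lebesgue_on {-a<..<a}. r x = f x + f (- x)"
    and eqn: "AE x in lebesgue_on {-a<..<a}. \<i> * v x + w x = of_real lam * log_nl (f x)"
  shows "Re (LINT x|lebesgue_on {-a<..<a}. v x * cnj (r x)) \<le> \<bar>lam\<bar> * nsq {-a<..<a} r"
proof -
  let ?I = "{-a<..<a}"
  have I: "open ?I" "is_interval ?I" "?I \<in> sets lebesgue" using \<open>a > 0\<close> by (auto intro: is_interval_oo)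
  have sym: "\<And>x. x \<in> ?I \<Longrightarrow> - x \<in> ?I" by auto
  have sub: "?I \<subseteq> {-a..a}" by auto
  obtain F0 D0 where p: "prim {-a..a} F0 D0" "prim {-a..a} D0 w" "AE x in lebesgue_on ?I. f x = F0 x"
    and bc: "(D0 a - D0 (- a)) * (F0 a + F0 (- a)) = 0"
    by (rule Dom_Laplace_boundary[OF assms(1,2) fd dw w])
  have p': "AE x in lebesgue_on ?I. f (- x) = F0 (- x)" by (rule AE_reflect[OF p(3) I(3) sym])
  have rF: "AE x in lebesgue_on ?I. r x = F0 x + F0 (- x)"
    using rf p(3) p' by eventually_elim simp
  obtain \<rho> where \<rho>: "\<And>n. \<rho> n > 0" "\<And>n. \<rho> n \<in> ?I" "\<And>x. x \<in> ?I \<Longrightarrow> \<forall>\<^sub>F n in sequentially. \<bar>x\<bar> \<le> \<rho> n"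
    "(\<lambda>n. cmod (D0 (\<rho> n) - D0 (- \<rho> n)) * cmod (F0 (\<rho> n) + F0 (- \<rho> n))) \<longlonglongrightarrow> 0"
    using flux_vanishes_on_interval[OF assms(1) p(1,2) bc] by blast
  show ?thesis
    by (rule flux_inequality[OF I(1,2) sym prim_subset[OF p(1) sub] prim_subset[OF p(2) sub] p(3) v r rF eqn \<rho>(2,1,3,4)])
qed

section \<open>Loss of regularity\<close>

text \<open>Here \<open>U = u - p\<close>, with \<open>p = 0\<close> or \<open>p = \<phi>\<close>; only \<open>U\<close> is assumed to be square integrable.\<close>

lemma (in time_derivative) not_Hs_bounded:
  assumes op: "open \<Omega>" and int: "is_interval \<Omega>" and zero: "0 \<in> \<Omega>" and sym: "\<And>x. x \<in> \<Omega> \<Longrightarrow> - x \<in> \<Omega>"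
    and lam: "lam \<noteq> 0" and s: "s > 7/2" and T: "T > 0" and x0: "x0 > 0" "{-x0<..<x0} \<subseteq> \<Omega>"
    and p: "p \<in> L2 {0<..<x0}" and podd: "AE x in lebesgue_on \<Omega>. p (- x) = - p x"
    and Uu: "\<And>t x. U t x = u t x - p x"
    and u0: "AE x in lebesgue_on \<Omega>. u 0 x = \<phi> x" and \<phi>: "\<phi> \<in> odd_data \<Omega>"
    and growth: "AE \<tau> in lebesgue. Re (LINT x|lebesgue_on \<Omega>. v \<tau> x * cnj (even_part \<tau> x)) \<le> \<bar>lam\<bar> * nsq \<Omega> (even_part \<tau>)"
    and eqn: "AE \<tau> in lebesgue. \<exists>d w. weak_deriv \<Omega> (u \<tau>) d \<and> weak_deriv \<Omega> d w \<and>
      (AE x in lebesgue_on \<Omega>. \<i> * v \<tau> x + w x = of_real lam * log_nl (u \<tau> x))"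
  shows "u \<notin> Linf {0<..<T} (Hs_sq s {-x0<..<x0})"
proof
  assume "u \<in> Linf {0<..<T} (Hs_sq s {-x0<..<x0})"
  then obtain C' where C': "AE t in lebesgue_on {0<..<T}. Hs_sq s {-x0<..<x0} (u t) \<le> ennreal C'"
    by (auto simp: Linf_def)
  \<comment> \<open>\<open>C'\<close> may be negative, which \<open>ennreal\<close>
    conceals.\<close>
  define C where "C = max C' 0"
  have C0: "C \<ge> 0" by (simp add: C_def)
  have "ennreal C' \<le> ennreal C" by (simp add: C_def ennreal_leI)
  with C' have C: "AE t in lebesgue_on {0<..<T}. Hs_sq s {-x0<..<x0} (u t) \<le> ennreal C"
    by (elim eventually_mono) (rule order_trans)
  let ?I = "{-x0<..<x0}"
  have I: "?I \<in> sets lebesgue" "open ?I" by auto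
  have J: "{0<..<x0} \<in> sets lebesgue" "{0<..<x0} \<subseteq> ?I" "{0<..<x0} \<subseteq> \<Omega>" using x0 by auto
  obtain K where K: "K \<ge> 0" and bounds: "\<And>f d w. Hs_sq s ?I f \<le> ennreal C \<Longrightarrow>
     AE x in lebesgue_on ?I. f (- x) = - f x \<Longrightarrow> weak_deriv ?I f d \<Longrightarrow> weak_deriv ?I d w \<Longrightarrow>
     (AE x in lebesgue_on {0<..<x0}. cmod (f x) \<le> K * x \<and> cmod (w x) \<le> K * x) \<and>
     (\<exists>F l. (AE x in lebesgue_on ?I. f x = F x) \<and> F 0 = 0 \<and> (F has_vector_derivative l) (at 0))"
    using Hs_odd_bounds[OF s x0(1) C0] by blast
  have \<phi>odd: "AE x in lebesgue_on \<Omega>. \<phi> (- x) = - \<phi> x" using \<phi> by (simp add: odd_data_def)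
  obtain g d where g: "continuous_on \<Omega> g" "AE x in lebesgue_on \<Omega>. g x = \<phi> x" "(g has_vector_derivative d) (at 0)" "d \<noteq> 0"
    using \<phi> by (auto simp: odd_data_def)
  have even0: "AE x in lebesgue_on \<Omega>. even_part 0 x = 0"
  proof -
    have "AE x in lebesgue_on \<Omega>. u 0 (- x) = \<phi> (- x)" by (rule AE_reflect[OF u0 \<Omega> sym])
    with u0 \<phi>odd podd show ?thesis by eventually_elim (simp add: even_part_def Uu)
  qed
  have odd: "AE x in lebesgue_on \<Omega>. u t (- x) = - u t x" if "t \<ge> 0" for t
  proof -
    have "AE x in lebesgue_on \<Omega>. even_part t x = 0"
      by (rule odd_preserved[OF sym even0 _ growth that]) simp_all
    with podd show ?thesis by eventually_elim (simp add: even_part_def Uu add_eq_0_iff)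
  qed
  have sT: "{0<..<T} \<in> sets lebesgue" by simp
  have "AE \<tau> in lebesgue_on {0<..<T}. \<exists>d w. weak_deriv \<Omega> (u \<tau>) d \<and> weak_deriv \<Omega> d w \<and>
      (AE x in lebesgue_on \<Omega>. \<i> * v \<tau> x + w x = of_real lam * log_nl (u \<tau> x))"
    using eqn by (simp add: AE_restrict_space_iff) (elim eventually_mono, simp)
  moreover have "AE \<tau> in lebesgue_on {0<..<T}. \<tau> \<in> {0<..<T}" by (rule AE_I2) simp
  ultimately have main: "AE \<tau> in lebesgue_on {0<..<T}.
      (AE x in lebesgue_on {0<..<x0}. cmod (U \<tau> x + p x) \<le> K * x \<and> cmod (\<i> * v \<tau> x - of_real lam * log_nl (U \<tau> x + p x)) \<le> K * x) \<and>
      (\<exists>F l. (AE x in lebesgue_on {0<..<x0}. U \<tau> x + p x = F x) \<and> F 0 = 0 \<and> (F has_vector_derivative l) (at 0))"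
    using C
  proof eventually_elim
    case (elim \<tau>)
    then obtain d w where dw: "weak_deriv \<Omega> (u \<tau>) d" "weak_deriv \<Omega> d w"
      and eq: "AE x in lebesgue_on \<Omega>. \<i> * v \<tau> x + w x = of_real lam * log_nl (u \<tau> x)" by blast
    have "AE x in lebesgue_on \<Omega>. u \<tau> (- x) = - u \<tau> x" using elim(2) by (intro odd) simp
    then have o: "AE x in lebesgue_on ?I. u \<tau> (- x) = - u \<tau> x"
      by (rule AE_lebesgue_on_subset[OF _ x0(2) \<Omega> I(1)])
    note b = bounds[OF elim(3) o weak_deriv_subset[OF dw(1) x0(2) op I(2)] weak_deriv_subset[OF dw(2) x0(2) op I(2)]]
    have eq': "AE x in lebesgue_on {0<..<x0}. \<i> * v \<tau> x + w x = of_real lam * log_nl (u \<tau> x)"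
      by (rule AE_lebesgue_on_subset[OF eq J(3) \<Omega> J(1)])
    have "AE x in lebesgue_on {0<..<x0}. cmod (u \<tau> x) \<le> K * x \<and> cmod (w x) \<le> K * x" using b ..
    with eq' have 1: "AE x in lebesgue_on {0<..<x0}. cmod (U \<tau> x + p x) \<le> K * x \<and> cmod (\<i> * v \<tau> x - of_real lam * log_nl (U \<tau> x + p x)) \<le> K * x"
    proof eventually_elim
      case (elim x)
      have "\<i> * v \<tau> x - of_real lam * log_nl (u \<tau> x) = - w x" using elim(1) by (simp add: eq_neg_iff_add_eq_0 algebra_simps)
      then show ?case using elim(2) by (simp add: Uu)
    qed
    obtain F l where F: "AE x in lebesgue_on ?I. u \<tau> x = F x" "F 0 = 0" "(F has_vector_derivative l) (at 0)"
      using b by blast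
    have "AE x in lebesgue_on {0<..<x0}. U \<tau> x + p x = F x"
      using AE_lebesgue_on_subset[OF F(1) J(2) I(1) J(1)] by (simp add: Uu)
    with 1 F(2,3) show ?case by blast
  qed
  \<comment> \<open>The continuous representative of an odd function is odd at every point.\<close>
  have g0: "g 0 = 0"
  proof -
    have "AE x in lebesgue_on \<Omega>. g (- x) = \<phi> (- x)" by (rule AE_reflect[OF g(2) \<Omega> sym])
    with g(2) \<phi>odd have ae: "AE x in lebesgue_on \<Omega>. g (- x) = - g x" by eventually_elim simp
    have "continuous_on \<Omega> (\<lambda>x. g (- x))"
      by (rule continuous_on_compose2[OF g(1)]) (use sym in \<open>auto intro: continuous_intros\<close>)
    from continuous_AE_eq_imp_eq[OF this continuous_on_minus[OF g(1)] op ae zero] show ?thesis by simp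
  qed
  have init: "AE x in lebesgue_on {0<..<x0}. U 0 x + p x = g x"
  proof -
    have "AE x in lebesgue_on \<Omega>. U 0 x + p x = g x" using u0 g(2) by eventually_elim (simp add: Uu)
    then show ?thesis by (rule AE_lebesgue_on_subset[OF _ J(3) \<Omega> J(1)])
  qed
  have "d = 0"
  proof (rule phase_contradiction[OF lam x0(1) T J(3) p K _ _ init g0 g(3)])
    show "AE \<tau> in lebesgue_on {0<..<T}. AE x in lebesgue_on {0<..<x0}.
        cmod (U \<tau> x + p x) \<le> K * x \<and> cmod (\<i> * v \<tau> x - of_real lam * log_nl (U \<tau> x + p x)) \<le> K * x"
      using main by eventually_elim blast
    show "AE \<tau> in lebesgue_on {0<..<T}. \<exists>F l. (AE x in lebesgue_on {0<..<x0}. U \<tau> x + p x = F x) \<and> F 0 = 0 \<and>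
        (F has_vector_derivative l) (at 0)"
      using main by eventually_elim blast
  qed
  then show False using g(4) by simp
qed

section \<open>The two situations with a strong form of the equation\<close>

lemma AE_lebesgue_all_bounded:
  assumes "\<And>T. T > 0 \<Longrightarrow> AE t in lebesgue_on {-T<..<T::real}. P t"
  shows "AE t in lebesgue. P t"
proof -
  have "AE t in lebesgue. t \<in> {- real (Suc n)<..<real (Suc n)} \<longrightarrow> P t" for n
    using assms[of "real (Suc n)"] by (simp add: AE_restrict_space_iff)
  then have "AE t in lebesgue. \<forall>n. t \<in> {- real (Suc n)<..<real (Suc n)} \<longrightarrow> P t"
    unfolding AE_all_countable by (rule allI)
  then show ?thesis
  proof eventually_elim
    case (elim t)
    obtain n where "\<bar>t\<bar> < real n" using reals_Archimedean2 by blast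
    then have "t \<in> {- real (Suc n)<..<real (Suc n)}" by auto
    then show ?case using elim by blast
  qed
qed

lemma (in time_derivative) v_L2_AE: "AE t in lebesgue. v t \<in> L2 \<Omega>"
proof (rule AE_lebesgue_all_bounded)
  fix T :: real assume "T > 0"
  then obtain C where "AE t in lebesgue_on {-T<..<T}. v t \<in> L2 \<Omega> \<and> nsq \<Omega> (v t) \<le> C"
    using v_bound by blast
  then show "AE t in lebesgue_on {-T<..<T}. v t \<in> L2 \<Omega>" by eventually_elim simp
qed

text \<open>The equation is given on bounded sets, with null sets of times depending on them;
  countably many intervals are enough. On \<open>w\<close> there is no global norm bound, but the
  equation dominates it by a constant plus an integrable function, which suffices for the flux at
  infinity.\<close>

lemma logNLS_line_not_Hs_bounded:
  assumes lam: "lam \<noteq> 0" and s: "s > 7/2" and T: "T > 0" and x0: "x0 > 0"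
    and \<phi>: "\<phi> \<in> odd_data UNIV" and sol: "logNLS_solution lam Line \<phi> u"
  shows "u \<notin> Linf {0<..<T} (Hs_sq s {-x0<..<x0})"
proof -
  obtain v w where C: "u \<in> C_time (L2_sq UNIV)" and u0: "AE x in lebesgue_on UNIV. u 0 x = \<phi> x"
    and W1: "W1inf_loc_L2 UNIV u v" and wd: "\<And>t. \<exists>d. weak_deriv UNIV (u t) d \<and> weak_deriv UNIV d (w t)"
    and eq: "\<And>\<omega>. open \<omega> \<and> bounded \<omega> \<and> \<omega> \<subseteq> UNIV \<Longrightarrow> AE t in lebesgue. eq_in_L2 lam \<omega> (u t) (v t) (w t)"
    using sol unfolding logNLS_solution_def Let_def region.simps by blast
  interpret time_derivative UNIV u v by unfold_locales (use C W1 in auto)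
  have eqn: "AE t in lebesgue. AE x in lebesgue_on UNIV. \<i> * v t x + w t x = of_real lam * log_nl (u t x)"
  proof -
    have "AE t in lebesgue. eq_in_L2 lam {- real (Suc n)<..<real (Suc n)} (u t) (v t) (w t)" for n
      by (rule eq) (auto intro: bounded_subset[OF bounded_closed_interval[of "- real (Suc n)" "real (Suc n)"]])
    then have "AE t in lebesgue. \<forall>n. eq_in_L2 lam {- real (Suc n)<..<real (Suc n)} (u t) (v t) (w t)"
      unfolding AE_all_countable by (rule allI)
    then show ?thesis
    proof eventually_elim
      case (elim t)
      have "AE x in lebesgue. \<i> * v t x + w t x = of_real lam * log_nl (u t x)"
      proof (rule AE_lebesgue_all_bounded)
        fix R :: real assume "R > 0"
        obtain n where n: "R < real n" using reals_Archimedean2 by blast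
        have "AE x in lebesgue_on {- real (Suc n)<..<real (Suc n)}. \<i> * v t x + w t x = of_real lam * log_nl (u t x)"
          using elim unfolding eq_in_L2_def by blast
        then show "AE x in lebesgue_on {-R<..<R}. \<i> * v t x + w t x = of_real lam * log_nl (u t x)"
          by (rule AE_lebesgue_on_subset) (use n in auto)
      qed
      then show ?case by (simp add: AE_restrict_space_iff)
    qed
  qed
  have growth: "AE t in lebesgue. Re (LINT x|lebesgue_on UNIV. v t x * cnj (even_part t x)) \<le> \<bar>lam\<bar> * nsq UNIV (even_part t)"
    using eqn v_L2_AE
  proof eventually_elim
    case (elim t)
    obtain d where d: "weak_deriv UNIV (u t) d" "weak_deriv UNIV d (w t)" using wd by blast
    let ?h = "\<lambda>x. 2 * \<bar>lam\<bar> * (cmod (u t x))\<^sup>2 + (cmod (v t x))\<^sup>2"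
    have hi: "integrable (lebesgue_on UNIV) ?h"
      using L2_D(2)[OF U_L2] L2_D(2)[OF elim(2)] by auto
    have wb: "AE x in lebesgue_on UNIV. cmod (w t x) \<le> (\<bar>lam\<bar> + 1) + ?h x"
      using elim(1)
    proof eventually_elim
      case (elim x)
      have "w t x = of_real lam * log_nl (u t x) - \<i> * v t x" using elim by (simp add: algebra_simps)
      then have "cmod (w t x) \<le> \<bar>lam\<bar> * cmod (log_nl (u t x)) + cmod (v t x)"
        using norm_triangle_ineq4[of "of_real lam * log_nl (u t x)" "\<i> * v t x"] by (simp add: norm_mult)
      also have "\<dots> \<le> \<bar>lam\<bar> * (1 + 2 * (cmod (u t x))\<^sup>2) + (1 + (cmod (v t x))\<^sup>2)"
      proof (intro add_mono mult_left_mono log_nl_norm_le)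
        show "cmod (v t x) \<le> 1 + (cmod (v t x))\<^sup>2"
          using zero_le_power2[of "cmod (v t x) - 1/2"] by (simp add: power2_eq_square algebra_simps)
      qed simp
      finally show ?case by (simp add: algebra_simps)
    qed
    have wi: "w t absolutely_integrable_on {a..b}" for a b
      using d(2) by (simp add: weak_deriv_def locally_integrable_def)
    have B: "integral {c..c + 2} (\<lambda>x. cmod (w t x)) \<le> (\<bar>lam\<bar> + 1) * (c + 2 - c) + (LINT x|lebesgue_on UNIV. ?h x)" for c
      by (rule integral_norm_le_of_bound[OF wi hi _ _ wb]) auto
    show ?case
    proof (rule growth_estimate_line[OF d elim(2) _ _ elim(1)])
      show "even_part t \<in> L2 UNIV"
        unfolding even_part_def[abs_def] by (intro L2_add U_L2 L2_reflect) auto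
      show "integral {c..c + 2} (\<lambda>x. cmod (w t x)) \<le> (\<bar>lam\<bar> + 1) * 2 + (LINT x|lebesgue_on UNIV. ?h x)" for c
        using B[of c] by simp
    qed (simp add: even_part_def)
  qed
  show ?thesis
  proof (rule not_Hs_bounded[where p="\<lambda>_. 0" and u=u, OF _ _ _ _ lam s T x0 _ _ _ _ u0 \<phi> growth])
    show "AE \<tau> in lebesgue. \<exists>d w. weak_deriv UNIV (u \<tau>) d \<and> weak_deriv UNIV d w \<and>
      (AE x in lebesgue_on UNIV. \<i> * v \<tau> x + w x = of_real lam * log_nl (u \<tau> x))"
      using eqn by eventually_elim (use wd in blast)
  qed (auto simp: L2_zero)
qed

text \<open>The boundary conditions enter through \<open>u t \<in> W2 (Interval a b)\<close>, which
  holds together with the equation at every time, so the growth estimate does as well.\<close>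

lemma logNLS_interval_not_Hs_bounded:
  assumes lam: "lam \<noteq> 0" and s: "s > 7/2" and T: "T > 0" and x0: "x0 > 0" "{-x0<..<x0} \<subseteq> {-a<..<a}"
    and a: "a > 0" and \<phi>: "\<phi> \<in> odd_data {-a<..<a}" and sol: "logNLS_solution lam (Interval a b) \<phi> u"
  shows "u \<notin> Linf {0<..<T} (Hs_sq s {-x0<..<x0})"
proof -
  let ?I = "{-a<..<a}"
  have bd: "bounded ?I" by (rule bounded_subset[OF bounded_closed_interval[of "- a" a]]) auto
  obtain v w where C: "u \<in> C_time (L2_sq ?I)" and u0: "AE x in lebesgue_on ?I. u 0 x = \<phi> x"
    and W1: "W1inf_loc_L2 ?I u v" and wd: "\<And>t. \<exists>d. weak_deriv ?I (u t) d \<and> weak_deriv ?I d (w t)"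
    and W2: "\<And>t. u t \<in> W2 (Interval a b)" and eq: "\<And>t. eq_in_L2 lam ?I (u t) (v t) (w t)"
    using sol bd unfolding logNLS_solution_def Let_def region.simps by blast
  interpret time_derivative ?I u v by unfold_locales (use C W1 in auto)
  have eqn: "AE x in lebesgue_on ?I. \<i> * v t x + w t x = of_real lam * log_nl (u t x)"
    and vL: "v t \<in> L2 ?I" and wL: "w t \<in> L2 ?I" for t
    using eq[of t] by (auto simp: eq_in_L2_def)
  have growth: "Re (LINT x|lebesgue_on ?I. v t x * cnj (even_part t x)) \<le> \<bar>lam\<bar> * nsq ?I (even_part t)" for t
  proof -
    obtain d where d: "weak_deriv ?I (u t) d" "weak_deriv ?I d (w t)" using wd by blast
    show ?thesis
    proof (rule growth_estimate_interval[OF a _ d wL vL _ _ eqn])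
      show "u t \<in> Dom_Laplace (Interval a b)" using W2[of t] unfolding W2_def by blast
      show "even_part t \<in> L2 ?I"
        unfolding even_part_def[abs_def] by (intro L2_add U_L2 L2_reflect) auto
    qed (simp add: even_part_def)
  qed
  show ?thesis
  proof (rule not_Hs_bounded[where p="\<lambda>_. 0" and u=u, OF _ _ _ _ lam s T x0 _ _ _ u0 \<phi>])
    show "AE \<tau> in lebesgue. \<exists>d w. weak_deriv ?I (u \<tau>) d \<and> weak_deriv ?I d w \<and>
      (AE x in lebesgue_on ?I. \<i> * v \<tau> x + w x = of_real lam * log_nl (u \<tau> x))"
      by (intro always_eventually allI) (use wd eqn in blast)
    show "is_interval ?I" by (rule is_interval_oo)
  qed (use a growth in \<open>auto simp: L2_zero\<close>)
qed

section \<open>From the distributional to the pointwise equation\<close>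

lemma log_nl_small:
  assumes "cmod z \<le> 1"
  shows "cmod (log_nl z) \<le> 4 * sqrt (cmod z)"
proof (cases "z = 0")
  case False
  define k where "k = sqrt (cmod z)"
  have k: "k > 0" "cmod z = k * k" using False by (simp_all add: k_def)
  have "ln (cmod z) = 2 * ln k" using k by (simp add: ln_mult)
  moreover have "ln (cmod z) \<le> 0" using assms False by simp
  moreover have "cmod (log_nl z) = cmod z * \<bar>2 * ln (cmod z)\<bar>"
    using False by (simp add: log_nl_def norm_mult ln_realpow)
  ultimately have "cmod (log_nl z) = 4 * k * (k * (- ln k))" unfolding k(2) by simp
  also have "\<dots> \<le> 4 * k * 1"
  proof (intro mult_left_mono)
    have "- ln k \<le> 1 / k" using ln_le_minus_one[of "1 / k"] k by (simp add: ln_div)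
    then have "k * (- ln k) \<le> k * (1 / k)" using k(1) by (intro mult_left_mono) auto
    then show "k * (- ln k) \<le> 1" using k(1) by simp
  qed (use k in simp)
  finally show ?thesis by (simp add: k_def)
qed (simp add: log_nl_def)

lemma log_nl_modulus:
  assumes "\<delta> > 0"
  obtains C where "C \<ge> 0" "\<And>z w. cmod (log_nl z - log_nl w) \<le> \<delta> + C * (cmod (z - w) * (1 + cmod z + cmod w))"
proof -
  \<comment> \<open>Then \<open>4 * sqrt \<kappa> \<le> \<delta> / 2\<close>, so by
    \<open>log_nl_small\<close> each of the two values costs at most half of \<delta>.\<close>
  define \<kappa> where "\<kappa> = min 1 ((\<delta> / 8)\<^sup>2)"
  have \<kappa>: "0 < \<kappa>" "\<kappa> \<le> 1" "\<kappa> \<le> (\<delta> / 8)\<^sup>2" using assms by (auto simp: \<kappa>_def)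
  have ln\<kappa>: "ln \<kappa> \<le> 0" using \<kappa> by simp
  define C where "C = 2 - 2 * ln \<kappa>"
  have C: "C \<ge> 2" using ln\<kappa> by (simp add: C_def)
  have main: "cmod (log_nl z - log_nl w) \<le> \<delta> + C * (cmod (z - w) * (1 + cmod z + cmod w))"
    if le: "cmod w \<le> cmod z" for z w
  proof (cases "cmod z < \<kappa>")
    case True
    have small: "cmod (log_nl y) \<le> \<delta> / 2" if "cmod y < \<kappa>" for y
    proof -
      have "cmod (log_nl y) \<le> 4 * sqrt (cmod y)" using that \<kappa> by (intro log_nl_small) simp
      also have "sqrt (cmod y) \<le> sqrt ((\<delta> / 8)\<^sup>2)" using that \<kappa>(3) by (intro real_sqrt_le_mono) simp
      also have "\<dots> = \<delta> / 8" using assms by simp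
      finally show ?thesis by simp
    qed
    have "cmod (log_nl z - log_nl w) \<le> \<delta>"
      using norm_triangle_ineq4[of "log_nl z" "log_nl w"] small[OF True] small[of w] le True by simp
    moreover have "0 \<le> C * (cmod (z - w) * (1 + cmod z + cmod w))" using C by simp
    ultimately show ?thesis by linarith
  next
    case False
    let ?L = "\<lambda>y. ln ((cmod y)\<^sup>2)"
    have zpos: "cmod z > 0" using False \<kappa>(1) by linarith
    have Lz: "\<bar>?L z\<bar> \<le> 2 * (cmod z - ln \<kappa>)"
    proof (cases "cmod z \<ge> 1")
      case True
      then have "\<bar>?L z\<bar> = 2 * ln (cmod z)" using zpos by (simp add: ln_realpow)
      also have "\<dots> \<le> 2 * (cmod z - ln \<kappa>)" using ln_le_minus_one[OF zpos] ln\<kappa> by simp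
      finally show ?thesis .
    next
      case z1: False
      then have "\<bar>?L z\<bar> = - 2 * ln (cmod z)" using zpos by (simp add: ln_realpow)
      also have "\<dots> \<le> - 2 * ln \<kappa>" using False \<kappa>(1) zpos by simp
      also have "\<dots> \<le> 2 * (cmod z - ln \<kappa>)" by simp
      finally show ?thesis .
    qed
    have Lw: "cmod w * \<bar>?L z - ?L w\<bar> \<le> 2 * cmod (z - w)"
    proof (cases "w = 0")
      case False
      then show ?thesis using ln_norm_sq_diff_le[OF False le] by (simp add: mult.commute)
    qed simp
    have "log_nl z - log_nl w = (z - w) * of_real (?L z) + w * of_real (?L z - ?L w)"
      by (simp add: log_nl_def algebra_simps)
    then have "cmod (log_nl z - log_nl w) \<le> cmod (z - w) * \<bar>?L z\<bar> + cmod w * \<bar>?L z - ?L w\<bar>"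
      using norm_triangle_ineq[of "(z - w) * of_real (?L z)" "w * of_real (?L z - ?L w)"]
      by (simp only: norm_mult norm_of_real)
    also have "\<dots> \<le> cmod (z - w) * (2 * (cmod z - ln \<kappa>)) + 2 * cmod (z - w)"
      by (intro add_mono mult_left_mono Lz Lw) auto
    also have "\<dots> = cmod (z - w) * (C + 2 * cmod z)" by (simp add: C_def algebra_simps)
    also have "\<dots> \<le> cmod (z - w) * (C * (1 + cmod z + cmod w))"
    proof (intro mult_left_mono)
      have "2 * cmod z \<le> C * cmod z" "0 \<le> C * cmod w" using C by (auto intro: mult_right_mono)
      then show "C + 2 * cmod z \<le> C * (1 + cmod z + cmod w)" by (simp add: algebra_simps)
    qed simp
    finally show ?thesis using assms by (simp add: mult_ac)
  qed
  have "cmod (log_nl z - log_nl w) \<le> \<delta> + C * (cmod (z - w) * (1 + cmod z + cmod w))" for z w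
  proof (cases "cmod w \<le> cmod z")
    case False
    then show ?thesis using main[of z w] by (simp add: norm_minus_commute add_ac)
  qed (rule main)
  with C show thesis by (intro that[of C]) auto
qed

section \<open>Products of test functions in time and in space\<close>

lemma test_fun_derivative:
  assumes "\<psi> \<in> test_fun \<Omega>"
  shows "(\<lambda>x. vector_derivative \<psi> (at x)) \<in> test_fun \<Omega>"
proof -
  obtain K where K: "compact K" "K \<subseteq> \<Omega>" "\<And>x. x \<notin> K \<Longrightarrow> \<psi> x = 0"
    using assms by (auto simp: test_fun_def)
  have "vector_derivative \<psi> (at x) = 0" if "x \<notin> K" for x
    by (rule vector_derivative_zero_on_open[of "- K"]) (use K that in \<open>auto simp: compact_imp_closed open_Compl\<close>)
  then show ?thesis using K smooth_D(2)[OF test_fun_smooth[OF assms]] by (auto simp: test_fun_def)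
qed

lemma test_fun_Icc_support:
  assumes "\<psi> \<in> test_fun UNIV"
  obtains a b where "a < b" "\<And>x. x \<notin> {a..b} \<Longrightarrow> \<psi> x = 0"
proof -
  obtain a b where "a < b" "\<forall>x. x \<le> a \<or> x \<ge> b \<longrightarrow> \<psi> x = 0 \<and> vector_derivative \<psi> (at x) = 0"
    using test_fun_support[OF assms open_UNIV UNIV_I] by blast
  then show thesis by (intro that[of a b]) auto
qed

lemma test_fun_L2: "\<psi> \<in> test_fun UNIV \<Longrightarrow> \<psi> \<in> L2 UNIV"
proof -
  assume \<psi>: "\<psi> \<in> test_fun UNIV"
  obtain a b where ab: "a < b" "\<And>x. x \<notin> {a..b} \<Longrightarrow> \<psi> x = 0" using test_fun_Icc_support[OF \<psi>] by blast
  have c: "continuous_on A \<psi>" for A by (rule smooth_imp_continuous_on[OF test_fun_smooth[OF \<psi>]])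
  have "integrable (lebesgue_on UNIV) (\<lambda>x. complex_of_real ((cmod (\<psi> x))\<^sup>2))"
    by (rule integral_lebesgue_on_support(1)[of a b])
       (use ab in \<open>auto intro!: absolutely_integrable_continuous_real continuous_intros c\<close>)
  then have "integrable (lebesgue_on UNIV) (\<lambda>x. (cmod (\<psi> x))\<^sup>2)" using integrable_Re by fastforce
  moreover have "\<psi> \<in> borel_measurable (lebesgue_on UNIV)"
    by (rule continuous_imp_measurable_on_sets_lebesgue[OF c]) simp
  ultimately show ?thesis by (simp add: L2_iff)
qed

lemma locally_integrable_UNIV_I:
  assumes "\<And>a b. f absolutely_integrable_on {a..b}"
  shows "locally_integrable UNIV f"
  by (rule prim_locally_integrable(1)[OF prim_int0[where c=0]]) (simp_all add: assms)

lemma locally_integrable_mult_test: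
  assumes "locally_integrable UNIV f" "\<psi> \<in> test_fun UNIV"
  shows "integrable (lebesgue_on UNIV) (\<lambda>x. f x * \<psi> x)"
proof -
  obtain a b where ab: "a < b" "\<And>x. x \<notin> {a..b} \<Longrightarrow> \<psi> x = 0" using test_fun_Icc_support[OF assms(2)] by blast
  have c: "continuous_on {a..b} \<psi>" by (rule smooth_imp_continuous_on[OF test_fun_smooth[OF assms(2)]])
  show ?thesis
    by (rule integral_lebesgue_on_support(1)[of a b])
       (use ab(2) assms(1) in \<open>simp_all add: abs_integrable_mult_continuous(1)[OF _ c] locally_integrable_def\<close>)
qed

lemma weak_deriv_add_UNIV:
  assumes "weak_deriv UNIV f g" "weak_deriv UNIV f' g'"
  shows "weak_deriv UNIV (\<lambda>x. f x + f' x) (\<lambda>x. g x + g' x)"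
proof -
  have li: "locally_integrable UNIV f" "locally_integrable UNIV g" "locally_integrable UNIV f'" "locally_integrable UNIV g'"
    using assms by (auto simp: weak_deriv_def)
  have add: "locally_integrable UNIV (\<lambda>x. h x + h' x)" if "locally_integrable UNIV h" "locally_integrable UNIV h'" for h h'
    using that by (auto simp: locally_integrable_def)
  show ?thesis
    unfolding weak_deriv_def
  proof (intro conjI ballI add li)
    fix \<psi> assume \<psi>: "\<psi> \<in> test_fun UNIV"
    note \<psi>' = test_fun_derivative[OF \<psi>]
    show "(LINT x|lebesgue_on UNIV. (f x + f' x) * vector_derivative \<psi> (at x)) = - (LINT x|lebesgue_on UNIV. (g x + g' x) * \<psi> x)"
      unfolding distrib_right
        Bochner_Integration.integral_add[OF locally_integrable_mult_test[OF li(1) \<psi>'] locally_integrable_mult_test[OF li(3) \<psi>']]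
        Bochner_Integration.integral_add[OF locally_integrable_mult_test[OF li(2) \<psi>] locally_integrable_mult_test[OF li(4) \<psi>]]
      using assms \<psi> by (simp add: weak_deriv_def)
  qed
qed

text \<open>Product tests are rich enough, because time is dealt with first for a fixed \<eta>, and
  space afterwards at a fixed time.\<close>

lemma test_fun2_product:
  assumes "\<theta> \<in> test_fun UNIV" "\<eta> \<in> test_fun UNIV"
  obtains D where "D \<in> test_fun2"
    "\<And>t x. D 0 0 t x = \<theta> t * \<eta> x" "\<And>t x. D 1 0 t x = vector_derivative \<theta> (at t) * \<eta> x"
    "\<And>t x. D 0 2 t x = \<theta> t * vector_derivative (\<lambda>y. vector_derivative \<eta> (at y)) (at x)"
proof -
  obtain A where A: "A 0 = \<theta>" "\<And>n x. (A n has_vector_derivative A (Suc n) x) (at x)"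
    using test_fun_smooth[OF assms(1)] unfolding smooth_def by auto
  obtain B where B: "B 0 = \<eta>" "\<And>n x. (B n has_vector_derivative B (Suc n) x) (at x)"
    using test_fun_smooth[OF assms(2)] unfolding smooth_def by auto
  have A1: "A 1 t = vector_derivative \<theta> (at t)" for t using vector_derivative_at[OF A(2)[of 0 t]] A(1) by simp
  have B1: "B 1 = (\<lambda>x. vector_derivative \<eta> (at x))" using vector_derivative_at[OF B(2)[of 0]] B(1) by auto
  have B2: "B 2 x = vector_derivative (\<lambda>y. vector_derivative \<eta> (at y)) (at x)" for x
    using vector_derivative_at[OF B(2)[of 1 x]] B1 by (simp add: numeral_2_eq_2)
  obtain a b where ab: "a < b" "\<And>x. x \<notin> {a..b} \<Longrightarrow> \<theta> x = 0" using test_fun_Icc_support[OF assms(1)] by blast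
  obtain a' b' where ab': "a' < b'" "\<And>x. x \<notin> {a'..b'} \<Longrightarrow> \<eta> x = 0" using test_fun_Icc_support[OF assms(2)] by blast
  have cA: "continuous_on UNIV (A n)" and cB: "continuous_on UNIV (B n)" for n
    using has_vector_derivative_continuous[OF A(2)] has_vector_derivative_continuous[OF B(2)]
    by (auto intro!: continuous_at_imp_continuous_on)
  define D where "D = (\<lambda>j k t x. A j t * B k x)"
  have "D \<in> test_fun2"
    unfolding test_fun2_def D_def
  proof (intro CollectI conjI allI)
    show "continuous_on UNIV (\<lambda>p. A j (fst p) * B k (snd p))" for j k
      by (intro continuous_intros continuous_on_compose2[OF cA] continuous_on_compose2[OF cB]) auto
    show "((\<lambda>\<tau>. A j \<tau> * B k x) has_vector_derivative A (Suc j) t * B k x) (at t)" for j k t x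
      by (rule has_vector_derivative_mult_left[OF A(2)])
    show "((\<lambda>y. A j t * B k y) has_vector_derivative A j t * B (Suc k) x) (at x)" for j k t x
      by (rule has_vector_derivative_mult_right[OF B(2)])
    define R where "R = \<bar>a\<bar> + \<bar>b\<bar> + \<bar>a'\<bar> + \<bar>b'\<bar>"
    have "A 0 t * B 0 x = 0" if "\<bar>t\<bar> > R \<or> \<bar>x\<bar> > R" for t x
    proof -
      have "t \<notin> {a..b} \<or> x \<notin> {a'..b'}" using that by (auto simp: R_def)
      then show ?thesis using A(1) B(1) ab(2) ab'(2) by auto
    qed
    then show "\<exists>R. \<forall>t x. \<bar>t\<bar> > R \<or> \<bar>x\<bar> > R \<longrightarrow> A 0 t * B 0 x = 0" by blast
  qed
  then show thesis
    by (rule that) (simp_all only: D_def A(1) B(1) A1 B2)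
qed

text \<open>Finite energy keeps the modulus close to 1 on most of the line, so \<open>u\<close>
  itself is not square integrable in the intended use. Its difference \<open>U\<close> from the
  datum is, and \<open>u\<close> is paired only with functions of compact support.\<close>

locale distributional_solution = time_derivative UNIV U v for U v +
  fixes \<phi> :: "real \<Rightarrow> complex" and u :: "real \<Rightarrow> real \<Rightarrow> complex" and lam :: real
  assumes u_eq: "\<And>t x. u t x = U t x + \<phi> x"
    and \<phi>_L2: "\<And>a b. \<phi> \<in> L2 {a..b}"
    and dist: "logNLS_distributional lam u"
begin

lemma u_L2_Icc: "u t \<in> L2 {a..b}"
  unfolding u_eq[abs_def] by (intro L2_add L2_subset(1)[OF U_L2] \<phi>_L2) auto

lemma u_locally_integrable: "locally_integrable UNIV (u t)"
  by (intro locally_integrable_UNIV_I L2_absolutely_integrable[OF u_L2_Icc]) auto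

lemma log_nl_u_locally_integrable: "locally_integrable UNIV (\<lambda>x. log_nl (u t x))"
proof (rule locally_integrable_UNIV_I)
  fix a b :: real
  have W: "{a..b} \<in> sets lebesgue" by simp
  have oi: "integrable (lebesgue_on {a..b}) (\<lambda>_. 1 :: real)"
    by (rule absolutely_integrable_imp_integrable[OF absolutely_integrable_continuous_real W]) (intro continuous_intros)
  have "integrable (lebesgue_on {a..b}) (\<lambda>x. log_nl (u t x))"
  proof (rule Bochner_Integration.integrable_bound)
    show "integrable (lebesgue_on {a..b}) (\<lambda>x. 1 + 2 * (cmod (u t x))\<^sup>2)"
      using L2_D(2)[OF u_L2_Icc] oi by auto
    show "(\<lambda>x. log_nl (u t x)) \<in> borel_measurable (lebesgue_on {a..b})"
      by (rule log_nl_measurable[OF L2_D(1)[OF u_L2_Icc]])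
    show "AE x in lebesgue_on {a..b}. norm (log_nl (u t x)) \<le> norm (1 + 2 * (cmod (u t x))\<^sup>2)"
      using log_nl_norm_le by (intro AE_I2) simp
  qed
  then show "(\<lambda>x. log_nl (u t x)) absolutely_integrable_on {a..b}"
    by (simp add: integrable_restrict_space set_integrable_def)
qed

lemma u_pairing_eq:
  assumes "\<eta> \<in> test_fun UNIV"
  shows "(LINT x|lebesgue_on UNIV. u t x * \<eta> x) = (LINT x|lebesgue_on UNIV. U t x * \<eta> x) + (LINT x|lebesgue_on UNIV. \<phi> x * \<eta> x)"
proof -
  have "locally_integrable UNIV \<phi>"
    by (intro locally_integrable_UNIV_I L2_absolutely_integrable[OF \<phi>_L2]) auto
  from Bochner_Integration.integral_add[OF L2_mult_integrable[OF U_L2 test_fun_L2[OF assms]] locally_integrable_mult_test[OF this assms]]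
  show ?thesis by (simp add: u_eq distrib_right)
qed

lemma u_pairing_continuous:
  assumes "\<eta> \<in> test_fun UNIV"
  shows "continuous_on UNIV (\<lambda>t. LINT x|lebesgue_on UNIV. u t x * \<eta> x)"
  unfolding u_pairing_eq[OF assms] by (intro continuous_on_add continuous_on_const inner_continuous test_fun_L2 assms)

text \<open>Makes the nonlinear term a locally integrable function of time without any appeal to
  joint measurability. The modulus of continuity leaves an error proportional to \<delta> and a part
  that vanishes with the \<open>L2\<close> distance of \<open>U t\<close> and
  \<open>U t0\<close>.\<close>

lemma log_nl_pairing_continuous:
  assumes "\<eta> \<in> test_fun UNIV"
  shows "continuous_on UNIV (\<lambda>t. LINT x|lebesgue_on UNIV. log_nl (u t x) * \<eta> x)"
proof (intro continuous_at_imp_continuous_on ballI)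
  fix t0 :: real
  let ?q = "\<lambda>t. LINT x|lebesgue_on UNIV. log_nl (u t x) * \<eta> x"
  let ?n = "\<lambda>t. nsq UNIV (\<lambda>x. U t x - U t0 x)"
  obtain a b where ab: "a < b" "\<And>x. x \<notin> {a..b} \<Longrightarrow> \<eta> x = 0" using test_fun_Icc_support[OF assms] by blast
  let ?W = "{a..b}"
  have W: "?W \<in> sets lebesgue" "(UNIV :: real set) \<in> sets lebesgue" by auto
  have c\<eta>: "continuous_on A \<eta>" for A by (rule smooth_imp_continuous_on[OF test_fun_smooth[OF assms]])
  have "bounded (\<eta> ` ?W)" by (rule compact_imp_bounded[OF compact_continuous_image[OF c\<eta> compact_Icc]])
  then obtain M where "\<forall>y\<in>\<eta> ` ?W. cmod y \<le> M" unfolding bounded_iff by blast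
  then have M: "cmod (\<eta> x) \<le> M" if "x \<in> ?W" for x using that by simp
  have M0: "M \<ge> 0" using order_trans[OF norm_ge_zero M[of a]] ab(1) by simp
  define g where "g = (\<lambda>x. complex_of_real (1 + 2 * cmod (u t0 x)))"
  have gL: "g \<in> L2 ?W"
  proof (rule L2_bound[where h="\<lambda>x. 2 + 8 * (cmod (u t0 x))\<^sup>2"])
    have "u t0 \<in> borel_measurable (lebesgue_on ?W)" by (rule L2_D(1)[OF u_L2_Icc])
    then have "(\<lambda>x. 1 + 2 * cmod (u t0 x)) \<in> borel_measurable (lebesgue_on ?W)" by measurable
    then show "g \<in> borel_measurable (lebesgue_on ?W)" unfolding g_def
      by (rule measurable_compose[OF _ borel_measurable_continuous_onI]) (intro continuous_intros)
    have oi: "integrable (lebesgue_on ?W) (\<lambda>_. 2 :: real)"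
      by (rule absolutely_integrable_imp_integrable[OF absolutely_integrable_continuous_real W(1)]) (intro continuous_intros)
    then show "integrable (lebesgue_on ?W) (\<lambda>x. 2 + 8 * (cmod (u t0 x))\<^sup>2)"
      using L2_D(2)[OF u_L2_Icc] by auto
    have "(cmod (g x))\<^sup>2 \<le> 2 + 8 * (cmod (u t0 x))\<^sup>2" for x
      using norm_sum_sq_le[of "1::real" "2 * cmod (u t0 x)"] unfolding g_def norm_of_real by (simp add: power_mult_distrib)
    then show "AE x in lebesgue_on ?W. (cmod (g x))\<^sup>2 \<le> 2 + 8 * (cmod (u t0 x))\<^sup>2" by simp
  qed
  have conv: "?q t = (LINT x|lebesgue_on ?W. log_nl (u t x) * \<eta> x)" for t
  proof -
    have "\<And>x. indicator UNIV x *\<^sub>R (log_nl (u t x) * \<eta> x) = indicator ?W x *\<^sub>R (log_nl (u t x) * \<eta> x)"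
      using ab(2) by (auto simp: indicator_def)
    then show ?thesis by (subst (1 2) integral_restrict_space) auto
  qed
  have Fi: "integrable (lebesgue_on ?W) (\<lambda>x. log_nl (u t x) * \<eta> x)" for t
    by (rule integrable_lebesgue_on_subset(1)[OF locally_integrable_mult_test[OF log_nl_u_locally_integrable assms] subset_UNIV W(2,1)])
  have bound: "\<exists>C\<ge>0. \<forall>t. cmod (?q t - ?q t0) \<le> M * (\<delta> * (b - a) + C * (sqrt (?n t) * sqrt (nsq ?W g) + ?n t))"
    if "\<delta> > 0" for \<delta>
  proof -
    obtain C where C: "C \<ge> 0" "\<And>z w. cmod (log_nl z - log_nl w) \<le> \<delta> + C * (cmod (z - w) * (1 + cmod z + cmod w))"
      using log_nl_modulus[OF \<open>\<delta> > 0\<close>] by blast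
    have "cmod (?q t - ?q t0) \<le> M * (\<delta> * (b - a) + C * (sqrt (?n t) * sqrt (nsq ?W g) + ?n t))" for t
    proof -
      define \<Delta> where "\<Delta> = (\<lambda>x. U t x - U t0 x)"
      have \<Delta>: "\<Delta> \<in> L2 UNIV" unfolding \<Delta>_def by (intro L2_diff U_L2)
      note \<Delta>W = L2_subset[OF \<Delta> subset_UNIV W(2,1)]
      have abs\<Delta>: "(\<lambda>x. complex_of_real (cmod (\<Delta> x))) \<in> L2 ?W"
      proof (rule L2_bound[OF _ L2_D(2)[OF \<Delta>W(1)]])
        have "(\<lambda>x. cmod (\<Delta> x)) \<in> borel_measurable (lebesgue_on ?W)" using L2_D(1)[OF \<Delta>W(1)] by measurable
        then show "(\<lambda>x. complex_of_real (cmod (\<Delta> x))) \<in> borel_measurable (lebesgue_on ?W)"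
          by (rule measurable_compose[OF _ borel_measurable_continuous_onI]) (intro continuous_intros)
      qed simp
      define P where "P = (\<lambda>x. complex_of_real (cmod (\<Delta> x)) * g x)"
      have Pi: "integrable (lebesgue_on ?W) P" unfolding P_def by (rule L2_mult_integrable[OF abs\<Delta> gL])
      have Pn: "cmod (LINT x|lebesgue_on ?W. P x) \<le> sqrt (?n t) * sqrt (nsq ?W g)"
      proof -
        have "cmod (LINT x|lebesgue_on ?W. P x) \<le> sqrt (nsq ?W (\<lambda>x. complex_of_real (cmod (\<Delta> x)))) * sqrt (nsq ?W g)"
          unfolding P_def by (rule L2_Cauchy_Schwarz[OF abs\<Delta> gL])
        also have "nsq ?W (\<lambda>x. complex_of_real (cmod (\<Delta> x))) = nsq ?W \<Delta>" by (simp add: nsq_def)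
        also have "sqrt (nsq ?W \<Delta>) * sqrt (nsq ?W g) \<le> sqrt (?n t) * sqrt (nsq ?W g)"
          using \<Delta>W(2) by (intro mult_right_mono) (auto simp: \<Delta>_def nsq_nonneg)
        finally show ?thesis .
      qed
      have RePI: "(LINT x|lebesgue_on ?W. Re (P x)) \<le> sqrt (?n t) * sqrt (nsq ?W g)"
        using Pn complex_Re_le_cmod[of "LINT x|lebesgue_on ?W. P x"] integral_Re[OF Pi] by simp
      have \<delta>i: "integrable (lebesgue_on ?W) (\<lambda>_. \<delta>)"
        by (rule absolutely_integrable_imp_integrable[OF absolutely_integrable_continuous_real W(1)]) (intro continuous_intros)
      have hi: "integrable (lebesgue_on ?W) (\<lambda>x. M * (\<delta> + C * (Re (P x) + (cmod (\<Delta> x))\<^sup>2)))"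
        using \<delta>i integrable_Re[OF Pi] L2_D(2)[OF \<Delta>W(1)] by auto
      have "?q t - ?q t0 = (LINT x|lebesgue_on ?W. log_nl (u t x) * \<eta> x - log_nl (u t0 x) * \<eta> x)"
        unfolding conv by (rule Bochner_Integration.integral_diff[symmetric, OF Fi Fi])
      also have "cmod \<dots> \<le> (LINT x|lebesgue_on ?W. cmod (log_nl (u t x) * \<eta> x - log_nl (u t0 x) * \<eta> x))"
        by (rule integral_norm_bound)
      also have "\<dots> \<le> (LINT x|lebesgue_on ?W. M * (\<delta> + C * (Re (P x) + (cmod (\<Delta> x))\<^sup>2)))"
      proof (rule integral_mono[OF _ hi])
        show "integrable (lebesgue_on ?W) (\<lambda>x. cmod (log_nl (u t x) * \<eta> x - log_nl (u t0 x) * \<eta> x))"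
          by (intro integrable_norm Bochner_Integration.integrable_diff Fi)
        fix x assume "x \<in> space (lebesgue_on ?W)"
        then have x: "x \<in> ?W" by simp
        have ud: "u t x - u t0 x = \<Delta> x" by (simp add: u_eq \<Delta>_def)
        have "cmod (u t x) \<le> cmod (u t0 x) + cmod (\<Delta> x)"
          using norm_triangle_sub[of "u t x" "u t0 x"] by (simp add: ud)
        then have "cmod (\<Delta> x) * (1 + cmod (u t x) + cmod (u t0 x)) \<le> cmod (\<Delta> x) * ((1 + 2 * cmod (u t0 x)) + cmod (\<Delta> x))"
          by (intro mult_left_mono) auto
        also have "\<dots> = Re (P x) + (cmod (\<Delta> x))\<^sup>2" by (simp add: P_def g_def power2_eq_square algebra_simps)
        finally have "C * (cmod (\<Delta> x) * (1 + cmod (u t x) + cmod (u t0 x))) \<le> C * (Re (P x) + (cmod (\<Delta> x))\<^sup>2)"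
          using C(1) by (intro mult_left_mono)
        then have F: "cmod (log_nl (u t x) - log_nl (u t0 x)) \<le> \<delta> + C * (Re (P x) + (cmod (\<Delta> x))\<^sup>2)"
          using C(2)[of "u t x" "u t0 x"] unfolding ud by linarith
        have "cmod (log_nl (u t x) * \<eta> x - log_nl (u t0 x) * \<eta> x) = cmod (\<eta> x) * cmod (log_nl (u t x) - log_nl (u t0 x))"
          unfolding left_diff_distrib[symmetric] norm_mult by (rule mult.commute)
        also have "\<dots> \<le> M * (\<delta> + C * (Re (P x) + (cmod (\<Delta> x))\<^sup>2))"
          by (intro mult_mono M[OF x] F M0) simp
        finally show "cmod (log_nl (u t x) * \<eta> x - log_nl (u t0 x) * \<eta> x) \<le> M * (\<delta> + C * (Re (P x) + (cmod (\<Delta> x))\<^sup>2))" .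
      qed
      also have "\<dots> = M * (\<delta> * (b - a) + C * ((LINT x|lebesgue_on ?W. Re (P x)) + nsq ?W \<Delta>))"
        using \<delta>i integrable_Re[OF Pi] L2_D(2)[OF \<Delta>W(1)] ab(1) by (simp add: nsq_def measure_restrict_space mult.commute)
      also have "\<dots> \<le> M * (\<delta> * (b - a) + C * (sqrt (?n t) * sqrt (nsq ?W g) + ?n t))"
        using RePI \<Delta>W(2) C(1) M0 by (intro mult_left_mono add_left_mono add_mono) (auto simp: \<Delta>_def)
      finally show ?thesis .
    qed
    with C(1) show ?thesis by blast
  qed
  have "(?q \<longlongrightarrow> ?q t0) (at t0)"
  proof (rule tendstoI)
    fix e :: real assume "e > 0"
    \<comment> \<open>The part of the bound that persists as \<open>t\<close> tends to
      \<open>t0\<close> is then at most \<open>e / 2\<close>; \<open>M + 1\<close> allows for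
      \<open>M = 0\<close>.\<close>
    define \<delta> where "\<delta> = e / (2 * (M + 1) * (b - a))"
    have \<delta>: "\<delta> > 0" using \<open>e > 0\<close> M0 ab(1) by (simp add: \<delta>_def)
    have "\<delta> * (b - a) = e / (2 * (M + 1))" using ab(1) by (simp add: \<delta>_def)
    then have "M * (\<delta> * (b - a)) = e / 2 * (M / (M + 1))" by simp
    also have "\<dots> \<le> e / 2 * 1" using M0 \<open>e > 0\<close> by (intro mult_left_mono) auto
    finally have M\<delta>: "M * (\<delta> * (b - a)) < e" using \<open>e > 0\<close> by simp
    obtain C where C: "\<And>t. cmod (?q t - ?q t0) \<le> M * (\<delta> * (b - a) + C * (sqrt (?n t) * sqrt (nsq ?W g) + ?n t))"
      using bound[OF \<delta>] by blast
    have "((\<lambda>t. M * (\<delta> * (b - a) + C * (sqrt (?n t) * sqrt (nsq ?W g) + ?n t))) \<longlongrightarrow>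
        M * (\<delta> * (b - a) + C * (sqrt 0 * sqrt (nsq ?W g) + 0))) (at t0)"
      by (intro tendsto_intros nsq_U_tendsto)
    then have "\<forall>\<^sub>F t in at t0. M * (\<delta> * (b - a) + C * (sqrt (?n t) * sqrt (nsq ?W g) + ?n t)) < e"
      by (rule order_tendstoD(2)) (use M\<delta> in simp)
    then show "\<forall>\<^sub>F t in at t0. dist (?q t) (?q t0) < e"
      unfolding dist_norm by eventually_elim (rule le_less_trans[OF C])
  qed
  then show "isCont ?q t0" by (simp add: isCont_def)
qed

text \<open>Testing with \<open>\<theta> t * \<eta> x\<close> leaves an identity for scalar
  functions of time, tested by \<theta>. All terms are locally integrable in time, so it holds at
  almost every time, with an exceptional set depending on \<eta>.\<close>

lemma pairing_equation:
  assumes \<eta>: "\<eta> \<in> test_fun UNIV"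
  shows "AE t in lebesgue. \<i> * (LINT x|lebesgue_on UNIV. v t x * \<eta> x)
     + (LINT x|lebesgue_on UNIV. u t x * vector_derivative (\<lambda>y. vector_derivative \<eta> (at y)) (at x))
     = of_real lam * (LINT x|lebesgue_on UNIV. log_nl (u t x) * \<eta> x)"
proof -
  define \<eta>2 where "\<eta>2 = (\<lambda>x. vector_derivative (\<lambda>y. vector_derivative \<eta> (at y)) (at x))"
  have \<eta>2: "\<eta>2 \<in> test_fun UNIV" unfolding \<eta>2_def by (intro test_fun_derivative \<eta>)
  define A where "A = (\<lambda>t. LINT x|lebesgue_on UNIV. u t x * \<eta> x)"
  define h where "h = (\<lambda>t. LINT x|lebesgue_on UNIV. v t x * \<eta> x)"
  define k where "k = (\<lambda>t. LINT x|lebesgue_on UNIV. u t x * \<eta>2 x)"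
  define q where "q = (\<lambda>t. LINT x|lebesgue_on UNIV. log_nl (u t x) * \<eta> x)"
  have ck: "continuous_on UNIV k" unfolding k_def by (rule u_pairing_continuous[OF \<eta>2])
  have cq: "continuous_on UNIV q" unfolding q_def by (rule log_nl_pairing_continuous[OF \<eta>])
  have pA: "prim UNIV A h"
    using inner_prim[OF test_fun_L2[OF \<eta>]] unfolding A_def h_def prim_def u_pairing_eq[OF \<eta>] by simp
  have lh: "locally_integrable UNIV h" by (rule prim_locally_integrable(1)[OF pA]) auto
  have cont_li: "locally_integrable UNIV f" if "continuous_on UNIV f" for f
    by (intro locally_integrable_UNIV_I absolutely_integrable_continuous_real continuous_on_subset[OF that]) simp
  define z where "z = (\<lambda>t. \<i> * h t + k t - of_real lam * q t)"
  have lz: "locally_integrable UNIV z"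
    using lh cont_li[OF ck] cont_li[OF cq] unfolding z_def locally_integrable_def
    by (auto intro!: set_integral_diff(1) set_integral_add(1) set_integrable_mult_right)
  have test: "(LINT t|lebesgue_on UNIV. z t * \<theta> t) = 0" if \<theta>: "\<theta> \<in> test_fun UNIV" for \<theta>
  proof -
    obtain D where D: "D \<in> test_fun2"
      "\<And>t x. D 0 0 t x = \<theta> t * \<eta> x" "\<And>t x. D 1 0 t x = vector_derivative \<theta> (at t) * \<eta> x"
      "\<And>t x. D 0 2 t x = \<theta> t * \<eta>2 x"
      using test_fun2_product[OF \<theta> \<eta>] unfolding \<eta>2_def by blast
    have "(LINT t|lebesgue_on UNIV. LINT x|lebesgue_on UNIV. u t x * (- \<i> * D 1 0 t x + D 0 2 t x)) =
      of_real lam * (LINT t|lebesgue_on UNIV. LINT x|lebesgue_on UNIV. log_nl (u t x) * D 0 0 t x)"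
      using dist D(1) unfolding logNLS_distributional_def lebesgue_on_UNIV_eq by blast
    moreover have "(LINT x|lebesgue_on UNIV. u t x * (- \<i> * D 1 0 t x + D 0 2 t x)) =
       - \<i> * (A t * vector_derivative \<theta> (at t)) + k t * \<theta> t" for t
    proof -
      have "(LINT x|lebesgue_on UNIV. u t x * (- \<i> * D 1 0 t x + D 0 2 t x)) =
        (LINT x|lebesgue_on UNIV. (- \<i> * vector_derivative \<theta> (at t)) * (u t x * \<eta> x) + \<theta> t * (u t x * \<eta>2 x))"
        unfolding D(3,4) by (simp add: algebra_simps)
      also have "\<dots> = (LINT x|lebesgue_on UNIV. (- \<i> * vector_derivative \<theta> (at t)) * (u t x * \<eta> x)) + (LINT x|lebesgue_on UNIV. \<theta> t * (u t x * \<eta>2 x))"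
        by (intro Bochner_Integration.integral_add integrable_mult_right locally_integrable_mult_test[OF u_locally_integrable] \<eta> \<eta>2)
      also have "\<dots> = (- \<i> * vector_derivative \<theta> (at t)) * A t + \<theta> t * k t"
        unfolding A_def k_def by (simp only: integral_mult_right_zero)
      finally show ?thesis by (simp add: mult_ac)
    qed
    moreover have "(LINT x|lebesgue_on UNIV. log_nl (u t x) * D 0 0 t x) = q t * \<theta> t" for t
    proof -
      have "(LINT x|lebesgue_on UNIV. log_nl (u t x) * D 0 0 t x) = (LINT x|lebesgue_on UNIV. \<theta> t * (log_nl (u t x) * \<eta> x))"
        unfolding D(2) by (simp add: mult_ac)
      then show ?thesis unfolding q_def by (simp only: integral_mult_right_zero mult.commute)
    qed
    ultimately have eq: "(LINT t|lebesgue_on UNIV. - \<i> * (A t * vector_derivative \<theta> (at t)) + k t * \<theta> t) = of_real lam * (LINT t|lebesgue_on UNIV. q t * \<theta> t)"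
      by simp
    note bp = test_fun_by_parts[OF pA open_UNIV is_interval_univ \<theta>]
    note ki = locally_integrable_mult_test[OF cont_li[OF ck] \<theta>] and qi = locally_integrable_mult_test[OF cont_li[OF cq] \<theta>]
    have "(LINT t|lebesgue_on UNIV. - \<i> * (A t * vector_derivative \<theta> (at t)) + k t * \<theta> t) =
      - \<i> * (LINT t|lebesgue_on UNIV. A t * vector_derivative \<theta> (at t)) + (LINT t|lebesgue_on UNIV. k t * \<theta> t)"
      unfolding Bochner_Integration.integral_add[OF integrable_mult_right[OF bp(1)] ki] by (simp only: integral_mult_right_zero)
    also have "\<dots> = \<i> * (LINT t|lebesgue_on UNIV. h t * \<theta> t) + (LINT t|lebesgue_on UNIV. k t * \<theta> t)"
      unfolding bp(3) by simp
    finally have "\<i> * (LINT t|lebesgue_on UNIV. h t * \<theta> t) + (LINT t|lebesgue_on UNIV. k t * \<theta> t) = of_real lam * (LINT t|lebesgue_on UNIV. q t * \<theta> t)"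
      using eq by simp
    moreover have "(LINT t|lebesgue_on UNIV. z t * \<theta> t) = (LINT t|lebesgue_on UNIV. (\<i> * (h t * \<theta> t) + k t * \<theta> t) - of_real lam * (q t * \<theta> t))"
      by (simp add: z_def algebra_simps)
    moreover have "\<dots> = \<i> * (LINT t|lebesgue_on UNIV. h t * \<theta> t) + (LINT t|lebesgue_on UNIV. k t * \<theta> t) - of_real lam * (LINT t|lebesgue_on UNIV. q t * \<theta> t)"
      using bp(2) ki qi by simp
    ultimately show ?thesis by simp
  qed
  have "AE t in lebesgue. z t = 0"
  proof (rule AE_zero_if_plateau_integrals_zero[OF lz])
    fix p l :: real and n assume "l \<ge> 0"
    then have "plateau (1 / real (Suc n)) p l \<in> test_fun UNIV" by (intro plateau_in_test_fun) auto
    from test[OF this] show "(LINT x|lebesgue. z x * plateau (1 / real (Suc n)) p l x) = 0"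
      by (simp add: lebesgue_on_UNIV_eq)
  qed
  then show ?thesis
    by eventually_elim (simp add: z_def h_def k_def q_def \<eta>2_def)
qed

text \<open>The exceptional times of the rational plateaus form one null set; outside it the
  derivatives are moved back from the plateaus to \<open>u t\<close>, and the same plateaus show
  that the remainder vanishes almost everywhere. Quantifying over \<open>d\<close> and
  \<open>w\<close> inside keeps the null set independent of the choice of the weak
  derivatives.\<close>

lemma pointwise_equation:
  "AE t in lebesgue. \<forall>d w. weak_deriv UNIV (u t) d \<longrightarrow> weak_deriv UNIV d w \<longrightarrow>
     (AE x in lebesgue_on UNIV. \<i> * v t x + w x = of_real lam * log_nl (u t x))"
proof -
  let ?I = "(\<rat> \<times> (\<rat> \<inter> {0..})) \<times> (UNIV :: nat set)"
  let ?\<eta> = "\<lambda>i. plateau (1 / real (Suc (snd i))) (fst (fst i)) (snd (fst i))"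
  have cI: "countable ?I" by (intro countable_SIGMA countable_Int1 countable_rat) auto
  have \<eta>: "?\<eta> i \<in> test_fun UNIV" if "i \<in> ?I" for i
    using that by (intro plateau_in_test_fun) auto
  have "AE t in lebesgue. \<forall>i\<in>?I. \<i> * (LINT x|lebesgue_on UNIV. v t x * ?\<eta> i x)
     + (LINT x|lebesgue_on UNIV. u t x * vector_derivative (\<lambda>y. vector_derivative (?\<eta> i) (at y)) (at x))
     = of_real lam * (LINT x|lebesgue_on UNIV. log_nl (u t x) * ?\<eta> i x)"
    unfolding AE_ball_countable[OF cI] using pairing_equation[OF \<eta>] by blast
  with v_L2_AE show ?thesis
  proof eventually_elim
    case (elim t)
    show ?case
    proof (intro allI impI)
      fix d w assume d: "weak_deriv UNIV (u t) d" and w: "weak_deriv UNIV d w"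
      have lv: "locally_integrable UNIV (v t)"
        by (intro locally_integrable_UNIV_I L2_absolutely_integrable[OF elim(1)]) auto
      have lw: "locally_integrable UNIV w" using w by (simp add: weak_deriv_def)
      define G where "G = (\<lambda>x. \<i> * v t x + w x - of_real lam * log_nl (u t x))"
      have lG: "locally_integrable UNIV G"
        using lv lw log_nl_u_locally_integrable[of t] unfolding G_def locally_integrable_def
        by (auto intro!: set_integral_diff(1) set_integral_add(1) set_integrable_mult_right)
      have "AE x in lebesgue. G x = 0"
      proof (rule AE_zero_if_plateau_integrals_zero[OF lG])
        fix p l :: real and n assume pl: "p \<in> \<rat>" "l \<in> \<rat>" "l \<ge> 0"
        define \<eta>' where "\<eta>' = plateau (1 / real (Suc n)) p l"
        have i: "((p, l), n) \<in> ?I" using pl by auto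
        have t\<eta>: "\<eta>' \<in> test_fun UNIV" unfolding \<eta>'_def using \<eta>[OF i] by simp
        note int = locally_integrable_mult_test[OF lv t\<eta>] locally_integrable_mult_test[OF lw t\<eta>]
          locally_integrable_mult_test[OF log_nl_u_locally_integrable t\<eta>, of t]
        have "(LINT x|lebesgue_on UNIV. u t x * vector_derivative (\<lambda>y. vector_derivative \<eta>' (at y)) (at x)) =
            - (LINT x|lebesgue_on UNIV. d x * vector_derivative \<eta>' (at x))"
          using d test_fun_derivative[OF t\<eta>] unfolding weak_deriv_def by blast
        also have "(LINT x|lebesgue_on UNIV. d x * vector_derivative \<eta>' (at x)) = - (LINT x|lebesgue_on UNIV. w x * \<eta>' x)"
          using w t\<eta> unfolding weak_deriv_def by blast
        finally have "\<i> * (LINT x|lebesgue_on UNIV. v t x * \<eta>' x) + (LINT x|lebesgue_on UNIV. w x * \<eta>' x)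
          = of_real lam * (LINT x|lebesgue_on UNIV. log_nl (u t x) * \<eta>' x)"
          using bspec[OF elim(2) i] by (simp add: \<eta>'_def)
        moreover have "(LINT x|lebesgue_on UNIV. G x * \<eta>' x) = (LINT x|lebesgue_on UNIV. (\<i> * (v t x * \<eta>' x) + w x * \<eta>' x) - of_real lam * (log_nl (u t x) * \<eta>' x))"
          by (simp add: G_def algebra_simps)
        moreover have "\<dots> = \<i> * (LINT x|lebesgue_on UNIV. v t x * \<eta>' x) + (LINT x|lebesgue_on UNIV. w x * \<eta>' x) - of_real lam * (LINT x|lebesgue_on UNIV. log_nl (u t x) * \<eta>' x)"
          using int by simp
        ultimately have "(LINT x|lebesgue_on UNIV. G x * \<eta>' x) = 0" by simp
        then show "(LINT x|lebesgue. G x * plateau (1 / real (Suc n)) p l x) = 0"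
          by (simp add: lebesgue_on_UNIV_eq \<eta>'_def)
      qed
      then show "AE x in lebesgue_on UNIV. \<i> * v t x + w x = of_real lam * log_nl (u t x)"
        unfolding lebesgue_on_UNIV_eq by eventually_elim (simp add: G_def)
    qed
  qed
qed

end

lemma Hs_loc_1_L2:
  assumes "\<phi> \<in> Hs_loc 1 UNIV"
  shows "\<phi> \<in> L2 {a..b}"
proof -
  \<comment> \<open>\<open>Hs_loc\<close> speaks of open sets with compact closure; the margin makes
    \<open>[a, b]\<close> a subset of one.\<close>
  let ?J = "{a - 1<..<b + 1}"
  have "bounded ?J" by (rule bounded_subset[OF bounded_closed_interval[of "a - 1" "b + 1"]]) auto
  then have "compact (closure ?J)" by (simp only: compact_closure)
  then have "Hs_sq 1 ?J \<phi> < \<infinity>" using assms by (auto simp: Hs_loc_def Hs_def)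
  from Hs_sq_lessD[OF this] have "\<phi> \<in> L2 ?J" by (auto simp: L2_def)
  then show ?thesis by (rule L2_subset(1)) auto
qed

text \<open>The regularity of \<open>d\<phi>\<close> puts the second derivative of \<phi> into
  \<open>L2\<close>, which opens the last clause of \<open>logGP_solution\<close>: a time derivative
  of \<open>u - \<phi>\<close> and a bound in \<open>H2\<close>. The derivatives of
  \<open>u t\<close> are those of \<open>U t\<close> plus those of \<phi>, so the second one lies in
  \<open>L2\<close> on the whole line, and this controls the flux at infinity.\<close>

lemma logGP_not_Hs_bounded:
  assumes lam: "lam > 0" and s: "s > 7/2" and T: "T > 0" and x0: "x0 > 0"
    and E: "\<phi> \<in> E_logGP lam" and \<phi>: "\<phi> \<in> odd_data UNIV" and sol: "logGP_solution lam \<phi> u"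
    and reg: "weak_deriv UNIV \<phi> d\<phi>" "d\<phi> \<in> Hs (s - 1) UNIV"
  shows "u \<notin> Linf {0<..<T} (Hs_sq s {-x0<..<x0})"
proof -
  have "Hs_sq (s - 1) UNIV d\<phi> < \<infinity>" using reg(2) by (simp add: Hs_def)
  then obtain D where D: "D 0 = d\<phi>" "\<forall>j<nat \<lfloor>s - 1\<rfloor>. weak_deriv UNIV (D j) (D (Suc j))"
    "\<forall>j\<le>nat \<lfloor>s - 1\<rfloor>. L2_sq UNIV (D j) < \<infinity>" using Hs_sq_lessD by blast
  have "nat \<lfloor>s - 1\<rfloor> \<ge> 1" using s by (simp add: le_nat_iff le_floor_iff)
  then have d2: "weak_deriv UNIV d\<phi> (D 1)" "D 1 \<in> L2 UNIV"
    using D(1) spec[OF D(2), of 0] spec[OF D(3), of 1] by (auto simp: L2_def)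
  define U where "U = (\<lambda>t x. u t x - \<phi> x)"
  have C: "U \<in> C_time (L2_sq UNIV)" and distr: "logNLS_distributional lam u" and u0: "AE x in lebesgue_on UNIV. u 0 x = \<phi> x"
    using sol unfolding logGP_solution_def U_def lebesgue_on_UNIV_eq by blast+
  obtain v where W1: "W1inf_loc_L2 UNIV U v" and H2: "U \<in> Linf_loc (Hs_sq 2 UNIV)"
    using sol reg(1) d2 unfolding logGP_solution_def U_def by blast
  have \<phi>L: "\<phi> \<in> L2 {a..b}" for a b using E by (intro Hs_loc_1_L2) (simp add: E_logGP_def)
  interpret distributional_solution U v \<phi> u lam
    by unfold_locales (use C W1 distr \<phi>L in \<open>auto simp: U_def\<close>)
  have "AE t in lebesgue. Hs_sq 2 UNIV (U t) < \<infinity>"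
  proof (rule AE_lebesgue_all_bounded)
    fix R :: real assume "R > 0"
    then obtain C where "AE t in lebesgue_on {-R<..<R}. Hs_sq 2 UNIV (U t) \<le> ennreal C"
      using H2 by (auto simp: Linf_loc_def Linf_def)
    then show "AE t in lebesgue_on {-R<..<R}. Hs_sq 2 UNIV (U t) < \<infinity>"
      by eventually_elim (auto intro: le_less_trans)
  qed
  then have derivs: "AE t in lebesgue. \<exists>d w. weak_deriv UNIV (u t) d \<and> weak_deriv UNIV d w \<and> w \<in> L2 UNIV"
  proof eventually_elim
    case (elim t)
    then obtain A where A: "A 0 = U t" "\<forall>j<nat \<lfloor>2::real\<rfloor>. weak_deriv UNIV (A j) (A (Suc j))"
      "\<forall>j\<le>nat \<lfloor>2::real\<rfloor>. L2_sq UNIV (A j) < \<infinity>" using Hs_sq_lessD by blast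
    have n2: "nat \<lfloor>2::real\<rfloor> = 2" by simp
    have w: "weak_deriv UNIV (U t) (A 1)" "weak_deriv UNIV (A 1) (A 2)" "A 2 \<in> L2 UNIV"
      using A(1) spec[OF A(2), of 0] spec[OF A(2), of 1] spec[OF A(3), of 2]
      by (simp_all add: n2 numeral_2_eq_2 L2_def)
    have "weak_deriv UNIV (u t) (\<lambda>x. A 1 x + d\<phi> x)"
      using weak_deriv_add_UNIV[OF w(1) reg(1)] by (simp add: U_def)
    moreover have "weak_deriv UNIV (\<lambda>x. A 1 x + d\<phi> x) (\<lambda>x. A 2 x + D 1 x)"
      by (rule weak_deriv_add_UNIV[OF w(2) d2(1)])
    moreover have "(\<lambda>x. A 2 x + D 1 x) \<in> L2 UNIV" by (rule L2_add[OF w(3) d2(2)])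
    ultimately show ?case by blast
  qed
  have \<phi>odd: "AE x in lebesgue_on UNIV. \<phi> (- x) = - \<phi> x" using \<phi> by (simp add: odd_data_def)
  have growth: "AE t in lebesgue. Re (LINT x|lebesgue_on UNIV. v t x * cnj (even_part t x)) \<le> \<bar>lam\<bar> * nsq UNIV (even_part t)"
    using derivs pointwise_equation v_L2_AE
  proof eventually_elim
    case (elim t)
    then obtain d w where d: "weak_deriv UNIV (u t) d" "weak_deriv UNIV d w" and w: "w \<in> L2 UNIV" by blast
    have eq: "AE x in lebesgue_on UNIV. \<i> * v t x + w x = of_real lam * log_nl (u t x)" using elim(2) d by blast
    have wi: "w absolutely_integrable_on {a..b}" for a b by (rule L2_absolutely_integrable[OF w]) auto
    have wb: "cmod (w x) \<le> 1 + (cmod (w x))\<^sup>2" for x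
      using zero_le_power2[of "cmod (w x) - 1/2"] by (simp add: power2_eq_square algebra_simps)
    have B: "integral {c..c + 2} (\<lambda>x. cmod (w x)) \<le> 1 * (c + 2 - c) + (LINT x|lebesgue_on UNIV. (cmod (w x))\<^sup>2)" for c
      by (rule integral_norm_le_of_bound[OF wi L2_D(2)[OF w]]) (auto intro: wb)
    show ?case
    proof (rule growth_estimate_line[OF d elim(3) _ _ eq])
      show "even_part t \<in> L2 UNIV"
        unfolding even_part_def[abs_def] by (intro L2_add U_L2 L2_reflect) auto
      show "AE x in lebesgue_on UNIV. even_part t x = u t x + u t (- x)"
        using \<phi>odd by eventually_elim (simp add: even_part_def u_eq)
      show "integral {c..c + 2} (\<lambda>x. cmod (w x)) \<le> 2 + (LINT x|lebesgue_on UNIV. (cmod (w x))\<^sup>2)" for c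
        using B[of c] by simp
    qed
  qed
  have lam0: "lam \<noteq> 0" using lam by simp
  show ?thesis
  proof (rule not_Hs_bounded[where p=\<phi> and u=u, OF _ _ _ _ lam0 s T x0 _ _ \<phi>odd _ u0 \<phi> growth])
    show "AE \<tau> in lebesgue. \<exists>d w. weak_deriv UNIV (u \<tau>) d \<and> weak_deriv UNIV d w \<and>
      (AE x in lebesgue_on UNIV. \<i> * v \<tau> x + w x = of_real lam * log_nl (u \<tau> x))"
      using derivs pointwise_equation by eventually_elim blast
    show "\<phi> \<in> L2 {0<..<x0}" by (rule L2_subset(1)[OF \<phi>L[of 0 x0]]) auto
  qed (auto simp: U_def)
qed

theorem theorem2p4:
  fixes lam s T x0 :: real
    and \<Omega> :: "real set"
    and \<phi> :: "real \<Rightarrow> complex"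
    and u :: "real \<Rightarrow> real \<Rightarrow> complex"
  assumes "lam \<noteq> 0"
    and "(\<Omega> = UNIV \<and> \<phi> \<in> W2 Line \<inter> odd_data \<Omega> \<and> logNLS_solution lam Line \<phi> u) \<or>
         (\<exists>a>0. \<exists>b. \<Omega> = {-a<..<a} \<and> \<phi> \<in> W2 (Interval a b) \<inter> odd_data \<Omega> \<and>
            logNLS_solution lam (Interval a b) \<phi> u) \<or>
         (\<Omega> = UNIV \<and> lam > 0 \<and> \<phi> \<in> E_logGP lam \<inter> odd_data \<Omega> \<and> logGP_solution lam \<phi> u)"
    and "s > 7 / 2"
    and "\<exists>d. weak_deriv \<Omega> \<phi> d \<and> d \<in> Hs (s - 1) \<Omega>"
    and "T > 0"
    and "x0 > 0" and "{-x0<..<x0} \<subseteq> \<Omega>"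
  shows "u \<notin> Linf {0<..<T} (Hs_sq s {-x0<..<x0})"
  using assms(2)
proof (elim disjE exE conjE bexE)
  assume "\<Omega> = UNIV" "\<phi> \<in> W2 Line \<inter> odd_data \<Omega>" "logNLS_solution lam Line \<phi> u"
  then show ?thesis
    by (intro logNLS_line_not_Hs_bounded[of lam s T x0 \<phi>] assms) simp_all
next
  fix a b
  assume "a > 0" "\<Omega> = {-a<..<a}" "\<phi> \<in> W2 (Interval a b) \<inter> odd_data \<Omega>"
    "logNLS_solution lam (Interval a b) \<phi> u"
  then show ?thesis
    using assms(7) by (intro logNLS_interval_not_Hs_bounded[of lam s T x0 a \<phi> b] assms) simp_all
next
  assume *: "\<Omega> = UNIV" "lam > 0" "\<phi> \<in> E_logGP lam \<inter> odd_data \<Omega>" "logGP_solution lam \<phi> u"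
  obtain d where "weak_deriv UNIV \<phi> d" "d \<in> Hs (s - 1) UNIV" using assms(4) *(1) by blast
  with * show ?thesis
    by (intro logGP_not_Hs_bounded[of lam s T x0 \<phi> u d] assms) simp_all
qed

end
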